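(* Let $(X_n)_{n\in\mathbb{N}}$ be a stationary, mixing process of real random variables and let $h:\mathbb{R}^2\to\mathbb{R}$ be a symmetric measurable kernel such that for some $\delta>0$ and $M>0$: $$\iint |h(x_1,x_2)|^{2+\delta}\,dF(x_1)\,dF(x_2)\le M,$$ $$\forall k\in\mathbb{N}_0:\quad \int |h(x_1,x_{1+k})|^{2+\delta}\,dP(x_1,x_{1+k})\le M.$$ Suppose that one of the following two conditions holds: (i) for some $\delta'\in(0,\delta)$: $\beta(n)=O\big(n^{-\frac{2+\delta'}{\delta'}}\big)$; (ii) $h$ is $\mathcal{P}$-Lipschitz-continuous, $E|X_1|^{\gamma}<\infty$ for some $\gamma>0$, and for some $\rho>\frac{3\gamma\delta+\delta+5\gamma+2}{2\gamma\delta}$: $\alpha(n)=O(n^{-\rho})$. Then $$\sqrt{n}\,\big(U_n(h)-\theta\big)\xrightarrow{\mathcal{D}}N\big(0,4\sigma_\infty^2\big)$$ with $\sigma_\infty^2=\operatorname{Var}[h_1(X_1)]+2\sum_{k=1}^{\infty}\operatorname{Cov}[h_1(X_1),h_1(X_{1+k})]$.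
   Context: Stationary means strictly stationary. $F$ is the distribution of $X_1$, and $dP(x_1,x_{1+k})$ denotes integration with respect to the joint distribution of $(X_1,X_{1+k})$. U-statistic: $U_n(h)=\frac{2}{n(n-1)}\sum_{1\le i<j\le n}h(X_i,X_j)$. Further $\theta=\iint h(x,y)\,dF(x)\,dF(y)$ and $h_1(x)=\int h(x,y)\,dF(y)-\theta$. Mixing coefficients: $\beta(m)=\sup_{k\in\mathbb{N}}\beta\big((X_1,\ldots,X_k),(X_j)_{j\ge k+m}\big)$ with $\beta(Y,Z)=E\big[\sup_{A\in\sigma(Y)}|P[A|Z]-P[A]|\big]$ (essential supremum); the process is absolutely regular if $\beta(m)\to0$. $\alpha(m)=\sup_{k\in\mathbb{N}}\alpha\big((X_1,\ldots,X_k),(X_j)_{j\ge k+m}\big)$ with $\alpha(Y,Z)=\sup_{A\in\sigma(Y),B\in\sigma(Z)}|P(A\cap B)-P(A)P(B)|$; the process is strongly mixing if $\alpha(m)\to0$. "Mixing" in the claim means absolutely regular in case (i) and strongly mixing in case (ii). $\mathcal{P}$-Lipschitz-continuity: $h$ is $\mathcal{P}$-Lipschitz-continuous if there is a constant $L>0$ with $E\big[|h(X,Y)-h(X',Y)|\,\mathbf{1}_{\{|X-X'|\le\epsilon\}}\big]\le L\epsilon$ for every $\epsilon>0$, every pair $X,Y$ whose joint distribution is either that of $(X_1,X_k)$ for some $k\in\mathbb{N}$ or the product $\mathcal{P}_{X_1}\times\mathcal{P}_{X_1}$, and every $X'$ such that the pair $X',Y$ also has one of these joint distributions ($X,X',Y$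 defined on a common probability space). *)

theory Defs
  imports "HOL-Probability.Probability" "HOL-Library.Landau_Symbols"
begin

text \<open>Processes are families \<open>X :: nat \<Rightarrow> 'a \<Rightarrow> real\<close> on a probability space \<open>M\<close>, of which only the
  members \<open>X 1, X 2, \<dots>\<close> are used; the value \<open>X 0\<close> never matters.\<close>

section \<open>Stationarity and mixing coefficients\<close>

definition strictly_stationary :: "'a measure \<Rightarrow> (nat \<Rightarrow> 'a \<Rightarrow> real) \<Rightarrow> bool" where
  "strictly_stationary M X \<longleftrightarrow>
     (\<forall>m k. distr M (PiM {1..m} (\<lambda>_. borel)) (\<lambda>\<omega>. \<lambda>i\<in>{1..m}. X (i + k) \<omega>)
          = distr M (PiM {1..m} (\<lambda>_. borel)) (\<lambda>\<omega>. \<lambda>i\<in>{1..m}. X i \<omega>))"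

definition process_algebra ::
    "'a measure \<Rightarrow> (nat \<Rightarrow> 'a \<Rightarrow> real) \<Rightarrow> nat set \<Rightarrow> 'a measure" where
  "process_algebra M X I =
     vimage_algebra (space M) (\<lambda>\<omega>. \<lambda>i\<in>I. X i \<omega>) (PiM I (\<lambda>_. borel))"

text \<open>\<open>is_family_ess_sup M \<F> g\<close>: \<open>g\<close> is a version of the essential supremum of the (possibly
  uncountable) family \<open>\<F>\<close> of random variables, i.e. an almost surely least almost sure upper bound.
  It is determined up to null sets, see \<open>is_family_ess_sup_unique\<close>.\<close>

definition is_family_ess_sup ::
    "'a measure \<Rightarrow> ('a \<Rightarrow> real) set \<Rightarrow> ('a \<Rightarrow> real) \<Rightarrow> bool" where
  "is_family_ess_sup M \<F> g \<longleftrightarrow>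
     g \<in> borel_measurable M \<and>
     (\<forall>f\<in>\<F>. AE \<omega> in M. f \<omega> \<le> g \<omega>) \<and>
     (\<forall>g'\<in>borel_measurable M. (\<forall>f\<in>\<F>. AE \<omega> in M. f \<omega> \<le> g' \<omega>) \<longrightarrow> (AE \<omega> in M. g \<omega> \<le> g' \<omega>))"

definition family_ess_sup :: "'a measure \<Rightarrow> ('a \<Rightarrow> real) set \<Rightarrow> 'a \<Rightarrow> real" where
  "family_ess_sup M \<F> = (SOME g. is_family_ess_sup M \<F> g)"

text \<open>The coefficients of two random elements \<open>Y, Z\<close> depend only on \<open>\<sigma>(Y)\<close> and \<open>\<sigma>(Z)\<close>, so the
  arguments \<open>F\<close>, \<open>G\<close> below are these sub-\<open>\<sigma>\<close>-algebras of \<open>M\<close>.\<close>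

definition cond_dev :: "'a measure \<Rightarrow> 'a measure \<Rightarrow> 'a set \<Rightarrow> 'a \<Rightarrow> real" where
  "cond_dev M G A \<omega> = \<bar>real_cond_exp M G (indicator A) \<omega> - measure M A\<bar>"

definition beta_coeff :: "'a measure \<Rightarrow> 'a measure \<Rightarrow> 'a measure \<Rightarrow> real" where
  "beta_coeff M F G = (\<integral>\<omega>. family_ess_sup M (cond_dev M G ` sets F) \<omega> \<partial>M)"

definition alpha_coeff :: "'a measure \<Rightarrow> 'a measure \<Rightarrow> 'a measure \<Rightarrow> real" where
  "alpha_coeff M F G =
     (SUP (A, B)\<in>sets F \<times> sets G. \<bar>measure M (A \<inter> B) - measure M A * measure M B\<bar>)"

definition beta_mix :: "'a measure \<Rightarrow> (nat \<Rightarrow> 'a \<Rightarrow> real) \<Rightarrow> nat \<Rightarrow> real" where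
  "beta_mix M X m =
     (SUP k\<in>{1..}. beta_coeff M (process_algebra M X {1..k}) (process_algebra M X {k + m..}))"

definition alpha_mix :: "'a measure \<Rightarrow> (nat \<Rightarrow> 'a \<Rightarrow> real) \<Rightarrow> nat \<Rightarrow> real" where
  "alpha_mix M X m =
     (SUP k\<in>{1..}. alpha_coeff M (process_algebra M X {1..k}) (process_algebra M X {k + m..}))"

definition absolutely_regular :: "'a measure \<Rightarrow> (nat \<Rightarrow> 'a \<Rightarrow> real) \<Rightarrow> bool" where
  "absolutely_regular M X \<longleftrightarrow> beta_mix M X \<longlonglongrightarrow> 0"

definition strongly_mixing :: "'a measure \<Rightarrow> (nat \<Rightarrow> 'a \<Rightarrow> real) \<Rightarrow> bool" where
  "strongly_mixing M X \<longleftrightarrow> alpha_mix M X \<longlonglongrightarrow> 0"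


section \<open>U-statistics\<close>

definition marginal :: "'a measure \<Rightarrow> (nat \<Rightarrow> 'a \<Rightarrow> real) \<Rightarrow> real measure" where
  "marginal M X = distr M borel (X 1)"

definition pair_law ::
    "'a measure \<Rightarrow> ('a \<Rightarrow> real) \<Rightarrow> ('a \<Rightarrow> real) \<Rightarrow> (real \<times> real) measure" where
  "pair_law M Y Z = distr M (borel \<Otimes>\<^sub>M borel) (\<lambda>\<omega>. (Y \<omega>, Z \<omega>))"

definition U_stat ::
    "(nat \<Rightarrow> 'a \<Rightarrow> real) \<Rightarrow> (real \<Rightarrow> real \<Rightarrow> real) \<Rightarrow> nat \<Rightarrow> 'a \<Rightarrow> real" where
  "U_stat X h n \<omega> =
     2 / (real n * (real n - 1)) * (\<Sum>(i, j)\<in>{(i, j). 1 \<le> i \<and> i < j \<and> j \<le> n}. h (X i \<omega>) (X j \<omega>))"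

definition U_mean ::
    "'a measure \<Rightarrow> (nat \<Rightarrow> 'a \<Rightarrow> real) \<Rightarrow> (real \<Rightarrow> real \<Rightarrow> real) \<Rightarrow> real" where
  "U_mean M X h = (\<integral>x. (\<integral>y. h x y \<partial>marginal M X) \<partial>marginal M X)"

definition h1 ::
    "'a measure \<Rightarrow> (nat \<Rightarrow> 'a \<Rightarrow> real) \<Rightarrow> (real \<Rightarrow> real \<Rightarrow> real) \<Rightarrow> real \<Rightarrow> real" where
  "h1 M X h x = (\<integral>y. h x y \<partial>marginal M X) - U_mean M X h"

definition covar :: "'a measure \<Rightarrow> ('a \<Rightarrow> real) \<Rightarrow> ('a \<Rightarrow> real) \<Rightarrow> real" where
  "covar M Y Z = (\<integral>\<omega>. (Y \<omega> - (\<integral>\<omega>'. Y \<omega>' \<partial>M)) * (Z \<omega> - (\<integral>\<omega>'. Z \<omega>' \<partial>M)) \<partial>M)"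

definition h1_covar ::
    "'a measure \<Rightarrow> (nat \<Rightarrow> 'a \<Rightarrow> real) \<Rightarrow> (real \<Rightarrow> real \<Rightarrow> real) \<Rightarrow> nat \<Rightarrow> real" where
  "h1_covar M X h k = covar M (\<lambda>\<omega>. h1 M X h (X 1 \<omega>)) (\<lambda>\<omega>. h1 M X h (X (1 + k) \<omega>))"

text \<open>The variance is the covariance at lag \<open>0\<close>; the series runs over the lags \<open>Suc k \<ge> 1\<close>.\<close>

definition long_run_variance ::
    "'a measure \<Rightarrow> (nat \<Rightarrow> 'a \<Rightarrow> real) \<Rightarrow> (real \<Rightarrow> real \<Rightarrow> real) \<Rightarrow> real" where
  "long_run_variance M X h = h1_covar M X h 0 + 2 * (\<Sum>k. h1_covar M X h (Suc k))"

text \<open>\<open>N(\<mu>, v)\<close> parametrised by the variance \<open>v \<ge> 0\<close>; \<open>N(\<mu>, 0)\<close> is the point mass at \<open>\<mu>\<close>.\<close>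

definition normal_law :: "real \<Rightarrow> real \<Rightarrow> real measure" where
  "normal_law \<mu> v =
     (if v = 0 then return borel \<mu> else density lborel (normal_density \<mu> (sqrt v)))"


section \<open>Lipschitz continuity with respect to the process\<close>

definition admissible_laws ::
    "'a measure \<Rightarrow> (nat \<Rightarrow> 'a \<Rightarrow> real) \<Rightarrow> (real \<times> real) measure set" where
  "admissible_laws M X =
     insert (marginal M X \<Otimes>\<^sub>M marginal M X) {pair_law M (X 1) (X k) |k. 1 \<le> k}"

text \<open>HOL cannot quantify over probability spaces of all types inside a formula. The common
  probability space \<open>Q\<close> of the triple \<open>(Y, Y', Z)\<close> lives on \<open>\<real>\<^sup>3\<close>, which is no restriction because the
  condition depends only on the joint law of the triple: \<open>P_Lipschitz_any_space\<close> below recovers the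
  inequality on probability spaces of arbitrary type.\<close>

definition P_Lipschitz ::
    "'a measure \<Rightarrow> (nat \<Rightarrow> 'a \<Rightarrow> real) \<Rightarrow> (real \<Rightarrow> real \<Rightarrow> real) \<Rightarrow> bool" where
  "P_Lipschitz M X h \<longleftrightarrow>
     (\<exists>L>0. \<forall>\<epsilon>>0. \<forall>(Q :: (real \<times> real \<times> real) measure) Y Y' Z.
        prob_space Q \<longrightarrow>
        Y \<in> borel_measurable Q \<longrightarrow> Y' \<in> borel_measurable Q \<longrightarrow> Z \<in> borel_measurable Q \<longrightarrow>
        pair_law Q Y Z \<in> admissible_laws M X \<longrightarrow> pair_law Q Y' Z \<in> admissible_laws M X \<longrightarrow>
        (\<integral>\<^sup>+\<omega>. ennreal (\<bar>h (Y \<omega>) (Z \<omega>) - h (Y' \<omega>) (Z \<omega>)\<bar> * indicator {\<omega>. \<bar>Y \<omega> - Y' \<omega>\<bar> \<le> \<epsilon>} \<omega>) \<partial>Q)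
          \<le> ennreal (L * \<epsilon>))"

lemma P_Lipschitz_any_space:
  assumes "P_Lipschitz M X h"
    and h: "(\<lambda>(x, y). h x y) \<in> borel_measurable (borel \<Otimes>\<^sub>M borel)"
  obtains L where "L > 0"
    and "\<And>\<epsilon> (Q :: 'b measure) Y Y' Z. \<epsilon> > 0 \<Longrightarrow> prob_space Q \<Longrightarrow>
        Y \<in> borel_measurable Q \<Longrightarrow> Y' \<in> borel_measurable Q \<Longrightarrow> Z \<in> borel_measurable Q \<Longrightarrow>
        pair_law Q Y Z \<in> admissible_laws M X \<Longrightarrow> pair_law Q Y' Z \<in> admissible_laws M X \<Longrightarrow>
        (\<integral>\<^sup>+\<omega>. ennreal (\<bar>h (Y \<omega>) (Z \<omega>) - h (Y' \<omega>) (Z \<omega>)\<bar> * indicator {\<omega>. \<bar>Y \<omega> - Y' \<omega>\<bar> \<le> \<epsilon>} \<omega>) \<partial>Q)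
          \<le> ennreal (L * \<epsilon>)"
proof -
  obtain L where L: "L > 0" "\<And>\<epsilon> (Q :: (real \<times> real \<times> real) measure) Y Y' Z. \<epsilon> > 0 \<Longrightarrow> prob_space Q \<Longrightarrow>
        Y \<in> borel_measurable Q \<Longrightarrow> Y' \<in> borel_measurable Q \<Longrightarrow> Z \<in> borel_measurable Q \<Longrightarrow>
        pair_law Q Y Z \<in> admissible_laws M X \<Longrightarrow> pair_law Q Y' Z \<in> admissible_laws M X \<Longrightarrow>
        (\<integral>\<^sup>+\<omega>. ennreal (\<bar>h (Y \<omega>) (Z \<omega>) - h (Y' \<omega>) (Z \<omega>)\<bar> * indicator {\<omega>. \<bar>Y \<omega> - Y' \<omega>\<bar> \<le> \<epsilon>} \<omega>) \<partial>Q)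
          \<le> ennreal (L * \<epsilon>)"
    using assms(1) unfolding P_Lipschitz_def by blast
  show thesis
  proof (rule that[OF L(1)])
    fix \<epsilon> and Q :: "'b measure" and Y Y' Z
    assume e: "\<epsilon> > (0::real)" and Q: "prob_space Q"
      and m[measurable]: "Y \<in> borel_measurable Q" "Y' \<in> borel_measurable Q" "Z \<in> borel_measurable Q"
      and l: "pair_law Q Y Z \<in> admissible_laws M X" "pair_law Q Y' Z \<in> admissible_laws M X"
    note h[measurable]
    define N where "N = (borel \<Otimes>\<^sub>M (borel \<Otimes>\<^sub>M borel) :: (real \<times> real \<times> real) measure)"
    define T where "T = (\<lambda>\<omega>. (Y \<omega>, Y' \<omega>, Z \<omega>))"
    have T[measurable]: "T \<in> measurable Q N" unfolding T_def N_def by measurable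
    let ?y = "\<lambda>t :: real \<times> real \<times> real. fst t"
    let ?y' = "\<lambda>t :: real \<times> real \<times> real. fst (snd t)"
    let ?z = "\<lambda>t :: real \<times> real \<times> real. snd (snd t)"
    have mm[measurable]: "?y \<in> borel_measurable N" "?y' \<in> borel_measurable N" "?z \<in> borel_measurable N"
      unfolding N_def by measurable
    have p: "prob_space (distr Q N T)" by (rule prob_space.prob_space_distr[OF Q T])
    have pm[measurable]: "(\<lambda>t. (?y t, ?z t)) \<in> N \<rightarrow>\<^sub>M borel \<Otimes>\<^sub>M borel"
        "(\<lambda>t. (?y' t, ?z t)) \<in> N \<rightarrow>\<^sub>M borel \<Otimes>\<^sub>M borel"
      by (intro measurable_Pair mm)+
    have q1: "pair_law (distr Q N T) ?y ?z = pair_law Q Y Z"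
      unfolding pair_law_def by (subst distr_distr[OF pm(1) T]) (simp add: T_def comp_def)
    have q2: "pair_law (distr Q N T) ?y' ?z = pair_law Q Y' Z"
      unfolding pair_law_def by (subst distr_distr[OF pm(2) T]) (simp add: T_def comp_def)
    have hc: "(\<lambda>t. h (?y t) (?z t)) \<in> borel_measurable N" "(\<lambda>t. h (?y' t) (?z t)) \<in> borel_measurable N"
      using measurable_compose[OF _ h, of "\<lambda>t. (?y t, ?z t)" N]
        measurable_compose[OF _ h, of "\<lambda>t. (?y' t, ?z t)" N] by simp_all
    note hc[measurable]
    have fm: "(\<lambda>t. ennreal (\<bar>h (?y t) (?z t) - h (?y' t) (?z t)\<bar> * indicator {t. \<bar>?y t - ?y' t\<bar> \<le> \<epsilon>} t))
        \<in> borel_measurable N"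
      by measurable
    have "(\<integral>\<^sup>+t. ennreal (\<bar>h (?y t) (?z t) - h (?y' t) (?z t)\<bar> * indicator {t. \<bar>?y t - ?y' t\<bar> \<le> \<epsilon>} t) \<partial>distr Q N T)
        \<le> ennreal (L * \<epsilon>)"
      by (rule L(2)[OF e p]) (auto simp: q1 q2 l)
    then show "(\<integral>\<^sup>+\<omega>. ennreal (\<bar>h (Y \<omega>) (Z \<omega>) - h (Y' \<omega>) (Z \<omega>)\<bar> * indicator {\<omega>. \<bar>Y \<omega> - Y' \<omega>\<bar> \<le> \<epsilon>} \<omega>) \<partial>Q)
          \<le> ennreal (L * \<epsilon>)"
      using nn_integral_distr[OF T, of "\<lambda>t. ennreal (\<bar>h (?y t) (?z t) - h (?y' t) (?z t)\<bar> * indicator {t. \<bar>?y t - ?y' t\<bar> \<le> \<epsilon>} t)"] fm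
      by (simp add: T_def indicator_def of_bool_def cong: if_cong)
  qed
qed


section \<open>Existence and uniqueness of essential suprema\<close>

lemma is_family_ess_sup_unique:
  assumes "is_family_ess_sup M \<F> g" "is_family_ess_sup M \<F> g'"
  shows "AE \<omega> in M. g \<omega> = g' \<omega>"
proof -
  have "AE \<omega> in M. g \<omega> \<le> g' \<omega>" "AE \<omega> in M. g' \<omega> \<le> g \<omega>"
    using assms unfolding is_family_ess_sup_def by auto
  then show ?thesis by eventually_elim simp
qed

lemma (in prob_space) family_ess_sup_exists_bounded:
  assumes ne: "\<F> \<noteq> {}" and meas: "\<And>f. f \<in> \<F> \<Longrightarrow> f \<in> borel_measurable M"
    and bd: "\<And>f \<omega>. f \<in> \<F> \<Longrightarrow> \<bar>f \<omega>\<bar> \<le> (B::real)"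
  shows "\<exists>g. is_family_ess_sup M \<F> g"
proof -
  define W where "W = {u :: nat \<Rightarrow> 'a \<Rightarrow> real. range u \<subseteq> \<F>}"
  define G where "G = (\<lambda>(u :: nat \<Rightarrow> 'a \<Rightarrow> real) \<omega>. SUP n. u n \<omega>)"
  have um: "u n \<in> borel_measurable M" and ub: "\<bar>u n \<omega>\<bar> \<le> B" if "u \<in> W" for u n \<omega>
    using that meas bd unfolding W_def by auto
  have bdd: "bdd_above (range (\<lambda>n. u n \<omega>))" if "u \<in> W" for u \<omega>
    using ub[OF that] by (auto intro!: bdd_aboveI[of _ B] simp: abs_le_iff)
  have Gge: "u n \<omega> \<le> G u \<omega>" if "u \<in> W" for u n \<omega>
    unfolding G_def by (rule cSUP_upper[OF _ bdd[OF that]]) simp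
  have Gle: "G u \<omega> \<le> c" if "\<And>n. u n \<omega> \<le> c" for u \<omega> c
    unfolding G_def by (rule cSUP_least) (auto simp: that)
  have Gb: "\<bar>G u \<omega>\<bar> \<le> B" if "u \<in> W" for u \<omega>
  proof -
    have "\<And>n. u n \<omega> \<le> B" "- B \<le> u 0 \<omega>" using ub[OF that] by (auto simp: abs_le_iff minus_le_iff)
    then show ?thesis using Gge[OF that, of 0 \<omega>] Gle[of u \<omega> B] by (simp add: abs_le_iff)
  qed
  have Gm[measurable]: "G u \<in> borel_measurable M" if "u \<in> W" for u
    unfolding G_def by (rule borel_measurable_cSUP) (auto simp: um[OF that] bdd[OF that])
  have Gi: "integrable M (G u)" if "u \<in> W" for u
    by (rule integrable_const_bound[of _ B]) (auto simp: Gb that Gm)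
  define J where "J = (\<lambda>u. \<integral>\<omega>. G u \<omega> \<partial>M)"
  have Jle: "J u \<le> B" if "u \<in> W" for u
  proof -
    have "J u \<le> (\<integral>\<omega>. B \<partial>M)" unfolding J_def
      by (rule integral_mono) (use Gi[OF that] Gb[OF that] in \<open>auto simp: abs_le_iff\<close>)
    then show ?thesis by (simp add: prob_space)
  qed
  have bJ: "bdd_above (J ` W)" using Jle by (auto intro!: bdd_aboveI[of _ B])
  have Wne: "W \<noteq> {}" using ne unfolding W_def by (auto intro!: exI[of _ "\<lambda>_. SOME f. f \<in> \<F>"] simp: some_in_eq)
  define s where "s = (SUP u\<in>W. J u)"
  have "\<exists>u\<in>W. s - 1 / real (Suc n) < J u" for n
    using less_cSUP_iff[OF Wne bJ, of "s - 1 / real (Suc n)"] unfolding s_def by simp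
  then obtain U where U: "\<And>n. U n \<in> W" "\<And>n. s - 1 / real (Suc n) < J (U n)" by metis
  define v where "v = (\<lambda>m. U (fst (prod_decode m)) (snd (prod_decode m)))"
  have vW: "v \<in> W" using U(1) unfolding v_def W_def by auto
  have GU: "G (U n) \<omega> \<le> G v \<omega>" for n \<omega>
  proof (rule Gle)
    fix i show "U n i \<omega> \<le> G v \<omega>"
      using Gge[OF vW, of "prod_encode (n, i)" \<omega>] by (simp add: v_def)
  qed
  have JU: "s - 1 / real (Suc n) \<le> J v" for n
  proof -
    have "J (U n) \<le> J v" unfolding J_def
      by (rule integral_mono) (auto simp: Gi U(1) vW GU)
    then show ?thesis using U(2)[of n] by simp
  qed
  have sJ: "s \<le> J v"
  proof (rule field_le_epsilon)
    fix e :: real assume "e > 0"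
    then obtain n where "inverse (real (Suc n)) < e" using reals_Archimedean by blast
    then show "s \<le> J v + e" using JU[of n] by (simp add: inverse_eq_divide)
  qed
  have up: "AE \<omega> in M. f \<omega> \<le> G v \<omega>" if f: "f \<in> \<F>" for f
  proof -
    define w where "w = case_nat f v"
    have wW: "w \<in> W" using f vW unfolding w_def W_def by (auto split: nat.splits simp: image_subset_iff)
    have vw: "G v \<omega> \<le> G w \<omega>" for \<omega>
      by (rule Gle) (use Gge[OF wW, of "Suc _" \<omega>] in \<open>auto simp: w_def\<close>)
    have fw: "f \<omega> \<le> G w \<omega>" for \<omega> using Gge[OF wW, of 0 \<omega>] by (simp add: w_def)
    have "J w \<le> s" unfolding s_def by (rule cSUP_upper[OF wW bJ])
    then have "(\<integral>\<omega>. G w \<omega> - G v \<omega> \<partial>M) \<le> 0"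
      using sJ Gi[OF wW] Gi[OF vW] by (simp add: J_def)
    moreover have "(\<integral>\<omega>. G w \<omega> - G v \<omega> \<partial>M) \<ge> 0" by (rule integral_nonneg_AE) (simp add: vw)
    ultimately have "(\<integral>\<omega>. G w \<omega> - G v \<omega> \<partial>M) = 0" by simp
    then have "AE \<omega> in M. G w \<omega> - G v \<omega> = 0"
      by (subst (asm) integral_nonneg_eq_0_iff_AE) (auto simp: Gi wW vW vw)
    then show ?thesis
    proof eventually_elim
      case (elim \<omega>) then show ?case using fw[of \<omega>] by simp
    qed
  qed
  have least: "AE \<omega> in M. G v \<omega> \<le> g' \<omega>" if g': "\<forall>f\<in>\<F>. AE \<omega> in M. f \<omega> \<le> g' \<omega>" for g' :: "'a \<Rightarrow> real"
  proof -
    have "AE \<omega> in M. \<forall>n. v n \<omega> \<le> g' \<omega>"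
      using g' vW by (subst AE_all_countable) (auto simp: W_def)
    then show ?thesis by eventually_elim (auto intro: Gle)
  qed
  show ?thesis unfolding is_family_ess_sup_def using Gm[OF vW] up least by blast
qed

lemma (in prob_space) is_family_ess_sup_cond_dev:
  assumes G: "subalgebra M G" and F: "sets F \<subseteq> sets M" and ne: "sets F \<noteq> {}"
  shows "is_family_ess_sup M (cond_dev M G ` sets F) (family_ess_sup M (cond_dev M G ` sets F))"
proof -
  interpret finite_measure_subalgebra M G by unfold_locales (rule G)
  have m[measurable]: "cond_dev M G A \<in> borel_measurable M" for A
    unfolding cond_dev_def[abs_def] by measurable
  have b: "AE \<omega> in M. \<bar>cond_dev M G A \<omega>\<bar> \<le> 1" if "A \<in> sets F" for A
  proof -
    have A: "A \<in> sets M" using that F by auto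
    have i: "integrable M (indicator A :: 'a \<Rightarrow> real)" using A by (simp add: emeasure_eq_measure)
    have "AE \<omega> in M. real_cond_exp M G (indicator A) \<omega> \<ge> 0"
      by (rule real_cond_exp_ge_c[OF i]) simp
    moreover have "AE \<omega> in M. real_cond_exp M G (indicator A) \<omega> \<le> 1"
      by (rule real_cond_exp_le_c[OF i]) (simp add: indicator_def)
    ultimately show ?thesis
    proof eventually_elim
      case (elim \<omega>) then show ?case using prob_le_1[of A] measure_nonneg[of M A] by (simp add: cond_dev_def abs_le_iff; linarith)
    qed
  qed
  define c where "c = (\<lambda>A \<omega>. max (-1) (min 1 (cond_dev M G A \<omega>)))"
  have ceq: "AE \<omega> in M. c A \<omega> = cond_dev M G A \<omega>" if "A \<in> sets F" for A
    using b[OF that] by eventually_elim (auto simp: c_def abs_le_iff)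
  have "\<exists>g. is_family_ess_sup M (c ` sets F) g"
    by (rule family_ess_sup_exists_bounded[of _ 1]) (use ne in \<open>auto simp: c_def[abs_def]\<close>)
  then obtain g where g: "is_family_ess_sup M (c ` sets F) g" ..
  have eqv: "(AE \<omega> in M. c A \<omega> \<le> k \<omega>) \<longleftrightarrow> (AE \<omega> in M. cond_dev M G A \<omega> \<le> k \<omega>)"
    if "A \<in> sets F" for A and k :: "'a \<Rightarrow> real"
  proof
    assume "AE \<omega> in M. c A \<omega> \<le> k \<omega>"
    with ceq[OF that] show "AE \<omega> in M. cond_dev M G A \<omega> \<le> k \<omega>" by eventually_elim simp
  next
    assume "AE \<omega> in M. cond_dev M G A \<omega> \<le> k \<omega>"
    with ceq[OF that] show "AE \<omega> in M. c A \<omega> \<le> k \<omega>" by eventually_elim simp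
  qed
  have "is_family_ess_sup M (cond_dev M G ` sets F) g"
    using g unfolding is_family_ess_sup_def by (simp add: eqv)
  then show ?thesis unfolding family_ess_sup_def by (rule someI[where P = "is_family_ess_sup M (cond_dev M G ` sets F)"])
qed

end

theory Submission
  imports Defs "HOL-Real_Asymp.Real_Asymp"
begin

text \<open>
  Hoeffding's decomposition \<open>h x y = \<theta> + h1 x + h1 y + h2 x y\<close> with \<open>h2\<close> degenerate turns
  \<open>sqrt n (U_n - \<theta>)\<close> into \<open>2 / sqrt n\<close> times the partial sum of the \<open>h1 (X i)\<close> plus a remainder.
  In both cases the process is strongly mixing with a rate that makes Davydov's covariance inequality
  summable, and the partial sums obey the central limit theorem by Bernstein's method of blocks and
  truncation.

  The remainder vanishes in \<open>L\<^sup>2\<close> as soon as \<open>E (h2 (X i) (X j) h2 (X k) (X l))\<close> decays faster than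
  \<open>1 / m\<close> whenever the smallest or the largest of the four indices is at distance at least \<open>m\<close> from the
  other three. Replacing the isolated variable by an independent copy makes this expectation vanish, so
  only the price of the replacement has to be bounded, for a truncated kernel. Under absolute
  regularity the price is \<open>2 \<beta>(m)\<close> times the bound of the integrand, because \<open>\<beta>\<close> controls the total variation
  distance. Under strong mixing the kernel is first averaged over the cells of a grid; a maximal
  coupling, whose two pairs have admissible laws, bounds the error by the Lipschitz condition.
  Averaged over \<open>N\<close> cells, the price is of order \<open>sqrt N \<alpha>(m)\<close> by Khintchine's inequality rather
  than the \<open>N \<alpha>(m)\<close> of the triangle inequality, which is what the rate on \<open>\<alpha>\<close> allows.
\<close>

section \<open>Covariance inequalities under strong mixing\<close>

text \<open>Decay faster than 1 / m suffices because each four-index expectation is bounded twice,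
  through the gap after the smallest and through the gap before the largest index. The geometric
  mean of the two bounds is a product of weights of order m^(-(1+\<eta>)/2), one per gap. The
  weights need not be summable: partial sums of order o(sqrt n) make the second moment of the
  degenerate sum o(n^3). Truncating the kernel at T costs T^(-\<delta>), which suggests T =
  m^((1+\<eta>)/\<delta>). Under absolute regularity the price T^2 \<beta>(m) has the same order
  when \<rho> = (1+\<eta>)(2+\<delta>)/\<delta>; the strict inequality \<delta>' < \<delta> leaves
  room for \<eta> > 0. Under strong mixing the obstacle is that \<alpha> controls events but not
  total variation, so the kernel has to become a step function of one argument. Cell width, tail and
  number of cells then enter the exponent, and at \<eta> = 0 their balance is exactly the rate
  demanded in (ii). Truncation destroys degeneracy, so truncated integrals are compared with each
  other, and degeneracy is used for the untruncated kernel.\<close>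

definition alpha_bound :: "'a measure \<Rightarrow> 'a measure \<Rightarrow> 'a measure \<Rightarrow> real \<Rightarrow> bool" where
  "alpha_bound M F G a \<longleftrightarrow>
     (\<forall>A\<in>sets F. \<forall>B\<in>sets G. \<bar>measure M (A \<inter> B) - measure M A * measure M B\<bar> \<le> a)"

lemma alpha_boundD:
  "alpha_bound M F G a \<Longrightarrow> A \<in> sets F \<Longrightarrow> B \<in> sets G \<Longrightarrow>
    \<bar>measure M (A \<inter> B) - measure M A * measure M B\<bar> \<le> a"
  unfolding alpha_bound_def by auto

context prob_space
begin

lemma integrable_bounded:
  fixes f :: "'a \<Rightarrow> real"
  assumes "f \<in> borel_measurable M" "\<And>\<omega>. \<omega> \<in> space M \<Longrightarrow> \<bar>f \<omega>\<bar> \<le> c"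
  shows "integrable M f"
  by (rule integrable_const_bound[of _ c]) (use assms in auto)

text \<open>A non-integrable function has integral 0 by convention, a case which the assumption
  \<open>0 \<le> c\<close> covers.\<close>

lemma abs_expectation_le_bound:
  fixes f :: "'a \<Rightarrow> real"
  assumes "\<And>\<omega>. \<omega> \<in> space M \<Longrightarrow> \<bar>f \<omega>\<bar> \<le> c" "0 \<le> c"
  shows "\<bar>expectation f\<bar> \<le> c"
proof (cases "integrable M f")
  case True
  have "\<bar>expectation f\<bar> \<le> (\<integral>\<omega>. \<bar>f \<omega>\<bar> \<partial>M)" by (rule integral_abs_bound)
  also have "\<dots> \<le> (\<integral>\<omega>. c \<partial>M)" using True assms by (intro integral_mono) auto
  finally show ?thesis by (simp add: prob_space)
qed (use assms in \<open>simp add: not_integrable_integral_eq\<close>)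

text \<open>The sets where the conditional expectation is above and below the mean both lie in
  \<open>F\<close>. On each of them the integral of the deviation is one of the covariances bounded
  by \<open>c\<close>, whence the factor 2.\<close>

lemma cond_exp_deviation_le:
  fixes \<psi> :: "'a \<Rightarrow> real"
  assumes F: "subalgebra M F" and \<psi>: "integrable M \<psi>"
    and c: "\<And>A. A \<in> sets F \<Longrightarrow> \<bar>(\<integral>\<omega>. indicator A \<omega> * \<psi> \<omega> \<partial>M) - prob A * expectation \<psi>\<bar> \<le> c"
  shows "(\<integral>\<omega>. \<bar>real_cond_exp M F \<psi> \<omega> - expectation \<psi>\<bar> \<partial>M) \<le> 2 * c"
proof -
  interpret finite_measure_subalgebra M F by unfold_locales (rule F)
  define a where "a = (\<lambda>\<omega>. real_cond_exp M F \<psi> \<omega> - expectation \<psi>)"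
  have aF[measurable]: "a \<in> borel_measurable F" unfolding a_def by measurable
  have ai: "integrable M a" unfolding a_def using \<psi> by (intro Bochner_Integration.integrable_diff real_cond_exp_int) auto
  have m[measurable]: "a \<in> borel_measurable M" using ai by auto
  have sp: "space F = space M" using F by (auto simp: subalgebra_def)
  have sM: "A \<in> sets M" if "A \<in> sets F" for A using F that by (auto simp: subalgebra_def)
  define A where "A = {\<omega>\<in>space M. a \<omega> \<ge> 0}"
  define B where "B = {\<omega>\<in>space M. a \<omega> < 0}"
  have A: "A \<in> sets F" and B: "B \<in> sets F" unfolding A_def B_def sp[symmetric] by measurable
  have *: "integrable M (\<lambda>\<omega>. indicator D \<omega> * a \<omega>)"
    "(\<integral>\<omega>. indicator D \<omega> * a \<omega> \<partial>M) = (\<integral>\<omega>. indicator D \<omega> * \<psi> \<omega> \<partial>M) - prob D * expectation \<psi>"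
    if D: "D \<in> sets F" for D
  proof -
    have i: "integrable M (\<lambda>\<omega>. indicator D \<omega> * \<psi> \<omega>)"
      using integrable_real_mult_indicator[OF sM[OF D] \<psi>] by (simp add: mult.commute)
    have r: "integrable M (\<lambda>\<omega>. indicator D \<omega> * real_cond_exp M F \<psi> \<omega>)"
      "(\<integral>\<omega>. indicator D \<omega> * real_cond_exp M F \<psi> \<omega> \<partial>M) = (\<integral>\<omega>. indicator D \<omega> * \<psi> \<omega> \<partial>M)"
      using real_cond_exp_intg[OF i _ ] D \<psi> by auto
    have j: "integrable M (\<lambda>\<omega>. indicator D \<omega> * expectation \<psi>)"
      using sM[OF D] by (intro integrable_mult_left integrable_real_indicator) (auto simp: emeasure_eq_measure)
    show "integrable M (\<lambda>\<omega>. indicator D \<omega> * a \<omega>)"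
      "(\<integral>\<omega>. indicator D \<omega> * a \<omega> \<partial>M) = (\<integral>\<omega>. indicator D \<omega> * \<psi> \<omega> \<partial>M) - prob D * expectation \<psi>"
      unfolding a_def right_diff_distrib using r j sM[OF D] by simp_all
  qed
  have "(\<integral>\<omega>. \<bar>a \<omega>\<bar> \<partial>M) = (\<integral>\<omega>. indicator A \<omega> * a \<omega> - indicator B \<omega> * a \<omega> \<partial>M)"
    by (rule Bochner_Integration.integral_cong) (auto simp: A_def B_def indicator_def)
  also have "\<dots> = (\<integral>\<omega>. indicator A \<omega> * a \<omega> \<partial>M) - (\<integral>\<omega>. indicator B \<omega> * a \<omega> \<partial>M)"
    using *(1)[OF A] *(1)[OF B] by simp
  also have "\<dots> \<le> 2 * c" using c[OF A] c[OF B] *(2)[OF A] *(2)[OF B] by linarith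
  finally show ?thesis by (simp add: a_def)
qed

text \<open>Since \<open>Z\<close> is \<open>F\<close>-measurable, \<open>\<psi>\<close> may be
  replaced by its conditional expectation. The bound on \<open>Z\<close> comes out, and the L1
  deviation of the preceding lemma remains.\<close>

lemma covariance_le_of_events:
  fixes \<psi> Z :: "'a \<Rightarrow> real"
  assumes F: "subalgebra M F" and \<psi>: "integrable M \<psi>"
    and c: "\<And>A. A \<in> sets F \<Longrightarrow> \<bar>(\<integral>\<omega>. indicator A \<omega> * \<psi> \<omega> \<partial>M) - prob A * expectation \<psi>\<bar> \<le> c"
    and Z: "Z \<in> borel_measurable F" "\<And>\<omega>. \<omega> \<in> space M \<Longrightarrow> \<bar>Z \<omega>\<bar> \<le> u" and u: "0 \<le> u"
  shows "\<bar>(\<integral>\<omega>. Z \<omega> * \<psi> \<omega> \<partial>M) - expectation Z * expectation \<psi>\<bar> \<le> 2 * c * u"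
proof -
  interpret finite_measure_subalgebra M F by unfold_locales (rule F)
  have ZM[measurable]: "Z \<in> borel_measurable M" by (rule measurable_from_subalg[OF F Z(1)])
  have Zi: "integrable M Z" by (rule integrable_bounded[OF ZM Z(2)])
  let ?c = "real_cond_exp M F \<psi>"
  have i: "integrable M (\<lambda>\<omega>. Z \<omega> * \<psi> \<omega>)"
    by (rule Bochner_Integration.integrable_bound[of _ "\<lambda>\<omega>. u * \<bar>\<psi> \<omega>\<bar>"])
      (use \<psi> Z(2) u in \<open>auto simp: abs_mult intro!: mult_right_mono AE_I2\<close>)
  note r = real_cond_exp_intg[OF i Z(1)]
  have di: "integrable M (\<lambda>\<omega>. ?c \<omega> - expectation \<psi>)" using \<psi> by (intro Bochner_Integration.integrable_diff real_cond_exp_int) auto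
  have "(\<integral>\<omega>. Z \<omega> * \<psi> \<omega> \<partial>M) - expectation Z * expectation \<psi> = (\<integral>\<omega>. Z \<omega> * (?c \<omega> - expectation \<psi>) \<partial>M)"
    using r \<psi> Zi by (simp add: right_diff_distrib)
  also have "\<bar>\<dots>\<bar> \<le> (\<integral>\<omega>. \<bar>Z \<omega> * (?c \<omega> - expectation \<psi>)\<bar> \<partial>M)" by (rule integral_abs_bound)
  also have "\<dots> \<le> (\<integral>\<omega>. u * \<bar>?c \<omega> - expectation \<psi>\<bar> \<partial>M)"
  proof (rule integral_mono)
    have "integrable M (\<lambda>\<omega>. Z \<omega> * (?c \<omega> - expectation \<psi>))"
      unfolding right_diff_distrib using r \<psi> Zi by auto
    then show "integrable M (\<lambda>\<omega>. \<bar>Z \<omega> * (?c \<omega> - expectation \<psi>)\<bar>)" by (rule integrable_abs)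
  qed (use di Z(2) in \<open>auto simp: abs_mult intro!: mult_right_mono\<close>)
  also have "\<dots> \<le> u * (2 * c)"
    using mult_left_mono[OF cond_exp_deviation_le[OF F \<psi> c] u] by simp
  finally show ?thesis by (simp add: mult_ac)
qed

lemma covariance_indicator_le:
  fixes Z :: "'a \<Rightarrow> real"
  assumes F: "subalgebra M F" and G: "subalgebra M G" and a: "alpha_bound M F G a"
    and Z: "Z \<in> borel_measurable F" "\<And>\<omega>. \<omega> \<in> space M \<Longrightarrow> \<bar>Z \<omega>\<bar> \<le> u" and u: "0 \<le> u"
    and B: "B \<in> sets G"
  shows "\<bar>(\<integral>\<omega>. indicator B \<omega> * Z \<omega> \<partial>M) - prob B * expectation Z\<bar> \<le> 2 * a * u"
proof -
  have BM: "B \<in> sets M" using G B by (auto simp: subalgebra_def)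
  have "\<bar>(\<integral>\<omega>. indicator A \<omega> * indicator B \<omega> \<partial>M) - prob A * (\<integral>\<omega>. indicator B \<omega> \<partial>M)\<bar> \<le> a"
    if "A \<in> sets F" for A
  proof -
    have "A \<in> sets M" using F that by (auto simp: subalgebra_def)
    then show ?thesis
      using alpha_boundD[OF a that B] BM by (simp add: indicator_inter_arith[symmetric])
  qed
  from covariance_le_of_events[OF F _ this Z u] BM
  show ?thesis by (simp add: mult.commute emeasure_eq_measure)
qed

text \<open>The passage from events to functions is made twice, once for each factor. Each passage
  costs a factor 2, and 4 is the product.\<close>

lemma covariance_bounded_le:
  fixes \<psi> Z :: "'a \<Rightarrow> real"
  assumes F: "subalgebra M F" and G: "subalgebra M G" and a: "alpha_bound M F G a"
    and Z: "Z \<in> borel_measurable F" "\<And>\<omega>. \<omega> \<in> space M \<Longrightarrow> \<bar>Z \<omega>\<bar> \<le> u" and u: "0 \<le> u"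
    and \<psi>: "\<psi> \<in> borel_measurable G" "\<And>\<omega>. \<omega> \<in> space M \<Longrightarrow> \<bar>\<psi> \<omega>\<bar> \<le> v" and v: "0 \<le> v"
  shows "\<bar>(\<integral>\<omega>. Z \<omega> * \<psi> \<omega> \<partial>M) - expectation Z * expectation \<psi>\<bar> \<le> 4 * a * u * v"
proof -
  have ZM: "Z \<in> borel_measurable M" by (rule measurable_from_subalg[OF F Z(1)])
  have "\<bar>(\<integral>\<omega>. \<psi> \<omega> * Z \<omega> \<partial>M) - expectation \<psi> * expectation Z\<bar> \<le> 2 * (2 * a * u) * v"
    by (rule covariance_le_of_events[OF G integrable_bounded[OF ZM Z(2)] _ \<psi> v])
      (use covariance_indicator_le[OF F G a Z u] in auto)
  then show ?thesis by (simp add: mult_ac)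
qed

end

section \<open>Rademacher sums and Khintchine's inequality\<close>

lemma sum_Pow_insert:
  fixes f :: "'b set \<Rightarrow> 'c :: comm_monoid_add"
  assumes "finite I" "x \<notin> I"
  shows "(\<Sum>S\<in>Pow (insert x I). f S) = (\<Sum>S\<in>Pow I. f S + f (insert x S))"
proof -
  have inj: "inj_on (insert x) (Pow I)" using assms(2) by (auto simp: inj_on_def)
  have "(\<Sum>S\<in>Pow (insert x I). f S) = (\<Sum>S\<in>Pow I. f S) + (\<Sum>S\<in>insert x ` Pow I. f S)"
    unfolding Pow_insert by (rule sum.union_disjoint) (use assms in auto)
  also have "(\<Sum>S\<in>insert x ` Pow I. f S) = (\<Sum>S\<in>Pow I. f (insert x S))"
    by (simp add: sum.reindex[OF inj])
  finally show ?thesis by (simp add: sum.distrib)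
qed

text \<open>A Rademacher sum: \<open>S\<close> is the set of indices that carry a plus sign.
  Averaging over \<open>Pow I\<close> is then the expectation over independent fair signs, without a
  probability space for them.\<close>

definition signed_sum :: "'b set \<Rightarrow> ('b \<Rightarrow> real) \<Rightarrow> 'b set \<Rightarrow> real" where
  "signed_sum I z S = (\<Sum>i\<in>I. if i \<in> S then z i else - z i)"

lemma signed_sum_insert:
  assumes "finite I" "x \<notin> I" "S \<subseteq> I"
  shows "signed_sum (insert x I) z S = - z x + signed_sum I z S"
    "signed_sum (insert x I) z (insert x S) = z x + signed_sum I z S"
proof -
  show "signed_sum (insert x I) z S = - z x + signed_sum I z S"
    using assms by (auto simp: signed_sum_def)
  have "(\<Sum>i\<in>I. if i \<in> insert x S then z i else - z i) = (\<Sum>i\<in>I. if i \<in> S then z i else - z i)"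
    by (rule sum.cong) (use assms in auto)
  then show "signed_sum (insert x I) z (insert x S) = z x + signed_sum I z S"
    using assms by (simp add: signed_sum_def)
qed

text \<open>The offset \<open>b\<close> is left free so that it can absorb the term of a new index:
  the induction hypothesis is used at \<open>b - z x\<close> and at \<open>b + z x\<close>, and the
  odd powers cancel.\<close>

lemma signed_sum_second_moment:
  assumes "finite I"
  shows "(\<Sum>S\<in>Pow I. (b + signed_sum I z S)^2) = 2 ^ card I * (b^2 + (\<Sum>i\<in>I. (z i)^2))"
  using assms
proof (induction I arbitrary: b rule: finite_induct)
  case empty then show ?case by (simp add: signed_sum_def)
next
  case (insert x I)
  have "(\<Sum>S\<in>Pow (insert x I). (b + signed_sum (insert x I) z S)^2)
      = (\<Sum>S\<in>Pow I. ((b - z x) + signed_sum I z S)^2) + (\<Sum>S\<in>Pow I. ((b + z x) + signed_sum I z S)^2)"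
    by (simp add: sum_Pow_insert[OF insert(1,2)] sum.distrib[symmetric] signed_sum_insert[OF insert(1,2)] algebra_simps)
  then show ?case
    by (simp only: insert.IH) (use insert in \<open>simp add: power2_eq_square algebra_simps\<close>)
qed

text \<open>At \<open>b = 0\<close> this is the Gaussian comparison: the fourth moment is at most 3
  times the squared second moment.\<close>

lemma signed_sum_fourth_moment:
  assumes "finite I"
  shows "(\<Sum>S\<in>Pow I. (b + signed_sum I z S)^4)
     \<le> 2 ^ card I * (b^4 + 6 * b^2 * (\<Sum>i\<in>I. (z i)^2) + 3 * (\<Sum>i\<in>I. (z i)^2)^2)"
  using assms
proof (induction I arbitrary: b rule: finite_induct)
  case empty then show ?case by (simp add: signed_sum_def)
next
  case (insert x I)
  let ?A = "\<Sum>i\<in>I. (z i)^2"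
  have "(\<Sum>S\<in>Pow (insert x I). (b + signed_sum (insert x I) z S)^4)
      = (\<Sum>S\<in>Pow I. ((b - z x) + signed_sum I z S)^4) + (\<Sum>S\<in>Pow I. ((b + z x) + signed_sum I z S)^4)"
    by (simp add: sum_Pow_insert[OF insert(1,2)] sum.distrib[symmetric] signed_sum_insert[OF insert(1,2)] algebra_simps)
  also have "\<dots> \<le> 2 ^ card I * ((b - z x)^4 + 6 * (b - z x)^2 * ?A + 3 * ?A^2)
      + 2 ^ card I * ((b + z x)^4 + 6 * (b + z x)^2 * ?A + 3 * ?A^2)"
    by (intro add_mono insert.IH)
  also have "\<dots> = 2 ^ Suc (card I) * (b^4 + 6 * b^2 * (z x^2 + ?A) + (z x^4 + 6 * z x^2 * ?A + 3 * ?A^2))"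
    by (simp add: power2_eq_square power4_eq_xxxx algebra_simps)
  also have "\<dots> \<le> 2 ^ Suc (card I) * (b^4 + 6 * b^2 * (z x^2 + ?A) + 3 * (z x^2 + ?A)^2)"
  proof -
    have "3 * (z x^2 + ?A)^2 = (z x^4 + 6 * z x^2 * ?A + 3 * ?A^2) + 2 * z x^4"
      by (simp add: power2_eq_square power4_eq_xxxx algebra_simps)
    then have "z x^4 + 6 * z x^2 * ?A + 3 * ?A^2 \<le> 3 * (z x^2 + ?A)^2" by simp
    then show ?thesis by (intro mult_left_mono add_left_mono) simp_all
  qed
  finally show ?case using insert by simp
qed

text \<open>The minorant may involve only even powers, because the second and fourth moments are
  what is known of a Rademacher sum.\<close>

lemma abs_ge_quadratic_minus_quartic:
  fixes u :: real assumes "u \<ge> 0" shows "u^2 - u^4 / 6 \<le> u"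
proof -
  \<comment> \<open>The cubic \<open>u^3 - 6 * u + 6\<close> has its minimum over u \<ge> 0 at the
    square root of 2, of which 71/50 is a rational approximation. With a double root c the expansion
    is u^3 - 3 c^2 u + 2 c^3, and here 3 c^2 exceeds 6 while 2 c^3 stays below 6.\<close>
  have "(u - 71/50)^2 * (u + 142/50) = u^3 - (15123/2500) * u + 357911/62500"
    by (simp add: power2_eq_square power3_eq_cube field_simps)
  moreover have "0 \<le> (u - 71/50)^2 * (u + 142/50)" using assms by simp
  ultimately have "0 \<le> u^3 - 6 * u + 6" using assms by linarith
  then have "0 \<le> u * (u^3 - 6 * u + 6)" using assms by simp
  then show ?thesis by (simp add: power2_eq_square power3_eq_cube power4_eq_xxxx algebra_simps)
qed

text \<open>The even minorant of the absolute value, rescaled by the l2 norm \<open>A\<close>, is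
  averaged over the signs. The quadratic part gives \<open>A\<close>, the quartic part removes at
  most \<open>3 * A / 6\<close>, and \<open>A / 2\<close> is left.\<close>

lemma Khintchine_L1:
  assumes I: "finite I"
  shows "sqrt (\<Sum>i\<in>I. (z i)^2) \<le> 2 / 2 ^ card I * (\<Sum>S\<in>Pow I. \<bar>signed_sum I z S\<bar>)"
proof (cases "(\<Sum>i\<in>I. (z i)^2) = 0")
  case True then show ?thesis by (simp add: sum_nonneg)
next
  case False
  define A where "A = sqrt (\<Sum>i\<in>I. (z i)^2)"
  have "(\<Sum>i\<in>I. (z i)^2) \<ge> 0" by (simp add: sum_nonneg)
  then have A: "A > 0" and A2: "A^2 = (\<Sum>i\<in>I. (z i)^2)" using False by (auto simp: A_def)
  have A4: "(\<Sum>i\<in>I. (z i)^2)^2 = A^4" unfolding A2[symmetric] by simp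
  have "\<bar>x\<bar> \<ge> x^2 / A - x^4 / (6 * A^3)" for x
  proof -
    have "A * ((\<bar>x\<bar> / A)^2 - (\<bar>x\<bar> / A)^4 / 6) \<le> A * (\<bar>x\<bar> / A)"
      using A by (intro mult_left_mono abs_ge_quadratic_minus_quartic) auto
    moreover have "A * ((\<bar>x\<bar> / A)^2 - (\<bar>x\<bar> / A)^4 / 6) = x^2 / A - x^4 / (6 * A^3)"
      using A by (simp add: power_divide right_diff_distrib) (simp add: field_simps eval_nat_numeral)
    ultimately show ?thesis using A by simp
  qed
  then have "(\<Sum>S\<in>Pow I. \<bar>signed_sum I z S\<bar>) \<ge> (\<Sum>S\<in>Pow I. (signed_sum I z S)^2 / A - (signed_sum I z S)^4 / (6 * A^3))"
    by (intro sum_mono) auto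
  also have "(\<Sum>S\<in>Pow I. (signed_sum I z S)^2 / A - (signed_sum I z S)^4 / (6 * A^3))
     = (\<Sum>S\<in>Pow I. (signed_sum I z S)^2) / A - (\<Sum>S\<in>Pow I. (signed_sum I z S)^4) / (6 * A^3)"
    by (simp add: sum_subtractf sum_divide_distrib)
  finally have "(\<Sum>S\<in>Pow I. (signed_sum I z S)^2) / A - (\<Sum>S\<in>Pow I. (signed_sum I z S)^4) / (6 * A^3)
      \<le> (\<Sum>S\<in>Pow I. \<bar>signed_sum I z S\<bar>)" .
  moreover have "(\<Sum>S\<in>Pow I. (signed_sum I z S)^2) / A = 2 ^ card I * A"
    using signed_sum_second_moment[OF I, of 0 z] A2[symmetric] A by (simp add: power2_eq_square)
  moreover have "(\<Sum>S\<in>Pow I. (signed_sum I z S)^4) / (6 * A^3) \<le> 2 ^ card I * (3 * A^4) / (6 * A^3)"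
    using signed_sum_fourth_moment[OF I, of 0 z] A A4 by (intro divide_right_mono) auto
  moreover have "2 ^ card I * (3 * A^4) / (6 * A^3) = 2 ^ card I * A / 2"
    using A by (simp add: field_simps eval_nat_numeral)
  ultimately have "2 ^ card I * A / 2 \<le> (\<Sum>S\<in>Pow I. \<bar>signed_sum I z S\<bar>)" by linarith
  then show ?thesis unfolding A_def[symmetric] by (simp add: field_simps)
qed

text \<open>Cauchy-Schwarz costs \<open>sqrt (card I)\<close> and leads to the l2 norm, to which
  Khintchine's inequality applies.\<close>

lemma sum_abs_le_signed_sums:
  assumes I: "finite I"
  shows "(\<Sum>i\<in>I. \<bar>z i\<bar>) \<le> 2 * sqrt (card I) / 2 ^ card I * (\<Sum>S\<in>Pow I. \<bar>signed_sum I z S\<bar>)"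
proof -
  have "(\<Sum>i\<in>I. \<bar>z i\<bar> * 1)^2 \<le> (\<Sum>i\<in>I. \<bar>z i\<bar>^2) * (\<Sum>i\<in>I. 1^2)"
    by (rule Cauchy_Schwarz_ineq_sum)
  then have "(\<Sum>i\<in>I. \<bar>z i\<bar>)^2 \<le> card I * (\<Sum>i\<in>I. (z i)^2)" by (simp add: mult.commute)
  then have "(\<Sum>i\<in>I. \<bar>z i\<bar>) \<le> sqrt (card I * (\<Sum>i\<in>I. (z i)^2))" by (rule real_le_rsqrt)
  also have "\<dots> = sqrt (card I) * sqrt (\<Sum>i\<in>I. (z i)^2)" by (simp add: real_sqrt_mult)
  also have "\<dots> \<le> sqrt (card I) * (2 / 2 ^ card I * (\<Sum>S\<in>Pow I. \<bar>signed_sum I z S\<bar>))"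
    by (intro mult_left_mono Khintchine_L1 I) simp
  finally show ?thesis by (simp add: mult_ac)
qed

section \<open>Sums of covariances over a finite family\<close>

context prob_space
begin

text \<open>Averaging over all sign patterns gains a factor \<open>sqrt (card I)\<close> over the triangle inequality.\<close>

lemma sum_cond_exp_deviation_le:
  fixes Z :: "'b \<Rightarrow> 'a \<Rightarrow> real"
  assumes F: "subalgebra M F" and G: "subalgebra M G" and a: "alpha_bound M F G a"
    and I: "finite I" and Z: "\<And>i. i \<in> I \<Longrightarrow> Z i \<in> borel_measurable F"
    and Zu: "\<And>\<omega>. \<omega> \<in> space M \<Longrightarrow> (\<Sum>i\<in>I. \<bar>Z i \<omega>\<bar>) \<le> u" and u: "0 \<le> u"
  shows "(\<Sum>i\<in>I. \<integral>\<omega>. \<bar>real_cond_exp M G (Z i) \<omega> - expectation (Z i)\<bar> \<partial>M) \<le> 8 * sqrt (card I) * a * u"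
proof -
  interpret finite_measure_subalgebra M G by unfold_locales (rule G)
  define d where "d = (\<lambda>i \<omega>. real_cond_exp M G (Z i) \<omega> - expectation (Z i))"
  have ZM[measurable]: "Z i \<in> borel_measurable M" if "i \<in> I" for i
    by (rule measurable_from_subalg[OF F Z[OF that]])
  have Zb: "\<bar>Z i \<omega>\<bar> \<le> u" if "i \<in> I" "\<omega> \<in> space M" for i \<omega>
    using member_le_sum[of i I "\<lambda>i. \<bar>Z i \<omega>\<bar>"] Zu[OF that(2)] I that(1) by simp
  have Zi: "integrable M (Z i)" if "i \<in> I" for i
    by (rule integrable_bounded[OF ZM[OF that] Zb[OF that]])
  have dG[measurable]: "d i \<in> borel_measurable G" for i unfolding d_def by measurable
  have di: "integrable M (d i)" if "i \<in> I" for i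
    unfolding d_def using Zi[OF that] by (intro Bochner_Integration.integrable_diff real_cond_exp_int) auto
  have S: "(\<integral>\<omega>. \<bar>signed_sum I (\<lambda>i. d i \<omega>) S\<bar> \<partial>M) \<le> 4 * a * u" 
    and Si: "integrable M (\<lambda>\<omega>. \<bar>signed_sum I (\<lambda>i. d i \<omega>) S\<bar>)" for S
  proof -
    define s where "s = (\<lambda>i. if i \<in> S then 1 else (-1::real))"
    have ss: "signed_sum I z S = (\<Sum>i\<in>I. s i * z i)" for z
      unfolding signed_sum_def s_def by (rule sum.cong) auto
    \<comment> \<open>The sign of the sum is \<open>G\<close>-measurable. Multiplying by it turns
      the L1 norm of a signed sum of deviations into a single covariance, between \<open>t\<close>
      and the signed sum of the \<open>Z i\<close>, which \<open>u\<close> bounds for every sign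
      pattern.\<close>
    define t where "t = (\<lambda>\<omega>. if 0 \<le> (\<Sum>i\<in>I. s i * d i \<omega>) then 1 else (-1::real))"
    have tG[measurable]: "t \<in> borel_measurable G" unfolding t_def by measurable
    have tM[measurable]: "t \<in> borel_measurable M" by (rule measurable_from_subalg[OF G tG])
    have tb: "\<bar>t \<omega>\<bar> \<le> 1" for \<omega> unfolding t_def by auto
    have ti: "integrable M t" by (rule integrable_bounded[OF tM tb])
    have tZi: "integrable M (\<lambda>\<omega>. t \<omega> * Z i \<omega>)" if "i \<in> I" for i
    proof (rule integrable_bounded[of _ u])
      show "(\<lambda>\<omega>. t \<omega> * Z i \<omega>) \<in> borel_measurable M" using that by measurable
      show "\<bar>t \<omega> * Z i \<omega>\<bar> \<le> u" if "\<omega> \<in> space M" for \<omega>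
        using mult_mono[OF tb Zb[OF \<open>i \<in> I\<close> that]] by (simp add: abs_mult)
    qed
    have tdi: "integrable M (\<lambda>\<omega>. t \<omega> * d i \<omega>)"
      and td: "(\<integral>\<omega>. t \<omega> * d i \<omega> \<partial>M) = (\<integral>\<omega>. t \<omega> * Z i \<omega> \<partial>M) - expectation (Z i) * expectation t" if "i \<in> I" for i
      using real_cond_exp_intg[OF tZi[OF that] tG ZM[OF that]] ti
      unfolding d_def right_diff_distrib by (auto simp: mult.commute)
    have sZi: "integrable M (\<lambda>\<omega>. s i * Z i \<omega>)" if "i \<in> I" for i using Zi[OF that] by simp
    have "integrable M (\<lambda>\<omega>. \<Sum>i\<in>I. s i * d i \<omega>)" using di by (intro Bochner_Integration.integrable_sum) simp
    then show "integrable M (\<lambda>\<omega>. \<bar>signed_sum I (\<lambda>i. d i \<omega>) S\<bar>)" unfolding ss by (rule integrable_abs)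
    have "(\<integral>\<omega>. \<bar>signed_sum I (\<lambda>i. d i \<omega>) S\<bar> \<partial>M) = (\<integral>\<omega>. (\<Sum>i\<in>I. s i * (t \<omega> * d i \<omega>)) \<partial>M)"
    proof (rule Bochner_Integration.integral_cong[OF refl])
      fix \<omega>
      have "\<bar>signed_sum I (\<lambda>i. d i \<omega>) S\<bar> = t \<omega> * (\<Sum>i\<in>I. s i * d i \<omega>)" unfolding ss t_def by auto
      then show "\<bar>signed_sum I (\<lambda>i. d i \<omega>) S\<bar> = (\<Sum>i\<in>I. s i * (t \<omega> * d i \<omega>))"
        by (simp add: sum_distrib_left mult_ac)
    qed
    also have "\<dots> = (\<Sum>i\<in>I. s i * (\<integral>\<omega>. t \<omega> * d i \<omega> \<partial>M))"
      using tdi by (subst Bochner_Integration.integral_sum) auto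
    also have "\<dots> = (\<Sum>i\<in>I. s i * (\<integral>\<omega>. t \<omega> * Z i \<omega> \<partial>M)) - (\<Sum>i\<in>I. s i * expectation (Z i)) * expectation t"
      using td by (simp add: sum_subtractf right_diff_distrib sum_distrib_left mult_ac)
    also have "(\<Sum>i\<in>I. s i * (\<integral>\<omega>. t \<omega> * Z i \<omega> \<partial>M)) = (\<integral>\<omega>. (\<Sum>i\<in>I. s i * Z i \<omega>) * t \<omega> \<partial>M)"
    proof -
      have "(\<lambda>\<omega>. (\<Sum>i\<in>I. s i * Z i \<omega>) * t \<omega>) = (\<lambda>\<omega>. \<Sum>i\<in>I. s i * (t \<omega> * Z i \<omega>))"
        by (simp add: sum_distrib_left mult_ac)
      then show ?thesis using tZi by (simp add: Bochner_Integration.integral_sum)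
    qed
    also have "(\<Sum>i\<in>I. s i * expectation (Z i)) = (\<integral>\<omega>. (\<Sum>i\<in>I. s i * Z i \<omega>) \<partial>M)"
      using sZi Zi by (subst Bochner_Integration.integral_sum) auto
    also have "(\<integral>\<omega>. (\<Sum>i\<in>I. s i * Z i \<omega>) * t \<omega> \<partial>M) - (\<integral>\<omega>. (\<Sum>i\<in>I. s i * Z i \<omega>) \<partial>M) * expectation t
        \<le> 4 * a * u * 1"
    proof (rule order_trans[OF abs_ge_self covariance_bounded_le[OF F G a _ _ u tG tb]])
      show "(\<lambda>\<omega>. \<Sum>i\<in>I. s i * Z i \<omega>) \<in> borel_measurable F" using Z by measurable
      show "\<bar>\<Sum>i\<in>I. s i * Z i \<omega>\<bar> \<le> u" if "\<omega> \<in> space M" for \<omega>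
      proof -
        have "\<bar>\<Sum>i\<in>I. s i * Z i \<omega>\<bar> \<le> (\<Sum>i\<in>I. \<bar>s i * Z i \<omega>\<bar>)" by (rule sum_abs)
        also have "\<dots> = (\<Sum>i\<in>I. \<bar>Z i \<omega>\<bar>)" by (rule sum.cong) (auto simp: s_def abs_mult)
        finally show ?thesis using Zu[OF that] by simp
      qed
    qed simp
    finally show "(\<integral>\<omega>. \<bar>signed_sum I (\<lambda>i. d i \<omega>) S\<bar> \<partial>M) \<le> 4 * a * u" by simp
  qed
  have "(\<Sum>i\<in>I. \<integral>\<omega>. \<bar>d i \<omega>\<bar> \<partial>M) = (\<integral>\<omega>. (\<Sum>i\<in>I. \<bar>d i \<omega>\<bar>) \<partial>M)"
    using di by (subst Bochner_Integration.integral_sum) auto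
  also have "\<dots> \<le> (\<integral>\<omega>. 2 * sqrt (card I) / 2 ^ card I * (\<Sum>S\<in>Pow I. \<bar>signed_sum I (\<lambda>i. d i \<omega>) S\<bar>) \<partial>M)"
    using di Si by (intro integral_mono sum_abs_le_signed_sums I) auto
  also have "\<dots> = 2 * sqrt (card I) / 2 ^ card I * (\<Sum>S\<in>Pow I. \<integral>\<omega>. \<bar>signed_sum I (\<lambda>i. d i \<omega>) S\<bar> \<partial>M)"
    using Si by (subst integral_mult_right_zero, subst Bochner_Integration.integral_sum) auto
  also have "\<dots> \<le> 2 * sqrt (card I) / 2 ^ card I * (\<Sum>S\<in>Pow I. 4 * a * u)"
    by (intro mult_left_mono sum_mono S) simp
  also have "\<dots> = 8 * sqrt (card I) * a * u" using I by (simp add: card_Pow)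
  finally show ?thesis by (simp add: d_def)
qed

text \<open>Each covariance is the integral of \<open>\<psi> i\<close> against the deviation of the
  conditional expectation of \<open>Z i\<close>, so \<open>v\<close> comes out and the summed
  deviations remain. In the applications the \<open>Z i\<close> live on disjoint cells, so that
  \<open>u\<close> does not grow with \<open>card I\<close>.\<close>

lemma sum_covariance_le:
  fixes Z \<psi> :: "'b \<Rightarrow> 'a \<Rightarrow> real"
  assumes F: "subalgebra M F" and G: "subalgebra M G" and a: "alpha_bound M F G a"
    and I: "finite I" and Z: "\<And>i. i \<in> I \<Longrightarrow> Z i \<in> borel_measurable F"
    and Zu: "\<And>\<omega>. \<omega> \<in> space M \<Longrightarrow> (\<Sum>i\<in>I. \<bar>Z i \<omega>\<bar>) \<le> u" and u: "0 \<le> u"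
    and \<psi>: "\<And>i. i \<in> I \<Longrightarrow> \<psi> i \<in> borel_measurable G"
    and \<psi>v: "\<And>i \<omega>. i \<in> I \<Longrightarrow> \<omega> \<in> space M \<Longrightarrow> \<bar>\<psi> i \<omega>\<bar> \<le> v" and v: "0 \<le> v"
  shows "\<bar>\<Sum>i\<in>I. (\<integral>\<omega>. Z i \<omega> * \<psi> i \<omega> \<partial>M) - expectation (Z i) * expectation (\<psi> i)\<bar> \<le> 8 * sqrt (card I) * a * u * v"
proof -
  interpret finite_measure_subalgebra M G by unfold_locales (rule G)
  have ZM[measurable]: "Z i \<in> borel_measurable M" if "i \<in> I" for i
    by (rule measurable_from_subalg[OF F Z[OF that]])
  have \<psi>M[measurable]: "\<psi> i \<in> borel_measurable M" if "i \<in> I" for i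
    by (rule measurable_from_subalg[OF G \<psi>[OF that]])
  have Zb: "\<bar>Z i \<omega>\<bar> \<le> u" if "i \<in> I" "\<omega> \<in> space M" for i \<omega>
    using member_le_sum[of i I "\<lambda>i. \<bar>Z i \<omega>\<bar>"] Zu[OF that(2)] I that(1) by simp
  have each: "\<bar>(\<integral>\<omega>. Z i \<omega> * \<psi> i \<omega> \<partial>M) - expectation (Z i) * expectation (\<psi> i)\<bar>
     \<le> v * (\<integral>\<omega>. \<bar>real_cond_exp M G (Z i) \<omega> - expectation (Z i)\<bar> \<partial>M)" if i: "i \<in> I" for i
  proof -
    have Zi: "integrable M (Z i)" by (rule integrable_bounded[OF ZM[OF i] Zb[OF i]])
    have \<psi>i: "integrable M (\<psi> i)" by (rule integrable_bounded[OF \<psi>M[OF i] \<psi>v[OF i]])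
    have pz: "integrable M (\<lambda>\<omega>. \<psi> i \<omega> * Z i \<omega>)"
    proof (rule integrable_bounded[of _ "v * u"])
      show "(\<lambda>\<omega>. \<psi> i \<omega> * Z i \<omega>) \<in> borel_measurable M" using i by measurable
      show "\<bar>\<psi> i \<omega> * Z i \<omega>\<bar> \<le> v * u" if "\<omega> \<in> space M" for \<omega>
        using mult_mono[OF \<psi>v[OF i that] Zb[OF i that] v] by (simp add: abs_mult)
    qed
    note r = real_cond_exp_intg[OF pz \<psi>[OF i] ZM[OF i]]
    have di: "integrable M (\<lambda>\<omega>. real_cond_exp M G (Z i) \<omega> - expectation (Z i))"
      using Zi by (intro Bochner_Integration.integrable_diff real_cond_exp_int) auto
    have "(\<integral>\<omega>. Z i \<omega> * \<psi> i \<omega> \<partial>M) - expectation (Z i) * expectation (\<psi> i)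
       = (\<integral>\<omega>. \<psi> i \<omega> * (real_cond_exp M G (Z i) \<omega> - expectation (Z i)) \<partial>M)"
      using r \<psi>i by (simp add: right_diff_distrib mult.commute)
    also have "\<bar>\<dots>\<bar> \<le> (\<integral>\<omega>. \<bar>\<psi> i \<omega> * (real_cond_exp M G (Z i) \<omega> - expectation (Z i))\<bar> \<partial>M)"
      by (rule integral_abs_bound)
    also have "\<dots> \<le> (\<integral>\<omega>. v * \<bar>real_cond_exp M G (Z i) \<omega> - expectation (Z i)\<bar> \<partial>M)"
    proof (rule integral_mono)
      have "integrable M (\<lambda>\<omega>. \<psi> i \<omega> * (real_cond_exp M G (Z i) \<omega> - expectation (Z i)))"
        unfolding right_diff_distrib using r \<psi>i by auto
      then show "integrable M (\<lambda>\<omega>. \<bar>\<psi> i \<omega> * (real_cond_exp M G (Z i) \<omega> - expectation (Z i))\<bar>)" by (rule integrable_abs)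
    qed (use di \<psi>v[OF i] in \<open>auto simp: abs_mult intro!: mult_right_mono\<close>)
    finally show ?thesis by simp
  qed
  have "\<bar>\<Sum>i\<in>I. (\<integral>\<omega>. Z i \<omega> * \<psi> i \<omega> \<partial>M) - expectation (Z i) * expectation (\<psi> i)\<bar>
     \<le> (\<Sum>i\<in>I. v * (\<integral>\<omega>. \<bar>real_cond_exp M G (Z i) \<omega> - expectation (Z i)\<bar> \<partial>M))"
    by (rule order_trans[OF sum_abs sum_mono[OF each]])
  also have "\<dots> \<le> v * (8 * sqrt (card I) * a * u)"
    unfolding sum_distrib_left[symmetric]
    by (intro mult_left_mono sum_cond_exp_deviation_le[OF F G a I Z Zu u] v) auto
  finally show ?thesis by (simp add: mult_ac)
qed

end

section \<open>Truncation, and covariances under moment bounds\<close>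

definition clip :: "real \<Rightarrow> real \<Rightarrow> real" where
  "clip T x = max (- T) (min T x)"

lemma borel_measurable_clip[measurable (raw)]:
  "f \<in> borel_measurable N \<Longrightarrow> (\<lambda>x. clip T (f x)) \<in> borel_measurable N"
  unfolding clip_def by (intro borel_measurable_max borel_measurable_min borel_measurable_const)

lemma abs_clip_le: "0 \<le> T \<Longrightarrow> \<bar>clip T x\<bar> \<le> T"
  unfolding clip_def by auto

lemma abs_clip_le_abs: "0 \<le> T \<Longrightarrow> \<bar>clip T x\<bar> \<le> \<bar>x\<bar>"
  unfolding clip_def by auto

text \<open>The reason for clipping instead of cutting off to 0: a 1-Lipschitz truncation preserves
  the Lipschitz condition on the kernel.\<close>

lemma abs_clip_diff_le: "\<bar>clip T x - clip T y\<bar> \<le> \<bar>x - y\<bar>"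
  unfolding clip_def by (auto simp: max_def min_def)

lemma clip_eq: "\<bar>x\<bar> \<le> T \<Longrightarrow> clip T x = x"
  unfolding clip_def by auto

lemma abs_diff_clip_le: "0 \<le> T \<Longrightarrow> \<bar>x - clip T x\<bar> \<le> \<bar>x\<bar>"
  unfolding clip_def by auto

lemma square_le_powr_tail:
  fixes x T d :: real
  assumes "T < x" "0 < T" "0 < d"
  shows "x * x \<le> T powr (- d) * x powr (2 + d)"
proof -
  have "T powr (- d) * x powr (2 + d) = x^2 * (T powr (-d) * x powr d)"
    using assms by (simp add: powr_add mult_ac)
  also have "T powr (-d) * x powr d \<ge> T powr (-d) * T powr d"
    using assms by (intro mult_left_mono powr_mono2) auto
  then have "x^2 * (T powr (-d) * x powr d) \<ge> x^2 * 1"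
    using assms by (intro mult_left_mono) (auto simp: powr_minus)
  finally show ?thesis by (simp add: power2_eq_square)
qed

lemma mult_le_of_abs:
  fixes x y T d :: real
  assumes T: "0 < T" and d: "0 < d" and m: "T < \<bar>x\<bar> \<or> T < \<bar>y\<bar>"
  shows "\<bar>x\<bar> * \<bar>y\<bar> \<le> T powr (- d) * (\<bar>x\<bar> powr (2 + d) + \<bar>y\<bar> powr (2 + d))"
proof -
  define z where "z = max \<bar>x\<bar> \<bar>y\<bar>"
  have "\<bar>x\<bar> * \<bar>y\<bar> \<le> z * z" unfolding z_def by (intro mult_mono) auto
  also have "\<dots> \<le> T powr (- d) * z powr (2 + d)"
    by (rule square_le_powr_tail) (use T d m in \<open>auto simp: z_def\<close>)
  also have "\<dots> \<le> T powr (- d) * (\<bar>x\<bar> powr (2 + d) + \<bar>y\<bar> powr (2 + d))"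
    by (intro mult_left_mono) (auto simp: z_def max_def)
  finally show ?thesis .
qed

text \<open>Clipping multiplies by a factor in [0, 1], so the difference is at most
  \<open>\<bar>x * y\<bar>\<close>. It vanishes unless one argument exceeds \<open>T\<close>, and
  then the larger argument dominates the product.\<close>

lemma clip_mult_diff_le:
  fixes x y T d :: real
  assumes T: "0 < T" and d: "0 < d"
  shows "\<bar>x * y - clip T x * clip T y\<bar> \<le> T powr (- d) * (\<bar>x\<bar> powr (2 + d) + \<bar>y\<bar> powr (2 + d))"
proof (cases "\<bar>x\<bar> \<le> T \<and> \<bar>y\<bar> \<le> T")
  case True then show ?thesis by (simp add: clip_eq)
next
  case False
  have c: "\<exists>s. 0 \<le> s \<and> s \<le> 1 \<and> clip T x = s * x" for x
  proof (cases "\<bar>x\<bar> \<le> T")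
    case True then show ?thesis by (intro exI[of _ 1]) (simp add: clip_eq)
  next
    case False then show ?thesis using T
      by (intro exI[of _ "T / \<bar>x\<bar>"]) (auto simp: clip_def field_simps abs_if)
  qed
  obtain s where s: "0 \<le> s" "s \<le> 1" "clip T x = s * x" using c by blast
  obtain r where r: "0 \<le> r" "r \<le> 1" "clip T y = r * y" using c by blast
  have "x * y - clip T x * clip T y = (1 - s * r) * (x * y)" using s r by (simp add: algebra_simps)
  moreover have "s * r \<le> 1" "0 \<le> s * r" using s r mult_mono[of s 1 r 1] by auto
  ultimately have "\<bar>x * y - clip T x * clip T y\<bar> \<le> 1 * \<bar>x * y\<bar>"
    by (simp only: abs_mult) (intro mult_right_mono, auto)
  also have "\<dots> \<le> T powr (- d) * (\<bar>x\<bar> powr (2 + d) + \<bar>y\<bar> powr (2 + d))"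
    using mult_le_of_abs[OF T d, of x y] False unfolding abs_mult by linarith
  finally show ?thesis .
qed

lemma square_le_powr_sum:
  fixes x d :: real assumes "0 < T" "0 < d"
  shows "x * x \<le> T^2 + T powr (- d) * \<bar>x\<bar> powr (2 + d)"
proof (cases "\<bar>x\<bar> \<le> T")
  case True
  then have "\<bar>x\<bar> * \<bar>x\<bar> \<le> T * T" by (intro mult_mono) auto
  then show ?thesis by (simp add: power2_eq_square add_increasing2)
next
  case False
  then show ?thesis using square_le_powr_tail[of T "\<bar>x\<bar>" d] assms by (simp add: add_increasing)
qed

context prob_space
begin

lemma square_integrable_of_powr:
  fixes Y :: "'a \<Rightarrow> real"
  assumes [measurable]: "Y \<in> borel_measurable M" and d: "0 < d"
    and Y: "integrable M (\<lambda>\<omega>. \<bar>Y \<omega>\<bar> powr (2 + d))"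
  shows "integrable M (\<lambda>\<omega>. Y \<omega> * Y \<omega>)" "integrable M Y"
proof -
  show i: "integrable M (\<lambda>\<omega>. Y \<omega> * Y \<omega>)"
    by (rule Bochner_Integration.integrable_bound[of _ "\<lambda>\<omega>. 1^2 + 1 powr (- d) * \<bar>Y \<omega>\<bar> powr (2 + d)"])
      (use Y square_le_powr_sum[of 1 d] d in \<open>auto intro!: AE_I2\<close>)
  show "integrable M Y"
    by (rule square_integrable_imp_integrable) (use i in \<open>auto simp: power2_eq_square\<close>)
qed

lemma integrable_mult_of_squares:
  fixes Y Z :: "'a \<Rightarrow> real"
  assumes [measurable]: "Y \<in> borel_measurable M" "Z \<in> borel_measurable M"
    and Y: "integrable M (\<lambda>\<omega>. Y \<omega> * Y \<omega>)" and Z: "integrable M (\<lambda>\<omega>. Z \<omega> * Z \<omega>)"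
  shows "integrable M (\<lambda>\<omega>. Y \<omega> * Z \<omega>)"
proof (rule Bochner_Integration.integrable_bound[of _ "\<lambda>\<omega>. Y \<omega> * Y \<omega> + Z \<omega> * Z \<omega>"])
  have "\<bar>y * z\<bar> \<le> y * y + z * z" for y z :: real
  proof -
    have "0 \<le> (\<bar>y\<bar> - \<bar>z\<bar>)^2" by simp
    then have "2 * (\<bar>y\<bar> * \<bar>z\<bar>) \<le> y * y + z * z" by (simp add: power2_eq_square algebra_simps)
    moreover have "0 \<le> \<bar>y\<bar> * \<bar>z\<bar>" by simp
    ultimately show ?thesis unfolding abs_mult by linarith
  qed
  then show "AE \<omega> in M. norm (Y \<omega> * Z \<omega>) \<le> norm (Y \<omega> * Y \<omega> + Z \<omega> * Z \<omega>)"
    by (auto intro!: AE_I2)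
qed (use Y Z in auto)

text \<open>Davydov's inequality, in the form in which a single moment bound serves both factors.\<close>

lemma covariance_le_of_moments:
  fixes Y Z :: "'a \<Rightarrow> real"
  assumes F: "subalgebra M F" and G: "subalgebra M G" and ab: "alpha_bound M F G a" and a: "0 < a"
    and Y: "Y \<in> borel_measurable F" and Z: "Z \<in> borel_measurable G"
    and d: "0 < d" and A: "0 < A"
    and Yi: "integrable M (\<lambda>\<omega>. \<bar>Y \<omega>\<bar> powr (2 + d))" and YA: "(\<integral>\<omega>. \<bar>Y \<omega>\<bar> powr (2 + d) \<partial>M) \<le> A"
    and Zi: "integrable M (\<lambda>\<omega>. \<bar>Z \<omega>\<bar> powr (2 + d))" and ZA: "(\<integral>\<omega>. \<bar>Z \<omega>\<bar> powr (2 + d) \<partial>M) \<le> A"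
  shows "\<bar>(\<integral>\<omega>. Y \<omega> * Z \<omega> \<partial>M) - expectation Y * expectation Z\<bar>
    \<le> 8 * A powr (2 / (2 + d)) * a powr (d / (2 + d))"
proof -
  have YM[measurable]: "Y \<in> borel_measurable M" by (rule measurable_from_subalg[OF F Y])
  have ZM[measurable]: "Z \<in> borel_measurable M" by (rule measurable_from_subalg[OF G Z])
  note sY = square_integrable_of_powr[OF YM d Yi] and sZ = square_integrable_of_powr[OF ZM d Zi]
  \<comment> \<open>At this level the mixing error \<open>4 * a * T * T\<close> and the truncation
    error \<open>T powr (-d) * A\<close> both have the claimed order, as \<open>e1\<close> and
    \<open>e2\<close> verify.\<close>
  define T where "T = (A / a) powr (1 / (2 + d))"
  have T: "0 < T" using a A by (simp add: T_def)
  let ?cY = "\<lambda>\<omega>. clip T (Y \<omega>)" and ?cZ = "\<lambda>\<omega>. clip T (Z \<omega>)"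
  have cYi: "integrable M ?cY" and cZi: "integrable M ?cZ"
    by (rule integrable_bounded[of _ T]; use T in \<open>simp add: abs_clip_le\<close>)+
  have cYZi: "integrable M (\<lambda>\<omega>. ?cY \<omega> * ?cZ \<omega>)"
    by (rule integrable_bounded[of _ "T * T"])
      (use T in \<open>auto simp: abs_mult abs_clip_le intro!: mult_mono\<close>)
  have YZi: "integrable M (\<lambda>\<omega>. Y \<omega> * Z \<omega>)" by (rule integrable_mult_of_squares[OF YM ZM sY(1) sZ(1)])
  have 1: "\<bar>(\<integral>\<omega>. ?cY \<omega> * ?cZ \<omega> \<partial>M) - expectation ?cY * expectation ?cZ\<bar> \<le> 4 * a * T * T"
    by (rule covariance_bounded_le[OF F G ab]) (use Y Z T in \<open>auto simp: abs_clip_le\<close>)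
  have 2: "\<bar>(\<integral>\<omega>. Y \<omega> * Z \<omega> \<partial>M) - (\<integral>\<omega>. ?cY \<omega> * ?cZ \<omega> \<partial>M)\<bar> \<le> T powr (-d) * (A + A)"
  proof -
    have "\<bar>(\<integral>\<omega>. Y \<omega> * Z \<omega> \<partial>M) - (\<integral>\<omega>. ?cY \<omega> * ?cZ \<omega> \<partial>M)\<bar> = \<bar>\<integral>\<omega>. Y \<omega> * Z \<omega> - ?cY \<omega> * ?cZ \<omega> \<partial>M\<bar>"
      using cYZi YZi by simp
    also have "\<dots> \<le> (\<integral>\<omega>. \<bar>Y \<omega> * Z \<omega> - ?cY \<omega> * ?cZ \<omega>\<bar> \<partial>M)" by (rule integral_abs_bound)
    also have "\<dots> \<le> (\<integral>\<omega>. T powr (-d) * (\<bar>Y \<omega>\<bar> powr (2 + d) + \<bar>Z \<omega>\<bar> powr (2 + d)) \<partial>M)"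
      using cYZi YZi Yi Zi by (intro integral_mono clip_mult_diff_le T d) auto
    also have "\<dots> = T powr (-d) * ((\<integral>\<omega>. \<bar>Y \<omega>\<bar> powr (2 + d) \<partial>M) + (\<integral>\<omega>. \<bar>Z \<omega>\<bar> powr (2 + d) \<partial>M))"
      using Yi Zi by simp
    also have "\<dots> \<le> T powr (-d) * (A + A)" using YA ZA by (intro mult_left_mono add_mono) auto
    finally show ?thesis .
  qed
  \<comment> \<open>The pointwise truncation bound is integrated in one variable at a time, as for
    an independent pair with the same marginals.\<close>
  have 3: "\<bar>expectation Y * expectation Z - expectation ?cY * expectation ?cZ\<bar> \<le> T powr (-d) * (A + A)"
  proof -
    have e: "(\<integral>\<omega>. y * Z \<omega> - clip T y * ?cZ \<omega> \<partial>M) = y * expectation Z - clip T y * expectation ?cZ" for y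
      using sZ(2) cZi by simp
    have "\<bar>y * expectation Z - clip T y * expectation ?cZ\<bar> \<le> T powr (-d) * (\<bar>y\<bar> powr (2 + d) + A)" for y
    proof -
      have "\<bar>y * expectation Z - clip T y * expectation ?cZ\<bar> \<le> (\<integral>\<omega>. \<bar>y * Z \<omega> - clip T y * ?cZ \<omega>\<bar> \<partial>M)"
        unfolding e[symmetric] by (rule integral_abs_bound)
      also have "\<dots> \<le> (\<integral>\<omega>. T powr (-d) * (\<bar>y\<bar> powr (2 + d) + \<bar>Z \<omega>\<bar> powr (2 + d)) \<partial>M)"
        using sZ(2) cZi Zi by (intro integral_mono clip_mult_diff_le T d) auto
      also have "\<dots> = T powr (-d) * (\<bar>y\<bar> powr (2 + d) + (\<integral>\<omega>. \<bar>Z \<omega>\<bar> powr (2 + d) \<partial>M))"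
        using Zi by (simp add: prob_space)
      also have "\<dots> \<le> T powr (-d) * (\<bar>y\<bar> powr (2 + d) + A)" using ZA by (intro mult_left_mono add_mono) auto
      finally show ?thesis .
    qed
    note y = this
    have "expectation Y * expectation Z - expectation ?cY * expectation ?cZ
       = (\<integral>\<omega>. Y \<omega> * expectation Z - ?cY \<omega> * expectation ?cZ \<partial>M)" using sY(2) cYi by simp
    also have "\<bar>\<dots>\<bar> \<le> (\<integral>\<omega>. \<bar>Y \<omega> * expectation Z - ?cY \<omega> * expectation ?cZ\<bar> \<partial>M)" by (rule integral_abs_bound)
    also have "\<dots> \<le> (\<integral>\<omega>. T powr (-d) * (\<bar>Y \<omega>\<bar> powr (2 + d) + A) \<partial>M)"
      using sY(2) cYi Yi by (intro integral_mono y) auto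
    also have "\<dots> = T powr (-d) * ((\<integral>\<omega>. \<bar>Y \<omega>\<bar> powr (2 + d) \<partial>M) + A)" using Yi by (simp add: prob_space)
    also have "\<dots> \<le> T powr (-d) * (A + A)" using YA by (intro mult_left_mono add_mono) auto
    finally show ?thesis .
  qed
  have e1: "a * T * T = A powr (2 / (2 + d)) * a powr (d / (2 + d))"
  proof -
    have "T * T = (A / a) powr (2 / (2 + d))" unfolding T_def by (simp add: powr_add[symmetric])
    also have "\<dots> = A powr (2 / (2 + d)) * a powr (- (2 / (2 + d)))"
      using a A by (simp add: powr_divide powr_minus_divide)
    finally have "a * T * T = A powr (2 / (2 + d)) * (a powr 1 * a powr (- (2 / (2 + d))))" using a by simp
    also have "a powr 1 * a powr (- (2 / (2 + d))) = a powr (d / (2 + d))"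
      unfolding powr_add[symmetric] using d by (simp add: field_simps)
    finally show ?thesis .
  qed
  have e2: "T powr (-d) * A = A powr (2 / (2 + d)) * a powr (d / (2 + d))"
  proof -
    have "T powr (-d) = (A / a) powr (- (d / (2 + d)))" unfolding T_def by (simp add: powr_powr)
    also have "\<dots> = A powr (- (d / (2 + d))) * a powr (d / (2 + d))"
      using a A by (simp add: powr_divide powr_minus_divide)
    finally have "T powr (-d) * A = (A powr (- (d / (2 + d))) * A powr 1) * a powr (d / (2 + d))" using A by simp
    also have "A powr (- (d / (2 + d))) * A powr 1 = A powr (2 / (2 + d))"
      unfolding powr_add[symmetric] using d by (simp add: field_simps)
    finally show ?thesis .
  qed
  have "\<bar>(\<integral>\<omega>. Y \<omega> * Z \<omega> \<partial>M) - expectation Y * expectation Z\<bar> \<le> 4 * (a * T * T) + 4 * (T powr (-d) * A)"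
    using 1 2 3 by (simp add: algebra_simps)
  then show ?thesis unfolding e1 e2 by (simp add: mult_ac)
qed

end

section \<open>Mixing coefficients of a stationary process\<close>

context prob_space
begin

text \<open>The essential supremum dominates the deviations of all \<open>A i\<close> at once. So
  the \<open>A i\<close> may vary arbitrarily with \<open>i\<close>, while disjointness of the
  \<open>B i\<close> lets the integrals over them add up to at most the integral of
  \<open>g\<close>.\<close>

lemma beta_coeff_rectangles:
  assumes F: "subalgebra M F" and G: "subalgebra M G"
  shows beta_coeff_le_1: "beta_coeff M F G \<le> 1"
    and "finite I \<Longrightarrow> (\<And>i. i \<in> I \<Longrightarrow> A i \<in> sets F) \<Longrightarrow> (\<And>i. i \<in> I \<Longrightarrow> B i \<in> sets G) \<Longrightarrow>
      disjoint_family_on B I \<Longrightarrow>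
      \<bar>\<Sum>i\<in>I. prob (A i \<inter> B i) - prob (A i) * prob (B i)\<bar> \<le> beta_coeff M F G"
proof -
  interpret finite_measure_subalgebra M G by unfold_locales (rule G)
  define g where "g = family_ess_sup M (cond_dev M G ` sets F)"
  have FM: "sets F \<subseteq> sets M" and GM: "sets G \<subseteq> sets M" using F G by (auto simp: subalgebra_def)
  have e: "is_family_ess_sup M (cond_dev M G ` sets F) g"
    unfolding g_def by (rule is_family_ess_sup_cond_dev[OF G FM]) auto
  have gm[measurable]: "g \<in> borel_measurable M" and gu: "\<And>A. A \<in> sets F \<Longrightarrow> AE \<omega> in M. cond_dev M G A \<omega> \<le> g \<omega>"
    and gl: "\<And>g'. g' \<in> borel_measurable M \<Longrightarrow> (\<And>A. A \<in> sets F \<Longrightarrow> AE \<omega> in M. cond_dev M G A \<omega> \<le> g' \<omega>)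
      \<Longrightarrow> AE \<omega> in M. g \<omega> \<le> g' \<omega>"
    using e unfolding is_family_ess_sup_def by auto
  have g0: "AE \<omega> in M. 0 \<le> g \<omega>"
    using gu[OF sets.empty_sets] by eventually_elim (auto simp: cond_dev_def intro: order_trans[OF abs_ge_zero])
  have g1: "AE \<omega> in M. g \<omega> \<le> 1"
  proof (rule gl)
    fix A assume "A \<in> sets F"
    then have i: "integrable M (indicator A :: 'a \<Rightarrow> real)" using FM by (auto simp: emeasure_eq_measure)
    have "AE \<omega> in M. real_cond_exp M G (indicator A) \<omega> \<ge> 0"
      by (rule real_cond_exp_ge_c[OF i]) simp
    moreover have "AE \<omega> in M. real_cond_exp M G (indicator A) \<omega> \<le> 1"
      by (rule real_cond_exp_le_c[OF i]) (simp add: indicator_def)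
    ultimately show "AE \<omega> in M. cond_dev M G A \<omega> \<le> 1"
    proof eventually_elim
      case (elim \<omega>) then show ?case
        using prob_le_1[of A] measure_nonneg[of M A] by (auto simp: cond_dev_def abs_le_iff; linarith)
    qed
  qed simp
  have gi: "integrable M g"
    by (rule integrable_const_bound[of _ 1]) (use g0 g1 in \<open>eventually_elim; auto\<close>, simp)
  have "(\<integral>\<omega>. g \<omega> \<partial>M) \<le> (\<integral>\<omega>. 1 \<partial>M)" using gi g1 by (intro integral_mono_AE) auto
  then show "beta_coeff M F G \<le> 1" by (simp add: beta_coeff_def g_def prob_space)
  show "\<bar>\<Sum>i\<in>I. prob (A i \<inter> B i) - prob (A i) * prob (B i)\<bar> \<le> beta_coeff M F G"
    if I: "finite I" and A: "\<And>i. i \<in> I \<Longrightarrow> A i \<in> sets F" and B: "\<And>i. i \<in> I \<Longrightarrow> B i \<in> sets G"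
      and dj: "disjoint_family_on B I"
  proof -
    have gBi: "integrable M (\<lambda>\<omega>. indicator (B i) \<omega> * g \<omega>)" if "i \<in> I" for i
      using integrable_real_mult_indicator[OF _ gi, of "B i"] B[OF that] GM by (auto simp: mult.commute)
    have each: "\<bar>prob (A i \<inter> B i) - prob (A i) * prob (B i)\<bar> \<le> (\<integral>\<omega>. indicator (B i) \<omega> * g \<omega> \<partial>M)" if i: "i \<in> I" for i
    proof -
      let ?c = "real_cond_exp M G (indicator (A i))"
      have AM: "A i \<in> sets M" and BM: "B i \<in> sets M" using A[OF i] B[OF i] FM GM by auto
      have Bi: "integrable M (\<lambda>\<omega>. indicator (B i) \<omega> * prob (A i))"
        using BM by (intro integrable_mult_left integrable_real_indicator) (auto simp: emeasure_eq_measure)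
      have ABi: "integrable M (\<lambda>\<omega>. indicator (B i) \<omega> * indicator (A i) \<omega> :: real)"
        using AM BM unfolding indicator_inter_arith[symmetric] by (auto simp: emeasure_eq_measure)
      have r1: "integrable M (\<lambda>\<omega>. indicator (B i) \<omega> * ?c \<omega>)" and
        r2: "(\<integral>\<omega>. indicator (B i) \<omega> * ?c \<omega> \<partial>M) = (\<integral>\<omega>. indicator (B i) \<omega> * indicator (A i) \<omega> \<partial>M)"
        using real_cond_exp_intg[OF ABi] B[OF i] AM by auto
      have di: "integrable M (\<lambda>\<omega>. indicator (B i) \<omega> * (?c \<omega> - prob (A i)))"
        unfolding right_diff_distrib using r1 Bi by auto
      have "prob (A i \<inter> B i) - prob (A i) * prob (B i) = (\<integral>\<omega>. indicator (B i) \<omega> * (?c \<omega> - prob (A i)) \<partial>M)"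
        unfolding right_diff_distrib using r1 r2 Bi AM BM
        by (simp add: indicator_inter_arith[symmetric] Int_commute mult.commute)
      also have "\<bar>\<dots>\<bar> \<le> (\<integral>\<omega>. \<bar>indicator (B i) \<omega> * (?c \<omega> - prob (A i))\<bar> \<partial>M)" by (rule integral_abs_bound)
      also have "\<dots> \<le> (\<integral>\<omega>. indicator (B i) \<omega> * g \<omega> \<partial>M)"
      proof (rule integral_mono_AE)
        show "AE \<omega> in M. \<bar>indicator (B i) \<omega> * (?c \<omega> - prob (A i))\<bar> \<le> indicator (B i) \<omega> * g \<omega>"
          using gu[OF A[OF i]] by eventually_elim (auto simp: cond_dev_def indicator_def)
      qed (use di gBi[OF i] in auto)
      finally show ?thesis .
    qed
    have "\<bar>\<Sum>i\<in>I. prob (A i \<inter> B i) - prob (A i) * prob (B i)\<bar> \<le> (\<Sum>i\<in>I. \<integral>\<omega>. indicator (B i) \<omega> * g \<omega> \<partial>M)"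
      by (rule order_trans[OF sum_abs sum_mono[OF each]])
    also have "\<dots> = (\<integral>\<omega>. (\<Sum>i\<in>I. indicator (B i) \<omega> * g \<omega>) \<partial>M)"
      using gBi by (subst Bochner_Integration.integral_sum) auto
    also have "\<dots> \<le> (\<integral>\<omega>. g \<omega> \<partial>M)"
    proof (rule integral_mono_AE)
      show "AE \<omega> in M. (\<Sum>i\<in>I. indicator (B i) \<omega> * g \<omega>) \<le> g \<omega>"
        using g0
      proof eventually_elim
        case (elim \<omega>)
        have "(\<Sum>i\<in>I. indicator (B i) \<omega> * g \<omega>) = indicator (\<Union>i\<in>I. B i) \<omega> * g \<omega>"
          by (simp add: indicator_UN_disjoint[OF I dj] sum_distrib_right)
        then show ?case using elim by (auto simp: indicator_def)
      qed
    qed (use gi gBi in auto)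
    finally show ?thesis by (simp add: beta_coeff_def g_def)
  qed
qed

text \<open>A single rectangle. Since \<open>alpha_bound\<close> accepts any upper bound and not
  just the supremum, the estimates for strong mixing apply verbatim with \<beta> in place of
  \<alpha>.\<close>

lemma alpha_bound_beta_coeff:
  assumes F: "subalgebra M F" and G: "subalgebra M G"
  shows "alpha_bound M F G (beta_coeff M F G)"
  unfolding alpha_bound_def
  using beta_coeff_rectangles(2)[OF F G, of "{()}" "\<lambda>_. _" "\<lambda>_. _"] by (auto simp: disjoint_family_on_def)

end

section \<open>Past and future of a stationary process, and shift invariance of its laws\<close>

locale stationary_process = prob_space +
  fixes X :: "nat \<Rightarrow> 'a \<Rightarrow> real"
  assumes X_measurable: "\<And>n. 1 \<le> n \<Longrightarrow> X n \<in> borel_measurable M"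
    and stationary: "strictly_stationary M X"
begin

abbreviation past :: "nat \<Rightarrow> 'a measure" where
  "past k \<equiv> process_algebra M X {1..k}"

abbreviation future :: "nat \<Rightarrow> 'a measure" where
  "future k \<equiv> process_algebra M X {k..}"

lemma subalgebra_process_algebra:
  assumes "I \<subseteq> {1..}"
  shows "subalgebra M (process_algebra M X I)"
proof -
  have f: "(\<lambda>\<omega>. \<lambda>i\<in>I. X i \<omega>) \<in> M \<rightarrow>\<^sub>M PiM I (\<lambda>_. borel)"
    by (rule measurable_restrict) (use assms X_measurable in auto)
  then show ?thesis
    unfolding subalgebra_def process_algebra_def sets_vimage_algebra
    by (auto intro!: sets.sigma_sets_subset measurable_sets[OF f])
qed

lemma subalgebra_past: "subalgebra M (past k)"
  by (rule subalgebra_process_algebra) auto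

lemma subalgebra_future: "1 \<le> k \<Longrightarrow> subalgebra M (future k)"
  by (rule subalgebra_process_algebra) auto

lemma measurable_process_algebra:
  assumes i: "i \<in> I"
  shows "X i \<in> borel_measurable (process_algebra M X I)"
proof -
  have "(\<lambda>\<omega>. \<lambda>i\<in>I. X i \<omega>) \<in> process_algebra M X I \<rightarrow>\<^sub>M PiM I (\<lambda>_. borel)"
    unfolding process_algebra_def by (rule measurable_vimage_algebra1) (auto simp: space_PiM)
  from measurable_compose[OF this measurable_component_singleton[OF i]]
  show ?thesis using i by simp
qed

lemma measurable_past: "1 \<le> i \<Longrightarrow> i \<le> k \<Longrightarrow> X i \<in> borel_measurable (past k)"
  by (rule measurable_process_algebra) auto

lemma measurable_future: "k \<le> i \<Longrightarrow> X i \<in> borel_measurable (future k)"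
  by (rule measurable_process_algebra) auto

text \<open>A real supremum is an upper bound only of a family bounded above. The bound 1 provides
  this at both levels, over the events and over the cut \<open>k\<close>.\<close>

lemma alpha_bound_alpha_mix:
  assumes k: "1 \<le> k"
  shows "alpha_bound M (past k) (future (k + m)) (alpha_mix M X m)"
  unfolding alpha_bound_def
proof (intro ballI)
  fix A B assume A: "A \<in> sets (past k)" and B: "B \<in> sets (future (k + m))"
  let ?h = "\<lambda>(A, B). \<bar>prob (A \<inter> B) - prob A * prob B\<bar>"
  have h1: "?h p \<le> 1" for p
  proof -
    obtain A B where p: "p = (A, B)" by (cases p)
    have "0 \<le> prob A * prob B" "prob A * prob B \<le> 1" by (auto intro!: mult_le_one)
    then show ?thesis using prob_le_1[of "A \<inter> B"] measure_nonneg[of M "A \<inter> B"] unfolding p by (auto simp: abs_le_iff; linarith)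
  qed
  have bd: "bdd_above (?h ` S)" for S using h1 by (auto intro!: bdd_aboveI[of _ 1])
  have ac1: "alpha_coeff M (past j) (future (j + m)) \<le> 1" for j
    unfolding alpha_coeff_def by (rule cSUP_least) (use h1 in auto)
  have "?h (A, B) \<le> alpha_coeff M (past k) (future (k + m))"
    unfolding alpha_coeff_def by (rule cSUP_upper[OF _ bd]) (use A B in auto)
  also have "\<dots> \<le> alpha_mix M X m"
    unfolding alpha_mix_def by (rule cSUP_upper) (use k ac1 in \<open>auto intro!: bdd_aboveI[of _ 1]\<close>)
  finally show "\<bar>prob (A \<inter> B) - prob A * prob B\<bar> \<le> alpha_mix M X m" by simp
qed

lemma beta_coeff_le_beta_mix:
  assumes k: "1 \<le> k"
  shows "beta_coeff M (past k) (future (k + m)) \<le> beta_mix M X m"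
proof -
  have "bdd_above ((\<lambda>k. beta_coeff M (past k) (future (k + m))) ` {1..})"
    by (intro bdd_aboveI2[of _ _ 1] beta_coeff_le_1 subalgebra_past subalgebra_future) simp
  then show ?thesis unfolding beta_mix_def by (rule cSUP_upper[rotated]) (use k in simp)
qed

lemma alpha_bound_beta_mix:
  assumes k: "1 \<le> k"
  shows "alpha_bound M (past k) (future (k + m)) (beta_mix M X m)"
  using alpha_bound_beta_coeff[OF subalgebra_past subalgebra_future, of "k + m" k] beta_coeff_le_beta_mix[OF k, of m] k
  unfolding alpha_bound_def by fastforce

lemma measurable_shifted:
  "(\<lambda>\<omega>. \<lambda>i\<in>{1..m}. X (i + k) \<omega>) \<in> M \<rightarrow>\<^sub>M PiM {1..m} (\<lambda>_. borel)"
  by (rule measurable_restrict) (auto intro: X_measurable)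

text \<open>Stationarity speaks of windows of the process; every statistic of a window inherits it.
  The shift lemmas below take a pair, a coordinate or a sum as \<open>\<phi>\<close>.\<close>

lemma distr_shift:
  assumes \<phi>: "\<phi> \<in> PiM {1..m} (\<lambda>_. borel) \<rightarrow>\<^sub>M N"
  shows "distr M N (\<lambda>\<omega>. \<phi> (\<lambda>i\<in>{1..m}. X (i + k) \<omega>)) = distr M N (\<lambda>\<omega>. \<phi> (\<lambda>i\<in>{1..m}. X i \<omega>))"
proof -
  have "distr M N (\<lambda>\<omega>. \<phi> (\<lambda>i\<in>{1..m}. X (i + k) \<omega>))
      = distr (distr M (PiM {1..m} (\<lambda>_. borel)) (\<lambda>\<omega>. \<lambda>i\<in>{1..m}. X (i + k) \<omega>)) N \<phi>"
    by (subst distr_distr[OF \<phi> measurable_shifted]) (simp add: comp_def)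
  also have "\<dots> = distr (distr M (PiM {1..m} (\<lambda>_. borel)) (\<lambda>\<omega>. \<lambda>i\<in>{1..m}. X i \<omega>)) N \<phi>"
    using stationary unfolding strictly_stationary_def by simp
  also have "\<dots> = distr M N (\<lambda>\<omega>. \<phi> (\<lambda>i\<in>{1..m}. X i \<omega>))"
    using distr_distr[OF \<phi> measurable_shifted[where m = m and k = 0]] by (simp add: comp_def)
  finally show ?thesis .
qed

lemma pair_law_shift:
  assumes i: "1 \<le> i"
  shows "pair_law M (X i) (X (i + d)) = pair_law M (X 1) (X (1 + d))"
proof -
  have \<phi>: "(\<lambda>v. (v (1::nat), v (1 + d))) \<in> PiM {1..1 + d} (\<lambda>_. borel) \<rightarrow>\<^sub>M (borel \<Otimes>\<^sub>M borel :: (real \<times> real) measure)"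
    by (intro measurable_Pair measurable_component_singleton) auto
  show ?thesis using distr_shift[OF \<phi>, of "i - 1"] i by (simp add: pair_law_def add.commute)
qed

lemma distr_X:
  assumes i: "1 \<le> i"
  shows "distr M borel (X i) = marginal M X"
proof -
  have \<phi>: "(\<lambda>v. v (1::nat)) \<in> PiM {1..1} (\<lambda>_. borel) \<rightarrow>\<^sub>M (borel :: real measure)"
    by (intro measurable_component_singleton) auto
  show ?thesis using distr_shift[OF \<phi>, of "i - 1"] i by (simp add: marginal_def)
qed

lemma distr_block_sum:
  assumes [measurable]: "f \<in> borel_measurable borel"
  shows "distr M borel (\<lambda>\<omega>. \<Sum>i\<in>{1..p}. f (X (i + k) \<omega>) :: real) = distr M borel (\<lambda>\<omega>. \<Sum>i\<in>{1..p}. f (X i \<omega>))"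
proof -
  have \<phi>: "(\<lambda>v. \<Sum>i\<in>{1..p}. f (v i)) \<in> PiM {1..p} (\<lambda>_. borel) \<rightarrow>\<^sub>M (borel :: real measure)"
    by (intro borel_measurable_sum measurable_compose[OF _ assms] measurable_component_singleton)
  show ?thesis using distr_shift[OF \<phi>, of k] by simp
qed

lemma prob_space_marginal: "prob_space (marginal M X)"
  unfolding marginal_def by (rule prob_space_distr) (simp add: X_measurable)

lemma sets_marginal[measurable_cong, simp]: "sets (marginal M X) = sets borel"
  and space_marginal[simp]: "space (marginal M X) = UNIV"
  unfolding marginal_def by simp_all

lemma integral_X:
  fixes f :: "real \<Rightarrow> real"
  assumes i: "1 \<le> i" and [measurable]: "f \<in> borel_measurable borel"
  shows "(\<integral>\<omega>. f (X i \<omega>) \<partial>M) = (\<integral>x. f x \<partial>marginal M X)"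
  unfolding distr_X[OF i, symmetric] by (rule integral_distr[symmetric]) (use X_measurable[OF i] in auto)

lemma integrable_X:
  fixes f :: "real \<Rightarrow> real"
  assumes i: "1 \<le> i" and [measurable]: "f \<in> borel_measurable borel"
  shows "integrable M (\<lambda>\<omega>. f (X i \<omega>)) \<longleftrightarrow> integrable (marginal M X) f"
  unfolding distr_X[OF i, symmetric] by (rule integrable_distr_eq[symmetric]) (use X_measurable[OF i] in auto)

lemma integral_X_pair:
  fixes f :: "real \<Rightarrow> real \<Rightarrow> real"
  assumes i: "1 \<le> i" and f: "(\<lambda>(x, y). f x y) \<in> borel_measurable (borel \<Otimes>\<^sub>M borel)"
  shows "(\<integral>\<omega>. f (X i \<omega>) (X (i + d) \<omega>) \<partial>M) = (\<integral>\<omega>. f (X 1 \<omega>) (X (1 + d) \<omega>) \<partial>M)"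
proof -
  have "(\<integral>\<omega>. f (X i \<omega>) (X (i + d) \<omega>) \<partial>M) = (\<integral>(x, y). f x y \<partial>pair_law M (X i) (X (i + d)))" if "1 \<le> i" for i
    unfolding pair_law_def using X_measurable that f
    by (subst integral_distr) (auto intro!: measurable_Pair)
  from this[OF i] this[of 1] show ?thesis using pair_law_shift[OF i, of d] by simp
qed

end

section \<open>Partial sums of a strongly mixing process\<close>

lemma Cesaro_mean_tendsto:
  fixes u :: "nat \<Rightarrow> real"
  assumes u: "u \<longlonglongrightarrow> L"
  shows "(\<lambda>n. (\<Sum>k<n. u k) / real n) \<longlonglongrightarrow> L"
proof (rule LIMSEQ_I)
  fix e :: real assume e: "0 < e"
  obtain N where N: "\<And>n. n \<ge> N \<Longrightarrow> \<bar>u n - L\<bar> < e / 2"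
    using LIMSEQ_D[OF u, of "e / 2"] e by auto
  define C where "C = (\<Sum>k<N. \<bar>u k - L\<bar>)"
  have C: "0 \<le> C" by (simp add: C_def sum_nonneg)
  obtain m where m: "2 * C / e < real m" using reals_Archimedean2 by blast
  show "\<exists>n0. \<forall>n\<ge>n0. norm ((\<Sum>k<n. u k) / real n - L) < e"
  proof (intro exI[of _ "max (Suc m) (Suc N)"] allI impI)
    fix n assume n: "n \<ge> max (Suc m) (Suc N)"
    then have n0: "0 < real n" by simp
    have "(\<Sum>k<n. u k) / real n - L = (\<Sum>k<n. u k - L) / real n"
      using n0 by (simp add: sum_subtractf diff_divide_distrib)
    also have "\<bar>\<dots>\<bar> \<le> (\<Sum>k<n. \<bar>u k - L\<bar>) / real n"
      using n0 by (simp add: divide_right_mono)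
    also have "(\<Sum>k<n. \<bar>u k - L\<bar>) < real n * e"
    proof -
    have "(\<Sum>k<n. \<bar>u k - L\<bar>) = C + (\<Sum>k\<in>{N..<n}. \<bar>u k - L\<bar>)"
      unfolding C_def using n by (subst sum.union_disjoint[symmetric]) (auto intro!: sum.cong)
    also have "(\<Sum>k\<in>{N..<n}. \<bar>u k - L\<bar>) \<le> (\<Sum>k\<in>{N..<n}. e / 2)"
      by (rule sum_mono) (use N in \<open>auto intro: less_imp_le\<close>)
    also have "\<dots> \<le> real n * (e / 2)" using e by (auto intro!: mult_right_mono)
    also have "C < real n * (e / 2)"
    proof -
      have "2 * C / e < real n" using m n by simp
      then show ?thesis using e by (simp add: field_simps)
    qed
    finally show ?thesis by (simp add: field_simps)
    qed
    then have "(\<Sum>k<n. \<bar>u k - L\<bar>) / real n < e" using n0 by (simp add: divide_less_eq mult.commute)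
    finally show "norm ((\<Sum>k<n. u k) / real n - L) < e" by simp
  qed
qed

text \<open>With truncated subtraction \<open>(i - j) + (j - i)\<close> is the distance of
  \<open>i\<close> and \<open>j\<close>. On each side of \<open>i\<close> every distance occurs at
  most once, so each side is bounded by the full series.\<close>

lemma sum_of_gaps_le:
  fixes w :: "nat \<Rightarrow> real"
  assumes w: "\<And>k. 0 \<le> w k" and s: "summable (\<lambda>k. w (Suc k))" and J: "finite J"
  shows "(\<Sum>j\<in>J. w ((i - j) + (j - i))) \<le> w 0 + 2 * (\<Sum>k. w (Suc k))"
proof -
  have le: "(\<Sum>k\<in>K. w (Suc k)) \<le> (\<Sum>k. w (Suc k))" if "finite K" for K
    by (rule sum_le_suminf[OF s that]) (simp add: w)
  let ?A = "{j\<in>J. j < i}" and ?B = "{j\<in>J. i < j}" and ?C = "J \<inter> {i}"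
  have "(\<Sum>j\<in>?A. w ((i - j) + (j - i))) = (\<Sum>k\<in>(\<lambda>j. i - j - 1) ` ?A. w (Suc k))"
    by (subst sum.reindex) (auto simp: inj_on_def intro!: sum.cong arg_cong[of _ _ w])
  also have "\<dots> \<le> (\<Sum>k. w (Suc k))" by (rule le) (use J in simp)
  finally have A: "(\<Sum>j\<in>?A. w ((i - j) + (j - i))) \<le> (\<Sum>k. w (Suc k))" .
  have "(\<Sum>j\<in>?B. w ((i - j) + (j - i))) = (\<Sum>k\<in>(\<lambda>j. j - i - 1) ` ?B. w (Suc k))"
    by (subst sum.reindex) (auto simp: inj_on_def intro!: sum.cong arg_cong[of _ _ w])
  also have "\<dots> \<le> (\<Sum>k. w (Suc k))" by (rule le) (use J in simp)
  finally have B: "(\<Sum>j\<in>?B. w ((i - j) + (j - i))) \<le> (\<Sum>k. w (Suc k))" .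
  have C: "(\<Sum>j\<in>?C. w ((i - j) + (j - i))) \<le> w 0" using w by (cases "i \<in> J") auto
  have "J = ?A \<union> ?B \<union> ?C" by auto
  then have "(\<Sum>j\<in>J. w ((i - j) + (j - i))) = (\<Sum>j\<in>?A \<union> ?B \<union> ?C. w ((i - j) + (j - i)))" by simp
  also have "\<dots> = (\<Sum>j\<in>?A. w ((i - j) + (j - i))) + (\<Sum>j\<in>?B. w ((i - j) + (j - i))) + (\<Sum>j\<in>?C. w ((i - j) + (j - i)))"
  proof -
    have "(\<Sum>j\<in>?A \<union> ?B \<union> ?C. w ((i - j) + (j - i)))
        = (\<Sum>j\<in>?A \<union> ?B. w ((i - j) + (j - i))) + (\<Sum>j\<in>?C. w ((i - j) + (j - i)))"
      by (rule sum.union_disjoint) (use J in auto)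
    also have "(\<Sum>j\<in>?A \<union> ?B. w ((i - j) + (j - i)))
        = (\<Sum>j\<in>?A. w ((i - j) + (j - i))) + (\<Sum>j\<in>?B. w ((i - j) + (j - i)))"
      by (rule sum.union_disjoint) (use J in auto)
    finally show ?thesis .
  qed
  finally show ?thesis using A B C by simp
qed

context stationary_process
begin

definition cen :: "(real \<Rightarrow> real) \<Rightarrow> nat \<Rightarrow> 'a \<Rightarrow> real" where
  "cen f i \<omega> = f (X i \<omega>) - (\<integral>x. f x \<partial>marginal M X)"

definition acov :: "(real \<Rightarrow> real) \<Rightarrow> nat \<Rightarrow> real" where
  "acov f k = (\<integral>\<omega>. cen f 1 \<omega> * cen f (1 + k) \<omega> \<partial>M)"

definition psum :: "(real \<Rightarrow> real) \<Rightarrow> nat set \<Rightarrow> 'a \<Rightarrow> real" where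
  "psum f J \<omega> = (\<Sum>i\<in>J. cen f i \<omega>)"

definition asym_var :: "(real \<Rightarrow> real) \<Rightarrow> real" where
  "asym_var f = acov f 0 + 2 * (\<Sum>k. acov f (Suc k))"

end

text \<open>The common ground of both cases of the theorem: a polynomial rate whose power with
  exponent \<open>\<delta> / (2 + \<delta>)\<close>, as it occurs in Davydov's inequality, is
  summable. The lemma \<open>decay_gt_1\<close> restates the condition on \<open>\<rho>\<close> in
  this form.\<close>

locale stationary_mixing = stationary_process M X for M :: "'a measure" and X +
  fixes \<delta> \<rho> a :: real
  assumes \<delta>: "0 < \<delta>" and a: "0 < a" and \<rho>: "(2 + \<delta>) / \<delta> < \<rho>"
    and mixing: "\<And>k m. 1 \<le> k \<Longrightarrow> 1 \<le> m \<Longrightarrow> alpha_bound M (past k) (future (k + m)) (a * real m powr (- \<rho>))"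
begin

text \<open>The bound \<open>A\<close> is a parameter because every variance bound below is
  proportional to \<open>A powr (2 / (2 + \<delta>))\<close>, hence small for the remainder of a
  truncation.\<close>

definition moment_le :: "(real \<Rightarrow> real) \<Rightarrow> real \<Rightarrow> bool" where
  "moment_le f A \<longleftrightarrow> f \<in> borel_measurable borel \<and> 0 < A \<and>
     integrable (marginal M X) (\<lambda>x. \<bar>f x\<bar> powr (2 + \<delta>)) \<and> (\<integral>x. \<bar>f x\<bar> powr (2 + \<delta>) \<partial>marginal M X) \<le> A"

definition decay :: real where "decay = \<rho> * \<delta> / (2 + \<delta>)"

text \<open>The 2 stands for lag 0, the 16 is twice the constant 8 of Davydov's inequality, for the
  lags on both sides; \<open>cov_bound_total\<close> assembles the pieces.\<close>

definition var_const :: real where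
  "var_const = 2 + 16 * a powr (\<delta> / (2 + \<delta>)) * (\<Sum>k. real (Suc k) powr (- decay))"

lemma decay_gt_1: "1 < decay"
  using \<rho> \<delta> unfolding decay_def by (simp add: field_simps)

lemma \<rho>_gt_1: "1 < \<rho>"
  by (rule less_trans[OF _ \<rho>]) (use \<delta> in \<open>simp add: field_simps\<close>)

lemma summable_decay: "summable (\<lambda>k. real (Suc k) powr (- decay))"
proof -
  have "summable (\<lambda>k. real k powr (- decay))"
    using decay_gt_1 by (simp add: summable_real_powr_iff)
  then show ?thesis by (subst summable_Suc_iff)
qed

lemma var_const_pos: "0 < var_const"
proof -
  have "0 \<le> (\<Sum>k. real (Suc k) powr (- decay))" by (rule suminf_nonneg[OF summable_decay]) simp
  then show ?thesis unfolding var_const_def by (simp add: add_pos_nonneg)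
qed

context
  fixes f :: "real \<Rightarrow> real" and A :: real
  assumes fA: "moment_le f A"
begin

lemma f_measurable[measurable]: "f \<in> borel_measurable borel"
  and A_pos: "0 < A"
  and f_moment: "integrable (marginal M X) (\<lambda>x. \<bar>f x\<bar> powr (2 + \<delta>))"
    "(\<integral>x. \<bar>f x\<bar> powr (2 + \<delta>) \<partial>marginal M X) \<le> A"
  using fA unfolding moment_le_def by auto

lemma f_integrable: "integrable (marginal M X) (\<lambda>x. f x * f x)" "integrable (marginal M X) f"
proof -
  have "f \<in> borel_measurable (marginal M X)" by simp
  note prob_space.square_integrable_of_powr[OF prob_space_marginal this \<delta> f_moment(1)]
  then show "integrable (marginal M X) (\<lambda>x. f x * f x)" "integrable (marginal M X) f" by blast+
qed

lemma fX_integrable: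
  assumes "1 \<le> i"
  shows "integrable M (\<lambda>\<omega>. f (X i \<omega>))" "integrable M (\<lambda>\<omega>. f (X i \<omega>) * f (X i \<omega>))"
    "integrable M (\<lambda>\<omega>. \<bar>f (X i \<omega>)\<bar> powr (2 + \<delta>))"
  using integrable_X[OF assms, of f] integrable_X[OF assms, of "\<lambda>x. f x * f x"]
    integrable_X[OF assms, of "\<lambda>x. \<bar>f x\<bar> powr (2 + \<delta>)"] f_integrable f_moment by auto

lemma fX_measurable: "1 \<le> i \<Longrightarrow> (\<lambda>\<omega>. f (X i \<omega>)) \<in> borel_measurable M"
  using measurable_compose[OF X_measurable f_measurable] by simp

lemma cen_measurable: "1 \<le> i \<Longrightarrow> cen f i \<in> borel_measurable M"
  unfolding cen_def[abs_def] using fX_measurable by simp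

lemma expectation_fX: "1 \<le> i \<Longrightarrow> (\<integral>\<omega>. f (X i \<omega>) \<partial>M) = (\<integral>x. f x \<partial>marginal M X)"
  by (rule integral_X) auto

lemma cen_integrable: "1 \<le> i \<Longrightarrow> integrable M (cen f i)"
  unfolding cen_def[abs_def] using fX_integrable by simp

lemma expectation_cen: "1 \<le> i \<Longrightarrow> expectation (cen f i) = 0"
  unfolding cen_def[abs_def] using fX_integrable expectation_fX by (simp add: prob_space)

lemma fX_mult_integrable: "1 \<le> i \<Longrightarrow> 1 \<le> j \<Longrightarrow> integrable M (\<lambda>\<omega>. f (X i \<omega>) * f (X j \<omega>))"
  using integrable_mult_of_squares[OF fX_measurable fX_measurable] fX_integrable by simp

lemma cen_mult:
  assumes "1 \<le> i" "1 \<le> j"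
  shows "integrable M (\<lambda>\<omega>. cen f i \<omega> * cen f j \<omega>)"
    and "(\<integral>\<omega>. cen f i \<omega> * cen f j \<omega> \<partial>M) = (\<integral>\<omega>. f (X i \<omega>) * f (X j \<omega>) \<partial>M)
      - (\<integral>\<omega>. f (X i \<omega>) \<partial>M) * (\<integral>\<omega>. f (X j \<omega>) \<partial>M)"
proof -
  let ?\<mu> = "\<integral>x. f x \<partial>marginal M X"
  have e: "cen f i \<omega> * cen f j \<omega> = f (X i \<omega>) * f (X j \<omega>) - ?\<mu> * f (X i \<omega>) - ?\<mu> * f (X j \<omega>) + ?\<mu> * ?\<mu>" for \<omega>
    unfolding cen_def by (simp add: algebra_simps)
  show "integrable M (\<lambda>\<omega>. cen f i \<omega> * cen f j \<omega>)"
    unfolding e using fX_mult_integrable[OF assms] fX_integrable(1) assms by auto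
  show "(\<integral>\<omega>. cen f i \<omega> * cen f j \<omega> \<partial>M) = (\<integral>\<omega>. f (X i \<omega>) * f (X j \<omega>) \<partial>M)
      - (\<integral>\<omega>. f (X i \<omega>) \<partial>M) * (\<integral>\<omega>. f (X j \<omega>) \<partial>M)"
    unfolding e using fX_mult_integrable[OF assms] fX_integrable(1) assms expectation_fX by (simp add: prob_space)
qed

lemma expectation_cen_mult_shift:
  assumes i: "1 \<le> i"
  shows "(\<integral>\<omega>. cen f i \<omega> * cen f (i + d) \<omega> \<partial>M) = acov f d"
  unfolding acov_def cen_def
  by (rule integral_X_pair[OF i, of "\<lambda>x y. (f x - (\<integral>x. f x \<partial>marginal M X)) * (f y - (\<integral>x. f x \<partial>marginal M X))"]) simp

lemma expectation_cen_mult: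
  assumes "1 \<le> i" "1 \<le> j"
  shows "(\<integral>\<omega>. cen f i \<omega> * cen f j \<omega> \<partial>M) = acov f ((i - j) + (j - i))"
proof (cases "i \<le> j")
  case True then show ?thesis using expectation_cen_mult_shift[OF assms(1), of "j - i"] by simp
next
  case False then show ?thesis using expectation_cen_mult_shift[OF assms(2), of "i - j"] by (simp add: mult.commute)
qed

definition cov_bound :: "nat \<Rightarrow> real" where
  "cov_bound d = A powr (2 / (2 + \<delta>)) *
     (if d = 0 then 2 else 8 * a powr (\<delta> / (2 + \<delta>)) * real d powr (- decay))"

lemma acov_le: "\<bar>acov f d\<bar> \<le> cov_bound d"
proof (cases "d = 0")
  case True
  \<comment> \<open>At lag 0 mixing says nothing. Splitting the square at this \<open>T\<close>
    bounds each of the two parts by \<open>A powr (2 / (2 + \<delta>))\<close>, which gives the 2 in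
    \<open>cov_bound\<close>.\<close>
  define T where "T = A powr (1 / (2 + \<delta>))"
  have T: "0 < T" using A_pos by (simp add: T_def)
  have "acov f 0 = (\<integral>\<omega>. f (X 1 \<omega>) * f (X 1 \<omega>) \<partial>M) - (\<integral>\<omega>. f (X 1 \<omega>) \<partial>M) * (\<integral>\<omega>. f (X 1 \<omega>) \<partial>M)"
    unfolding acov_def using cen_mult(2)[of 1 1] by simp
  also have "\<dots> \<le> (\<integral>\<omega>. f (X 1 \<omega>) * f (X 1 \<omega>) \<partial>M)" by simp
  also have "\<dots> \<le> (\<integral>\<omega>. T^2 + T powr (- \<delta>) * \<bar>f (X 1 \<omega>)\<bar> powr (2 + \<delta>) \<partial>M)"
    using fX_integrable[of 1] T \<delta> by (intro integral_mono square_le_powr_sum) auto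
  also have "\<dots> = T^2 + T powr (- \<delta>) * (\<integral>x. \<bar>f x\<bar> powr (2 + \<delta>) \<partial>marginal M X)"
    using fX_integrable[of 1] integral_X[of 1 "\<lambda>x. \<bar>f x\<bar> powr (2 + \<delta>)"] by (simp add: prob_space)
  also have "\<dots> \<le> T^2 + T powr (- \<delta>) * A" using f_moment(2) by (intro add_left_mono mult_left_mono) auto
  also have "T^2 = A powr (2 / (2 + \<delta>))" unfolding T_def by (simp add: power2_eq_square powr_add[symmetric])
  also have "T powr (- \<delta>) * A = A powr (- (\<delta> / (2 + \<delta>))) * A powr 1" unfolding T_def using A_pos by (simp add: powr_powr)
  also have "\<dots> = A powr (2 / (2 + \<delta>))" unfolding powr_add[symmetric] using \<delta> by (simp add: field_simps)
  finally have "acov f 0 \<le> cov_bound 0" unfolding cov_bound_def by simp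
  moreover have "0 \<le> acov f 0" unfolding acov_def by simp
  ultimately show ?thesis using True by simp
next
  case False
  have m1: "(\<lambda>\<omega>. f (X 1 \<omega>)) \<in> borel_measurable (past 1)"
    by (rule measurable_compose[OF measurable_past f_measurable]) auto
  have m2: "(\<lambda>\<omega>. f (X (1 + d) \<omega>)) \<in> borel_measurable (future (1 + d))"
    by (rule measurable_compose[OF measurable_future f_measurable]) auto
  have b: "(\<integral>\<omega>. \<bar>f (X i \<omega>)\<bar> powr (2 + \<delta>) \<partial>M) \<le> A" if "1 \<le> i" for i
    using integral_X[OF that, of "\<lambda>x. \<bar>f x\<bar> powr (2 + \<delta>)"] f_moment(2) by simp
  have "\<bar>acov f d\<bar> \<le> 8 * A powr (2 / (2 + \<delta>)) * (a * real d powr (- \<rho>)) powr (\<delta> / (2 + \<delta>))"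
  proof -
    have mb: "alpha_bound M (past 1) (future (1 + d)) (a * real d powr (- \<rho>))"
      by (rule mixing) (use False in auto)
    have ap: "0 < a * real d powr (- \<rho>)" using a False by simp
    have d1: "1 \<le> 1 + d" by simp
    have "acov f d = (\<integral>\<omega>. f (X 1 \<omega>) * f (X (1 + d) \<omega>) \<partial>M) - (\<integral>\<omega>. f (X 1 \<omega>) \<partial>M) * (\<integral>\<omega>. f (X (1 + d) \<omega>) \<partial>M)"
      unfolding acov_def by (rule cen_mult(2)) auto
    then show ?thesis
      using covariance_le_of_moments[OF subalgebra_past subalgebra_future[OF d1] mb ap m1 m2 \<delta> A_pos
        fX_integrable(3)[OF order_refl] b[OF order_refl] fX_integrable(3)[OF d1] b[OF d1]] by (simp only:)
  qed
  moreover have "(a * real d powr (- \<rho>)) powr (\<delta> / (2 + \<delta>)) = a powr (\<delta> / (2 + \<delta>)) * real d powr (- decay)"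
    using a by (simp add: powr_mult powr_powr decay_def)
  moreover have "cov_bound d = 8 * A powr (2 / (2 + \<delta>)) * (a powr (\<delta> / (2 + \<delta>)) * real d powr (- decay))"
    unfolding cov_bound_def using False by simp
  ultimately show ?thesis by simp
qed

lemma cov_bound_nonneg: "0 \<le> cov_bound d"
  unfolding cov_bound_def by simp

lemma cov_bound_Suc: "cov_bound (Suc k)
    = (A powr (2 / (2 + \<delta>)) * (8 * a powr (\<delta> / (2 + \<delta>)))) * real (Suc k) powr (- decay)"
  unfolding cov_bound_def by simp

lemma summable_cov_bound: "summable (\<lambda>k. cov_bound (Suc k))"
  unfolding cov_bound_Suc by (rule summable_mult[OF summable_decay])

lemma cov_bound_total: "cov_bound 0 + 2 * (\<Sum>k. cov_bound (Suc k)) = A powr (2 / (2 + \<delta>)) * var_const"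
proof -
  have "(\<Sum>k. cov_bound (Suc k)) = A powr (2 / (2 + \<delta>)) * (8 * a powr (\<delta> / (2 + \<delta>)) * (\<Sum>k. real (Suc k) powr (- decay)))"
    unfolding cov_bound_Suc by (subst suminf_mult[OF summable_decay]) simp
  then show ?thesis by (simp add: cov_bound_def var_const_def algebra_simps)
qed

lemma summable_acov: "summable (\<lambda>k. acov f (Suc k))"
  by (rule summable_comparison_test[OF _ summable_cov_bound]) (use acov_le in auto)

lemma psum_measurable: "J \<subseteq> {1..} \<Longrightarrow> psum f J \<in> borel_measurable M"
  unfolding psum_def[abs_def] by (intro borel_measurable_sum cen_measurable) auto

lemma psum_integrable: "J \<subseteq> {1..} \<Longrightarrow> integrable M (psum f J)"
  unfolding psum_def[abs_def] by (intro Bochner_Integration.integrable_sum cen_integrable) auto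

lemma expectation_psum: "J \<subseteq> {1..} \<Longrightarrow> expectation (psum f J) = 0"
  unfolding psum_def[abs_def]
  by (subst Bochner_Integration.integral_sum) (auto simp: cen_integrable expectation_cen intro!: sum.neutral)

lemma psum_square:
  assumes J: "finite J" "J \<subseteq> {1..}"
  shows "integrable M (\<lambda>\<omega>. (psum f J \<omega>)^2)"
    and "(\<integral>\<omega>. (psum f J \<omega>)^2 \<partial>M) = (\<Sum>i\<in>J. \<Sum>j\<in>J. acov f ((i - j) + (j - i)))"
proof -
  have e: "(psum f J \<omega>)^2 = (\<Sum>i\<in>J. \<Sum>j\<in>J. cen f i \<omega> * cen f j \<omega>)" for \<omega>
    unfolding psum_def power2_eq_square by (simp add: sum_product)
  have i: "integrable M (\<lambda>\<omega>. cen f i \<omega> * cen f j \<omega>)" if "i \<in> J" "j \<in> J" for i j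
    using cen_mult(1)[of i j] that J by auto
  show "integrable M (\<lambda>\<omega>. (psum f J \<omega>)^2)"
    unfolding e by (intro Bochner_Integration.integrable_sum i)
  have "(\<integral>\<omega>. (psum f J \<omega>)^2 \<partial>M) = (\<Sum>i\<in>J. \<integral>\<omega>. (\<Sum>j\<in>J. cen f i \<omega> * cen f j \<omega>) \<partial>M)"
    unfolding e by (intro Bochner_Integration.integral_sum Bochner_Integration.integrable_sum i)
  also have "\<dots> = (\<Sum>i\<in>J. \<Sum>j\<in>J. \<integral>\<omega>. cen f i \<omega> * cen f j \<omega> \<partial>M)"
    by (intro sum.cong refl Bochner_Integration.integral_sum i)
  also have "\<dots> = (\<Sum>i\<in>J. \<Sum>j\<in>J. acov f ((i - j) + (j - i)))"
    by (intro sum.cong refl expectation_cen_mult) (use J in auto)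
  finally show "(\<integral>\<omega>. (psum f J \<omega>)^2 \<partial>M) = (\<Sum>i\<in>J. \<Sum>j\<in>J. acov f ((i - j) + (j - i)))" .
qed

lemma psum_variance_le:
  assumes J: "finite J" "J \<subseteq> {1..}"
  shows "(\<integral>\<omega>. (psum f J \<omega>)^2 \<partial>M) \<le> real (card J) * (A powr (2 / (2 + \<delta>)) * var_const)"
proof -
  have "(\<integral>\<omega>. (psum f J \<omega>)^2 \<partial>M) \<le> (\<Sum>i\<in>J. \<Sum>j\<in>J. cov_bound ((i - j) + (j - i)))"
    unfolding psum_square(2)[OF J] by (intro sum_mono) (use acov_le in \<open>auto simp: abs_le_iff\<close>)
  also have "\<dots> \<le> (\<Sum>i\<in>J. A powr (2 / (2 + \<delta>)) * var_const)"
    unfolding cov_bound_total[symmetric]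
    by (intro sum_mono sum_of_gaps_le cov_bound_nonneg summable_cov_bound J)
  finally show ?thesis by simp
qed

lemma expectation_abs_psum_le:
  assumes J: "finite J" "J \<subseteq> {1..}"
  shows "(\<integral>\<omega>. \<bar>psum f J \<omega>\<bar> \<partial>M) \<le> sqrt (real (card J) * (A powr (2 / (2 + \<delta>)) * var_const))"
proof -
  have i: "integrable M (\<lambda>\<omega>. \<bar>psum f J \<omega>\<bar>)" using psum_integrable J by auto
  have "(\<integral>\<omega>. \<bar>psum f J \<omega>\<bar> \<partial>M)^2 \<le> (\<integral>\<omega>. (psum f J \<omega>)^2 \<partial>M)"
    using variance_positive[of "\<lambda>\<omega>. \<bar>psum f J \<omega>\<bar>"] variance_eq[OF i] psum_square(1)[OF J] by simp
  also note psum_variance_le[OF J]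
  finally show ?thesis by (rule real_le_rsqrt)
qed

text \<open>Passing from \<open>n\<close> to \<open>n + 1\<close> summands raises the variance by
  \<open>acov f 0\<close> plus twice the sum of the autocovariances at lags 1 to \<open>n\<close>.
  The normalised variance is the Cesaro mean of these increments, which converge to
  \<open>asym_var f\<close>.\<close>

lemma psum_variance_tendsto:
  "(\<lambda>n. (\<integral>\<omega>. (psum f {1..n} \<omega>)^2 \<partial>M) / real n) \<longlonglongrightarrow> asym_var f"
proof -
  define u where "u = (\<lambda>n. acov f 0 + 2 * (\<Sum>k<n. acov f (Suc k)))"
  have "(\<integral>\<omega>. (psum f {1..n} \<omega>)^2 \<partial>M) = (\<Sum>k<n. u k)" for n
  proof (induction n)
    case 0 then show ?case by (simp add: psum_def)
  next
    case (Suc n)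
    have S: "(\<Sum>i\<in>{1..Suc n}. \<Sum>j\<in>{1..Suc n}. acov f ((i - j) + (j - i)))
       = (\<Sum>i\<in>{1..n}. \<Sum>j\<in>{1..n}. acov f ((i - j) + (j - i)))
        + (2 * (\<Sum>i\<in>{1..n}. acov f (Suc n - i)) + acov f 0)"
      by (simp add: sum.distrib)
    have "(\<Sum>i\<in>{1..n}. acov f (Suc n - i)) = (\<Sum>k<n. acov f (Suc k))"
      by (rule sum.reindex_bij_witness[of _ "\<lambda>k. n - k" "\<lambda>i. n - i"]) (auto simp: Suc_diff_le)
    then show ?case using Suc S
      by (simp add: psum_square(2) u_def)
  qed
  moreover have "u \<longlonglongrightarrow> asym_var f"
    unfolding u_def asym_var_def
    by (intro tendsto_add tendsto_const tendsto_mult summable_LIMSEQ summable_acov)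
  ultimately show ?thesis using Cesaro_mean_tendsto[of u] by simp
qed

text \<open>The sign is not visible from the series; it comes from the representation as a limit of
  variances.\<close>

lemma asym_var_nonneg: "0 \<le> asym_var f"
  by (rule LIMSEQ_le_const[OF psum_variance_tendsto]) auto

end

declare f_measurable [measurable del]

end

section \<open>The central limit theorem for strongly mixing sequences\<close>

lemma cmod_iexp_diff_le: "cmod (iexp x - iexp y) \<le> \<bar>x - y\<bar>"
proof -
  have "iexp x - iexp y = iexp y * (iexp (x - y) - 1)"
    by (simp add: algebra_simps exp_add[symmetric])
  then have "cmod (iexp x - iexp y) = cmod (iexp (x - y) - 1)" by (simp add: norm_mult)
  also have "\<dots> \<le> \<bar>x - y\<bar>" using iexp_approx1[of "x - y" 0] by simp
  finally show ?thesis .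
qed

lemma norm_add4_le: "norm (w + x + y + z) \<le> norm w + norm x + norm y + norm (z :: 'b :: real_normed_vector)"
  using norm_triangle_ineq[of "w + x + y" z] norm_triangle_ineq[of "w + x" y] norm_triangle_ineq[of w x] by linarith

lemma cmod_of_real_diff: "cmod (complex_of_real x - complex_of_real y) = \<bar>x - y\<bar>"
  by (metis norm_of_real of_real_diff)

lemma abs_exp_diff_le:
  fixes x y :: real
  assumes "0 \<le> x" "0 \<le> y"
  shows "\<bar>exp (- x) - exp (- y)\<bar> \<le> \<bar>x - y\<bar>"
proof -
  have *: "exp (- u) - exp (- v) \<le> v - u" if "0 \<le> u" "u \<le> v" for u v :: real
  proof -
    have "exp (- u) - exp (- v) = exp (- u) * (1 - exp (u - v))" by (simp add: algebra_simps exp_add[symmetric])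
    also have "\<dots> \<le> 1 * (1 - exp (u - v))" using that by (intro mult_right_mono) auto
    also have "\<dots> \<le> v - u" using exp_ge_add_one_self[of "u - v"] by argo
    finally show ?thesis .
  qed
  show ?thesis using *[of x y] *[of y x] assms by (cases "x \<le> y") auto
qed

lemma exp_minus_quadratic:
  fixes x :: real
  assumes "0 \<le> x"
  shows "\<bar>(1 - x) - exp (- x)\<bar> \<le> x^2"
proof (cases "x \<le> 1")
  case True
  have 1: "1 - x \<le> exp (- x)" using exp_ge_add_one_self[of "- x"] by simp
  have 2: "exp (- x) \<le> 1 / (1 + x)"
    using exp_ge_add_one_self[of x] assms by (simp add: exp_minus inverse_eq_divide frac_le)
  have "1 / (1 + x) \<le> 1 - x + x^2"
  proof -
    have "1 \<le> (1 - x + x^2) * (1 + x)"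
      using assms zero_le_power[OF assms, of 3] by (simp add: algebra_simps power2_eq_square power3_eq_cube)
    then show ?thesis using assms by (simp add: divide_le_eq)
  qed
  then show ?thesis using 1 2 by (simp add: abs_le_iff)
next
  case False
  have "exp (- x) \<le> 1" "0 \<le> exp (- x)" "1 - x \<le> exp (- x)" using assms exp_ge_add_one_self[of "- x"] by auto
  moreover have "x \<le> x^2" using False by (simp add: power2_eq_square)
  ultimately show ?thesis using False unfolding abs_le_iff by linarith
qed

context prob_space
begin

definition chf :: "('a \<Rightarrow> real) \<Rightarrow> real \<Rightarrow> complex" where
  "chf Y t = (CLINT \<omega>|M. iexp (t * Y \<omega>))"

lemma char_distr_eq: "Y \<in> borel_measurable M \<Longrightarrow> char (distr M borel Y) t = chf Y t"
  unfolding char_def chf_def by (subst integral_distr) auto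

lemma iexp_integrable: "Y \<in> borel_measurable M \<Longrightarrow> integrable M (\<lambda>\<omega>. iexp (t * Y \<omega>))"
  by (rule integrable_const_bound[of _ 1]) auto

lemma cmod_chf_le_1:
  assumes "Y \<in> borel_measurable M"
  shows "cmod (chf Y t) \<le> 1"
proof -
  have "cmod (chf Y t) \<le> (\<integral>\<omega>. cmod (iexp (t * Y \<omega>)) \<partial>M)"
    unfolding chf_def by (rule integral_norm_bound)
  then show ?thesis by (simp add: prob_space)
qed

lemma chf_diff_le:
  assumes Y: "Y \<in> borel_measurable M" and Z: "Z \<in> borel_measurable M"
    and i: "integrable M (\<lambda>\<omega>. Y \<omega> - Z \<omega>)"
  shows "cmod (chf Y t - chf Z t) \<le> \<bar>t\<bar> * (\<integral>\<omega>. \<bar>Y \<omega> - Z \<omega>\<bar> \<partial>M)"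
proof -
  have "chf Y t - chf Z t = (CLINT \<omega>|M. iexp (t * Y \<omega>) - iexp (t * Z \<omega>))"
    unfolding chf_def using iexp_integrable[OF Y] iexp_integrable[OF Z] by simp
  also have "cmod \<dots> \<le> (\<integral>\<omega>. cmod (iexp (t * Y \<omega>) - iexp (t * Z \<omega>)) \<partial>M)" by (rule integral_norm_bound)
  also have "\<dots> \<le> (\<integral>\<omega>. \<bar>t\<bar> * \<bar>Y \<omega> - Z \<omega>\<bar> \<partial>M)"
  proof (rule integral_mono)
    show "integrable M (\<lambda>\<omega>. cmod (iexp (t * Y \<omega>) - iexp (t * Z \<omega>)))"
      using iexp_integrable[OF Y] iexp_integrable[OF Z] by (intro integrable_norm Bochner_Integration.integrable_diff)
    show "integrable M (\<lambda>\<omega>. \<bar>t\<bar> * \<bar>Y \<omega> - Z \<omega>\<bar>)" using i by auto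
    show "cmod (iexp (t * Y \<omega>) - iexp (t * Z \<omega>)) \<le> \<bar>t\<bar> * \<bar>Y \<omega> - Z \<omega>\<bar>" for \<omega>
      using cmod_iexp_diff_le[of "t * Y \<omega>" "t * Z \<omega>"] by (simp add: right_diff_distrib[symmetric] abs_mult)
  qed
  finally show ?thesis by simp
qed

text \<open>Real and imaginary part of the difference are each a combination of two covariances of
  cosines and sines, bounded by \<open>4 * \<alpha>\<close> apiece. The modulus is at most the sum
  of all four.\<close>

lemma chf_add_le:
  assumes F: "subalgebra M F" and G: "subalgebra M G" and ab: "alpha_bound M F G \<alpha>"
    and Y: "Y \<in> borel_measurable F" and Z: "Z \<in> borel_measurable G"
  shows "cmod (chf (\<lambda>\<omega>. Y \<omega> + Z \<omega>) t - chf Y t * chf Z t) \<le> 16 * \<alpha>"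
proof -
  have YM[measurable]: "Y \<in> borel_measurable M" and ZM[measurable]: "Z \<in> borel_measurable M"
    by (rule measurable_from_subalg[OF F Y], rule measurable_from_subalg[OF G Z])
  let ?c = "\<lambda>Y \<omega>. cos (t * Y \<omega>)" and ?s = "\<lambda>Y \<omega>. sin (t * Y \<omega>)"
  have re: "Re (chf V t) = (\<integral>\<omega>. ?c V \<omega> \<partial>M)" and im: "Im (chf V t) = (\<integral>\<omega>. ?s V \<omega> \<partial>M)"
    if "V \<in> borel_measurable M" for V
  proof -
    have "Re (chf V t) = (\<integral>\<omega>. Re (iexp (t * V \<omega>)) \<partial>M)" "Im (chf V t) = (\<integral>\<omega>. Im (iexp (t * V \<omega>)) \<partial>M)"
      unfolding chf_def by (rule integral_Re[OF iexp_integrable[OF that], symmetric],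
        rule integral_Im[OF iexp_integrable[OF that], symmetric])
    then show "Re (chf V t) = (\<integral>\<omega>. ?c V \<omega> \<partial>M)" "Im (chf V t) = (\<integral>\<omega>. ?s V \<omega> \<partial>M)"
      by (simp_all add: Re_exp Im_exp)
  qed
  have prod: "integrable M (\<lambda>\<omega>. u \<omega> * v \<omega>)" if "u \<in> borel_measurable M" "v \<in> borel_measurable M"
    "\<And>\<omega>. \<bar>u \<omega>\<bar> \<le> 1" "\<And>\<omega>. \<bar>v \<omega>\<bar> \<le> 1" for u v :: "'a \<Rightarrow> real"
    by (rule integrable_bounded[of _ 1]) (use that in \<open>auto simp: abs_mult intro!: mult_le_one\<close>)
  have cov: "\<bar>(\<integral>\<omega>. u (t * Y \<omega>) * v (t * Z \<omega>) \<partial>M) - (\<integral>\<omega>. u (t * Y \<omega>) \<partial>M) * (\<integral>\<omega>. v (t * Z \<omega>) \<partial>M)\<bar> \<le> 4 * \<alpha>"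
    if [measurable]: "u \<in> borel_measurable borel" "v \<in> borel_measurable borel" and b: "\<And>x. \<bar>u x\<bar> \<le> 1" "\<And>x. \<bar>v x\<bar> \<le> 1"
    for u v :: "real \<Rightarrow> real"
    using covariance_bounded_le[OF F G ab, of "\<lambda>\<omega>. u (t * Y \<omega>)" 1 "\<lambda>\<omega>. v (t * Z \<omega>)" 1] Y Z b by simp
  have R: "(\<integral>\<omega>. ?c (\<lambda>\<omega>. Y \<omega> + Z \<omega>) \<omega> \<partial>M) = (\<integral>\<omega>. ?c Y \<omega> * ?c Z \<omega> \<partial>M) - (\<integral>\<omega>. ?s Y \<omega> * ?s Z \<omega> \<partial>M)"
    by (simp add: distrib_left cos_add, subst Bochner_Integration.integral_diff) (auto intro!: prod)
  have I: "(\<integral>\<omega>. ?s (\<lambda>\<omega>. Y \<omega> + Z \<omega>) \<omega> \<partial>M) = (\<integral>\<omega>. ?s Y \<omega> * ?c Z \<omega> \<partial>M) + (\<integral>\<omega>. ?c Y \<omega> * ?s Z \<omega> \<partial>M)"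
    by (simp add: distrib_left sin_add, subst Bochner_Integration.integral_add) (auto intro!: prod)
  let ?d = "chf (\<lambda>\<omega>. Y \<omega> + Z \<omega>) t - chf Y t * chf Z t"
  have "\<bar>Re ?d\<bar> \<le> 8 * \<alpha>"
    using cov[of cos cos] cov[of sin sin] R by (simp add: re im)
  moreover have "\<bar>Im ?d\<bar> \<le> 8 * \<alpha>"
    using cov[of sin cos] cov[of cos sin] I by (simp add: re im)
  ultimately show ?thesis using cmod_le[of ?d] by simp
qed

text \<open>In the Taylor remainder the cubic branch of the minimum is used, with one factor
  \<open>\<bar>Y \<omega>\<bar>\<close> replaced by \<open>b\<close>. The error is then proportional
  to the second moment, which for a block grows at most linearly in its length.\<close>

lemma chf_quadratic_approx:
  assumes Y[measurable]: "Y \<in> borel_measurable M" and b: "\<And>\<omega>. \<omega> \<in> space M \<Longrightarrow> \<bar>Y \<omega>\<bar> \<le> b"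
    and m: "expectation Y = 0"
  shows "cmod (chf Y t - (1 - t^2 * (\<integral>\<omega>. (Y \<omega>)^2 \<partial>M) / 2)) \<le> \<bar>t\<bar>^3 * b * (\<integral>\<omega>. (Y \<omega>)^2 \<partial>M)"
proof -
  have i1: "integrable M Y" by (rule integrable_bounded[OF Y b])
  have i2: "integrable M (\<lambda>\<omega>. (Y \<omega>)^2)"
    by (rule integrable_bounded[of _ "b^2"]) (use b power_mono[OF b, of _ 2] in auto)
  have i3: "integrable M (\<lambda>\<omega>. \<bar>t\<bar> * (b * (Y \<omega>)^2))" using i2 by simp
  have b0: "0 \<le> b" using b not_empty by (meson abs_ge_zero all_not_in_conv order_trans)
  have "cmod (chf Y t - (1 - t^2 * (\<integral>\<omega>. (Y \<omega>)^2 \<partial>M) / 2))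
      \<le> (t^2 / 6) * (\<integral>\<omega>. min (6 * (Y \<omega>)^2) (\<bar>t\<bar> * \<bar>Y \<omega>\<bar>^3) \<partial>M)"
    using char_approx3'[OF Y i1 i2 m refl refl, of t] m by (simp add: char_distr_eq)
  also have "\<dots> \<le> (t^2 / 6) * (\<integral>\<omega>. \<bar>t\<bar> * (b * (Y \<omega>)^2) \<partial>M)"
  proof (intro mult_left_mono integral_mono)
    show "integrable M (\<lambda>\<omega>. min (6 * (Y \<omega>)^2) (\<bar>t\<bar> * \<bar>Y \<omega>\<bar>^3))"
      by (rule Bochner_Integration.integrable_bound[of _ "\<lambda>\<omega>. 6 * (Y \<omega>)^2"]) (use i2 in \<open>auto simp: min_def\<close>)
    show "min (6 * (Y \<omega>)^2) (\<bar>t\<bar> * \<bar>Y \<omega>\<bar>^3) \<le> \<bar>t\<bar> * (b * (Y \<omega>)^2)" if "\<omega> \<in> space M" for \<omega>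
    proof -
      have "\<bar>Y \<omega>\<bar>^3 = \<bar>Y \<omega>\<bar> * (Y \<omega>)^2" by (simp add: power3_eq_cube power2_eq_square abs_mult_self_eq mult.assoc)
      also have "\<dots> \<le> b * (Y \<omega>)^2" using b[OF that] by (intro mult_right_mono) auto
      finally have "\<bar>t\<bar> * \<bar>Y \<omega>\<bar>^3 \<le> \<bar>t\<bar> * (b * (Y \<omega>)^2)" by (intro mult_left_mono) auto
      then show ?thesis by simp
    qed
  qed (use i3 in auto)
  also have "\<dots> = (\<bar>t\<bar>^3 * b * (\<integral>\<omega>. (Y \<omega>)^2 \<partial>M)) / 6"
    using i2 by (simp add: power2_eq_square power3_eq_cube abs_mult_self_eq)
  also have "\<dots> \<le> \<bar>t\<bar>^3 * b * (\<integral>\<omega>. (Y \<omega>)^2 \<partial>M)"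
  proof -
    have "0 \<le> \<bar>t\<bar>^3 * b * (\<integral>\<omega>. (Y \<omega>)^2 \<partial>M)" using b0 by simp
    then show ?thesis by linarith
  qed
  finally show ?thesis .
qed

end

section \<open>Bernstein blocks\<close>

context stationary_mixing
begin

text \<open>Block \<open>j\<close> opens a period of length \<open>p + q\<close>; the other
  \<open>q\<close> indices of the period form a gap, whose contribution is discarded.\<close>

definition block :: "nat \<Rightarrow> nat \<Rightarrow> nat \<Rightarrow> nat set" where
  "block p q j = {j * (p + q) + 1..j * (p + q) + p}"

lemma block_disjoint:
  assumes "i < j" shows "block p q i \<inter> block p q j = {}"
proof -
  have "Suc i * (p + q) \<le> j * (p + q)" using assms by (intro mult_right_mono) auto
  then show ?thesis unfolding block_def by auto
qed

lemma block_disjoint_family: "disjoint_family_on (block p q) I"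
  unfolding disjoint_family_on_def using block_disjoint by (metis Int_commute linorder_neqE_nat)

lemma blocks_subset: "(\<Union>j<k. block p q j) \<subseteq> {1..k * (p + q)}"
proof
  fix i assume "i \<in> (\<Union>j<k. block p q j)"
  then obtain j where j: "j < k" "i \<in> block p q j" by auto
  have "Suc j * (p + q) \<le> k * (p + q)" using j by (intro mult_right_mono) auto
  then show "i \<in> {1..k * (p + q)}" using j(2) unfolding block_def by auto
qed

lemma card_blocks: "card (\<Union>j<k. block p q j) = k * p"
  using block_disjoint_family[of p q "{..<k}"]
  by (subst card_UN_disjoint') (auto simp: block_def disjoint_family_on_def)

lemma sum_psum_blocks: "(\<Sum>j<k. psum f (block p q j) \<omega>) = psum f (\<Union>j<k. block p q j) \<omega>"
  unfolding psum_def using block_disjoint_family[of p q "{..<k}"]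
  by (subst sum.UNION_disjoint) (auto simp: block_def disjoint_family_on_def)

lemma psum_process_measurable:
  assumes [measurable]: "f \<in> borel_measurable borel" and "J \<subseteq> I"
  shows "psum f J \<in> borel_measurable (process_algebra M X I)"
proof -
  have "(\<lambda>\<omega>. f (X i \<omega>)) \<in> borel_measurable (process_algebra M X I)" if "i \<in> J" for i
    by (rule measurable_compose[OF measurable_process_algebra]) (use that assms in auto)
  then show ?thesis unfolding psum_def[abs_def] cen_def by (intro borel_measurable_sum) auto
qed

context
  fixes f :: "real \<Rightarrow> real" and A :: real
  assumes fA: "moment_le f A"
begin

lemma chf_block: "chf (psum f (block p q j)) s = chf (psum f {1..p}) s"
proof -
  note [measurable] = f_measurable[OF fA]
  have m: "psum f (block p q j) \<in> borel_measurable M" "psum f {1..p} \<in> borel_measurable M"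
    by (rule psum_measurable[OF fA]; auto simp: block_def)+
  have e: "psum f (block p q j) = (\<lambda>\<omega>. \<Sum>i\<in>{1..p}. f (X (i + j * (p + q)) \<omega>) - (\<integral>x. f x \<partial>marginal M X))"
  proof
    fix \<omega>
    show "psum f (block p q j) \<omega> = (\<Sum>i\<in>{1..p}. f (X (i + j * (p + q)) \<omega>) - (\<integral>x. f x \<partial>marginal M X))"
      unfolding psum_def cen_def block_def
      using sum.shift_bounds_cl_nat_ivl[of "\<lambda>i. f (X i \<omega>) - (\<integral>x. f x \<partial>marginal M X)" 1 "j * (p + q)" p]
      by (simp add: add.commute)
  qed
  have "distr M borel (psum f (block p q j)) = distr M borel (psum f {1..p})"
    unfolding e using distr_block_sum[where f = "\<lambda>x. f x - (\<integral>x. f x \<partial>marginal M X)" and p = p and k = "j * (p + q)"]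
    by (simp add: psum_def[abs_def] cen_def)
  then show ?thesis using char_distr_eq[OF m(1), of s] char_distr_eq[OF m(2), of s] by simp
qed

text \<open>One block is split off at a time at the price of \<open>chf_add_le\<close>. Earlier
  errors are multiplied by a characteristic function and therefore do not grow.\<close>

lemma chf_blocks:
  assumes p: "1 \<le> p"
  shows "cmod (chf (\<lambda>\<omega>. \<Sum>j<k. psum f (block p q j) \<omega>) s - chf (psum f {1..p}) s ^ k)
    \<le> real k * (16 * (a * real (Suc q) powr (- \<rho>)))"
proof (induction k)
  case 0 then show ?case by (simp add: chf_def prob_space)
next
  case (Suc k)
  note [measurable] = f_measurable[OF fA]
  let ?\<phi> = "chf (psum f {1..p}) s" and ?S = "\<lambda>k \<omega>. \<Sum>j<k. psum f (block p q j) \<omega>"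
  have p1: "cmod ?\<phi> \<le> 1" by (rule cmod_chf_le_1[OF psum_measurable[OF fA]]) auto
  have "cmod (chf (?S (Suc k)) s - chf (?S k) s * ?\<phi>) \<le> 16 * (a * real (Suc q) powr (- \<rho>))"
  proof (cases k)
    case 0
    then have "chf (?S (Suc k)) s - chf (?S k) s * ?\<phi> = 0"
      using chf_block[of p q 0 s] by (simp add: chf_def prob_space)
    then show ?thesis using a by simp
  next
    case (Suc l)
    let ?e = "l * (p + q) + p"
    have e1: "1 \<le> ?e" using p by simp
    \<comment> \<open>After a gap of \<open>q\<close> indices the next block begins
      \<open>q + 1\<close> steps beyond the end of the previous one, hence \<open>Suc q\<close> in
      the rate.\<close>
    have ek: "?e + Suc q = k * (p + q) + 1" using Suc by simp
    have sub: "(\<Union>j<k. block p q j) \<subseteq> {1..?e}"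
    proof
      fix i assume "i \<in> (\<Union>j<k. block p q j)"
      then obtain j where "j < k" and "i \<in> block p q j" by auto
      then have j: "j \<le> l" "i \<in> block p q j" using Suc by auto
      have "j * (p + q) \<le> l * (p + q)" using j by (intro mult_right_mono) auto
      moreover have "j * (p + q) + 1 \<le> i" "i \<le> j * (p + q) + p" using j(2) unfolding block_def by auto
      ultimately show "i \<in> {1..?e}" by (simp only: atLeastAtMost_iff) linarith
    qed
    have m1: "?S k \<in> borel_measurable (past ?e)"
      unfolding sum_psum_blocks by (rule psum_process_measurable[OF _ sub, unfolded]) simp
    have m2: "psum f (block p q k) \<in> borel_measurable (future (?e + Suc q))"
      unfolding ek by (rule psum_process_measurable) (auto simp: block_def)
    have f1: "1 \<le> ?e + Suc q" by simp
    have q1: "1 \<le> Suc q" by simp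
    have "cmod (chf (\<lambda>\<omega>. ?S k \<omega> + psum f (block p q k) \<omega>) s - chf (?S k) s * chf (psum f (block p q k)) s)
        \<le> 16 * (a * real (Suc q) powr (- \<rho>))"
      by (rule chf_add_le[OF subalgebra_past subalgebra_future[OF f1] mixing[OF e1 q1] m1 m2])
    then show ?thesis by (simp add: chf_block)
  qed
  moreover have "cmod (chf (?S k) s * ?\<phi> - ?\<phi> ^ Suc k) \<le> real k * (16 * (a * real (Suc q) powr (- \<rho>)))"
  proof -
    have eq: "chf (?S k) s * ?\<phi> - ?\<phi> ^ Suc k = (chf (?S k) s - ?\<phi> ^ k) * ?\<phi>"
      by (simp add: algebra_simps)
    have "cmod (chf (?S k) s - ?\<phi> ^ k) * cmod ?\<phi> \<le> cmod (chf (?S k) s - ?\<phi> ^ k) * 1"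
      by (rule mult_left_mono[OF p1]) simp
    then show ?thesis unfolding eq norm_mult using Suc.IH by linarith
  qed
  ultimately have "cmod ((chf (?S (Suc k)) s - chf (?S k) s * ?\<phi>) + (chf (?S k) s * ?\<phi> - ?\<phi> ^ Suc k))
      \<le> 16 * (a * real (Suc q) powr (- \<rho>)) + real k * (16 * (a * real (Suc q) powr (- \<rho>)))"
    by (rule norm_triangle_mono)
  then show ?case by (simp add: algebra_simps)
qed

text \<open>The summands of the bound are, in order: the discarded gaps and the incomplete last
  period; the decoupling of the blocks; the Taylor remainder of one block, \<open>k\<close> times;
  the replacement of \<open>1 - x\<close> by \<open>exp (- x)\<close>, \<open>k\<close> times; the
  distance between the accumulated block variance and the target \<open>v\<close>.\<close>

lemma chf_psum_bound:
  fixes n p q :: nat and t K :: real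
  assumes K: "\<And>x. \<bar>f x\<bar> \<le> K" and n: "1 \<le> n" and p: "1 \<le> p"
  defines "k \<equiv> n div (p + q)" and "s \<equiv> t / sqrt (real n)" and "V \<equiv> (\<integral>\<omega>. (psum f {1..p} \<omega>)^2 \<partial>M)"
    and "B \<equiv> A powr (2 / (2 + \<delta>)) * var_const"
  shows "cmod (chf (psum f {1..n}) s - complex_of_real (exp (- (t^2 * v / 2))))
     \<le> \<bar>s\<bar> * sqrt (real (n - k * p) * B) + real k * (16 * (a * real (Suc q) powr (- \<rho>)))
       + real k * (\<bar>s\<bar>^3 * (2 * K * real p) * (real p * B)) + real k * (s^2 * (real p * B))^2
       + \<bar>exp (- (real k * (s^2 * V / 2))) - exp (- (t^2 * v / 2))\<bar>"
proof -
  note [measurable] = f_measurable[OF fA]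
  let ?J = "{1..n} - (\<Union>j<k. block p q j)" and ?U = "\<Union>j<k. block p q j" and ?\<phi> = "chf (psum f {1..p}) s"
  have kn: "k * (p + q) \<le> n" unfolding k_def by simp
  have U: "?U \<subseteq> {1..n}" using blocks_subset[of p q k] kn by fastforce
  have fU: "finite ?U" by (rule finite_subset[OF U]) simp
  have cJ: "card ?J = n - k * p" using card_Diff_subset[OF fU U] card_blocks[of p q k] by simp
  have split: "psum f {1..n} \<omega> = psum f ?U \<omega> + psum f ?J \<omega>" for \<omega>
    unfolding psum_def using sum.subset_diff[OF U, of "\<lambda>i. cen f i \<omega>"] by simp
  have sp: "(\<lambda>\<omega>. psum f {1..n} \<omega> - psum f ?U \<omega>) = psum f ?J"
    by (rule ext) (simp only: split add_diff_cancel_left')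
  have U1: "?U \<subseteq> {1..}" using U by auto
  have m: "psum f {1..n} \<in> borel_measurable M" "psum f ?U \<in> borel_measurable M"
    by (rule psum_measurable[OF fA], use U1 in auto)+
  have J: "finite ?J" "?J \<subseteq> {1..}" by auto
  have Kn: "0 \<le> K" using K[of 0] by simp
  have V0: "0 \<le> V" unfolding V_def by simp
  have VB: "V \<le> real p * B" unfolding V_def B_def using psum_variance_le[OF fA, of "{1..p}"] by simp
  have 1: "cmod (chf (psum f {1..n}) s - chf (psum f ?U) s) \<le> \<bar>s\<bar> * sqrt (real (n - k * p) * B)"
  proof -
    have "cmod (chf (psum f {1..n}) s - chf (psum f ?U) s) \<le> \<bar>s\<bar> * (\<integral>\<omega>. \<bar>psum f {1..n} \<omega> - psum f ?U \<omega>\<bar> \<partial>M)"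
      using psum_integrable[OF fA J(2)] by (intro chf_diff_le m) (simp only: sp)
    also have "\<dots> = \<bar>s\<bar> * (\<integral>\<omega>. \<bar>psum f ?J \<omega>\<bar> \<partial>M)" by (simp only: fun_cong[OF sp])
    also have "\<dots> \<le> \<bar>s\<bar> * sqrt (real (n - k * p) * B)"
      using expectation_abs_psum_le[OF fA J] unfolding cJ B_def by (intro mult_left_mono) auto
    finally show ?thesis .
  qed
  have 2: "cmod (chf (psum f ?U) s - ?\<phi> ^ k) \<le> real k * (16 * (a * real (Suc q) powr (- \<rho>)))"
    using chf_blocks[OF p, where k = k and q = q and s = s] unfolding sum_psum_blocks .
  have p1: "cmod ?\<phi> \<le> 1" by (rule cmod_chf_le_1[OF psum_measurable[OF fA]]) auto
  have e1: "cmod (complex_of_real (exp (- (s^2 * V / 2)))) \<le> 1" using V0 by simp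
  have 3: "cmod (?\<phi> ^ k - complex_of_real (exp (- (real k * (s^2 * V / 2)))))
     \<le> real k * (\<bar>s\<bar>^3 * (2 * K * real p) * (real p * B)) + real k * (s^2 * (real p * B))^2"
  proof -
    have eq: "complex_of_real (exp (- (real k * (s^2 * V / 2)))) = complex_of_real (exp (- (s^2 * V / 2))) ^ k"
    proof -
      have "exp (- (real k * (s^2 * V / 2))) = exp (real k * (- (s^2 * V / 2)))" by simp
      then show ?thesis unfolding exp_of_nat_mult by simp
    qed
    have "cmod (?\<phi> ^ k - complex_of_real (exp (- (real k * (s^2 * V / 2)))))
        \<le> real k * cmod (?\<phi> - complex_of_real (exp (- (s^2 * V / 2))))"
      unfolding eq by (rule norm_power_diff[OF p1 e1])
    also have "cmod (?\<phi> - complex_of_real (exp (- (s^2 * V / 2)))) \<le> \<bar>s\<bar>^3 * (2 * K * real p) * (real p * B) + (s^2 * (real p * B))^2"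
    proof -
      have b: "\<bar>psum f {1..p} \<omega>\<bar> \<le> 2 * K * real p" if "\<omega> \<in> space M" for \<omega>
      proof -
        have mu: "\<bar>\<integral>x. f x \<partial>marginal M X\<bar> \<le> K"
          by (rule prob_space.abs_expectation_le_bound[OF prob_space_marginal]) (use K Kn in auto)
        have "\<bar>psum f {1..p} \<omega>\<bar> \<le> (\<Sum>i\<in>{1..p}. \<bar>cen f i \<omega>\<bar>)" unfolding psum_def by (rule sum_abs)
        also have "\<dots> \<le> (\<Sum>i\<in>{1..p}. 2 * K)"
        proof (rule sum_mono)
          fix i show "\<bar>cen f i \<omega>\<bar> \<le> 2 * K" using K[of "X i \<omega>"] mu unfolding cen_def by linarith
        qed
        finally show ?thesis by (simp add: mult_ac)
      qed
      have "cmod (?\<phi> - (1 - s^2 * V / 2)) \<le> \<bar>s\<bar>^3 * (2 * K * real p) * V"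
        unfolding V_def
        by (rule chf_quadratic_approx[OF psum_measurable[OF fA] b expectation_psum[OF fA]]) auto
      also have "\<dots> \<le> \<bar>s\<bar>^3 * (2 * K * real p) * (real p * B)" using VB Kn by (intro mult_left_mono) auto
      finally have c1: "cmod (?\<phi> - (1 - s^2 * V / 2)) \<le> \<bar>s\<bar>^3 * (2 * K * real p) * (real p * B)" .
      have "cmod (complex_of_real (1 - s^2 * V / 2) - complex_of_real (exp (- (s^2 * V / 2)))) = \<bar>(1 - s^2 * V / 2) - exp (- (s^2 * V / 2))\<bar>"
        by (rule cmod_of_real_diff)
      also have "\<dots> \<le> (s^2 * V / 2)^2" by (rule exp_minus_quadratic) (use V0 in simp)
      also have "\<dots> \<le> (s^2 * (real p * B))^2"
      proof (rule power_mono)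
        have "s^2 * V \<le> s^2 * (real p * B)" using VB by (intro mult_left_mono) auto
        moreover have "0 \<le> s^2 * V" using V0 by simp
        ultimately show "s^2 * V / 2 \<le> s^2 * (real p * B)" by linarith
      qed (use V0 in simp)
      finally have c2: "cmod (complex_of_real (1 - s^2 * V / 2) - complex_of_real (exp (- (s^2 * V / 2)))) \<le> (s^2 * (real p * B))^2" .
      have "?\<phi> - complex_of_real (exp (- (s^2 * V / 2))) = (?\<phi> - (1 - s^2 * V / 2)) + (complex_of_real (1 - s^2 * V / 2) - complex_of_real (exp (- (s^2 * V / 2))))"
        by simp
      then show ?thesis using c1 c2 norm_triangle_ineq by (smt (verit, best))
    qed
    finally show ?thesis by (simp add: distrib_left mult_left_mono)
  qed
  let ?E = "complex_of_real (exp (- (t^2 * v / 2)))" and ?e = "complex_of_real (exp (- (real k * (s^2 * V / 2))))"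
  have tri: "cmod (u - z) \<le> cmod (u - w) + cmod (w - x) + cmod (x - y) + cmod (y - z)" for u w x y z
    using norm_add4_le[of "u - w" "w - x" "x - y" "y - z"] by simp
  have "cmod (chf (psum f {1..n}) s - ?E) \<le> cmod (chf (psum f {1..n}) s - chf (psum f ?U) s)
     + cmod (chf (psum f ?U) s - ?\<phi> ^ k) + cmod (?\<phi> ^ k - ?e) + cmod (?e - ?E)"
    by (rule tri)
  moreover have "cmod (?e - ?E) = \<bar>exp (- (real k * (s^2 * V / 2))) - exp (- (t^2 * v / 2))\<bar>"
    by (rule cmod_of_real_diff)
  ultimately show ?thesis using 1 2 3 by linarith
qed

end

end

section \<open>Choice of the block lengths, and the passage to unbounded functions\<close>

context stationary_mixing
begin

context
  fixes f :: "real \<Rightarrow> real" and A :: real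
  assumes fA: "moment_le f A"
begin

lemma chf_psum_tendsto_bounded:
  fixes t K :: real
  assumes K: "\<And>x. \<bar>f x\<bar> \<le> K"
  shows "(\<lambda>n. chf (psum f {1..n}) (t / sqrt (real n))) \<longlonglongrightarrow> complex_of_real (exp (- (t^2 * asym_var f / 2)))"
proof -
  \<comment> \<open>Blocks have length about \<open>n powr (1/2 - e)\<close>, gaps about
    \<open>n powr (1/2 - 2 * e)\<close>: gaps are negligible against blocks, and blocks against
    \<open>sqrt n\<close>. This \<open>e\<close> makes the decoupling error of order
    \<open>n powr (- c)\<close> with \<open>c = (\<rho> - 1) / 2 - e * (1 + 2 * \<rho>) = (\<rho> -
    1) / 4\<close>.\<close>
  define e where "e = (\<rho> - 1) / (4 * (1 + 2 * \<rho>))"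
  have e: "0 < e" "e < 1/8" unfolding e_def using \<rho>_gt_1 by (auto simp: divide_less_eq)
  have e\<rho>: "e * (1 + 2 * \<rho>) = (\<rho> - 1) / 4" unfolding e_def using \<rho>_gt_1 by (simp add: field_simps)
  define \<alpha> where "\<alpha> = 1/2 - e"
  define \<beta> where "\<beta> = 1/2 - 2 * e"
  define c where "c = \<alpha> + \<beta> * \<rho> - 1"
  have c: "0 < c" unfolding c_def \<alpha>_def \<beta>_def using e\<rho> \<rho>_gt_1 by (simp add: algebra_simps)
  have \<alpha>\<beta>: "0 < \<alpha>" "0 < \<beta>" using e by (auto simp: \<alpha>_def \<beta>_def)
  define p where "p = (\<lambda>n. nat \<lceil>real n powr \<alpha>\<rceil>)"
  define q where "q = (\<lambda>n. nat \<lfloor>real n powr \<beta>\<rfloor>)"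
  define k where "k = (\<lambda>n. n div (p n + q n))"
  define V where "V = (\<lambda>m. \<integral>\<omega>. (psum f {1..m} \<omega>)^2 \<partial>M)"
  define B where "B = A powr (2 / (2 + \<delta>)) * var_const"
  have B0: "0 \<le> B" unfolding B_def using var_const_pos by simp
  have K0: "0 \<le> K" using K[of 0] by simp
  have pl: "real n powr \<alpha> \<le> real (p n)" for n unfolding p_def by linarith
  have ql: "real n powr \<beta> \<le> real (Suc (q n))" for n unfolding q_def by linarith
  have qu: "real (q n) \<le> real n powr \<beta>" for n unfolding q_def by simp
  have pu: "real (p n) \<le> 2 * real n powr \<alpha>" if n: "1 \<le> n" for n
  proof -
    have "1 \<le> real n powr \<alpha>" using n \<alpha>\<beta> by (intro ge_one_powr_ge_zero) auto
    then show ?thesis unfolding p_def by linarith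
  qed
  have p1: "1 \<le> p n" if n: "1 \<le> n" for n
  proof -
    have "0 < real n powr \<alpha>" using n by simp
    then show ?thesis using pl[of n] by linarith
  qed
  have kp: "real (k n) * real (p n) \<le> real n" for n
  proof -
    have "k n * p n \<le> k n * (p n + q n)" by simp
    also have "\<dots> \<le> n" unfolding k_def by simp
    finally show ?thesis by (metis of_nat_le_iff of_nat_mult)
  qed
  have ku: "real (k n) \<le> real n powr (1 - \<alpha>)" if n: "1 \<le> n" for n
  proof -
    have "real (k n) * real n powr \<alpha> \<le> real n powr (1 - \<alpha>) * real n powr \<alpha>"
      using mult_left_mono[OF pl[of n], of "real (k n)"] kp[of n] n by (simp add: powr_add[symmetric])
    then show ?thesis using n by (simp add: mult_le_cancel_right)
  qed
  \<comment> \<open>Discarded are \<open>k\<close> gaps and a last incomplete period shorter than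
    \<open>p + q\<close>. The gaps dominate, with order \<open>n powr (1 - e)\<close>.\<close>
  have rest: "real (n - k n * p n) \<le> 4 * real n powr (1 - e)" if n: "1 \<le> n" for n
  proof -
    have "n < (k n + 1) * (p n + q n)"
      unfolding k_def using p1[OF n] by (metis add_gr_0 dividend_less_div_times less_le_trans less_one mult.commute mult_Suc_right not_less Suc_eq_plus1)
    then have "n - k n * p n \<le> k n * q n + p n + q n" by (simp add: algebra_simps)
    then have "real (n - k n * p n) \<le> real (k n) * real (q n) + real (p n) + real (q n)"
      by (metis of_nat_add of_nat_le_iff of_nat_mult)
    also have "\<dots> \<le> real n powr (1 - \<alpha>) * real n powr \<beta> + 2 * real n powr \<alpha> + real n powr \<beta>"
      by (intro add_mono mult_mono ku pu qu n) auto
    also have "real n powr (1 - \<alpha>) * real n powr \<beta> = real n powr (1 - e)"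
      unfolding powr_add[symmetric] by (simp add: \<alpha>_def \<beta>_def)
    also have "real n powr \<alpha> \<le> real n powr (1 - e)" using n e by (intro powr_mono) (auto simp: \<alpha>_def)
    also have "real n powr \<beta> \<le> real n powr (1 - e)" using n e by (intro powr_mono) (auto simp: \<beta>_def)
    finally show ?thesis by simp
  qed
  have ptop: "filterlim p at_top sequentially"
  proof -
    have "filterlim (\<lambda>n. real n powr \<alpha>) at_top sequentially" using \<alpha>\<beta> by real_asymp
    then have "filterlim (\<lambda>n. real (p n)) at_top sequentially"
      by (rule filterlim_at_top_mono) (use pl in auto)
    then show ?thesis by (simp add: filterlim_sequentially_iff_filterlim_real)
  qed
  have Vlim: "(\<lambda>n. V (p n) / real (p n)) \<longlonglongrightarrow> asym_var f"
    using filterlim_compose[OF psum_variance_tendsto[OF fA] ptop] unfolding V_def .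
  have neg: "(\<lambda>n. real n powr (- u)) \<longlonglongrightarrow> 0" if "0 < u" for u
    using that by real_asymp
  have kplim: "(\<lambda>n. real (k n) * real (p n) / real n) \<longlonglongrightarrow> 1"
  proof -
    have "(\<lambda>n. 1 - real (k n) * real (p n) / real n) \<longlonglongrightarrow> 0"
    proof (rule Lim_null_comparison)
      show "\<forall>\<^sub>F n in sequentially. norm (1 - real (k n) * real (p n) / real n) \<le> 4 * real n powr (- e)"
        using eventually_ge_at_top[of 1]
      proof eventually_elim
        case (elim n)
        have "1 - real (k n) * real (p n) / real n = real (n - k n * p n) / real n"
          using kp[of n] elim by (subst of_nat_diff) (auto simp: field_simps simp flip: of_nat_mult)
        also have "\<bar>\<dots>\<bar> \<le> 4 * real n powr (1 - e) / real n"
          using rest[OF elim] by (simp add: divide_right_mono)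
        also have "\<dots> = 4 * real n powr (- e)" using elim by (simp add: powr_diff powr_minus field_simps)
        finally show ?case by simp
      qed
      show "(\<lambda>n. 4 * real n powr (- e)) \<longlonglongrightarrow> 0" using tendsto_mult_left[OF neg[OF e(1)], of 4] by simp
    qed
    from tendsto_diff[OF tendsto_const this, of 1] show ?thesis by simp
  qed
  let ?T5 = "\<lambda>n. \<bar>exp (- (real (k n) * ((t / sqrt (real n))^2 * V (p n) / 2))) - exp (- (t^2 * asym_var f / 2))\<bar>"
  have T5: "?T5 \<longlonglongrightarrow> 0"
  proof -
    have "(\<lambda>n. t^2 / 2 * ((real (k n) * real (p n) / real n) * (V (p n) / real (p n)))) \<longlonglongrightarrow> t^2 / 2 * (1 * asym_var f)"
      by (intro tendsto_mult tendsto_const kplim Vlim)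
    moreover have "\<forall>\<^sub>F n in sequentially. t^2 / 2 * ((real (k n) * real (p n) / real n) * (V (p n) / real (p n)))
        = real (k n) * ((t / sqrt (real n))^2 * V (p n) / 2)"
      using eventually_ge_at_top[of 1]
    proof eventually_elim
      case (elim n)
      then show ?case using p1[OF elim] by (simp add: power_divide mult_ac)
    qed
    ultimately have "(\<lambda>n. real (k n) * ((t / sqrt (real n))^2 * V (p n) / 2)) \<longlonglongrightarrow> t^2 / 2 * (1 * asym_var f)"
      by (rule Lim_transform_eventually)
    moreover have "t^2 / 2 * (1 * asym_var f) = t^2 * asym_var f / 2" by simp
    ultimately have "(\<lambda>n. real (k n) * ((t / sqrt (real n))^2 * V (p n) / 2)) \<longlonglongrightarrow> t^2 * asym_var f / 2"
      by (simp only:)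
    then have "(\<lambda>n. exp (- (real (k n) * ((t / sqrt (real n))^2 * V (p n) / 2)))) \<longlonglongrightarrow> exp (- (t^2 * asym_var f / 2))"
      by (intro tendsto_exp tendsto_minus)
    from tendsto_rabs_zero[OF LIM_zero[OF this]] show ?thesis .
  qed
  define g where "g = (\<lambda>n. \<bar>t\<bar> * sqrt (4 * B * real n powr (- e)) + 16 * a * real n powr (- c)
      + 4 * K * B * \<bar>t\<bar>^3 * real n powr (- e) + 2 * t^4 * B^2 * real n powr (\<alpha> - 1) + ?T5 n)"
  have "(\<lambda>n. chf (psum f {1..n}) (t / sqrt (real n)) - complex_of_real (exp (- (t^2 * asym_var f / 2)))) \<longlonglongrightarrow> 0"
  proof (rule Lim_null_comparison)
    show "\<forall>\<^sub>F n in sequentially. cmod (chf (psum f {1..n}) (t / sqrt (real n)) - complex_of_real (exp (- (t^2 * asym_var f / 2)))) \<le> g n"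
      using eventually_ge_at_top[of 1]
    proof eventually_elim
      case (elim n)
      let ?s = "t / sqrt (real n)" and ?x = "real n"
      have x: "0 < ?x" using elim by simp
      have xh: "?x powr (-1/2) = inverse (sqrt ?x)"
        using powr_minus[of ?x "1/2"] powr_half_sqrt[of ?x] x by simp
      have "\<bar>?s\<bar> = \<bar>t\<bar> / sqrt ?x" by simp
      then have s1: "\<bar>?s\<bar> = \<bar>t\<bar> * ?x powr (-1/2)" by (simp only: xh divide_inverse[of "\<bar>t\<bar>"])
      have xi: "?x powr (-1) = inverse ?x" using powr_minus[of ?x 1] x by simp
      have "?s^2 = t^2 / ?x" by (simp add: power_divide)
      then have s2: "?s^2 = t^2 * ?x powr (-1)" by (simp only: xi divide_inverse[of "t^2"])
      have s3: "\<bar>?s\<bar>^3 = \<bar>t\<bar>^3 * ?x powr (-3/2)"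
        unfolding s1 power_mult_distrib using x by (simp add: powr_power)
      have t1: "\<bar>?s\<bar> * sqrt (real (n - k n * p n) * B) \<le> \<bar>t\<bar> * sqrt (4 * B * ?x powr (- e))"
      proof -
        have "sqrt (real (n - k n * p n) * B) \<le> sqrt (4 * ?x powr (1 - e) * B)"
          using rest[OF elim] B0 by (intro real_sqrt_le_mono mult_right_mono) auto
        then have "\<bar>?s\<bar> * sqrt (real (n - k n * p n) * B) \<le> \<bar>?s\<bar> * sqrt (4 * ?x powr (1 - e) * B)"
          by (intro mult_left_mono) auto
        also have "\<dots> = \<bar>t\<bar> * sqrt (4 * ?x powr (1 - e) * B / ?x)"
          using x by (simp add: real_sqrt_divide)
        also have "4 * ?x powr (1 - e) * B / ?x = 4 * B * ?x powr (- e)" using x by (simp add: powr_diff powr_minus field_simps)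
        finally show ?thesis .
      qed
      have t2: "real (k n) * (16 * (a * real (Suc (q n)) powr (- \<rho>))) \<le> 16 * a * ?x powr (- c)"
      proof -
        have "real (Suc (q n)) powr (- \<rho>) \<le> (?x powr \<beta>) powr (- \<rho>)"
          using ql[of n] x \<rho>_gt_1 by (intro powr_mono2') auto
        then have "real (k n) * (16 * (a * real (Suc (q n)) powr (- \<rho>))) \<le> ?x powr (1 - \<alpha>) * (16 * (a * (?x powr \<beta>) powr (- \<rho>)))"
          using a by (intro mult_mono ku elim) auto
        also have "\<dots> = 16 * a * (?x powr (1 - \<alpha>) * ?x powr (- (\<beta> * \<rho>)))" by (simp add: powr_powr)
        also have "?x powr (1 - \<alpha>) * ?x powr (- (\<beta> * \<rho>)) = ?x powr (- c)"
          unfolding powr_add[symmetric] c_def by (simp add: algebra_simps)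
        finally show ?thesis .
      qed
      have t3: "real (k n) * (\<bar>?s\<bar>^3 * (2 * K * real (p n)) * (real (p n) * B)) \<le> 4 * K * B * \<bar>t\<bar>^3 * ?x powr (- e)"
      proof -
        have "real (k n) * (\<bar>?s\<bar>^3 * (2 * K * real (p n)) * (real (p n) * B))
           = (2 * K * B * \<bar>?s\<bar>^3) * ((real (k n) * real (p n)) * real (p n))" by (simp add: mult_ac)
        also have "\<dots> \<le> (2 * K * B * \<bar>?s\<bar>^3) * (?x * (2 * ?x powr \<alpha>))"
          using K0 B0 by (intro mult_left_mono mult_mono kp pu elim) auto
        also have "\<dots> = 4 * K * B * \<bar>t\<bar>^3 * (?x powr (-3/2) * ?x powr 1 * ?x powr \<alpha>)"
          unfolding s3 using x by simp
        also have "?x powr (-3/2) * ?x powr 1 * ?x powr \<alpha> = ?x powr (- e)"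
          unfolding powr_add[symmetric] \<alpha>_def by simp
        finally show ?thesis .
      qed
      have t4: "real (k n) * (?s^2 * (real (p n) * B))^2 \<le> 2 * t^4 * B^2 * ?x powr (\<alpha> - 1)"
      proof -
        have "real (k n) * (?s^2 * (real (p n) * B))^2 = (B^2 * (?s^2)^2) * ((real (k n) * real (p n)) * real (p n))"
          by (simp add: power2_eq_square mult_ac)
        also have "\<dots> \<le> (B^2 * (?s^2)^2) * (?x * (2 * ?x powr \<alpha>))"
          by (intro mult_left_mono mult_mono kp pu elim) auto
        also have "\<dots> = 2 * t^4 * B^2 * ((?x powr (-1) * ?x powr (-1)) * ?x powr 1 * ?x powr \<alpha>)"
          unfolding s2 using x by (simp add: power2_eq_square power4_eq_xxxx mult_ac)
        also have "(?x powr (-1) * ?x powr (-1)) * ?x powr 1 * ?x powr \<alpha> = ?x powr (\<alpha> - 1)"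
          unfolding powr_add[symmetric] by simp
        finally show ?thesis .
      qed
      have "cmod (chf (psum f {1..n}) ?s - complex_of_real (exp (- (t^2 * asym_var f / 2))))
        \<le> \<bar>?s\<bar> * sqrt (real (n - k n * p n) * B) + real (k n) * (16 * (a * real (Suc (q n)) powr (- \<rho>)))
       + real (k n) * (\<bar>?s\<bar>^3 * (2 * K * real (p n)) * (real (p n) * B)) + real (k n) * (?s^2 * (real (p n) * B))^2 + ?T5 n"
        using chf_psum_bound[OF fA K elim p1[OF elim], where q = "q n" and t = t and v = "asym_var f"]
        unfolding k_def V_def B_def by simp
      then show ?case unfolding g_def using t1 t2 t3 t4 by linarith
    qed
    have "g \<longlonglongrightarrow> \<bar>t\<bar> * sqrt (4 * B * 0) + 16 * a * 0 + 4 * K * B * \<bar>t\<bar>^3 * 0 + 2 * t^4 * B^2 * 0 + 0"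
      unfolding g_def using neg[of "1 - \<alpha>"] e
      by (intro tendsto_intros neg c T5) (auto simp: \<alpha>_def)
    then show "g \<longlonglongrightarrow> 0" by simp
  qed
  then show ?thesis by (rule LIM_zero_cancel)
qed

lemma moment_le_clip:
  assumes "0 \<le> T" shows "moment_le (\<lambda>x. clip T (f x)) A"
proof -
  note [measurable] = f_measurable[OF fA]
  have le: "\<bar>clip T (f x)\<bar> powr (2 + \<delta>) \<le> \<bar>f x\<bar> powr (2 + \<delta>)" for x
    using assms \<delta> by (intro powr_mono2 abs_clip_le_abs) auto
  have i: "integrable (marginal M X) (\<lambda>x. \<bar>clip T (f x)\<bar> powr (2 + \<delta>))"
    by (rule Bochner_Integration.integrable_bound[OF f_moment(1)[OF fA]]) (use le in auto)
  have "(\<integral>x. \<bar>clip T (f x)\<bar> powr (2 + \<delta>) \<partial>marginal M X) \<le> (\<integral>x. \<bar>f x\<bar> powr (2 + \<delta>) \<partial>marginal M X)"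
    by (intro integral_mono i f_moment(1)[OF fA] le)
  then show ?thesis using i f_moment(2)[OF fA] A_pos[OF fA] unfolding moment_le_def by auto
qed

lemma moment_le_clip_rest:
  "\<exists>b :: nat \<Rightarrow> real. b \<longlonglongrightarrow> 0 \<and> (\<forall>N. 0 < b N \<and> moment_le (\<lambda>x. f x - clip (real N) (f x)) (b N))"
proof -
  note [measurable] = f_measurable[OF fA]
  define r where "r = (\<lambda>N x. \<bar>f x - clip (real N) (f x)\<bar> powr (2 + \<delta>))"
  have le: "r N x \<le> \<bar>f x\<bar> powr (2 + \<delta>)" for N x
    unfolding r_def using \<delta> by (intro powr_mono2 abs_diff_clip_le) auto
  have rm: "r N \<in> borel_measurable (marginal M X)" for N unfolding r_def by measurable
  have i: "integrable (marginal M X) (r N)" for N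
    by (rule Bochner_Integration.integrable_bound[OF f_moment(1)[OF fA] rm]) (use le in \<open>auto simp: r_def\<close>)
  have "(\<lambda>N. \<integral>x. r N x \<partial>marginal M X) \<longlonglongrightarrow> (\<integral>x. 0 \<partial>marginal M X)"
  proof (rule integral_dominated_convergence[where w = "\<lambda>x. \<bar>f x\<bar> powr (2 + \<delta>)"])
    show "AE x in marginal M X. (\<lambda>N. r N x) \<longlonglongrightarrow> 0"
    proof (rule AE_I2)
      fix x
      obtain m where m: "\<bar>f x\<bar> \<le> real m" using real_arch_simple by blast
      have "\<forall>\<^sub>F N in sequentially. r N x = 0"
        using eventually_ge_at_top[of m]
      proof eventually_elim
        case (elim N)
        then have "\<bar>f x\<bar> \<le> real N" using m by linarith
        then show ?case by (simp add: r_def clip_eq)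
      qed
      then show "(\<lambda>N. r N x) \<longlonglongrightarrow> 0" by (rule tendsto_eventually)
    qed
  qed (use rm f_moment(1)[OF fA] le in \<open>auto simp: r_def\<close>)
  \<comment> \<open>The summand \<open>1 / real (Suc N)\<close> keeps the bound strictly positive,
    as \<open>moment_le\<close> demands, even where the remainder vanishes.\<close>
  then have l: "(\<lambda>N. (\<integral>x. r N x \<partial>marginal M X) + 1 / real (Suc N)) \<longlonglongrightarrow> 0"
    using tendsto_add[OF _ LIMSEQ_inverse_real_of_nat] by (fastforce simp: inverse_eq_divide)
  have pos: "0 < (\<integral>x. r N x \<partial>marginal M X) + 1 / real (Suc N)" for N
  proof -
    have "0 \<le> (\<integral>x. r N x \<partial>marginal M X)" by (rule integral_nonneg_AE) (simp add: r_def)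
    then show ?thesis by (simp add: add_nonneg_pos)
  qed
  have "moment_le (\<lambda>x. f x - clip (real N) (f x)) ((\<integral>x. r N x \<partial>marginal M X) + 1 / real (Suc N))" for N
    unfolding moment_le_def using i[of N] pos[of N] unfolding r_def by auto
  then show ?thesis using l pos by blast
qed

end

lemma psum_add:
  assumes "moment_le f A" "moment_le g B"
  shows "psum (\<lambda>x. f x + g x) J \<omega> = psum f J \<omega> + psum g J \<omega>"
  unfolding psum_def cen_def using f_integrable(2)[OF assms(1)] f_integrable(2)[OF assms(2)]
  by (simp add: sum.distrib[symmetric] algebra_simps)

lemma asym_var_le:
  assumes "moment_le f A"
  shows "asym_var f \<le> A powr (2 / (2 + \<delta>)) * var_const"
proof (rule LIMSEQ_le_const2[OF psum_variance_tendsto[OF assms]])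
  show "\<exists>N. \<forall>n\<ge>N. (\<integral>\<omega>. (psum f {1..n} \<omega>)^2 \<partial>M) / real n \<le> A powr (2 / (2 + \<delta>)) * var_const"
    using psum_variance_le[OF assms, of "{1.._}"] by (intro exI[of _ 1]) (auto simp: divide_le_eq mult.commute)
qed

text \<open>The square is split as \<open>(x + y)^2 \<le> (1 + e) * x^2 + (1 + 1 / e) * y^2\<close>,
  with the size \<open>e\<close> of the perturbation itself as weight, so that its contribution
  becomes \<open>e + e^2\<close>. The estimate is one-sided; exchanging the two functions yields the
  other side.\<close>

lemma asym_var_perturb:
  assumes fA: "moment_le f A" and gB: "moment_le g B"
  defines "e \<equiv> sqrt (B powr (2 / (2 + \<delta>)) * var_const)"
  assumes hA: "moment_le (\<lambda>x. f x + g x) A'"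
  shows "asym_var (\<lambda>x. f x + g x) \<le> (1 + e) * asym_var f + (e + e^2)"
proof -
  have B: "0 < B" using gB by (simp add: moment_le_def)
  have e: "0 < e" and e2: "e^2 = B powr (2 / (2 + \<delta>)) * var_const"
    unfolding e_def using B var_const_pos by (auto simp: zero_le_mult_iff)
  show ?thesis
  proof (rule LIMSEQ_le[OF psum_variance_tendsto[OF hA]
        tendsto_add[OF tendsto_mult[OF tendsto_const psum_variance_tendsto[OF fA]] tendsto_const]])
    show "\<exists>N. \<forall>n\<ge>N. (\<integral>\<omega>. (psum (\<lambda>x. f x + g x) {1..n} \<omega>)^2 \<partial>M) / real n
        \<le> (1 + e) * ((\<integral>\<omega>. (psum f {1..n} \<omega>)^2 \<partial>M) / real n) + (e + e^2)"
    proof (intro exI[of _ 1] allI impI)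
      fix n :: nat assume n: "1 \<le> n"
      have i: "integrable M (\<lambda>\<omega>. (psum f {1..n} \<omega>)^2)" "integrable M (\<lambda>\<omega>. (psum g {1..n} \<omega>)^2)"
        "integrable M (\<lambda>\<omega>. (psum (\<lambda>x. f x + g x) {1..n} \<omega>)^2)"
        by (rule psum_square(1)[OF fA] psum_square(1)[OF gB] psum_square(1)[OF hA]; auto)+
      have "(x + y)^2 \<le> (1 + e) * x^2 + (1 + 1 / e) * y^2" for x y :: real
      proof -
        have "0 \<le> (e * x - y)^2 / e" using e by simp
        also have "(e * x - y)^2 / e = e * x^2 - 2 * x * y + y^2 / e"
          using e by (simp add: power2_eq_square field_simps)
        finally show ?thesis by (simp add: power2_eq_square algebra_simps)
      qed
      then have "(\<integral>\<omega>. (psum (\<lambda>x. f x + g x) {1..n} \<omega>)^2 \<partial>M)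
          \<le> (\<integral>\<omega>. (1 + e) * (psum f {1..n} \<omega>)^2 + (1 + 1 / e) * (psum g {1..n} \<omega>)^2 \<partial>M)"
        using i by (intro integral_mono) (auto simp: psum_add[OF fA gB])
      also have "\<dots> = (1 + e) * (\<integral>\<omega>. (psum f {1..n} \<omega>)^2 \<partial>M) + (1 + 1 / e) * (\<integral>\<omega>. (psum g {1..n} \<omega>)^2 \<partial>M)"
        using i by simp
      also have "\<dots> \<le> (1 + e) * (\<integral>\<omega>. (psum f {1..n} \<omega>)^2 \<partial>M) + (1 + 1 / e) * (real n * e^2)"
        using psum_variance_le[OF gB, of "{1..n}"] e unfolding e2 by (intro add_left_mono mult_left_mono) auto
      also have "(1 + 1 / e) * (real n * e^2) = real n * (e + e^2)"
        using e by (simp add: power2_eq_square field_simps)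
      finally show "(\<integral>\<omega>. (psum (\<lambda>x. f x + g x) {1..n} \<omega>)^2 \<partial>M) / real n
        \<le> (1 + e) * ((\<integral>\<omega>. (psum f {1..n} \<omega>)^2 \<partial>M) / real n) + (e + e^2)"
        using n by (simp add: field_simps)
    qed
  qed
qed

lemma moment_le_minus: "moment_le f A \<Longrightarrow> moment_le (\<lambda>x. - f x) A"
  unfolding moment_le_def by auto

text \<open>The function is clipped at a level \<open>N\<close> chosen before \<open>n\<close>. The
  remainder moves the characteristic function by at most \<open>\<bar>t\<bar> * e N\<close>
  uniformly in \<open>n\<close>, and by perturbation the limiting variances of the clipped and the
  full function are close.\<close>

theorem chf_psum_tendsto:
  assumes fA: "moment_le f A"
  shows "(\<lambda>n. chf (psum f {1..n}) (t / sqrt (real n))) \<longlonglongrightarrow> complex_of_real (exp (- (t^2 * asym_var f / 2)))"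
proof (rule LIMSEQ_I)
  fix \<epsilon> :: real assume \<epsilon>: "0 < \<epsilon>"
  obtain b where b0: "b \<longlonglongrightarrow> (0::real)" and b: "\<And>N. 0 < b N"
    "\<And>N :: nat. moment_le (\<lambda>x. f x - clip (real N) (f x)) (b N)"
    using moment_le_clip_rest[OF fA] by blast
  define e where "e = (\<lambda>N. sqrt (b N powr (2 / (2 + \<delta>)) * var_const))"
  define B where "B = A powr (2 / (2 + \<delta>)) * var_const"
  have e_lim: "e \<longlonglongrightarrow> 0"
  proof -
    have "(\<lambda>N. b N powr (2 / (2 + \<delta>))) \<longlonglongrightarrow> 0 powr (2 / (2 + \<delta>))"
      by (rule tendsto_powr2[OF b0 tendsto_const]) (use b(1) \<delta> in \<open>auto intro!: always_eventually less_imp_le\<close>)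
    then have "(\<lambda>N. sqrt (b N powr (2 / (2 + \<delta>)) * var_const)) \<longlonglongrightarrow> sqrt (0 powr (2 / (2 + \<delta>)) * var_const)"
      by (intro tendsto_real_sqrt tendsto_mult_right)
    then show ?thesis unfolding e_def by simp
  qed
  have "(\<lambda>N. \<bar>t\<bar> * e N + t^2 / 2 * (e N * B + (e N + (e N)^2))) \<longlonglongrightarrow> \<bar>t\<bar> * 0 + t^2 / 2 * (0 * B + (0 + 0^2))"
    by (intro tendsto_intros e_lim)
  then have "(\<lambda>N. \<bar>t\<bar> * e N + t^2 / 2 * (e N * B + (e N + (e N)^2))) \<longlonglongrightarrow> 0" by simp
  then have "\<forall>\<^sub>F N in sequentially. \<bar>t\<bar> * e N + t^2 / 2 * (e N * B + (e N + (e N)^2)) < \<epsilon> / 2"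
    by (rule order_tendstoD(2)) (use \<epsilon> in simp)
  then obtain N where N: "\<bar>t\<bar> * e N + t^2 / 2 * (e N * B + (e N + (e N)^2)) < \<epsilon> / 2"
    unfolding eventually_sequentially by blast
  define g where "g = (\<lambda>x. clip (real N) (f x))"
  define r where "r = (\<lambda>x. f x - clip (real N) (f x))"
  have gA: "moment_le g A" unfolding g_def by (rule moment_le_clip[OF fA]) simp
  have rb: "moment_le r (b N)" unfolding r_def by (rule b)
  have fgr: "(\<lambda>x. g x + r x) = f" and gfr: "(\<lambda>x. f x + - r x) = g" by (auto simp: g_def r_def)
  have e0: "0 < e N" unfolding e_def using b(1)[of N] var_const_pos by simp
  have v1: "asym_var f \<le> (1 + e N) * asym_var g + (e N + (e N)^2)"
    using asym_var_perturb[OF gA rb] fA unfolding fgr e_def by blast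
  have v2: "asym_var g \<le> (1 + e N) * asym_var f + (e N + (e N)^2)"
    using asym_var_perturb[OF fA moment_le_minus[OF rb]] gA unfolding gfr e_def by blast
  have vB: "e N * asym_var f \<le> e N * B" "e N * asym_var g \<le> e N * B"
    using asym_var_le[OF fA] asym_var_le[OF gA] e0 unfolding B_def by auto
  have v: "\<bar>asym_var g - asym_var f\<bar> \<le> e N * B + (e N + (e N)^2)"
    using v1 v2 vB unfolding abs_le_iff distrib_right by linarith
  let ?E = "\<lambda>f. exp (- (t^2 * asym_var f / 2))"
  have "cmod (complex_of_real (?E g) - complex_of_real (?E f)) = \<bar>?E g - ?E f\<bar>" by (rule cmod_of_real_diff)
  also have "\<dots> \<le> \<bar>t^2 * asym_var g / 2 - t^2 * asym_var f / 2\<bar>"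
    using asym_var_nonneg[OF fA] asym_var_nonneg[OF gA] by (intro abs_exp_diff_le) auto
  also have "\<dots> = t^2 / 2 * \<bar>asym_var g - asym_var f\<bar>"
    by (simp add: right_diff_distrib[symmetric] diff_divide_distrib[symmetric] abs_mult)
  also have "\<dots> \<le> t^2 / 2 * (e N * B + (e N + (e N)^2))" using v by (intro mult_left_mono) auto
  finally have c3: "cmod (complex_of_real (?E g) - complex_of_real (?E f)) \<le> t^2 / 2 * (e N * B + (e N + (e N)^2))" .
  have c1: "cmod (chf (psum f {1..n}) (t / sqrt (real n)) - chf (psum g {1..n}) (t / sqrt (real n))) \<le> \<bar>t\<bar> * e N"
    if n: "1 \<le> n" for n
  proof -
    have sp: "psum f {1..n} \<omega> - psum g {1..n} \<omega> = psum r {1..n} \<omega>" for \<omega>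
      using psum_add[OF gA rb, of "{1..n}" \<omega>] unfolding fgr by simp
    have s1: "{1..n} \<subseteq> {1..}" by auto
    have "cmod (chf (psum f {1..n}) (t / sqrt (real n)) - chf (psum g {1..n}) (t / sqrt (real n)))
       \<le> \<bar>t / sqrt (real n)\<bar> * (\<integral>\<omega>. \<bar>psum f {1..n} \<omega> - psum g {1..n} \<omega>\<bar> \<partial>M)"
      by (rule chf_diff_le[OF psum_measurable[OF fA s1] psum_measurable[OF gA s1]])
        (simp only: sp psum_integrable[OF rb s1])
    also have "\<dots> \<le> \<bar>t / sqrt (real n)\<bar> * sqrt (real n * (b N powr (2 / (2 + \<delta>)) * var_const))"
      unfolding sp using expectation_abs_psum_le[OF rb, of "{1..n}"] by (intro mult_left_mono) auto
    also have "\<dots> = \<bar>t\<bar> * e N" unfolding e_def real_sqrt_mult using n by simp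
    finally show ?thesis .
  qed
  have "\<bar>g x\<bar> \<le> real N" for x unfolding g_def by (rule abs_clip_le) simp
  from LIMSEQ_D[OF chf_psum_tendsto_bounded[OF gA this, of t], of "\<epsilon> / 2"] \<epsilon>
  obtain n0 where n0: "\<And>n. n \<ge> n0 \<Longrightarrow> cmod (chf (psum g {1..n}) (t / sqrt (real n)) - complex_of_real (?E g)) < \<epsilon> / 2" by auto
  have tri: "cmod (u - y) \<le> cmod (u - w) + cmod (w - x) + cmod (x - y)" for u w x y
    using norm_triangle_ineq[of "u - w" "w - x"] norm_triangle_ineq[of "u - x" "x - y"] by simp
  show "\<exists>n0. \<forall>n\<ge>n0. cmod (chf (psum f {1..n}) (t / sqrt (real n)) - complex_of_real (?E f)) < \<epsilon>"
  proof (intro exI[of _ "max n0 1"] allI impI)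
    fix n assume n: "max n0 1 \<le> n"
    then have "1 \<le> n" "n0 \<le> n" by auto
    from tri[of "chf (psum f {1..n}) (t / sqrt (real n))" "complex_of_real (?E f)" "chf (psum g {1..n}) (t / sqrt (real n))" "complex_of_real (?E g)"]
      c1[OF this(1)] n0[OF this(2)] c3 N
    show "cmod (chf (psum f {1..n}) (t / sqrt (real n)) - complex_of_real (?E f)) < \<epsilon>" by linarith
  qed
qed

end

section \<open>Absolute regularity bounds the total variation distance from independence\<close>

text \<open>The second sides partition \<open>space T\<close>, up to empty pieces, and the first
  sides are arbitrary. For families of this shape \<open>beta_coeff_rectangles\<close> gives a bound
  that does not depend on the number of rectangles.\<close>

definition elementary :: "'b measure \<Rightarrow> 'c measure \<Rightarrow> ('b set \<times> 'c set) set \<Rightarrow> bool" where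
  "elementary S T P \<longleftrightarrow> finite P \<and> P \<subseteq> sets S \<times> sets T \<and> disjoint_family_on snd P \<and> (\<Union>(snd ` P)) = space T"

definition rect_union :: "('b set \<times> 'c set) set \<Rightarrow> ('b \<times> 'c) set" where
  "rect_union P = (\<Union>(A, B)\<in>P. A \<times> B)"

lemma rect_union_sets: "elementary S T P \<Longrightarrow> rect_union P \<in> sets (S \<Otimes>\<^sub>M T)"
  unfolding rect_union_def elementary_def by (intro sets.finite_UN) auto

lemma elementary_rect:
  assumes "A \<in> sets S" "B \<in> sets T"
  shows "\<exists>P. elementary S T P \<and> rect_union P = A \<times> B"
  by (rule exI[of _ "{(A, B), ({}, space T - B)}"])
    (use assms sets.sets_into_space[OF assms(2)] in \<open>auto simp: elementary_def rect_union_def disjoint_family_on_def\<close>)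

text \<open>Because the second sides partition the space, it suffices to complement the first side
  over each of them.\<close>

lemma elementary_compl:
  assumes P: "elementary S T P"
  shows "\<exists>Q. elementary S T Q \<and> rect_union Q = space (S \<Otimes>\<^sub>M T) - rect_union P"
proof (intro exI conjI)
  let ?Q = "(\<lambda>(A, B). (space S - A, B)) ` P"
  have dj: "p = q" if "p \<in> P" "q \<in> P" "x \<in> snd p" "x \<in> snd q" for p q x
    using P that unfolding elementary_def disjoint_family_on_def by (metis IntI empty_iff)
  show "elementary S T ?Q"
    unfolding elementary_def
  proof (intro conjI)
    show "finite ?Q" "?Q \<subseteq> sets S \<times> sets T" using P unfolding elementary_def by auto
    show "disjoint_family_on snd ?Q"
      unfolding disjoint_family_on_def
    proof (intro ballI impI)
      fix p q assume pq: "p \<in> ?Q" "q \<in> ?Q" "p \<noteq> q"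
      obtain p' where p': "p' \<in> P" "p = (space S - fst p', snd p')" using pq(1) by (auto simp: split_beta)
      obtain q' where q': "q' \<in> P" "q = (space S - fst q', snd q')" using pq(2) by (auto simp: split_beta)
      show "snd p \<inter> snd q = {}" using dj[OF p'(1) q'(1)] p' q' pq(3) by auto
    qed
    have "snd ` ?Q = snd ` P" by (auto simp: image_image split_beta)
    then show "\<Union>(snd ` ?Q) = space T" using P unfolding elementary_def by simp
  qed
  have sub: "fst p \<subseteq> space S" "snd p \<subseteq> space T" if "p \<in> P" for p
  proof -
    have "fst p \<in> sets S" "snd p \<in> sets T" using P that unfolding elementary_def by (auto simp: mem_Times_iff)
    then show "fst p \<subseteq> space S" "snd p \<subseteq> space T" using sets.sets_into_space by blast+
  qed
  show "rect_union ?Q = space (S \<Otimes>\<^sub>M T) - rect_union P"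
  proof (intro set_eqI iffI)
    fix z assume "z \<in> rect_union ?Q"
    then obtain p where p: "p \<in> P" "fst z \<in> space S - fst p" "snd z \<in> snd p"
      unfolding rect_union_def by (auto simp: split_beta)
    have "z \<notin> rect_union P"
    proof
      assume "z \<in> rect_union P"
      then obtain q where q: "q \<in> P" "fst z \<in> fst q" "snd z \<in> snd q"
        unfolding rect_union_def by (auto simp: split_beta)
      then show False using dj[OF p(1) q(1) p(3) q(3)] p by auto
    qed
    moreover have "snd z \<in> space T" using sub(2)[OF p(1)] p(3) by (rule subsetD)
    ultimately show "z \<in> space (S \<Otimes>\<^sub>M T) - rect_union P"
      using p(2) by (simp add: space_pair_measure mem_Times_iff)
  next
    fix z assume z: "z \<in> space (S \<Otimes>\<^sub>M T) - rect_union P"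
    then have "snd z \<in> \<Union>(snd ` P)" using P unfolding elementary_def by (auto simp: space_pair_measure mem_Times_iff)
    then obtain p where p: "p \<in> P" "snd z \<in> snd p" by auto
    have zT: "snd z \<in> space T" using sub(2)[OF p(1)] p(2) by (rule subsetD)
    have "fst z \<notin> fst p" using z p unfolding rect_union_def by (auto simp: split_beta mem_Times_iff)
    then have "z \<in> (space S - fst p) \<times> snd p" using z p zT by (auto simp: space_pair_measure mem_Times_iff)
    then show "z \<in> rect_union ?Q" using p unfolding rect_union_def by (auto simp: split_beta)
  qed
qed

text \<open>The second sides are refined by intersection, and over each piece the first sides are
  united.\<close>

lemma elementary_Un:
  assumes P: "elementary S T P" and Q: "elementary S T Q"
  shows "\<exists>R. elementary S T R \<and> rect_union R = rect_union P \<union> rect_union Q"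
proof (intro exI conjI)
  let ?R = "(\<lambda>(p, q). (fst p \<union> fst q, snd p \<inter> snd q)) ` (P \<times> Q)"
  have dP: "p = q" if "p \<in> P" "q \<in> P" "x \<in> snd p" "x \<in> snd q" for p q x
    using P that unfolding elementary_def disjoint_family_on_def by (metis IntI empty_iff)
  have dQ: "p = q" if "p \<in> Q" "q \<in> Q" "x \<in> snd p" "x \<in> snd q" for p q x
    using Q that unfolding elementary_def disjoint_family_on_def by (metis IntI empty_iff)
  have cP: "\<exists>p\<in>P. x \<in> snd p" if "x \<in> space T" for x using P that unfolding elementary_def by blast
  have cQ: "\<exists>p\<in>Q. x \<in> snd p" if "x \<in> space T" for x using Q that unfolding elementary_def by blast
  have sP: "fst p \<in> sets S" "snd p \<in> sets T" if "p \<in> P" for p using P that unfolding elementary_def by (auto simp: mem_Times_iff)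
  have sQ: "fst p \<in> sets S" "snd p \<in> sets T" if "p \<in> Q" for p using Q that unfolding elementary_def by (auto simp: mem_Times_iff)
  show "elementary S T ?R"
    unfolding elementary_def
  proof (intro conjI)
    show "finite ?R" using P Q unfolding elementary_def by auto
    show "?R \<subseteq> sets S \<times> sets T"
    proof
      fix r assume "r \<in> ?R"
      then obtain p q where "p \<in> P" "q \<in> Q" "r = (fst p \<union> fst q, snd p \<inter> snd q)" by auto
      then show "r \<in> sets S \<times> sets T" using sP[of p] sQ[of q] by auto
    qed
    show "disjoint_family_on snd ?R"
      unfolding disjoint_family_on_def
    proof (intro ballI impI)
      fix r r' assume r: "r \<in> ?R" "r' \<in> ?R" "r \<noteq> r'"
      obtain p q where pq: "p \<in> P" "q \<in> Q" "r = (fst p \<union> fst q, snd p \<inter> snd q)" using r(1) by auto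
      obtain p' q' where pq': "p' \<in> P" "q' \<in> Q" "r' = (fst p' \<union> fst q', snd p' \<inter> snd q')" using r(2) by auto
      show "snd r \<inter> snd r' = {}"
        using dP[OF pq(1) pq'(1)] dQ[OF pq(2) pq'(2)] pq(3) pq'(3) r(3) by auto
    qed
    show "\<Union>(snd ` ?R) = space T"
    proof (intro set_eqI iffI)
      fix x assume "x \<in> \<Union>(snd ` ?R)"
      then show "x \<in> space T" using sP sets.sets_into_space by fastforce
    next
      fix x assume x: "x \<in> space T"
      obtain p q where "p \<in> P" "x \<in> snd p" "q \<in> Q" "x \<in> snd q" using cP[OF x] cQ[OF x] by blast
      then show "x \<in> \<Union>(snd ` ?R)" by (intro UnionI[of "snd p \<inter> snd q"]) (auto simp: image_image intro!: image_eqI[of _ _ "(p, q)"])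
    qed
  qed
  show "rect_union ?R = rect_union P \<union> rect_union Q"
  proof (intro set_eqI iffI)
    fix z assume "z \<in> rect_union ?R"
    then obtain p q where "p \<in> P" "q \<in> Q" "fst z \<in> fst p \<union> fst q" "snd z \<in> snd p" "snd z \<in> snd q"
      unfolding rect_union_def by (auto simp: split_beta)
    then show "z \<in> rect_union P \<union> rect_union Q"
      unfolding rect_union_def by (auto simp: split_beta mem_Times_iff)
  next
    fix z assume "z \<in> rect_union P \<union> rect_union Q"
    then have "\<exists>p q. p \<in> P \<and> q \<in> Q \<and> fst z \<in> fst p \<union> fst q \<and> snd z \<in> snd p \<and> snd z \<in> snd q"
    proof
      assume "z \<in> rect_union P"
      then obtain p where p: "p \<in> P" "fst z \<in> fst p" "snd z \<in> snd p"
        unfolding rect_union_def by (auto simp: split_beta)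
      have "snd z \<in> space T" using sets.sets_into_space[OF sP(2)[OF p(1)]] p(3) by auto
      then show ?thesis using cQ p by blast
    next
      assume "z \<in> rect_union Q"
      then obtain p where p: "p \<in> Q" "fst z \<in> fst p" "snd z \<in> snd p"
        unfolding rect_union_def by (auto simp: split_beta)
      have "snd z \<in> space T" using sets.sets_into_space[OF sQ(2)[OF p(1)]] p(3) by auto
      then show ?thesis using cP p by blast
    qed
    then obtain p q where pq: "p \<in> P" "q \<in> Q" "fst z \<in> fst p \<union> fst q" "snd z \<in> snd p \<inter> snd q" by auto
    then have "(fst p \<union> fst q, snd p \<inter> snd q) \<in> ?R" by (auto intro!: image_eqI[of _ _ "(p, q)"])
    then show "z \<in> rect_union ?R" using pq(3,4) unfolding rect_union_def by (auto simp: mem_Times_iff)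
  qed
qed

lemma elementary_finite_UN:
  assumes "\<And>i. i < n \<Longrightarrow> \<exists>P. elementary S T P \<and> rect_union P = E i"
  shows "\<exists>P. elementary S T P \<and> rect_union P = (\<Union>i<(n::nat). E i)"
  using assms
proof (induction n)
  case 0
  show ?case using elementary_rect[of "{}" S "{}" T] by auto
next
  case (Suc n)
  obtain P where P: "elementary S T P" "rect_union P = (\<Union>i<n. E i)" using Suc by auto
  obtain Q where Q: "elementary S T Q" "rect_union Q = E n" using Suc.prems[of n] by auto
  show ?case using elementary_Un[OF P(1) Q(1)] P(2) Q(2) by (auto simp: lessThan_Suc Un_commute)
qed

text \<open>The approximable sets contain the rectangles and are closed under complements and
  countable unions; a countable union is reduced to a finite one by continuity from below.\<close>

lemma elementary_approx:
  assumes L: "finite_measure L" and sL: "sets L = sets (S \<Otimes>\<^sub>M T)" and D: "D \<in> sets (S \<Otimes>\<^sub>M T)" and e: "0 < e"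
  shows "\<exists>P. elementary S T P \<and> measure L ((D - rect_union P) \<union> (rect_union P - D)) < e"
proof -
  interpret L: finite_measure L by (rule L)
  have sp: "space L = space (S \<Otimes>\<^sub>M T)" by (rule sets_eq_imp_space_eq[OF sL])
  have rs: "rect_union P \<in> sets L" if "elementary S T P" for P using rect_union_sets[OF that] sL by simp
  let ?d = "\<lambda>D E. (D - E) \<union> (E - D)"
  have "D \<in> sigma_sets (space S \<times> space T) {A \<times> B |A B. A \<in> sets S \<and> B \<in> sets T}"
    using D by (simp add: sets_pair_measure)
  then show ?thesis using e
  proof (induction arbitrary: e rule: sigma_sets.induct)
    case (Basic a)
    then obtain A B where AB: "A \<in> sets S" "B \<in> sets T" "a = A \<times> B" by auto
    obtain P where "elementary S T P" "rect_union P = a" using elementary_rect[OF AB(1,2)] AB(3) by auto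
    then show ?case using Basic.prems by (intro exI[of _ P]) simp
  next
    case Empty
    obtain P where "elementary S T P" "rect_union P = {}" using elementary_rect[of "{}" S "{}" T] by auto
    then show ?case using Empty.prems by (intro exI[of _ P]) simp
  next
    case (Compl a)
    have aL: "a \<in> sets L" using Compl.hyps unfolding sL by (simp add: sets_pair_measure)
    obtain P where P: "elementary S T P" "measure L (?d a (rect_union P)) < e" using Compl.IH[OF Compl.prems] by blast
    obtain Q where Q: "elementary S T Q" "rect_union Q = space (S \<Otimes>\<^sub>M T) - rect_union P" using elementary_compl[OF P(1)] by blast
    have "?d (space S \<times> space T - a) (rect_union Q) = ?d a (rect_union P)"
      using sets.sets_into_space[OF aL] sets.sets_into_space[OF rs[OF P(1)]] unfolding Q(2) sp space_pair_measure by auto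
    then show ?case using P(2) Q(1) by (intro exI[of _ Q]) simp
  next
    case (Union a)
    have aL: "a i \<in> sets L" for i using Union.hyps[of i] unfolding sL by (simp add: sets_pair_measure)
    have "(\<lambda>n. measure L (\<Union>i<n. a i)) \<longlonglongrightarrow> measure L (\<Union>n. \<Union>i<n. a i)"
    proof (rule L.finite_Lim_measure_incseq)
      show "incseq (\<lambda>n. \<Union>i<n. a i)" by (intro monoI UN_mono) auto
    qed (use aL in auto)
    moreover have "(\<Union>n. \<Union>i<n. a i) = (\<Union>i. a i)" by auto
    ultimately have "(\<lambda>n. measure L (\<Union>i<n. a i)) \<longlonglongrightarrow> measure L (\<Union>i. a i)" by simp
    then have "\<forall>\<^sub>F n in sequentially. measure L (\<Union>i. a i) - e / 2 < measure L (\<Union>i<n. a i)"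
      by (rule order_tendstoD(1)) (use Union.prems in simp)
    then obtain n where n: "measure L (\<Union>i. a i) - e / 2 < measure L (\<Union>i<n. a i)"
      unfolding eventually_sequentially by blast
    \<comment> \<open>One half of \<open>e\<close> is spent on cutting the union, the other half is
      shared by the \<open>n\<close> remaining sets; \<open>Suc n\<close> covers
      \<open>n = 0\<close>.\<close>
    have "\<exists>P. elementary S T P \<and> measure L (?d (a i) (rect_union P)) < e / (2 * real (Suc n))" for i
      by (rule Union.IH) (use Union.prems in simp)
    then obtain P where P: "\<And>i. elementary S T (P i)" "\<And>i. measure L (?d (a i) (rect_union (P i))) < e / (2 * real (Suc n))"
      by metis
    obtain R where R: "elementary S T R" "rect_union R = (\<Union>i<n. rect_union (P i))"
      using elementary_finite_UN[of n S T "\<lambda>i. rect_union (P i)"] P(1) by blast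
    have dm: "?d (a i) (rect_union (P i)) \<in> sets L" for i using aL rs[OF P(1)] by auto
    have "?d (\<Union>i. a i) (rect_union R) \<subseteq> ((\<Union>i. a i) - (\<Union>i<n. a i)) \<union> (\<Union>i<n. ?d (a i) (rect_union (P i)))"
      unfolding R(2) by auto
    then have "measure L (?d (\<Union>i. a i) (rect_union R))
        \<le> measure L (((\<Union>i. a i) - (\<Union>i<n. a i)) \<union> (\<Union>i<n. ?d (a i) (rect_union (P i))))"
      by (rule L.finite_measure_mono) (use aL dm in auto)
    also have "\<dots> \<le> measure L ((\<Union>i. a i) - (\<Union>i<n. a i)) + measure L (\<Union>i<n. ?d (a i) (rect_union (P i)))"
      by (rule measure_Un_le) (use aL dm in auto)
    also have "measure L ((\<Union>i. a i) - (\<Union>i<n. a i)) = measure L (\<Union>i. a i) - measure L (\<Union>i<n. a i)"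
      by (rule L.finite_measure_Diff) (use aL in auto)
    also have "measure L (\<Union>i<n. ?d (a i) (rect_union (P i))) \<le> (\<Sum>i<n. measure L (?d (a i) (rect_union (P i))))"
      by (rule measure_UNION_le) (use dm in auto)
    also have "\<dots> \<le> (\<Sum>i<n. e / (2 * real (Suc n)))" by (rule sum_mono) (use P(2) in \<open>auto intro: less_imp_le\<close>)
    also have "\<dots> \<le> e / 2" using Union.prems by (simp add: field_simps)
    finally have "measure L (?d (\<Union>i. a i) (rect_union R)) < e" using n by linarith
    then show ?case using R(1) by blast
  qed
qed

text \<open>A discrete layer-cake formula: \<open>g\<close> rounds \<open>f\<close> down to
  multiples of \<open>1 / n\<close> and is an average of indicators of level sets, so the bound for
  sets passes to \<open>g\<close> without loss. Rounding costs at most \<open>1 / n\<close> under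
  each law.\<close>

lemma integral_diff_le_of_sets:
  fixes f :: "'b \<Rightarrow> real"
  assumes N: "prob_space N" and Q: "prob_space Q" and s: "sets N = sets Q"
    and le: "\<And>D. D \<in> sets N \<Longrightarrow> \<bar>measure N D - measure Q D\<bar> \<le> b"
    and f[measurable]: "f \<in> borel_measurable N" and f01: "\<And>x. 0 \<le> f x" "\<And>x. f x \<le> 1"
  shows "\<bar>(\<integral>x. f x \<partial>N) - (\<integral>x. f x \<partial>Q)\<bar> \<le> b"
proof (rule field_le_epsilon)
  fix e :: real assume e: "0 < e"
  obtain n where n: "2 / e < real n" using reals_Archimedean2 by blast
  have n0: "0 < real n" using n e by (metis divide_pos_pos less_trans zero_less_numeral)
  interpret N: prob_space N by (rule N)
  interpret Q: prob_space Q by (rule Q)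
  note s[measurable_cong]
  have fQ[measurable]: "f \<in> borel_measurable Q" using f measurable_cong_sets[OF s refl] by auto
  define D where "D = (\<lambda>r. {x\<in>space N. real r \<le> real n * f x})"
  have DN: "D r \<in> sets N" for r unfolding D_def by measurable
  have DQ: "D r \<in> sets Q" for r using DN s by simp
  define g where "g = (\<lambda>x. (\<Sum>r\<in>{1..n}. indicator (D r) x) / real n :: real)"
  have fg: "f x - 1 / real n \<le> g x" "g x \<le> f x" if x: "x \<in> space N" for x
  proof -
    have nf: "0 \<le> real n * f x" "real n * f x \<le> real n" using f01[of x] n0 by (auto simp: mult_left_le)
    have "(\<Sum>r\<in>{1..n}. indicator (D r) x :: real) = real (card {r\<in>{1..n}. real r \<le> real n * f x})"
      using x by (simp add: D_def indicator_def of_bool_def sum.If_cases Int_def)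
    also have "{r\<in>{1..n}. real r \<le> real n * f x} = {1..nat \<lfloor>real n * f x\<rfloor>}"
    proof (intro set_eqI iffI)
      fix r assume "r \<in> {r\<in>{1..n}. real r \<le> real n * f x}"
      then show "r \<in> {1..nat \<lfloor>real n * f x\<rfloor>}" by (auto simp: le_nat_floor)
    next
      fix r assume "r \<in> {1..nat \<lfloor>real n * f x\<rfloor>}"
      then have "1 \<le> r" "real r \<le> real n * f x" using nf(1) by (auto simp: nat_le_iff) linarith
      moreover from this have "r \<le> n" using nf(2) by linarith
      ultimately show "r \<in> {r\<in>{1..n}. real r \<le> real n * f x}" by simp
    qed
    also have "real (card {1..nat \<lfloor>real n * f x\<rfloor>}) = of_int \<lfloor>real n * f x\<rfloor>" using nf(1) by simp
    finally have g: "g x = of_int \<lfloor>real n * f x\<rfloor> / real n" unfolding g_def by simp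
    define w where "w = real_of_int \<lfloor>real n * f x\<rfloor>"
    have w: "real n * f x - 1 \<le> w" "w \<le> real n * f x" unfolding w_def by linarith+
    show "f x - 1 / real n \<le> g x" "g x \<le> f x"
    proof -
      have "f x - 1 / real n = (real n * f x - 1) / real n" using n0 by (simp add: field_simps)
      then show "f x - 1 / real n \<le> g x"
        unfolding g w_def[symmetric] using w(1) n0 by (simp add: divide_right_mono)
      show "g x \<le> f x" unfolding g w_def[symmetric] using w(2) n0 by (simp add: pos_divide_le_eq mult.commute)
    qed
  qed
  have sp: "space Q = space N" using sets_eq_imp_space_eq[OF s] by simp
  have gN[measurable]: "g \<in> borel_measurable N" unfolding g_def using DN by measurable
  have gQ[measurable]: "g \<in> borel_measurable Q" unfolding g_def using DQ by measurable
  have iN: "integrable N f" "integrable N g" "integrable Q f" "integrable Q g"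
  proof -
    have gb: "\<bar>g x\<bar> \<le> 2" if "x \<in> space N" for x
    proof -
      have "1 / real n \<le> 1" using n0 by (simp add: divide_le_eq)
      then show ?thesis using fg[OF that] f01[of x] by (auto simp: abs_le_iff)
    qed
    show "integrable N f" "integrable Q f"
      by (rule N.integrable_bounded[of _ 1] Q.integrable_bounded[of _ 1]; use f01 in \<open>simp add: abs_le_iff order_trans[OF _ f01(1)]\<close>)+
    show "integrable N g" by (rule N.integrable_bounded[of _ 2]) (use gb in auto)
    show "integrable Q g" by (rule Q.integrable_bounded[of _ 2]) (use gb sp in auto)
  qed
  have gi: "(\<integral>x. g x \<partial>N) = (\<Sum>r\<in>{1..n}. measure N (D r)) / real n" "(\<integral>x. g x \<partial>Q) = (\<Sum>r\<in>{1..n}. measure Q (D r)) / real n"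
    unfolding g_def using DN DQ
    by (simp_all add: N.emeasure_eq_measure Q.emeasure_eq_measure)
  have "\<bar>(\<integral>x. g x \<partial>N) - (\<integral>x. g x \<partial>Q)\<bar> = \<bar>\<Sum>r\<in>{1..n}. measure N (D r) - measure Q (D r)\<bar> / real n"
    unfolding gi by (simp add: sum_subtractf diff_divide_distrib[symmetric])
  also have "\<dots> \<le> (\<Sum>r\<in>{1..n}. b) / real n"
    by (intro divide_right_mono order_trans[OF sum_abs] sum_mono le DN) auto
  also have "\<dots> = b" using n0 by simp
  finally have g: "\<bar>(\<integral>x. g x \<partial>N) - (\<integral>x. g x \<partial>Q)\<bar> \<le> b" .
  have a1: "(\<integral>x. f x \<partial>N) - 1 / real n \<le> (\<integral>x. g x \<partial>N)"
  proof -
    have "(\<integral>x. f x - 1 / real n \<partial>N) \<le> (\<integral>x. g x \<partial>N)" using iN fg by (intro integral_mono) auto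
    then show ?thesis using iN by (simp add: N.prob_space)
  qed
  have a2: "(\<integral>x. f x \<partial>Q) - 1 / real n \<le> (\<integral>x. g x \<partial>Q)"
  proof -
    have "(\<integral>x. f x - 1 / real n \<partial>Q) \<le> (\<integral>x. g x \<partial>Q)" using iN fg sp by (intro integral_mono) auto
    then show ?thesis using iN by (simp add: Q.prob_space)
  qed
  have a3: "(\<integral>x. g x \<partial>N) \<le> (\<integral>x. f x \<partial>N)" "(\<integral>x. g x \<partial>Q) \<le> (\<integral>x. f x \<partial>Q)"
    using iN fg sp by (auto intro!: integral_mono)
  have "2 / real n < e" using n n0 e by (simp add: field_simps)
  moreover have "1 / real n + 1 / real n = 2 / real n" by simp
  ultimately show "\<bar>(\<integral>x. f x \<partial>N) - (\<integral>x. f x \<partial>Q)\<bar> \<le> b + e"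
    using g a1 a2 a3 e unfolding abs_le_iff by linarith
qed

context prob_space
begin

text \<open>Elementary sets obey the bound by \<open>beta_coeff_rectangles\<close>, measurable sets
  by approximation, functions by averaging over level sets. Mapping \<open>[-K, K]\<close> affinely
  onto \<open>[0, 1]\<close> accounts for the factor \<open>2 * K\<close>.\<close>

lemma beta_coeff_integral:
  fixes \<Phi> :: "'b \<times> 'c \<Rightarrow> real"
  assumes F: "subalgebra M F" and G: "subalgebra M G"
    and U: "U \<in> F \<rightarrow>\<^sub>M S" and V: "V \<in> G \<rightarrow>\<^sub>M T"
    and \<Phi>[measurable]: "\<Phi> \<in> borel_measurable (S \<Otimes>\<^sub>M T)" and b: "\<And>z. \<bar>\<Phi> z\<bar> \<le> K" and K: "0 < K"
  shows "\<bar>(\<integral>\<omega>. \<Phi> (U \<omega>, V \<omega>) \<partial>M) - (\<integral>z. \<Phi> z \<partial>(distr M S U \<Otimes>\<^sub>M distr M T V))\<bar> \<le> 2 * K * beta_coeff M F G"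
proof -
  have UM[measurable]: "U \<in> M \<rightarrow>\<^sub>M S" by (rule measurable_from_subalg[OF F U])
  have VM[measurable]: "V \<in> M \<rightarrow>\<^sub>M T" by (rule measurable_from_subalg[OF G V])
  define N where "N = distr M (S \<Otimes>\<^sub>M T) (\<lambda>\<omega>. (U \<omega>, V \<omega>))"
  define Q where "Q = distr M S U \<Otimes>\<^sub>M distr M T V"
  interpret PU: prob_space "distr M S U" by (rule prob_space_distr) simp
  interpret PV: prob_space "distr M T V" by (rule prob_space_distr) simp
  interpret PQ: pair_prob_space "distr M S U" "distr M T V" by unfold_locales
  have Np: "prob_space N" unfolding N_def by (rule prob_space_distr) simp
  have Qp: "prob_space Q" unfolding Q_def by unfold_locales
  interpret N: prob_space N by (rule Np)
  interpret Q: prob_space Q by (rule Qp)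
  have sN: "sets N = sets (S \<Otimes>\<^sub>M T)" unfolding N_def by simp
  have sQ: "sets Q = sets (S \<Otimes>\<^sub>M T)" unfolding Q_def by (intro sets_pair_measure_cong) simp_all
  have spF: "space F = space M" and spG: "space G = space M" using F G by (auto simp: subalgebra_def)
  have rect: "measure N (A \<times> B) = prob ((U -` A \<inter> space M) \<inter> (V -` B \<inter> space M))"
    "measure Q (A \<times> B) = prob (U -` A \<inter> space M) * prob (V -` B \<inter> space M)"
    if "A \<in> sets S" "B \<in> sets T" for A B
  proof -
    show "measure N (A \<times> B) = prob ((U -` A \<inter> space M) \<inter> (V -` B \<inter> space M))"
      unfolding N_def using that by (subst measure_distr) (auto intro!: arg_cong[of _ _ prob])
    show "measure Q (A \<times> B) = prob (U -` A \<inter> space M) * prob (V -` B \<inter> space M)"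
      unfolding Q_def measure_def using that
      by (subst PV.emeasure_pair_measure_Times) (auto simp: emeasure_distr enn2real_mult)
  qed
  have elem: "\<bar>measure N (rect_union P) - measure Q (rect_union P)\<bar> \<le> beta_coeff M F G" if P: "elementary S T P" for P
  proof -
    have fP: "finite P" and sP: "\<And>p. p \<in> P \<Longrightarrow> fst p \<in> sets S" "\<And>p. p \<in> P \<Longrightarrow> snd p \<in> sets T" and dP: "disjoint_family_on snd P"
      using P unfolding elementary_def by (auto simp: mem_Times_iff)
    have ru: "rect_union P = (\<Union>p\<in>P. fst p \<times> snd p)" unfolding rect_union_def by (auto simp: split_beta)
    have d: "disjoint_family_on (\<lambda>p. fst p \<times> snd p) P"
      using dP unfolding disjoint_family_on_def by fastforce
    have "measure N (rect_union P) = (\<Sum>p\<in>P. measure N (fst p \<times> snd p))"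
      unfolding ru by (rule N.finite_measure_finite_Union[OF fP _ d]) (use sP in \<open>auto simp: sN\<close>)
    moreover have "measure Q (rect_union P) = (\<Sum>p\<in>P. measure Q (fst p \<times> snd p))"
      unfolding ru by (rule Q.finite_measure_finite_Union[OF fP _ d]) (use sP in \<open>auto simp: sQ\<close>)
    ultimately have "measure N (rect_union P) - measure Q (rect_union P)
      = (\<Sum>p\<in>P. prob ((U -` fst p \<inter> space M) \<inter> (V -` snd p \<inter> space M)) - prob (U -` fst p \<inter> space M) * prob (V -` snd p \<inter> space M))"
      using rect sP by (simp add: sum_subtractf)
    also have "\<bar>\<dots>\<bar> \<le> beta_coeff M F G"
    proof (rule beta_coeff_rectangles(2)[OF F G fP])
      show "U -` fst p \<inter> space M \<in> sets F" if "p \<in> P" for p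
        using measurable_sets[OF U sP(1)[OF that]] spF by simp
      show "V -` snd p \<inter> space M \<in> sets G" if "p \<in> P" for p
        using measurable_sets[OF V sP(2)[OF that]] spG by simp
      show "disjoint_family_on (\<lambda>p. V -` snd p \<inter> space M) P"
        using dP unfolding disjoint_family_on_def by blast
    qed
    finally show ?thesis .
  qed
  have sets: "\<bar>measure N D - measure Q D\<bar> \<le> beta_coeff M F G" if D: "D \<in> sets N" for D
  proof (rule field_le_epsilon)
    fix e :: real assume e: "0 < e"
    let ?d = "\<lambda>D E. (D - E) \<union> (E - D)"
    have Df: "D \<in> sets (S \<Otimes>\<^sub>M T)" using D sN by simp
    have close: "\<bar>measure R D - measure R E\<bar> \<le> measure R (?d D E)"
      if R: "prob_space R" "sets R = sets (S \<Otimes>\<^sub>M T)" and E: "E \<in> sets (S \<Otimes>\<^sub>M T)" for R E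
    proof -
      interpret R: prob_space R by (rule R(1))
      have "measure R D \<le> measure R (E \<union> ?d D E)" by (rule R.finite_measure_mono) (use R(2) E Df in auto)
      also have "\<dots> \<le> measure R E + measure R (?d D E)" by (rule measure_Un_le) (use R(2) E Df in auto)
      finally have 1: "measure R D \<le> measure R E + measure R (?d D E)" .
      have "measure R E \<le> measure R (D \<union> ?d D E)" by (rule R.finite_measure_mono) (use R(2) E Df in auto)
      also have "\<dots> \<le> measure R D + measure R (?d D E)" by (rule measure_Un_le) (use R(2) E Df in auto)
      finally show ?thesis using 1 by linarith
    qed
    \<comment> \<open>The sum of both laws: one elementary set then approximates \<open>D\<close>
      under \<open>N\<close> and under \<open>Q\<close> simultaneously.\<close>
    define W where "W = measure_of (space (S \<Otimes>\<^sub>M T)) (sets (S \<Otimes>\<^sub>M T)) (\<lambda>A. emeasure N A + emeasure Q A)"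
    have eW: "emeasure W A = emeasure N A + emeasure Q A" if A: "A \<in> sets (S \<Otimes>\<^sub>M T)" for A
      unfolding W_def
    proof (rule emeasure_measure_of_sigma[OF _ _ _ A])
      show "sigma_algebra (space (S \<Otimes>\<^sub>M T)) (sets (S \<Otimes>\<^sub>M T))" by (rule sets.sigma_algebra_axioms)
      show "positive (sets (S \<Otimes>\<^sub>M T)) (\<lambda>A. emeasure N A + emeasure Q A)" by (simp add: positive_def)
      show "countably_additive (sets (S \<Otimes>\<^sub>M T)) (\<lambda>A. emeasure N A + emeasure Q A)"
      proof (rule countably_additiveI)
        fix A :: "nat \<Rightarrow> _" assume A: "range A \<subseteq> sets (S \<Otimes>\<^sub>M T)" "disjoint_family A"
        show "(\<Sum>i. emeasure N (A i) + emeasure Q (A i)) = emeasure N (\<Union>i. A i) + emeasure Q (\<Union>i. A i)"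
          using suminf_emeasure[of A N] suminf_emeasure[of A Q] A sN sQ
          by (subst suminf_add[symmetric]) auto
      qed
    qed
    have sW: "sets W = sets (S \<Otimes>\<^sub>M T)" unfolding W_def by simp
    have spW: "space W = space (S \<Otimes>\<^sub>M T)" unfolding W_def by simp
    have W: "finite_measure W"
      by (rule finite_measureI) (simp add: spW eW N.emeasure_eq_measure Q.emeasure_eq_measure flip: ennreal_plus)
    interpret W: finite_measure W by (rule W)
    have mW: "measure W A = measure N A + measure Q A" if "A \<in> sets (S \<Otimes>\<^sub>M T)" for A
      using eW[OF that] by (simp add: measure_def enn2real_plus less_top[symmetric])
    obtain P where P: "elementary S T P" "measure W (?d D (rect_union P)) < e"
      using elementary_approx[OF W sW Df e] by blast
    have E: "rect_union P \<in> sets (S \<Otimes>\<^sub>M T)" by (rule rect_union_sets[OF P(1)])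
    have "measure N (?d D (rect_union P)) + measure Q (?d D (rect_union P)) < e"
      using P(2) mW[of "?d D (rect_union P)"] Df E by auto
    then show "\<bar>measure N D - measure Q D\<bar> \<le> beta_coeff M F G + e"
      using close[OF Np sN E] close[OF Qp sQ E] elem[OF P(1)] by linarith
  qed
  have \<Phi>N: "\<Phi> \<in> borel_measurable N" and \<Phi>Q: "\<Phi> \<in> borel_measurable Q"
    by (simp_all only: measurable_cong_sets[OF sN refl] measurable_cong_sets[OF sQ refl] \<Phi>)
  have iN: "integrable N \<Phi>" by (rule N.integrable_bounded[OF \<Phi>N b])
  have iQ: "integrable Q \<Phi>" by (rule Q.integrable_bounded[OF \<Phi>Q b])
  have "\<bar>(\<integral>z. (\<Phi> z + K) / (2 * K) \<partial>N) - (\<integral>z. (\<Phi> z + K) / (2 * K) \<partial>Q)\<bar> \<le> beta_coeff M F G"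
  proof (rule integral_diff_le_of_sets[OF Np Qp _ sets])
    fix z
    have "\<Phi> z \<le> K" "- K \<le> \<Phi> z" using b[of z] by auto
    then show "0 \<le> (\<Phi> z + K) / (2 * K)" "(\<Phi> z + K) / (2 * K) \<le> 1" using K by auto
  qed (use \<Phi>N sN sQ in auto)
  moreover have "(\<integral>z. (\<Phi> z + K) / (2 * K) \<partial>N) - (\<integral>z. (\<Phi> z + K) / (2 * K) \<partial>Q) = ((\<integral>z. \<Phi> z \<partial>N) - (\<integral>z. \<Phi> z \<partial>Q)) / (2 * K)"
    using iN iQ by (simp add: N.prob_space Q.prob_space diff_divide_distrib add_divide_distrib)
  ultimately have "\<bar>(\<integral>z. \<Phi> z \<partial>N) - (\<integral>z. \<Phi> z \<partial>Q)\<bar> \<le> 2 * K * beta_coeff M F G"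
    using K by (simp add: abs_divide divide_le_eq mult.commute)
  moreover have "(\<integral>z. \<Phi> z \<partial>N) = (\<integral>\<omega>. \<Phi> (U \<omega>, V \<omega>) \<partial>M)"
    unfolding N_def by (rule integral_distr) simp_all
  ultimately show ?thesis unfolding Q_def by simp
qed

end

section \<open>The Hoeffding decomposition of the kernel\<close>

lemma powr_add4_le:
  fixes p :: real assumes p: "0 < p"
  shows "\<bar>x + y + z + w\<bar> powr p \<le> 4 powr p * (\<bar>x\<bar> powr p + \<bar>y\<bar> powr p + \<bar>z\<bar> powr p + \<bar>w\<bar> powr p)"
proof -
  define m where "m = max (max \<bar>x\<bar> \<bar>y\<bar>) (max \<bar>z\<bar> \<bar>w\<bar>)"
  have sum4: "a + b + c + d \<le> 4 * m" if "a \<le> m" "b \<le> m" "c \<le> m" "d \<le> m" for a b c d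
    using that by linarith
  have "\<bar>x + y + z + w\<bar> \<le> \<bar>x\<bar> + \<bar>y\<bar> + \<bar>z\<bar> + \<bar>w\<bar>"
    using norm_add4_le[of x y z w] by (simp only: real_norm_def)
  also have "\<dots> \<le> 4 * m" by (rule sum4) (simp_all add: m_def le_max_iff_disj)
  finally have "\<bar>x + y + z + w\<bar> \<le> 4 * m" .
  then have 1: "\<bar>x + y + z + w\<bar> powr p \<le> (4 * m) powr p" using p by (intro powr_mono2) auto
  have "m = \<bar>x\<bar> \<or> m = \<bar>y\<bar> \<or> m = \<bar>z\<bar> \<or> m = \<bar>w\<bar>" unfolding m_def by (simp add: max_def)
  then have "m powr p \<le> \<bar>x\<bar> powr p + \<bar>y\<bar> powr p + \<bar>z\<bar> powr p + \<bar>w\<bar> powr p"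
    by (elim disjE) (simp_all add: add_nonneg_nonneg)
  then have "4 powr p * m powr p \<le> 4 powr p * (\<bar>x\<bar> powr p + \<bar>y\<bar> powr p + \<bar>z\<bar> powr p + \<bar>w\<bar> powr p)"
    by (rule mult_left_mono) simp
  then show ?thesis using 1 powr_mult[of 4 m p] by linarith
qed

text \<open>Lyapunov's inequality up to a constant, by splitting at half of the mean.\<close>

lemma (in prob_space) powr_expectation_le:
  fixes u :: "'a \<Rightarrow> real"
  assumes u: "integrable M u" "\<And>\<omega>. 0 \<le> u \<omega>" and p: "1 < p" and up: "integrable M (\<lambda>\<omega>. u \<omega> powr p)"
  shows "expectation u powr p \<le> 2 powr p * expectation (\<lambda>\<omega>. u \<omega> powr p)"
proof (cases "expectation u = 0")
  case True
  then show ?thesis by (simp add: integral_nonneg_AE)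
next
  case False
  define c where "c = expectation u"
  have c: "0 < c" using False u(2) by (simp add: c_def integral_nonneg_AE order_less_le)
  have "u \<omega> \<le> c / 2 + (c / 2) powr (1 - p) * u \<omega> powr p" for \<omega>
  proof (cases "u \<omega> \<le> c / 2")
    case False
    then have v: "c / 2 < u \<omega>" "0 < u \<omega>" using c by auto
    have "(c / 2) powr (1 - p) \<ge> u \<omega> powr (1 - p)" using v c p by (intro powr_mono2') auto
    then have "u \<omega> powr (1 - p) * u \<omega> powr p \<le> (c / 2) powr (1 - p) * u \<omega> powr p" by (intro mult_right_mono) auto
    moreover have "u \<omega> powr (1 - p) * u \<omega> powr p = u \<omega>" using v by (simp add: powr_add[symmetric])
    ultimately show ?thesis using c by linarith
  qed (simp add: add_increasing2)
  then have "expectation u \<le> (\<integral>\<omega>. c / 2 + (c / 2) powr (1 - p) * u \<omega> powr p \<partial>M)"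
    using u up by (intro integral_mono) auto
  then have "c / 2 \<le> (c / 2) powr (1 - p) * expectation (\<lambda>\<omega>. u \<omega> powr p)"
    using up by (simp add: prob_space c_def)
  then have "(c / 2) powr (p - 1) * (c / 2) \<le> (c / 2) powr (p - 1) * ((c / 2) powr (1 - p) * expectation (\<lambda>\<omega>. u \<omega> powr p))"
    by (intro mult_left_mono) auto
  moreover have "(c / 2) powr (p - 1) * (c / 2) = (c / 2) powr p"
    using c powr_add[of "c / 2" "p - 1" 1] by simp
  moreover have "(c / 2) powr (p - 1) * ((c / 2) powr (1 - p) * E) = E" for E
    using c by (simp add: powr_add[symmetric] mult.assoc[symmetric])
  ultimately have le: "(c / 2) powr p \<le> expectation (\<lambda>\<omega>. u \<omega> powr p)" by simp
  have "c powr p = 2 powr p * (c / 2) powr p" using c by (simp add: powr_mult[symmetric])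
  also have "\<dots> \<le> 2 powr p * expectation (\<lambda>\<omega>. u \<omega> powr p)" using le by (intro mult_left_mono) auto
  finally show ?thesis by (simp add: c_def)
qed

locale ustat_process = stationary_process M X for M :: "'a measure" and X +
  fixes h :: "real \<Rightarrow> real \<Rightarrow> real" and \<delta> C :: real
  assumes h_sym: "\<And>x y. h x y = h y x"
    and h_measurable: "(\<lambda>(x, y). h x y) \<in> borel_measurable (borel \<Otimes>\<^sub>M borel)"
    and \<delta>_pos: "0 < \<delta>" and C_pos: "0 < C"
    and h_product_moment: "(\<integral>\<^sup>+x. (\<integral>\<^sup>+y. ennreal (\<bar>h x y\<bar> powr (2 + \<delta>)) \<partial>marginal M X) \<partial>marginal M X) \<le> ennreal C"
    and h_pair_moment: "\<And>k :: nat. (\<integral>\<^sup>+(x, y). ennreal (\<bar>h x y\<bar> powr (2 + \<delta>)) \<partial>pair_law M (X 1) (X (1 + k))) \<le> ennreal C"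
begin

abbreviation law :: "real measure" where "law \<equiv> marginal M X"

sublocale law: prob_space law by (rule prob_space_marginal)

sublocale law2: pair_prob_space law law by unfold_locales

sublocale ext: pair_prob_space M law by unfold_locales

lemma measure_law_UNIV[simp]: "measure law UNIV = 1"
  using law.prob_space by simp

lemma h_comp_measurable[measurable (raw)]:
  assumes "u \<in> borel_measurable N" "v \<in> borel_measurable N"
  shows "(\<lambda>x. h (u x) (v x)) \<in> borel_measurable N"
  using measurable_compose[OF measurable_Pair[OF assms] h_measurable] by simp

lemma h1_measurable[measurable]: "h1 M X h \<in> borel_measurable borel"
  unfolding h1_def[abs_def] by measurable

definition h2 :: "real \<Rightarrow> real \<Rightarrow> real" where
  "h2 x y = h x y - U_mean M X h - h1 M X h x - h1 M X h y"

lemma h2_sym: "h2 x y = h2 y x"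
  unfolding h2_def using h_sym[of x y] by simp

lemma h2_comp_measurable[measurable (raw)]:
  assumes [measurable]: "u \<in> borel_measurable N" "v \<in> borel_measurable N"
  shows "(\<lambda>x. h2 (u x) (v x)) \<in> borel_measurable N"
  unfolding h2_def by measurable

lemma h_product_powr:
  "integrable (law \<Otimes>\<^sub>M law) (\<lambda>(x, y). \<bar>h x y\<bar> powr (2 + \<delta>))"
  "(\<integral>(x, y). \<bar>h x y\<bar> powr (2 + \<delta>) \<partial>(law \<Otimes>\<^sub>M law)) \<le> C"
proof -
  let ?f = "\<lambda>(x, y). \<bar>h x y\<bar> powr (2 + \<delta>)"
  have m[measurable]: "?f \<in> borel_measurable (law \<Otimes>\<^sub>M law)" by measurable
  have "(\<integral>\<^sup>+z. ennreal (?f z) \<partial>(law \<Otimes>\<^sub>M law)) = (\<integral>\<^sup>+x. (\<integral>\<^sup>+y. ennreal (?f (x, y)) \<partial>law) \<partial>law)"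
    by (rule law.nn_integral_fst[symmetric]) measurable
  also have "\<dots> \<le> ennreal C" using h_product_moment by simp
  finally have le: "(\<integral>\<^sup>+z. ennreal (?f z) \<partial>(law \<Otimes>\<^sub>M law)) \<le> ennreal C" .
  show i: "integrable (law \<Otimes>\<^sub>M law) ?f"
    by (rule integrableI_nonneg) (use le in \<open>auto simp: case_prod_unfold intro: le_less_trans\<close>)
  have "ennreal (\<integral>z. ?f z \<partial>(law \<Otimes>\<^sub>M law)) \<le> ennreal C"
    using le nn_integral_eq_integral[OF i] by (auto simp: case_prod_unfold)
  then show "(\<integral>z. ?f z \<partial>(law \<Otimes>\<^sub>M law)) \<le> C" using C_pos by (simp add: ennreal_le_iff)
qed

lemma h_pair_powr:
  assumes i: "1 \<le> i" and ij: "i \<le> j"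
  shows "integrable M (\<lambda>\<omega>. \<bar>h (X i \<omega>) (X j \<omega>)\<bar> powr (2 + \<delta>))"
    "(\<integral>\<omega>. \<bar>h (X i \<omega>) (X j \<omega>)\<bar> powr (2 + \<delta>) \<partial>M) \<le> C"
proof -
  have m[measurable]: "X i \<in> borel_measurable M" "X j \<in> borel_measurable M" using X_measurable i ij by auto
  have "(\<integral>\<^sup>+\<omega>. ennreal (\<bar>h (X i \<omega>) (X j \<omega>)\<bar> powr (2 + \<delta>)) \<partial>M)
     = (\<integral>\<^sup>+(x, y). ennreal (\<bar>h x y\<bar> powr (2 + \<delta>)) \<partial>pair_law M (X i) (X j))"
    unfolding pair_law_def by (subst nn_integral_distr) auto
  also have "\<dots> \<le> ennreal C"
    using pair_law_shift[OF i, of "j - i"] h_pair_moment[of "j - i"] ij by simp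
  finally have le: "(\<integral>\<^sup>+\<omega>. ennreal (\<bar>h (X i \<omega>) (X j \<omega>)\<bar> powr (2 + \<delta>)) \<partial>M) \<le> ennreal C" .
  show int: "integrable M (\<lambda>\<omega>. \<bar>h (X i \<omega>) (X j \<omega>)\<bar> powr (2 + \<delta>))"
    by (rule integrableI_nonneg) (use le in \<open>auto intro: le_less_trans\<close>)
  have "ennreal (\<integral>\<omega>. \<bar>h (X i \<omega>) (X j \<omega>)\<bar> powr (2 + \<delta>) \<partial>M) \<le> ennreal C"
    using le nn_integral_eq_integral[OF int] by auto
  then show "(\<integral>\<omega>. \<bar>h (X i \<omega>) (X j \<omega>)\<bar> powr (2 + \<delta>) \<partial>M) \<le> C" using C_pos by (simp add: ennreal_le_iff)
qed

text \<open>Fubini controls the sections of the kernel for almost every \<open>x\<close>. Elsewhere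
  the integral inside \<open>h1\<close> may be the default 0, which is why degeneracy in
  \<open>integral_h2\<close> is an almost sure statement.\<close>

lemma AE_h_integrable:
  "AE x in law. integrable law (h x) \<and> integrable law (\<lambda>y. \<bar>h x y\<bar> powr (2 + \<delta>))"
proof -
  have "AE x in law. integrable law (\<lambda>y. \<bar>h x y\<bar> powr (2 + \<delta>))"
    using law2.AE_integrable_fst[OF h_product_powr(1)] by simp
  then show ?thesis
  proof eventually_elim
    case (elim x)
    have "h x \<in> borel_measurable law" by measurable
    from law.square_integrable_of_powr(2)[OF this \<delta>_pos elim] elim show ?case by simp
  qed
qed

lemma h_product_integrable: "integrable (law \<Otimes>\<^sub>M law) (\<lambda>(x, y). h x y)"
proof -
  have m: "(\<lambda>(x, y). h x y) \<in> borel_measurable (law \<Otimes>\<^sub>M law)" by measurable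
  show ?thesis
    by (rule law2.P.square_integrable_of_powr(2)[OF m \<delta>_pos]) (use h_product_powr(1) in \<open>simp add: case_prod_unfold\<close>)
qed

lemma integral_h1: "integrable law (h1 M X h)" "(\<integral>x. h1 M X h x \<partial>law) = 0"
proof -
  have i: "integrable law (\<lambda>x. \<integral>y. h x y \<partial>law)"
    using law2.integrable_fst[OF h_product_integrable] by simp
  then show "integrable law (h1 M X h)" unfolding h1_def[abs_def] by simp
  show "(\<integral>x. h1 M X h x \<partial>law) = 0"
    unfolding h1_def[abs_def] using i by (simp add: law.prob_space U_mean_def)
qed

text \<open>Averaging over the second argument keeps the moment: on almost every section Lyapunov's
  inequality bounds the power of the mean by the mean of the power, which is integrable by
  Fubini.\<close>

lemma h1_powr_integrable: "integrable law (\<lambda>x. \<bar>h1 M X h x\<bar> powr (2 + \<delta>))"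
proof -
  let ?p = "2 + \<delta>"
  have i: "integrable law (\<lambda>x. \<integral>y. \<bar>h x y\<bar> powr ?p \<partial>law)"
    using law2.integrable_fst[OF h_product_powr(1)] by simp
  show ?thesis
  proof (rule Bochner_Integration.integrable_bound)
    show "integrable law (\<lambda>x. 4 powr ?p * (2 powr ?p * (\<integral>y. \<bar>h x y\<bar> powr ?p \<partial>law) + \<bar>U_mean M X h\<bar> powr ?p))"
      using i by simp
    show "(\<lambda>x. \<bar>h1 M X h x\<bar> powr ?p) \<in> borel_measurable law" by measurable
    show "AE x in law. norm (\<bar>h1 M X h x\<bar> powr ?p)
        \<le> norm (4 powr ?p * (2 powr ?p * (\<integral>y. \<bar>h x y\<bar> powr ?p \<partial>law) + \<bar>U_mean M X h\<bar> powr ?p))"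
      using AE_h_integrable
    proof eventually_elim
      case (elim x)
      have b: "\<bar>h1 M X h x\<bar> powr ?p \<le> 4 powr ?p * (\<bar>\<integral>y. h x y \<partial>law\<bar> powr ?p + \<bar>U_mean M X h\<bar> powr ?p)"
        using powr_add4_le[of ?p "\<integral>y. h x y \<partial>law" "- U_mean M X h" 0 0] \<delta>_pos by (simp add: h1_def)
      have "\<bar>\<integral>y. h x y \<partial>law\<bar> powr ?p \<le> (\<integral>y. \<bar>h x y\<bar> \<partial>law) powr ?p"
        using \<delta>_pos by (intro powr_mono2 integral_abs_bound) auto
      also have "\<dots> \<le> 2 powr ?p * (\<integral>y. \<bar>h x y\<bar> powr ?p \<partial>law)"
        using elim \<delta>_pos by (intro law.powr_expectation_le) auto
      finally have "4 powr ?p * (\<bar>\<integral>y. h x y \<partial>law\<bar> powr ?p + \<bar>U_mean M X h\<bar> powr ?p)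
        \<le> 4 powr ?p * (2 powr ?p * (\<integral>y. \<bar>h x y\<bar> powr ?p \<partial>law) + \<bar>U_mean M X h\<bar> powr ?p)"
        by (intro mult_left_mono add_right_mono) simp_all
      with b have "\<bar>h1 M X h x\<bar> powr ?p
        \<le> 4 powr ?p * (2 powr ?p * (\<integral>y. \<bar>h x y\<bar> powr ?p \<partial>law) + \<bar>U_mean M X h\<bar> powr ?p)"
        by (rule order_trans)
      then show ?case by (simp add: order_trans[OF _ abs_ge_self])
    qed
  qed
qed

text \<open>The outcome of \<open>powr_add4_le\<close> for the four summands of \<open>h2\<close>;
  the two values of \<open>h1\<close> have the same moment, hence the 2.\<close>

definition C2 :: real where
  "C2 = 4 powr (2 + \<delta>) * (C + \<bar>U_mean M X h\<bar> powr (2 + \<delta>) + 2 * (\<integral>x. \<bar>h1 M X h x\<bar> powr (2 + \<delta>) \<partial>law))"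

lemma C2_pos: "0 < C2"
proof -
  have "0 \<le> (\<integral>x. \<bar>h1 M X h x\<bar> powr (2 + \<delta>) \<partial>law)" by (rule integral_nonneg_AE) simp
  then show ?thesis using C_pos unfolding C2_def by (intro mult_pos_pos) (auto intro!: add_pos_nonneg)
qed

text \<open>The space \<open>Q\<close> is arbitrary because two kinds of pairs are needed: two
  members of the process on \<open>M\<close>, and a member with an independent copy on the product
  space.\<close>

lemma h2_powr_general:
  fixes Q :: "'b measure"
  assumes Q: "prob_space Q" and Y[measurable]: "Y \<in> borel_measurable Q" and Z[measurable]: "Z \<in> borel_measurable Q"
    and dY: "distr Q borel Y = law" and dZ: "distr Q borel Z = law"
    and i: "integrable Q (\<lambda>\<omega>. \<bar>h (Y \<omega>) (Z \<omega>)\<bar> powr (2 + \<delta>))" and le: "(\<integral>\<omega>. \<bar>h (Y \<omega>) (Z \<omega>)\<bar> powr (2 + \<delta>) \<partial>Q) \<le> C"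
  shows "integrable Q (\<lambda>\<omega>. \<bar>h2 (Y \<omega>) (Z \<omega>)\<bar> powr (2 + \<delta>))"
    "(\<integral>\<omega>. \<bar>h2 (Y \<omega>) (Z \<omega>)\<bar> powr (2 + \<delta>) \<partial>Q) \<le> C2"
proof -
  interpret Q: prob_space Q by (rule Q)
  let ?p = "2 + \<delta>" and ?t = "\<bar>U_mean M X h\<bar> powr (2 + \<delta>)"
  let ?b = "\<lambda>\<omega>. 4 powr ?p * (\<bar>h (Y \<omega>) (Z \<omega>)\<bar> powr ?p + ?t + \<bar>h1 M X h (Y \<omega>)\<bar> powr ?p + \<bar>h1 M X h (Z \<omega>)\<bar> powr ?p)"
  have iY: "integrable Q (\<lambda>\<omega>. \<bar>h1 M X h (V \<omega>)\<bar> powr ?p)"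
    "(\<integral>\<omega>. \<bar>h1 M X h (V \<omega>)\<bar> powr ?p \<partial>Q) = (\<integral>x. \<bar>h1 M X h x\<bar> powr ?p \<partial>law)"
    if [measurable]: "V \<in> borel_measurable Q" and d: "distr Q borel V = law" for V
    using h1_powr_integrable integrable_distr_eq[of V Q borel "\<lambda>x. \<bar>h1 M X h x\<bar> powr ?p"]
      integral_distr[of V Q borel "\<lambda>x. \<bar>h1 M X h x\<bar> powr ?p"] unfolding d by auto
  have bi: "integrable Q ?b" using i iY(1)[OF Y dY] iY(1)[OF Z dZ] by simp
  have b: "\<bar>h2 (Y \<omega>) (Z \<omega>)\<bar> powr ?p \<le> ?b \<omega>" for \<omega>
    using powr_add4_le[of ?p "h (Y \<omega>) (Z \<omega>)" "- U_mean M X h" "- h1 M X h (Y \<omega>)" "- h1 M X h (Z \<omega>)"] \<delta>_pos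
    by (simp add: h2_def)
  show int: "integrable Q (\<lambda>\<omega>. \<bar>h2 (Y \<omega>) (Z \<omega>)\<bar> powr (2 + \<delta>))"
  proof (rule Bochner_Integration.integrable_bound[OF bi])
    have "norm (\<bar>h2 (Y \<omega>) (Z \<omega>)\<bar> powr ?p) \<le> norm (?b \<omega>)" for \<omega>
      using order_trans[OF b[of \<omega>] abs_ge_self] by (simp only: real_norm_def abs_of_nonneg[OF powr_ge_zero])
    then show "AE \<omega> in Q. norm (\<bar>h2 (Y \<omega>) (Z \<omega>)\<bar> powr ?p) \<le> norm (?b \<omega>)" by (rule AE_I2)
  qed measurable
  have "(\<integral>\<omega>. \<bar>h2 (Y \<omega>) (Z \<omega>)\<bar> powr (2 + \<delta>) \<partial>Q) \<le> (\<integral>\<omega>. ?b \<omega> \<partial>Q)" by (rule integral_mono[OF int bi b])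
  also have "\<dots> = 4 powr ?p * ((\<integral>\<omega>. \<bar>h (Y \<omega>) (Z \<omega>)\<bar> powr ?p \<partial>Q) + ?t + 2 * (\<integral>x. \<bar>h1 M X h x\<bar> powr ?p \<partial>law))"
    using i iY[OF Y dY] iY[OF Z dZ] by (simp add: Q.prob_space)
  also have "\<dots> \<le> C2" unfolding C2_def using le by (intro mult_left_mono) auto
  finally show "(\<integral>\<omega>. \<bar>h2 (Y \<omega>) (Z \<omega>)\<bar> powr (2 + \<delta>) \<partial>Q) \<le> C2" .
qed

lemma h2_pair_powr:
  assumes i: "1 \<le> i" and ij: "i \<le> j"
  shows "integrable M (\<lambda>\<omega>. \<bar>h2 (X i \<omega>) (X j \<omega>)\<bar> powr (2 + \<delta>))"
    "(\<integral>\<omega>. \<bar>h2 (X i \<omega>) (X j \<omega>)\<bar> powr (2 + \<delta>) \<partial>M) \<le> C2"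
proof -
  have j: "1 \<le> j" using i ij by simp
  show "integrable M (\<lambda>\<omega>. \<bar>h2 (X i \<omega>) (X j \<omega>)\<bar> powr (2 + \<delta>))"
    "(\<integral>\<omega>. \<bar>h2 (X i \<omega>) (X j \<omega>)\<bar> powr (2 + \<delta>) \<partial>M) \<le> C2"
    using h2_powr_general[OF prob_space_axioms X_measurable[OF i] X_measurable[OF j] distr_X[OF i] distr_X[OF j] h_pair_powr[OF i ij]]
    by auto
qed

text \<open>On the product space \<open>M \<Otimes>\<^sub>M law\<close> the second coordinate is an independent copy of \<open>X 1\<close>.\<close>

lemma distr_independent_copy:
  assumes r: "1 \<le> r"
  shows "distr (M \<Otimes>\<^sub>M law) (borel \<Otimes>\<^sub>M borel) (\<lambda>z. (X r (fst z), snd z)) = law \<Otimes>\<^sub>M law"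
proof -
  have [measurable]: "X r \<in> borel_measurable M" by (rule X_measurable[OF r])
  have d: "distr law borel (\<lambda>y. y) = law" by (rule distr_id2) simp
  have "distr M borel (X r) \<Otimes>\<^sub>M distr law borel (\<lambda>y. y) = distr (M \<Otimes>\<^sub>M law) (borel \<Otimes>\<^sub>M borel) (\<lambda>(x, y). (X r x, y))"
    by (rule pair_measure_distr) (auto simp: d law.sigma_finite_measure_axioms)
  then show ?thesis by (simp add: distr_X[OF r] d case_prod_unfold)
qed

lemma h2_product_powr:
  assumes r: "1 \<le> r"
  shows "integrable (M \<Otimes>\<^sub>M law) (\<lambda>z. \<bar>h2 (X r (fst z)) (snd z)\<bar> powr (2 + \<delta>))"
    "(\<integral>z. \<bar>h2 (X r (fst z)) (snd z)\<bar> powr (2 + \<delta>) \<partial>(M \<Otimes>\<^sub>M law)) \<le> C2"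
proof -
  have [measurable]: "X r \<in> borel_measurable M" by (rule X_measurable[OF r])
  have m[measurable]: "(\<lambda>z. (X r (fst z), snd z)) \<in> M \<Otimes>\<^sub>M law \<rightarrow>\<^sub>M borel \<Otimes>\<^sub>M borel" by measurable
  have hm: "(\<lambda>(x, y). \<bar>h x y\<bar> powr (2 + \<delta>)) \<in> borel_measurable (borel \<Otimes>\<^sub>M borel)" by measurable
  have d1: "distr (M \<Otimes>\<^sub>M law) borel (\<lambda>z. X r (fst z)) = law"
  proof -
    have "distr (M \<Otimes>\<^sub>M law) borel (\<lambda>z. X r (fst z)) = distr (law \<Otimes>\<^sub>M law) borel fst"
      unfolding distr_independent_copy[OF r, symmetric] by (subst distr_distr) (auto simp: comp_def)
    also have "\<dots> = distr (law \<Otimes>\<^sub>M law) law fst" by (rule distr_cong) auto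
    also have "\<dots> = law" by (rule law.distr_pair_fst)
    finally show ?thesis .
  qed
  have d2: "distr (M \<Otimes>\<^sub>M law) borel snd = law"
  proof -
    have "distr (M \<Otimes>\<^sub>M law) borel snd = distr (M \<Otimes>\<^sub>M law) law snd" by (rule distr_cong) auto
    also have "\<dots> = law"
    proof (rule measure_eqI)
      fix A assume "A \<in> sets (distr (M \<Otimes>\<^sub>M law) law snd)"
      then have A: "A \<in> sets law" by simp
      have "snd -` A \<inter> space (M \<Otimes>\<^sub>M law) = space M \<times> A" by (auto simp: space_pair_measure)
      then show "emeasure (distr (M \<Otimes>\<^sub>M law) law snd) A = emeasure law A"
        using A by (simp add: emeasure_distr law.emeasure_pair_measure_Times emeasure_space_1)
    qed simp
    finally show ?thesis .
  qed
  have i: "integrable (M \<Otimes>\<^sub>M law) (\<lambda>z. \<bar>h (X r (fst z)) (snd z)\<bar> powr (2 + \<delta>))"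
    using h_product_powr(1) integrable_distr_eq[OF m hm] unfolding distr_independent_copy[OF r] by (simp add: case_prod_unfold)
  have e: "(\<integral>z. \<bar>h (X r (fst z)) (snd z)\<bar> powr (2 + \<delta>) \<partial>(M \<Otimes>\<^sub>M law)) \<le> C"
    using h_product_powr(2) integral_distr[OF m hm] unfolding distr_independent_copy[OF r] by (simp add: case_prod_unfold)
  show "integrable (M \<Otimes>\<^sub>M law) (\<lambda>z. \<bar>h2 (X r (fst z)) (snd z)\<bar> powr (2 + \<delta>))"
    "(\<integral>z. \<bar>h2 (X r (fst z)) (snd z)\<bar> powr (2 + \<delta>) \<partial>(M \<Otimes>\<^sub>M law)) \<le> C2"
    using h2_powr_general[OF ext.P.prob_space_axioms _ _ d1 d2 i e] by auto
qed

lemma integral_h2: "AE x in law. (\<integral>y. h2 x y \<partial>law) = 0"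
  using AE_h_integrable
proof eventually_elim
  case (elim x)
  then have "(\<integral>y. h2 x y \<partial>law) = (\<integral>y. h x y \<partial>law) - U_mean M X h - h1 M X h x - (\<integral>y. h1 M X h y \<partial>law)"
    unfolding h2_def using integral_h1(1) by (simp add: law.prob_space)
  then show ?case by (simp add: integral_h1(2)) (simp add: h1_def)
qed

section \<open>Four-index expectations and their truncation\<close>

definition quad :: "nat \<Rightarrow> nat \<Rightarrow> nat \<Rightarrow> nat \<Rightarrow> real" where
  "quad i j k l = (\<integral>\<omega>. h2 (X i \<omega>) (X j \<omega>) * h2 (X k \<omega>) (X l \<omega>) \<partial>M)"

lemma quad_sym: "quad i j k l = quad k l i j"
  unfolding quad_def by (simp add: mult.commute)

lemma h2_X_measurable: "1 \<le> i \<Longrightarrow> 1 \<le> j \<Longrightarrow> (\<lambda>\<omega>. h2 (X i \<omega>) (X j \<omega>)) \<in> borel_measurable M"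
  by (rule h2_comp_measurable) (auto intro: X_measurable)

lemma h2_square_integrable:
  "1 \<le> i \<Longrightarrow> i \<le> j \<Longrightarrow> integrable M (\<lambda>\<omega>. h2 (X i \<omega>) (X j \<omega>) * h2 (X i \<omega>) (X j \<omega>))"
  by (rule square_integrable_of_powr(1)[OF h2_X_measurable \<delta>_pos h2_pair_powr(1)]) auto

lemma quad_integrable:
  assumes "1 \<le> i" "i \<le> j" "1 \<le> k" "k \<le> l"
  shows "integrable M (\<lambda>\<omega>. h2 (X i \<omega>) (X j \<omega>) * h2 (X k \<omega>) (X l \<omega>))"
  by (rule integrable_mult_of_squares[OF h2_X_measurable h2_X_measurable h2_square_integrable h2_square_integrable])
    (use assms in auto)

lemma abs_integral_mult_clip_le:
  fixes Q :: "'b measure"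
  assumes Q: "prob_space Q" and [measurable]: "Y \<in> borel_measurable Q" "Z \<in> borel_measurable Q" and T: "0 < T"
    and Y: "integrable Q (\<lambda>\<omega>. \<bar>Y \<omega>\<bar> powr (2 + \<delta>))" "(\<integral>\<omega>. \<bar>Y \<omega>\<bar> powr (2 + \<delta>) \<partial>Q) \<le> C2"
    and Z: "integrable Q (\<lambda>\<omega>. \<bar>Z \<omega>\<bar> powr (2 + \<delta>))" "(\<integral>\<omega>. \<bar>Z \<omega>\<bar> powr (2 + \<delta>) \<partial>Q) \<le> C2"
  shows "\<bar>(\<integral>\<omega>. Y \<omega> * Z \<omega> \<partial>Q) - (\<integral>\<omega>. clip T (Y \<omega>) * clip T (Z \<omega>) \<partial>Q)\<bar> \<le> 2 * C2 * T powr (- \<delta>)"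
proof -
  interpret Q: prob_space Q by (rule Q)
  have i: "integrable Q (\<lambda>\<omega>. Y \<omega> * Z \<omega>)"
    by (rule Q.integrable_mult_of_squares)
      (use Q.square_integrable_of_powr(1)[OF _ \<delta>_pos Y(1)] Q.square_integrable_of_powr(1)[OF _ \<delta>_pos Z(1)] in auto)
  have c: "integrable Q (\<lambda>\<omega>. clip T (Y \<omega>) * clip T (Z \<omega>))"
    by (rule Q.integrable_bounded[of _ "T * T"])
      (use T in \<open>auto simp: abs_mult abs_clip_le intro!: mult_mono\<close>)
  have "\<bar>(\<integral>\<omega>. Y \<omega> * Z \<omega> \<partial>Q) - (\<integral>\<omega>. clip T (Y \<omega>) * clip T (Z \<omega>) \<partial>Q)\<bar>
     = \<bar>\<integral>\<omega>. Y \<omega> * Z \<omega> - clip T (Y \<omega>) * clip T (Z \<omega>) \<partial>Q\<bar>" using i c by simp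
  also have "\<dots> \<le> (\<integral>\<omega>. \<bar>Y \<omega> * Z \<omega> - clip T (Y \<omega>) * clip T (Z \<omega>)\<bar> \<partial>Q)" by (rule integral_abs_bound)
  also have "\<dots> \<le> (\<integral>\<omega>. T powr (- \<delta>) * (\<bar>Y \<omega>\<bar> powr (2 + \<delta>) + \<bar>Z \<omega>\<bar> powr (2 + \<delta>)) \<partial>Q)"
    using i c Y(1) Z(1) by (intro integral_mono clip_mult_diff_le T \<delta>_pos) auto
  also have "\<dots> = T powr (- \<delta>) * ((\<integral>\<omega>. \<bar>Y \<omega>\<bar> powr (2 + \<delta>) \<partial>Q) + (\<integral>\<omega>. \<bar>Z \<omega>\<bar> powr (2 + \<delta>) \<partial>Q))"
    using Y(1) Z(1) by simp
  also have "\<dots> \<le> T powr (- \<delta>) * (C2 + C2)" using Y(2) Z(2) by (intro mult_left_mono add_mono) auto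
  finally show ?thesis by (simp add: mult_ac)
qed

text \<open>Replacing the isolated variable by an independent copy makes the expectation vanish, by degeneracy.\<close>

definition clip_quad :: "real \<Rightarrow> nat \<Rightarrow> nat \<Rightarrow> nat \<Rightarrow> nat \<Rightarrow> real" where
  "clip_quad T i j k l = (\<integral>\<omega>. clip T (h2 (X i \<omega>) (X j \<omega>)) * clip T (h2 (X k \<omega>) (X l \<omega>)) \<partial>M)"

definition clip_quad_indep :: "real \<Rightarrow> nat \<Rightarrow> nat \<Rightarrow> nat \<Rightarrow> real" where
  "clip_quad_indep T r k l =
     (\<integral>z. clip T (h2 (X r (fst z)) (snd z)) * clip T (h2 (X k (fst z)) (X l (fst z))) \<partial>(M \<Otimes>\<^sub>M law))"

text \<open>The integral that vanishes by degeneracy is the unclipped one with the independent copy.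
  Passing from \<open>quad\<close> to its clipped version, then to the clipped version with the
  copy, then to the unclipped one, pays the truncation error
  \<open>2 * C2 * T powr (- \<delta>)\<close> at both ends. In the applications \<open>r\<close> is
  the partner of the replaced variable.\<close>

lemma quad_le_clip_quad:
  assumes ij: "1 \<le> i" "i \<le> j" and kl: "1 \<le> k" "k \<le> l" and r: "1 \<le> r" and T: "0 < T"
  shows "\<bar>quad i j k l\<bar> \<le> 4 * C2 * T powr (- \<delta>) + \<bar>clip_quad T i j k l - clip_quad_indep T r k l\<bar>"
proof -
  have mX[measurable]: "X i \<in> borel_measurable M" "X j \<in> borel_measurable M" "X k \<in> borel_measurable M"
    "X l \<in> borel_measurable M" "X r \<in> borel_measurable M" using X_measurable ij kl r by auto
  have 1: "\<bar>quad i j k l - clip_quad T i j k l\<bar> \<le> 2 * C2 * T powr (- \<delta>)"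
    unfolding quad_def clip_quad_def
    by (rule abs_integral_mult_clip_le[OF prob_space_axioms _ _ T h2_pair_powr[OF ij] h2_pair_powr[OF kl]]) auto
  let ?W = "\<lambda>\<omega>. h2 (X k \<omega>) (X l \<omega>)"
  have Wi: "integrable (M \<Otimes>\<^sub>M law) (\<lambda>z. \<bar>?W (fst z)\<bar> powr (2 + \<delta>))"
    and We: "(\<integral>z. \<bar>?W (fst z)\<bar> powr (2 + \<delta>) \<partial>(M \<Otimes>\<^sub>M law)) \<le> C2"
  proof -
    have m: "(\<lambda>\<omega>. \<bar>?W \<omega>\<bar> powr (2 + \<delta>)) \<in> borel_measurable M" by measurable
    have d: "distr (M \<Otimes>\<^sub>M law) M fst = M" by (rule law.distr_pair_fst)
    show "integrable (M \<Otimes>\<^sub>M law) (\<lambda>z. \<bar>?W (fst z)\<bar> powr (2 + \<delta>))"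
      using integrable_distr_eq[OF measurable_fst m, of law] h2_pair_powr(1)[OF kl] unfolding d by simp
    show "(\<integral>z. \<bar>?W (fst z)\<bar> powr (2 + \<delta>) \<partial>(M \<Otimes>\<^sub>M law)) \<le> C2"
      using integral_distr[OF measurable_fst m, of law] h2_pair_powr(2)[OF kl] unfolding d by simp
  qed
  have 2: "\<bar>(\<integral>z. h2 (X r (fst z)) (snd z) * ?W (fst z) \<partial>(M \<Otimes>\<^sub>M law)) - clip_quad_indep T r k l\<bar> \<le> 2 * C2 * T powr (- \<delta>)"
    unfolding clip_quad_indep_def
    by (rule abs_integral_mult_clip_le[OF ext.P.prob_space_axioms _ _ T h2_product_powr[OF r] Wi We]) measurable
  have 3: "(\<integral>z. h2 (X r (fst z)) (snd z) * ?W (fst z) \<partial>(M \<Otimes>\<^sub>M law)) = 0"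
  proof -
    have sq: "integrable (M \<Otimes>\<^sub>M law) (\<lambda>z. h2 (X r (fst z)) (snd z) * h2 (X r (fst z)) (snd z))"
      by (rule ext.P.square_integrable_of_powr(1)[OF _ \<delta>_pos h2_product_powr(1)[OF r]]) measurable
    have sq': "integrable (M \<Otimes>\<^sub>M law) (\<lambda>z. ?W (fst z) * ?W (fst z))"
      by (rule ext.P.square_integrable_of_powr(1)[OF _ \<delta>_pos Wi]) measurable
    have i: "integrable (M \<Otimes>\<^sub>M law) (\<lambda>(\<omega>, y). h2 (X r \<omega>) y * ?W \<omega>)"
      unfolding case_prod_unfold by (rule ext.P.integrable_mult_of_squares[OF _ _ sq sq']) measurable
    have "(\<integral>z. h2 (X r (fst z)) (snd z) * ?W (fst z) \<partial>(M \<Otimes>\<^sub>M law)) = (\<integral>\<omega>. (\<integral>y. h2 (X r \<omega>) y * ?W \<omega> \<partial>law) \<partial>M)"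
      using ext.integral_fst[OF i] by (simp add: case_prod_unfold)
    also have "\<dots> = (\<integral>\<omega>. 0 \<partial>M)"
    proof (rule integral_cong_AE)
      have "AE x in distr M borel (X r). (\<integral>y. h2 x y \<partial>law) = 0" unfolding distr_X[OF r] by (rule integral_h2)
      then have "AE \<omega> in M. (\<integral>y. h2 (X r \<omega>) y \<partial>law) = 0" by (rule AE_distrD[rotated]) simp
      then show "AE \<omega> in M. (\<integral>y. h2 (X r \<omega>) y * ?W \<omega> \<partial>law) = 0" by eventually_elim simp
    qed (measurable, measurable)
    finally show ?thesis by simp
  qed
  show ?thesis using 1 2 3 by linarith
qed

text \<open>Truncation at level 1. The bound serves gap 0, where mixing gives nothing.\<close>

lemma quad_le_const:
  assumes ij: "1 \<le> i" "i \<le> j" and kl: "1 \<le> k" "k \<le> l"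
  shows "\<bar>quad i j k l\<bar> \<le> 1 + 2 * C2"
proof -
  have mX[measurable]: "X i \<in> borel_measurable M" "X j \<in> borel_measurable M" "X k \<in> borel_measurable M"
    "X l \<in> borel_measurable M" using X_measurable ij kl by auto
  have "\<bar>quad i j k l - clip_quad 1 i j k l\<bar> \<le> 2 * C2 * 1 powr (- \<delta>)"
    unfolding quad_def clip_quad_def
    by (rule abs_integral_mult_clip_le[OF prob_space_axioms _ _ _ h2_pair_powr[OF ij] h2_pair_powr[OF kl]]) auto
  moreover have "\<bar>clip_quad 1 i j k l\<bar> \<le> 1"
    unfolding clip_quad_def
    by (rule abs_expectation_le_bound) (auto simp: abs_mult abs_clip_le intro!: mult_le_one)
  ultimately show ?thesis by simp
qed

end

section \<open>The degenerate part\<close>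

lemma finite_index_pairs: "finite {(i, j). 1 \<le> i \<and> i < j \<and> j \<le> (n::nat)}"
  by (rule finite_subset[of _ "{1..n} \<times> {1..n}"]) auto

section \<open>Growth of sums of powers\<close>

lemma powr_increment_ge:
  fixes s x :: real
  assumes s: "0 < s" "s < 1" and x: "0 \<le> x"
  shows "(1 - s) * (x + 1) powr (- s) \<le> (x + 1) powr (1 - s) - x powr (1 - s)"
proof (cases "x = 0")
  case True then show ?thesis using s by simp
next
  case False
  then have x0: "0 < x" using x by simp
  have "\<exists>z. z > x \<and> z < x + 1 \<and> (x + 1) powr (1 - s) - x powr (1 - s) = ((x + 1) - x) * ((1 - s) * z powr (1 - s - 1))"
    by (rule MVT2) (use x0 in \<open>auto intro!: derivative_eq_intros\<close>)
  then obtain z where z: "z > x" "z < x + 1" "(x + 1) powr (1 - s) - x powr (1 - s) = (1 - s) * z powr (- s)" by auto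
  have "(x + 1) powr (- s) \<le> z powr (- s)" using z x0 s by (intro powr_mono2') auto
  then show ?thesis unfolding z(3) using s by (intro mult_left_mono) auto
qed

text \<open>Telescoping: each term is at most an increment of the function
  \<open>x powr (1 - s) / (1 - s)\<close>.\<close>

lemma sum_powr_le:
  fixes s :: real
  assumes s: "0 < s" "s < 1"
  shows "(\<Sum>a<n. real (Suc a) powr (- s)) \<le> real n powr (1 - s) / (1 - s)"
proof (induction n)
  case (Suc n)
  have "real (Suc n) powr (- s) \<le> (real (Suc n) powr (1 - s) - real n powr (1 - s)) / (1 - s)"
    using powr_increment_ge[OF s, of "real n"] s by (simp add: pos_le_divide_eq mult.commute add.commute)
  then have "(\<Sum>a<Suc n. real (Suc a) powr (- s)) \<le> real n powr (1 - s) / (1 - s) + (real (Suc n) powr (1 - s) - real n powr (1 - s)) / (1 - s)"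
    using Suc by simp
  then show ?case by (simp add: diff_divide_distrib)
qed simp

lemma sum_powr_over_sqrt_tendsto:
  fixes s :: real
  assumes s: "1/2 < s"
  shows "(\<lambda>n. (\<Sum>a<n. real (Suc a) powr (- s)) / sqrt (real n)) \<longlonglongrightarrow> 0"
proof (rule Lim_null_comparison)
  \<comment> \<open>Lowering the exponent below 1 makes \<open>sum_powr_le\<close> available; any
    cap strictly between 1/2 and 1 would do in place of 3/4.\<close>
  define r where "r = min s (3/4)"
  have r: "1/2 < r" "r < 1" "r \<le> s" using s by (auto simp: r_def)
  show "\<forall>\<^sub>F n in sequentially. norm ((\<Sum>a<n. real (Suc a) powr (- s)) / sqrt (real n)) \<le> 1 / (1 - r) * real n powr (1/2 - r)"
    using eventually_ge_at_top[of 1]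
  proof eventually_elim
    case (elim n)
    have "(\<Sum>a<n. real (Suc a) powr (- s)) \<le> (\<Sum>a<n. real (Suc a) powr (- r))"
      using r by (intro sum_mono powr_mono) auto
    also have "\<dots> \<le> real n powr (1 - r) / (1 - r)" by (rule sum_powr_le) (use r in auto)
    finally have le: "(\<Sum>a<n. real (Suc a) powr (- s)) \<le> real n powr (1 - r) / (1 - r)" .
    have nn: "0 \<le> (\<Sum>a<n. real (Suc a) powr (- s))" by (rule sum_nonneg) simp
    have e: "real n powr (1 - r) / sqrt (real n) = real n powr (1/2 - r)"
      using elim powr_diff[of "real n" "1 - r" "1/2"] powr_half_sqrt[of "real n"] by simp
    have "norm ((\<Sum>a<n. real (Suc a) powr (- s)) / sqrt (real n)) = (\<Sum>a<n. real (Suc a) powr (- s)) / sqrt (real n)"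
      using nn by simp
    also have "\<dots> \<le> (real n powr (1 - r) / (1 - r)) / sqrt (real n)"
      by (rule divide_right_mono[OF le]) simp
    also have "\<dots> = 1 / (1 - r) * (real n powr (1 - r) / sqrt (real n))" by simp
    finally show ?case unfolding e .
  qed
  have "(\<lambda>n. real n powr (1/2 - r)) \<longlonglongrightarrow> 0" using r by real_asymp
  from tendsto_mult_left[OF this, of "1 / (1 - r)"]
  show "(\<lambda>n. 1 / (1 - r) * real n powr (1/2 - r)) \<longlonglongrightarrow> 0" by simp
qed

section \<open>The second moment of the degenerate part\<close>

context ustat_process
begin

text \<open>The two clauses isolate \<open>i\<close> as the smallest and \<open>j\<close> as the
  largest of the four indices. By \<open>quad_sym\<close> an extreme index of the second pair can be
  moved into the first.\<close>

definition quad_decay :: "real \<Rightarrow> real \<Rightarrow> bool" where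
  "quad_decay D \<eta> \<longleftrightarrow> 0 \<le> D \<and> 0 < \<eta> \<and>
     (\<forall>m i j k l. 1 \<le> m \<longrightarrow> 1 \<le> i \<longrightarrow> i + m \<le> j \<longrightarrow> i + m \<le> k \<longrightarrow> k < l \<longrightarrow>
        \<bar>quad i j k l\<bar> \<le> D * real m powr (- (1 + \<eta>))) \<and>
     (\<forall>m i j k l. 1 \<le> m \<longrightarrow> 1 \<le> i \<longrightarrow> 1 \<le> k \<longrightarrow> k < l \<longrightarrow> i + m \<le> j \<longrightarrow> l + m \<le> j \<longrightarrow>
        \<bar>quad i j k l\<bar> \<le> D * real m powr (- (1 + \<eta>)))"

definition degenerate_sum :: "nat \<Rightarrow> 'a \<Rightarrow> real" where
  "degenerate_sum n \<omega> = (\<Sum>(i, j)\<in>{(i, j). 1 \<le> i \<and> i < j \<and> j \<le> n}. h2 (X i \<omega>) (X j \<omega>))"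

context
  fixes D \<eta> :: real
  assumes dec: "quad_decay D \<eta>"
begin

text \<open>The square root of the decay rate, because one factor of decay will be shared by two
  gaps. \<open>Suc m\<close> admits gap 0; the factor \<open>2 powr (1 + \<eta>)\<close> pays for
  replacing \<open>m\<close> by \<open>Suc m\<close>, and \<open>1 + 2 * C2\<close> covers gap
  0.\<close>

definition gap_weight :: "nat \<Rightarrow> real" where
  "gap_weight m = sqrt (2 powr (1 + \<eta>) * D + 1 + 2 * C2) * real (Suc m) powr (- ((1 + \<eta>) / 2))"

lemma D_nonneg: "0 \<le> D" and \<eta>_pos: "0 < \<eta>"
  and first_gap: "1 \<le> m \<Longrightarrow> 1 \<le> i \<Longrightarrow> i + m \<le> j \<Longrightarrow> i + m \<le> k \<Longrightarrow> k < l \<Longrightarrow> \<bar>quad i j k l\<bar> \<le> D * real m powr (- (1 + \<eta>))"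
  and last_gap: "1 \<le> m \<Longrightarrow> 1 \<le> i \<Longrightarrow> 1 \<le> k \<Longrightarrow> k < l \<Longrightarrow> i + m \<le> j \<Longrightarrow> l + m \<le> j \<Longrightarrow> \<bar>quad i j k l\<bar> \<le> D * real m powr (- (1 + \<eta>))"
  using dec unfolding quad_decay_def by blast+

lemma gap_weight_nonneg: "0 \<le> gap_weight m"
  unfolding gap_weight_def using D_nonneg C2_pos by (intro mult_nonneg_nonneg real_sqrt_ge_zero add_nonneg_nonneg) auto

lemma gap_weight_square:
  "gap_weight m * gap_weight m = (2 powr (1 + \<eta>) * D + 1 + 2 * C2) * real (Suc m) powr (- (1 + \<eta>))"
proof -
  have K: "0 \<le> 2 powr (1 + \<eta>) * D + 1 + 2 * C2" using D_nonneg C2_pos by (intro add_nonneg_nonneg) auto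
  have "gap_weight m * gap_weight m = (sqrt (2 powr (1 + \<eta>) * D + 1 + 2 * C2) * sqrt (2 powr (1 + \<eta>) * D + 1 + 2 * C2))
     * (real (Suc m) powr (- ((1 + \<eta>) / 2)) * real (Suc m) powr (- ((1 + \<eta>) / 2)))"
    unfolding gap_weight_def by (simp only: mult_ac)
  also have "real (Suc m) powr (- ((1 + \<eta>) / 2)) * real (Suc m) powr (- ((1 + \<eta>) / 2)) = real (Suc m) powr (- (1 + \<eta>))"
  proof -
    have ex: "- ((1 + \<eta>) / 2) + - ((1 + \<eta>) / 2) = - (1 + \<eta>)"
      by (simp only: minus_add_distrib[symmetric] field_sum_of_halves)
    show ?thesis unfolding powr_add[symmetric] ex ..
  qed
  finally show ?thesis using K by simp
qed

lemma decay_le_gap_weight: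
  assumes m: "1 \<le> m"
  shows "D * real m powr (- (1 + \<eta>)) \<le> gap_weight m * gap_weight m"
proof -
  have "real m powr (- (1 + \<eta>)) \<le> (real (Suc m) / 2) powr (- (1 + \<eta>))"
    using m \<eta>_pos by (intro powr_mono2') auto
  also have "\<dots> = real (Suc m) powr (- (1 + \<eta>)) / 2 powr (- (1 + \<eta>))" by (simp add: powr_divide)
  also have "\<dots> = 2 powr (1 + \<eta>) * real (Suc m) powr (- (1 + \<eta>))"
    by (simp only: powr_minus[of 2] divide_inverse inverse_inverse_eq mult.commute)
  finally have "D * real m powr (- (1 + \<eta>)) \<le> D * (2 powr (1 + \<eta>) * real (Suc m) powr (- (1 + \<eta>)))"
    by (rule mult_left_mono[OF _ D_nonneg])
  also have "\<dots> \<le> (2 powr (1 + \<eta>) * D + 1 + 2 * C2) * real (Suc m) powr (- (1 + \<eta>))"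
    using C2_pos by (simp add: distrib_right mult_ac)
  finally show ?thesis unfolding gap_weight_square .
qed

lemma const_le_gap_weight: "1 + 2 * C2 \<le> gap_weight 0 * gap_weight 0"
  unfolding gap_weight_square using D_nonneg by simp

text \<open>The smaller of the two squares is at most the product.\<close>

lemma le_geometric_mean:
  fixes u v e :: real
  assumes "e \<le> u * u" "e \<le> v * v" "0 \<le> u" "0 \<le> v"
  shows "e \<le> u * v"
proof (cases "u \<le> v")
  case True
  then have "u * u \<le> u * v" using assms by (intro mult_left_mono) auto
  then show ?thesis using assms by linarith
next
  case False
  then have "v * v \<le> u * v" using assms by (intro mult_right_mono) auto
  then show ?thesis using assms by linarith
qed

definition gap_kernel :: "nat \<Rightarrow> nat \<Rightarrow> real" where
  "gap_kernel x y = gap_weight ((x - y) + (y - x))"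

lemma gap_kernel_nonneg: "0 \<le> gap_kernel x y" unfolding gap_kernel_def by (rule gap_weight_nonneg)

lemma gap_kernel_sym: "gap_kernel x y = gap_kernel y x" unfolding gap_kernel_def by (simp add: add.commute)

lemma quad_le_first:
  assumes "1 \<le> i" "i < j" "k < l" "i + m \<le> j" "i + m \<le> k"
  shows "\<bar>quad i j k l\<bar> \<le> gap_weight m * gap_weight m"
proof (cases "m = 0")
  case True then show ?thesis using quad_le_const[of i j k l] const_le_gap_weight assms by simp
next
  case False then show ?thesis using first_gap[of m i j k l] decay_le_gap_weight[of m] assms by simp
qed

lemma quad_le_last:
  assumes "1 \<le> i" "i < j" "1 \<le> k" "k < l" "i + m \<le> j" "l + m \<le> j"
  shows "\<bar>quad i j k l\<bar> \<le> gap_weight m * gap_weight m"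
proof (cases "m = 0")
  case True then show ?thesis using quad_le_const[of i j k l] const_le_gap_weight assms by simp
next
  case False then show ?thesis using last_gap[of m i k l j] decay_le_gap_weight[of m] assms by simp
qed

text \<open>Here \<open>i\<close> is the smallest index. Both the first and the last gap of the four
  sorted indices bound the expectation, and the geometric mean is the product of their weights. The
  two outer gaps separate \<open>i\<close> from \<open>j\<close> and \<open>k\<close> from
  \<open>l\<close> if \<open>j \<le> k\<close>; otherwise they separate \<open>i\<close> from
  \<open>k\<close> and \<open>j\<close> from \<open>l\<close>. The sum covers all orderings.\<close>

lemma quad_le_ordered:
  assumes i: "1 \<le> i" "i < j" and kl: "k < l" and ik: "i \<le> k"
  shows "\<bar>quad i j k l\<bar> \<le> gap_kernel i j * gap_kernel k l + gap_kernel i k * gap_kernel j l"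
proof -
  have nn: "0 \<le> gap_kernel i j * gap_kernel k l" "0 \<le> gap_kernel i k * gap_kernel j l"
    using gap_kernel_nonneg by auto
  consider "j \<le> k" | "k \<le> j" "j \<le> l" | "l \<le> j" by linarith
  then show ?thesis
  proof cases
    case 1
    have "\<bar>quad i j k l\<bar> \<le> gap_weight (j - i) * gap_weight (l - k)"
    proof (rule le_geometric_mean)
      show "\<bar>quad i j k l\<bar> \<le> gap_weight (j - i) * gap_weight (j - i)" by (rule quad_le_first) (use 1 assms in auto)
      show "\<bar>quad i j k l\<bar> \<le> gap_weight (l - k) * gap_weight (l - k)"
        unfolding quad_sym[of i j k l] by (rule quad_le_last) (use 1 assms in auto)
    qed (rule gap_weight_nonneg)+
    also have "\<dots> = gap_kernel i j * gap_kernel k l" using i kl by (simp add: gap_kernel_def)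
    finally show ?thesis using nn by linarith
  next
    case 2
    have "\<bar>quad i j k l\<bar> \<le> gap_weight (k - i) * gap_weight (l - j)"
    proof (rule le_geometric_mean)
      show "\<bar>quad i j k l\<bar> \<le> gap_weight (k - i) * gap_weight (k - i)" by (rule quad_le_first) (use 2 assms in auto)
      show "\<bar>quad i j k l\<bar> \<le> gap_weight (l - j) * gap_weight (l - j)"
        unfolding quad_sym[of i j k l] by (rule quad_le_last) (use 2 assms in auto)
    qed (rule gap_weight_nonneg)+
    also have "\<dots> = gap_kernel i k * gap_kernel j l" using 2 ik by (simp add: gap_kernel_def)
    finally show ?thesis using nn by linarith
  next
    case 3
    have "\<bar>quad i j k l\<bar> \<le> gap_weight (k - i) * gap_weight (j - l)"
    proof (rule le_geometric_mean)
      show "\<bar>quad i j k l\<bar> \<le> gap_weight (k - i) * gap_weight (k - i)" by (rule quad_le_first) (use 3 assms in auto)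
      show "\<bar>quad i j k l\<bar> \<le> gap_weight (j - l) * gap_weight (j - l)" by (rule quad_le_last) (use 3 assms in auto)
    qed (rule gap_weight_nonneg)+
    also have "\<dots> = gap_kernel i k * gap_kernel j l" using 3 ik by (simp add: gap_kernel_def)
    finally show ?thesis using nn by linarith
  qed
qed

lemma quad_le:
  assumes "1 \<le> i" "i < j" "1 \<le> k" "k < l"
  shows "\<bar>quad i j k l\<bar> \<le> gap_kernel i j * gap_kernel k l + gap_kernel i k * gap_kernel j l"
proof (cases "i \<le> k")
  case True then show ?thesis using quad_le_ordered[OF assms(1,2,4)] by simp
next
  case False
  then show ?thesis using quad_le_ordered[OF assms(3,4,2)] quad_sym[of i j k l] gap_kernel_sym[of k i] gap_kernel_sym[of l j]
    by (simp add: mult.commute)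
qed

lemma sum_gap_kernel_le:
  "(\<Sum>i\<in>{1..n}. \<Sum>j\<in>{1..n}. gap_kernel i j) \<le> real n * (2 * (\<Sum>m<n. gap_weight m))"
proof -
  have "(\<Sum>j\<in>{1..n}. gap_kernel i j) \<le> 2 * (\<Sum>m<n. gap_weight m)" if i: "i \<in> {1..n}" for i
  proof -
    have "(\<Sum>j\<in>{1..n}. gap_kernel i j) \<le> (\<Sum>j\<in>{1..i} \<union> {i..n}. gap_kernel i j)"
      by (rule sum_mono2) (use gap_kernel_nonneg in auto)
    also have "\<dots> \<le> (\<Sum>j\<in>{1..i}. gap_kernel i j) + (\<Sum>j\<in>{i..n}. gap_kernel i j)"
      using sum.union_inter[of "{1..i}" "{i..n}" "gap_kernel i"] sum_nonneg[of "{1..i} \<inter> {i..n}" "gap_kernel i"] gap_kernel_nonneg by simp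
    also have "(\<Sum>j\<in>{1..i}. gap_kernel i j) = (\<Sum>m<i. gap_weight m)"
      by (rule sum.reindex_bij_witness[of _ "\<lambda>m. i - m" "\<lambda>j. i - j"]) (auto simp: gap_kernel_def)
    also have "(\<Sum>m<i. gap_weight m) \<le> (\<Sum>m<n. gap_weight m)"
      by (rule sum_mono2) (use i gap_weight_nonneg in auto)
    also have "(\<Sum>j\<in>{i..n}. gap_kernel i j) = (\<Sum>m<Suc n - i. gap_weight m)"
      by (rule sum.reindex_bij_witness[of _ "\<lambda>m. i + m" "\<lambda>j. j - i"]) (auto simp: gap_kernel_def)
    also have "(\<Sum>m<Suc n - i. gap_weight m) \<le> (\<Sum>m<n. gap_weight m)"
      by (rule sum_mono2) (use i gap_weight_nonneg in auto)
    finally show ?thesis by simp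
  qed
  then have "(\<Sum>i\<in>{1..n}. \<Sum>j\<in>{1..n}. gap_kernel i j) \<le> (\<Sum>i\<in>{1..n}. 2 * (\<Sum>m<n. gap_weight m))" by (rule sum_mono)
  then show ?thesis by simp
qed

text \<open>The bound of \<open>quad_le\<close> is a sum of two products, and each of them
  factorises the fourfold sum into the square of a double sum of \<open>gap_kernel\<close>.\<close>

lemma degenerate_sum_square:
  "integrable M (\<lambda>\<omega>. (degenerate_sum n \<omega>)^2)"
  "(\<integral>\<omega>. (degenerate_sum n \<omega>)^2 \<partial>M) \<le> 2 * (real n * (2 * (\<Sum>m<n. gap_weight m)))^2"
proof -
  let ?P = "{(i, j). 1 \<le> i \<and> i < j \<and> j \<le> n}" and ?H = "\<lambda>p \<omega>. h2 (X (fst p) \<omega>) (X (snd p) \<omega>)"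
  let ?N = "{1..n}"
  have PN: "?P \<subseteq> ?N \<times> ?N" by auto
  have e: "(degenerate_sum n \<omega>)^2 = (\<Sum>p\<in>?P. \<Sum>q\<in>?P. ?H p \<omega> * ?H q \<omega>)" for \<omega>
    unfolding degenerate_sum_def power2_eq_square case_prod_unfold by (simp add: sum_product)
  have i: "integrable M (\<lambda>\<omega>. ?H p \<omega> * ?H q \<omega>)" if "p \<in> ?P" "q \<in> ?P" for p q
    by (rule quad_integrable) (use that in auto)
  show "integrable M (\<lambda>\<omega>. (degenerate_sum n \<omega>)^2)"
    unfolding e by (intro Bochner_Integration.integrable_sum i)
  have "(\<integral>\<omega>. (degenerate_sum n \<omega>)^2 \<partial>M) = (\<Sum>p\<in>?P. \<integral>\<omega>. (\<Sum>q\<in>?P. ?H p \<omega> * ?H q \<omega>) \<partial>M)"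
    unfolding e by (intro Bochner_Integration.integral_sum Bochner_Integration.integrable_sum i)
  also have "\<dots> = (\<Sum>p\<in>?P. \<Sum>q\<in>?P. quad (fst p) (snd p) (fst q) (snd q))"
    unfolding quad_def by (intro sum.cong refl Bochner_Integration.integral_sum i)
  also have "\<dots> \<le> (\<Sum>p\<in>?P. \<Sum>q\<in>?P. gap_kernel (fst p) (snd p) * gap_kernel (fst q) (snd q) + gap_kernel (fst p) (fst q) * gap_kernel (snd p) (snd q))"
    by (intro sum_mono order_trans[OF abs_ge_self quad_le]) auto
  \<comment> \<open>All terms are nonnegative, so summing over the full index square only enlarges
    the bound, and it creates the product structure that factorises.\<close>
  also have "\<dots> \<le> (\<Sum>p\<in>?N \<times> ?N. \<Sum>q\<in>?N \<times> ?N. gap_kernel (fst p) (snd p) * gap_kernel (fst q) (snd q) + gap_kernel (fst p) (fst q) * gap_kernel (snd p) (snd q))"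
  proof -
    have nn: "0 \<le> gap_kernel a b * gap_kernel c d + gap_kernel a' b' * gap_kernel c' d'" for a b c d a' b' c' d'
      using gap_kernel_nonneg by simp
    have "(\<Sum>p\<in>?P. \<Sum>q\<in>?P. gap_kernel (fst p) (snd p) * gap_kernel (fst q) (snd q) + gap_kernel (fst p) (fst q) * gap_kernel (snd p) (snd q))
       \<le> (\<Sum>p\<in>?P. \<Sum>q\<in>?N \<times> ?N. gap_kernel (fst p) (snd p) * gap_kernel (fst q) (snd q) + gap_kernel (fst p) (fst q) * gap_kernel (snd p) (snd q))"
      by (intro sum_mono sum_mono2 PN) (auto simp: nn)
    also have "\<dots> \<le> (\<Sum>p\<in>?N \<times> ?N. \<Sum>q\<in>?N \<times> ?N. gap_kernel (fst p) (snd p) * gap_kernel (fst q) (snd q) + gap_kernel (fst p) (fst q) * gap_kernel (snd p) (snd q))"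
      by (intro sum_mono2 PN sum_nonneg) (auto simp: nn)
    finally show ?thesis .
  qed
  also have "\<dots> = 2 * (\<Sum>i\<in>?N. \<Sum>j\<in>?N. gap_kernel i j)^2"
  proof -
    have 1: "(\<Sum>p\<in>?N \<times> ?N. \<Sum>q\<in>?N \<times> ?N. gap_kernel (fst p) (snd p) * gap_kernel (fst q) (snd q)) = (\<Sum>i\<in>?N. \<Sum>j\<in>?N. gap_kernel i j)^2"
      by (simp add: sum_product[symmetric] power2_eq_square sum.cartesian_product case_prod_unfold)
    have "(\<Sum>p\<in>?N \<times> ?N. \<Sum>q\<in>?N \<times> ?N. gap_kernel (fst p) (fst q) * gap_kernel (snd p) (snd q))
       = (\<Sum>i\<in>?N. \<Sum>j\<in>?N. \<Sum>k\<in>?N. \<Sum>l\<in>?N. gap_kernel i k * gap_kernel j l)"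
    proof -
      have "(\<Sum>p\<in>?N \<times> ?N. u p) = (\<Sum>i\<in>?N. \<Sum>j\<in>?N. u (i, j))" for u :: "nat \<times> nat \<Rightarrow> real"
        by (simp add: sum.cartesian_product)
      then show ?thesis by (simp only: fst_conv snd_conv)
    qed
    also have "\<dots> = (\<Sum>i\<in>?N. \<Sum>k\<in>?N. \<Sum>j\<in>?N. \<Sum>l\<in>?N. gap_kernel i k * gap_kernel j l)"
      by (intro sum.cong refl sum.swap)
    also have "\<dots> = (\<Sum>i\<in>?N. \<Sum>j\<in>?N. gap_kernel i j)^2"
      by (simp only: power2_eq_square sum_distrib_left[symmetric] sum_distrib_right[symmetric])
    finally show ?thesis using 1 by (simp add: sum.distrib)
  qed
  also have "\<dots> \<le> 2 * (real n * (2 * (\<Sum>m<n. gap_weight m)))^2"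
    by (intro mult_left_mono power_mono sum_gap_kernel_le sum_nonneg gap_kernel_nonneg) simp
  finally show "(\<integral>\<omega>. (degenerate_sum n \<omega>)^2 \<partial>M) \<le> 2 * (real n * (2 * (\<Sum>m<n. gap_weight m)))^2" .
qed

text \<open>The second moment is at most a constant times \<open>n^2\<close> times the squared
  partial sum of the weights. Division by \<open>n^3\<close> leaves the square of a quantity that
  \<open>sum_powr_over_sqrt_tendsto\<close> sends to 0.\<close>

lemma degenerate_sum_tendsto: "(\<lambda>n. (\<integral>\<omega>. (degenerate_sum n \<omega>)^2 \<partial>M) / real n ^ 3) \<longlonglongrightarrow> 0"
proof (rule Lim_null_comparison)
  let ?c = "sqrt (2 powr (1 + \<eta>) * D + 1 + 2 * C2)"
  let ?S = "\<lambda>n. \<Sum>a<n. real (Suc a) powr (- ((1 + \<eta>) / 2))"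
  have gw: "(\<Sum>m<n. gap_weight m) = ?c * ?S n" for n
    unfolding gap_weight_def by (simp add: sum_distrib_left)
  show "\<forall>\<^sub>F n in sequentially. norm ((\<integral>\<omega>. (degenerate_sum n \<omega>)^2 \<partial>M) / real n ^ 3) \<le> 8 * ?c^2 * (?S n / sqrt (real n))^2"
    using eventually_ge_at_top[of 1]
  proof eventually_elim
    case (elim n)
    have "norm ((\<integral>\<omega>. (degenerate_sum n \<omega>)^2 \<partial>M) / real n ^ 3) = (\<integral>\<omega>. (degenerate_sum n \<omega>)^2 \<partial>M) / real n ^ 3" by simp
    also have "\<dots> \<le> 2 * (real n * (2 * (?c * ?S n)))^2 / real n ^ 3"
      using degenerate_sum_square(2)[of n] unfolding gw by (intro divide_right_mono) auto
    also have "\<dots> = 8 * ?c^2 * ((?S n)^2 / real n)"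
    proof -
      have "2 * (real n * (2 * (c * S)))^2 / real n ^ 3 = 8 * c^2 * (S^2 / real n)" for c S :: real
        using elim by (simp add: power_mult_distrib power2_eq_square power3_eq_cube field_simps)
      then show ?thesis .
    qed
    also have "(?S n)^2 / real n = (?S n / sqrt (real n))^2" by (simp add: power_divide)
    finally show ?case .
  qed
  have "(\<lambda>n. ?S n / sqrt (real n)) \<longlonglongrightarrow> 0"
    by (rule sum_powr_over_sqrt_tendsto) (use \<eta>_pos in simp)
  then have "(\<lambda>n. 8 * ?c^2 * (?S n / sqrt (real n))^2) \<longlonglongrightarrow> 8 * ?c^2 * 0^2"
    by (intro tendsto_mult tendsto_const tendsto_power)
  then show "(\<lambda>n. 8 * ?c^2 * (?S n / sqrt (real n))^2) \<longlonglongrightarrow> 0" by simp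
qed

end

section \<open>Decay of the four-index expectations under absolute regularity\<close>

lemma integral_independent_copy:
  fixes \<Phi> :: "'b \<times> real \<Rightarrow> real"
  assumes V: "V \<in> M \<rightarrow>\<^sub>M T" and \<Phi>: "\<Phi> \<in> borel_measurable (T \<Otimes>\<^sub>M borel)"
  shows "(\<integral>z. \<Phi> z \<partial>(distr M T V \<Otimes>\<^sub>M law)) = (\<integral>z. \<Phi> (V (fst z), snd z) \<partial>(M \<Otimes>\<^sub>M law))"
    "(\<integral>z. \<Phi> (snd z, fst z) \<partial>(law \<Otimes>\<^sub>M distr M T V)) = (\<integral>z. \<Phi> (V (fst z), snd z) \<partial>(M \<Otimes>\<^sub>M law))"
proof -
  have d: "distr law borel (\<lambda>y. y) = law" by (rule distr_id2) simp
  have e: "distr M T V \<Otimes>\<^sub>M law = distr (M \<Otimes>\<^sub>M law) (T \<Otimes>\<^sub>M borel) (\<lambda>z. (V (fst z), snd z))"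
    using pair_measure_distr[OF V, of "\<lambda>y. y" law borel] by (simp add: d law.sigma_finite_measure_axioms case_prod_unfold)
  show 1: "(\<integral>z. \<Phi> z \<partial>(distr M T V \<Otimes>\<^sub>M law)) = (\<integral>z. \<Phi> (V (fst z), snd z) \<partial>(M \<Otimes>\<^sub>M law))"
    unfolding e using V \<Phi> by (subst integral_distr) auto
  interpret VT: prob_space "distr M T V" by (rule prob_space_distr[OF V])
  interpret L: pair_sigma_finite law "distr M T V" by unfold_locales
  have sw: "(\<lambda>(x, y). (y, x)) \<in> law \<Otimes>\<^sub>M distr M T V \<rightarrow>\<^sub>M distr M T V \<Otimes>\<^sub>M law" by (rule measurable_pair_swap')
  have \<Phi>': "\<Phi> \<in> borel_measurable (distr M T V \<Otimes>\<^sub>M law)"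
    using \<Phi> by (subst measurable_cong_sets[OF sets_pair_measure_cong[of _ T _ borel] refl]) auto
  interpret R: pair_sigma_finite "distr M T V" law by unfold_locales
  have "distr M T V \<Otimes>\<^sub>M law = distr (law \<Otimes>\<^sub>M distr M T V) (distr M T V \<Otimes>\<^sub>M law) (\<lambda>(x, y). (y, x))"
    by (rule R.distr_pair_swap)
  then have "(\<integral>z. \<Phi> z \<partial>(distr M T V \<Otimes>\<^sub>M law)) = (\<integral>z. \<Phi> z \<partial>(distr (law \<Otimes>\<^sub>M distr M T V) (distr M T V \<Otimes>\<^sub>M law) (\<lambda>(x, y). (y, x))))" by simp
  also have "\<dots> = (\<integral>z. \<Phi> (snd z, fst z) \<partial>(law \<Otimes>\<^sub>M distr M T V))"
    by (subst integral_distr[OF sw \<Phi>']) (simp add: case_prod_unfold)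
  finally show "(\<integral>z. \<Phi> (snd z, fst z) \<partial>(law \<Otimes>\<^sub>M distr M T V)) = (\<integral>z. \<Phi> (V (fst z), snd z) \<partial>(M \<Otimes>\<^sub>M law))"
    using 1 by simp
qed

text \<open>The triple holds the partner of the isolated variable and the second pair, the last
  component the isolated variable itself. In this arrangement one function serves both ends, up to a
  swap of the coordinates when the isolated variable belongs to the past.\<close>

definition clip_product :: "real \<Rightarrow> (real \<times> real \<times> real) \<times> real \<Rightarrow> real" where
  "clip_product T z = clip T (h2 (fst (fst z)) (snd z)) * clip T (h2 (fst (snd (fst z))) (snd (snd (fst z))))"

lemma clip_product_measurable: "clip_product T \<in> borel_measurable ((borel \<Otimes>\<^sub>M (borel \<Otimes>\<^sub>M borel)) \<Otimes>\<^sub>M borel)"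
  unfolding clip_product_def[abs_def] by measurable

lemma abs_clip_product_le: "0 < T \<Longrightarrow> \<bar>clip_product T z\<bar> \<le> T^2"
  unfolding clip_product_def power2_eq_square abs_mult by (intro mult_mono abs_clip_le) auto

lemma clip_quad_diff_le_beta_first:
  assumes i: "1 \<le> i" and m: "1 \<le> m" and j: "i + m \<le> j" and k: "i + m \<le> k" "k < l" and T: "0 < T"
  shows "\<bar>clip_quad T i j k l - clip_quad_indep T j k l\<bar> \<le> 2 * T^2 * beta_mix M X m"
proof -
  let ?S = "borel \<Otimes>\<^sub>M (borel \<Otimes>\<^sub>M borel) :: (real \<times> real \<times> real) measure"
  let ?V = "\<lambda>\<omega>. (X j \<omega>, X k \<omega>, X l \<omega>)"
  have U: "X i \<in> borel_measurable (past i)" by (rule measurable_past) (use i in auto)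
  have V: "?V \<in> future (i + m) \<rightarrow>\<^sub>M ?S" by (intro measurable_Pair measurable_future) (use j k in auto)
  have VM: "?V \<in> M \<rightarrow>\<^sub>M ?S" by (intro measurable_Pair X_measurable) (use i j k in auto)
  have f1: "1 \<le> i + m" using i by simp
  have sw: "(\<lambda>z. clip_product T (snd z, fst z)) \<in> borel_measurable (borel \<Otimes>\<^sub>M ?S)"
    by (rule measurable_compose[OF _ clip_product_measurable]) measurable
  have "\<bar>(\<integral>\<omega>. (\<lambda>z. clip_product T (snd z, fst z)) (X i \<omega>, ?V \<omega>) \<partial>M)
      - (\<integral>z. clip_product T (snd z, fst z) \<partial>(distr M borel (X i) \<Otimes>\<^sub>M distr M ?S ?V))\<bar>
      \<le> 2 * T^2 * beta_coeff M (past i) (future (i + m))"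
    by (rule beta_coeff_integral[OF subalgebra_past subalgebra_future[OF f1] U V sw])
      (use abs_clip_product_le[OF T] T in auto)
  also have "(\<integral>\<omega>. (\<lambda>z. clip_product T (snd z, fst z)) (X i \<omega>, ?V \<omega>) \<partial>M) = clip_quad T i j k l"
    unfolding clip_quad_def clip_product_def by (simp add: h2_sym[of "X j _"])
  also have "(\<integral>z. clip_product T (snd z, fst z) \<partial>(distr M borel (X i) \<Otimes>\<^sub>M distr M ?S ?V)) = clip_quad_indep T j k l"
    unfolding distr_X[OF i] integral_independent_copy(2)[OF VM clip_product_measurable]
    unfolding clip_quad_indep_def clip_product_def by simp
  also have "2 * T^2 * beta_coeff M (past i) (future (i + m)) \<le> 2 * T^2 * beta_mix M X m"
    by (intro mult_left_mono beta_coeff_le_beta_mix i) simp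
  finally show ?thesis .
qed

lemma clip_quad_diff_le_beta_last:
  assumes i: "1 \<le> i" and m: "1 \<le> m" and k: "1 \<le> k" "k < l" and j: "i + m \<le> j" "l + m \<le> j" and T: "0 < T"
  shows "\<bar>clip_quad T i j k l - clip_quad_indep T i k l\<bar> \<le> 2 * T^2 * beta_mix M X m"
proof -
  let ?S = "borel \<Otimes>\<^sub>M (borel \<Otimes>\<^sub>M borel) :: (real \<times> real \<times> real) measure"
  let ?U = "\<lambda>\<omega>. (X i \<omega>, X k \<omega>, X l \<omega>)"
  \<comment> \<open>The cut: the other three indices are at most \<open>j - m\<close>, and
    \<open>X j\<close> comes \<open>m\<close> steps later.\<close>
  define e where "e = j - m"
  have e: "1 \<le> e" "e + m = j" "i \<le> e" "l \<le> e" using i j by (auto simp: e_def)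
  have U: "?U \<in> past e \<rightarrow>\<^sub>M ?S" by (intro measurable_Pair measurable_past) (use i k e in auto)
  have UM: "?U \<in> M \<rightarrow>\<^sub>M ?S" by (intro measurable_Pair X_measurable) (use i k in auto)
  have V: "X j \<in> borel_measurable (future (e + m))" by (rule measurable_future) (use e in simp)
  have f1: "1 \<le> e + m" using e by simp
  have j1: "1 \<le> j" using i j by simp
  have "\<bar>(\<integral>\<omega>. clip_product T (?U \<omega>, X j \<omega>) \<partial>M)
      - (\<integral>z. clip_product T z \<partial>(distr M ?S ?U \<Otimes>\<^sub>M distr M borel (X j)))\<bar>
      \<le> 2 * T^2 * beta_coeff M (past e) (future (e + m))"
    by (rule beta_coeff_integral[OF subalgebra_past subalgebra_future[OF f1] U V clip_product_measurable])
      (use abs_clip_product_le[OF T] T in auto)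
  also have "(\<integral>\<omega>. clip_product T (?U \<omega>, X j \<omega>) \<partial>M) = clip_quad T i j k l"
    unfolding clip_quad_def clip_product_def by simp
  also have "(\<integral>z. clip_product T z \<partial>(distr M ?S ?U \<Otimes>\<^sub>M distr M borel (X j))) = clip_quad_indep T i k l"
    unfolding distr_X[OF j1] integral_independent_copy(1)[OF UM clip_product_measurable]
    unfolding clip_quad_indep_def clip_product_def by simp
  also have "2 * T^2 * beta_coeff M (past e) (future (e + m)) \<le> 2 * T^2 * beta_mix M X m"
    by (intro mult_left_mono beta_coeff_le_beta_mix e) simp
  finally show ?thesis .
qed

text \<open>Truncation at \<open>m powr ((1 + \<eta>) / \<delta>)\<close> gives the truncation error
  exactly the target order, so that only the price of the replacement remains to be
  estimated.\<close>

lemma quad_decayI: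
  assumes \<eta>: "0 < \<eta>" and E: "0 \<le> E"
    and first: "\<And>m i j k l. 1 \<le> m \<Longrightarrow> 1 \<le> i \<Longrightarrow> i + m \<le> j \<Longrightarrow> i + m \<le> k \<Longrightarrow> k < l \<Longrightarrow>
      \<bar>clip_quad (real m powr ((1 + \<eta>) / \<delta>)) i j k l - clip_quad_indep (real m powr ((1 + \<eta>) / \<delta>)) j k l\<bar> \<le> E * real m powr (- (1 + \<eta>))"
    and last: "\<And>m i j k l. 1 \<le> m \<Longrightarrow> 1 \<le> i \<Longrightarrow> 1 \<le> k \<Longrightarrow> k < l \<Longrightarrow> i + m \<le> j \<Longrightarrow> l + m \<le> j \<Longrightarrow>
      \<bar>clip_quad (real m powr ((1 + \<eta>) / \<delta>)) i j k l - clip_quad_indep (real m powr ((1 + \<eta>) / \<delta>)) i k l\<bar> \<le> E * real m powr (- (1 + \<eta>))"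
  shows "quad_decay (4 * C2 + E) \<eta>"
proof -
  have ex: "(x powr ((1 + \<eta>) / \<delta>)) powr (- \<delta>) = x powr (- (1 + \<eta>))" for x
    unfolding powr_powr using \<delta>_pos by simp
  show ?thesis
  unfolding quad_decay_def
proof (intro conjI allI impI \<eta>)
  show "0 \<le> 4 * C2 + E" using C2_pos E by simp
next
  fix m i j k l :: nat
  assume a: "1 \<le> m" "1 \<le> i" "i + m \<le> j" "i + m \<le> k" "k < l"
  have "\<bar>quad i j k l\<bar> \<le> 4 * C2 * (real m powr ((1 + \<eta>) / \<delta>)) powr (- \<delta>) + E * real m powr (- (1 + \<eta>))"
    using quad_le_clip_quad[of i j k l j "real m powr ((1 + \<eta>) / \<delta>)"] first[OF a] a by simp
  then show "\<bar>quad i j k l\<bar> \<le> (4 * C2 + E) * real m powr (- (1 + \<eta>))"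
    unfolding ex distrib_right .
next
  fix m i j k l :: nat
  assume a: "1 \<le> m" "1 \<le> i" "1 \<le> k" "k < l" "i + m \<le> j" "l + m \<le> j"
  have "\<bar>quad i j k l\<bar> \<le> 4 * C2 * (real m powr ((1 + \<eta>) / \<delta>)) powr (- \<delta>) + E * real m powr (- (1 + \<eta>))"
    using quad_le_clip_quad[of i j k l i "real m powr ((1 + \<eta>) / \<delta>)"] last[OF a] a by simp
  then show "\<bar>quad i j k l\<bar> \<le> (4 * C2 + E) * real m powr (- (1 + \<eta>))"
    unfolding ex distrib_right .
qed
qed

lemma quad_decay_beta:
  assumes \<rho>: "(2 + \<delta>) / \<delta> < \<rho>" and b: "0 \<le> b" "\<And>m. 1 \<le> m \<Longrightarrow> beta_mix M X m \<le> b * real m powr (- \<rho>)"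
  shows "\<exists>D \<eta>. quad_decay D \<eta>"
proof -
  \<comment> \<open>The solution of
    \<open>2 * (1 + \<eta>) / \<delta> - \<rho> = - (1 + \<eta>)\<close>, which gives the price
    \<open>T^2 * \<beta>(m)\<close> the order of the truncation error. Its positivity is the
    assumption on \<open>\<rho>\<close>.\<close>
  define \<eta> where "\<eta> = \<rho> * \<delta> / (2 + \<delta>) - 1"
  have \<eta>: "0 < \<eta>" using \<rho> \<delta>_pos unfolding \<eta>_def by (simp add: field_simps)
  have \<eta>1: "1 + \<eta> = \<rho> * \<delta> / (2 + \<delta>)" "(1 + \<eta>) / \<delta> = \<rho> / (2 + \<delta>)" unfolding \<eta>_def using \<delta>_pos by simp_all
  have ex: "2 * ((1 + \<eta>) / \<delta>) - \<rho> = - (1 + \<eta>)" unfolding \<eta>1(2) unfolding \<eta>1(1) using \<delta>_pos by (simp add: field_simps)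
  have le: "2 * (real m powr ((1 + \<eta>) / \<delta>))^2 * beta_mix M X m \<le> (2 * b) * real m powr (- (1 + \<eta>))" if m: "1 \<le> m" for m
  proof -
    have "2 * (real m powr ((1 + \<eta>) / \<delta>))^2 * beta_mix M X m \<le> 2 * (real m powr ((1 + \<eta>) / \<delta>))^2 * (b * real m powr (- \<rho>))"
      by (intro mult_left_mono b(2) m) simp
    also have "\<dots> = 2 * b * (real m powr (2 * ((1 + \<eta>) / \<delta>)) * real m powr (- \<rho>))"
      by (simp add: power2_eq_square powr_add[symmetric])
    also have "real m powr (2 * ((1 + \<eta>) / \<delta>)) * real m powr (- \<rho>) = real m powr (- (1 + \<eta>))"
      unfolding powr_add[symmetric] ex[symmetric] by simp
    finally show ?thesis .
  qed
  have pos: "0 < real m powr ((1 + \<eta>) / \<delta>)" if "1 \<le> m" for m using that by simp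
  have "quad_decay (4 * C2 + 2 * b) \<eta>"
  proof (rule quad_decayI[OF \<eta>])
    show "0 \<le> 2 * b" using b(1) by simp
  next
    fix m i j k l :: nat
    assume a: "1 \<le> m" "1 \<le> i" "i + m \<le> j" "i + m \<le> k" "k < l"
    show "\<bar>clip_quad (real m powr ((1 + \<eta>) / \<delta>)) i j k l - clip_quad_indep (real m powr ((1 + \<eta>) / \<delta>)) j k l\<bar>
        \<le> 2 * b * real m powr (- (1 + \<eta>))"
      by (rule order_trans[OF clip_quad_diff_le_beta_first[OF a(2,1,3,4,5) pos[OF a(1)]] le[OF a(1)]])
  next
    fix m i j k l :: nat
    assume a: "1 \<le> m" "1 \<le> i" "1 \<le> k" "k < l" "i + m \<le> j" "l + m \<le> j"
    show "\<bar>clip_quad (real m powr ((1 + \<eta>) / \<delta>)) i j k l - clip_quad_indep (real m powr ((1 + \<eta>) / \<delta>)) i k l\<bar>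
        \<le> 2 * b * real m powr (- (1 + \<eta>))"
      by (rule order_trans[OF clip_quad_diff_le_beta_last[OF a(2,1,3,4,5,6) pos[OF a(1)]] le[OF a(1)]])
  qed
  then show ?thesis by blast
qed

end

section \<open>Averaging a Lipschitz kernel over small cells\<close>

text \<open>The type argument stands for the outcome space of \<open>Q\<close>, over which a formula cannot quantify.\<close>

definition Lipschitz_at ::
    "'b itself \<Rightarrow> 'a measure \<Rightarrow> (nat \<Rightarrow> 'a \<Rightarrow> real) \<Rightarrow> (real \<Rightarrow> real \<Rightarrow> real) \<Rightarrow> real \<Rightarrow> real \<Rightarrow> bool" where
  "Lipschitz_at _ M X g \<epsilon> b \<longleftrightarrow>
     (\<forall>(Q :: 'b measure) U U' Z. prob_space Q \<longrightarrow>
        U \<in> borel_measurable Q \<longrightarrow> U' \<in> borel_measurable Q \<longrightarrow> Z \<in> borel_measurable Q \<longrightarrow>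
        pair_law Q U Z \<in> admissible_laws M X \<longrightarrow> pair_law Q U' Z \<in> admissible_laws M X \<longrightarrow>
        (\<integral>\<^sup>+\<omega>. ennreal (\<bar>g (U \<omega>) (Z \<omega>) - g (U' \<omega>) (Z \<omega>)\<bar> * indicator {\<omega>. \<bar>U \<omega> - U' \<omega>\<bar> \<le> \<epsilon>} \<omega>) \<partial>Q)
          \<le> ennreal b)"

lemma Lipschitz_atD:
  fixes Q :: "'b measure"
  assumes "Lipschitz_at TYPE('b) M X g \<epsilon> b" "prob_space Q"
    "U \<in> borel_measurable Q" "U' \<in> borel_measurable Q" "Z \<in> borel_measurable Q"
    "pair_law Q U Z \<in> admissible_laws M X" "pair_law Q U' Z \<in> admissible_laws M X"
  shows "(\<integral>\<^sup>+\<omega>. ennreal (\<bar>g (U \<omega>) (Z \<omega>) - g (U' \<omega>) (Z \<omega>)\<bar> * indicator {\<omega>. \<bar>U \<omega> - U' \<omega>\<bar> \<le> \<epsilon>} \<omega>) \<partial>Q) \<le> ennreal b"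
  using assms unfolding Lipschitz_at_def by blast

lemma P_Lipschitz_imp_Lipschitz_at:
  assumes "P_Lipschitz M X h" "(\<lambda>(x, y). h x y) \<in> borel_measurable (borel \<Otimes>\<^sub>M borel)"
  obtains L where "0 < L" "\<And>\<epsilon>. 0 < \<epsilon> \<Longrightarrow> Lipschitz_at TYPE('b) M X h \<epsilon> (L * \<epsilon>)"
proof (rule P_Lipschitz_any_space[OF assms, where 'b = 'b])
  fix L assume L: "0 < L" and l: "\<And>\<epsilon> (Q :: 'b measure) Y Y' Z. \<epsilon> > 0 \<Longrightarrow> prob_space Q \<Longrightarrow>
        Y \<in> borel_measurable Q \<Longrightarrow> Y' \<in> borel_measurable Q \<Longrightarrow> Z \<in> borel_measurable Q \<Longrightarrow>
        pair_law Q Y Z \<in> admissible_laws M X \<Longrightarrow> pair_law Q Y' Z \<in> admissible_laws M X \<Longrightarrow>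
        (\<integral>\<^sup>+\<omega>. ennreal (\<bar>h (Y \<omega>) (Z \<omega>) - h (Y' \<omega>) (Z \<omega>)\<bar> * indicator {\<omega>. \<bar>Y \<omega> - Y' \<omega>\<bar> \<le> \<epsilon>} \<omega>) \<partial>Q)
          \<le> ennreal (L * \<epsilon>)"
  show thesis
    by (rule that[OF L], unfold Lipschitz_at_def, intro allI impI) (rule l)
qed

lemma Lipschitz_at_mono: "Lipschitz_at TYPE('b) M X g \<epsilon> b \<Longrightarrow> b \<le> b' \<Longrightarrow> Lipschitz_at TYPE('b) M X g \<epsilon> b'"
  unfolding Lipschitz_at_def by (blast intro: order_trans ennreal_leI)

lemma Lipschitz_at_clip:
  assumes "Lipschitz_at TYPE('b) M X g \<epsilon> b"
  shows "Lipschitz_at TYPE('b) M X (\<lambda>x y. clip T (g x y)) \<epsilon> b"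
  unfolding Lipschitz_at_def
proof (intro allI impI)
  fix Q :: "'b measure" and U U' Z
  assume a: "prob_space Q" "U \<in> borel_measurable Q" "U' \<in> borel_measurable Q" "Z \<in> borel_measurable Q"
    "pair_law Q U Z \<in> admissible_laws M X" "pair_law Q U' Z \<in> admissible_laws M X"
  show "(\<integral>\<^sup>+\<omega>. ennreal (\<bar>clip T (g (U \<omega>) (Z \<omega>)) - clip T (g (U' \<omega>) (Z \<omega>))\<bar> * indicator {\<omega>. \<bar>U \<omega> - U' \<omega>\<bar> \<le> \<epsilon>} \<omega>) \<partial>Q) \<le> ennreal b"
    by (rule order_trans[OF _ Lipschitz_atD[OF assms a]])
      (intro nn_integral_mono ennreal_leI mult_right_mono abs_clip_diff_le indicator_pos_le)
qed

context ustat_process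
begin

lemma admissible_law_marginals:
  assumes Q: "prob_space Q" and [measurable]: "Y \<in> borel_measurable Q" "Z \<in> borel_measurable Q"
    and a: "pair_law Q Y Z \<in> admissible_laws M X"
  shows "distr Q borel Y = law" "distr Q borel Z = law"
proof -
  have fs: "distr Q borel Y = distr (pair_law Q Y Z) borel fst" "distr Q borel Z = distr (pair_law Q Y Z) borel snd"
    unfolding pair_law_def by (subst distr_distr; simp add: comp_def)+
  have "distr N borel fst = law \<and> distr N borel snd = law" if "N \<in> admissible_laws M X" for N
  proof -
    consider "N = law \<Otimes>\<^sub>M law" | k where "1 \<le> k" "N = pair_law M (X 1) (X k)"
      using \<open>N \<in> admissible_laws M X\<close> unfolding admissible_laws_def by auto
    then show ?thesis
    proof cases
      case 1
      have "distr (law \<Otimes>\<^sub>M law) borel fst = distr (law \<Otimes>\<^sub>M law) law fst" by (rule distr_cong) auto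
      moreover have "distr (law \<Otimes>\<^sub>M law) law fst = law" by (rule law.distr_pair_fst)
      moreover have "distr (law \<Otimes>\<^sub>M law) borel snd = distr (law \<Otimes>\<^sub>M law) law snd" by (rule distr_cong) auto
      moreover have "distr (law \<Otimes>\<^sub>M law) law snd = law"
      proof (rule measure_eqI)
        fix A assume "A \<in> sets (distr (law \<Otimes>\<^sub>M law) law snd)"
        then have A: "A \<in> sets law" by simp
        have "snd -` A \<inter> space (law \<Otimes>\<^sub>M law) = space law \<times> A" by (auto simp: space_pair_measure)
        then show "emeasure (distr (law \<Otimes>\<^sub>M law) law snd) A = emeasure law A"
          using A law.emeasure_space_1 by (simp add: emeasure_distr law.emeasure_pair_measure_Times)
      qed simp
      ultimately show ?thesis using 1 by simp
    next
      case 2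
      have [measurable]: "X 1 \<in> borel_measurable M" "X k \<in> borel_measurable M" using X_measurable 2 by auto
      have m: "(\<lambda>\<omega>. (X 1 \<omega>, X k \<omega>)) \<in> M \<rightarrow>\<^sub>M borel \<Otimes>\<^sub>M borel" by measurable
      have "distr N borel fst = distr M borel (X 1)" "distr N borel snd = distr M borel (X k)"
        unfolding 2(2) pair_law_def distr_distr[OF measurable_fst m] distr_distr[OF measurable_snd m]
        by (simp_all add: comp_def)
      then show ?thesis using distr_X[of 1] distr_X[OF 2(1)] by simp
    qed
  qed
  from this[OF a] show "distr Q borel Y = law" "distr Q borel Z = law" unfolding fs by auto
qed

text \<open>In the difference of \<open>h2\<close> the value of \<open>h1\<close> at
  \<open>Z\<close> cancels, and the difference of \<open>h1\<close> is an integral over an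
  independent second argument. So the Lipschitz condition is used a second time, on the product of
  \<open>Q\<close> with \<open>law\<close>, where both pairs have the product law; this is the
  instance at type \<open>'b \<times> real\<close>.\<close>

lemma h2_Lipschitz:
  assumes P: "P_Lipschitz M X h"
  obtains L where "0 < L" "\<And>\<epsilon>. 0 < \<epsilon> \<Longrightarrow> Lipschitz_at TYPE('b) M X h2 \<epsilon> (L * \<epsilon>)"
proof (rule P_Lipschitz_imp_Lipschitz_at[OF P h_measurable, where 'b = 'b],
    rule P_Lipschitz_imp_Lipschitz_at[OF P h_measurable, where 'b = "'b \<times> real"])
  fix L1 assume L1: "0 < L1" and l1: "\<And>\<epsilon>. 0 < \<epsilon> \<Longrightarrow> Lipschitz_at TYPE('b) M X h \<epsilon> (L1 * \<epsilon>)"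
  fix L2 assume L2: "0 < L2" and l2: "\<And>\<epsilon>. 0 < \<epsilon> \<Longrightarrow> Lipschitz_at TYPE('b \<times> real) M X h \<epsilon> (L2 * \<epsilon>)"
  show thesis
  proof (rule that[of "L1 + L2"])
    show "0 < L1 + L2" using L1 L2 by simp
    fix \<epsilon> :: real assume e: "\<epsilon> > 0"
    show "Lipschitz_at TYPE('b) M X h2 \<epsilon> ((L1 + L2) * \<epsilon>)"
      unfolding Lipschitz_at_def
    proof (intro allI impI)
      fix Q :: "'b measure" and Y Y' Z
      assume Q: "prob_space Q"
        and m[measurable]: "Y \<in> borel_measurable Q" "Y' \<in> borel_measurable Q" "Z \<in> borel_measurable Q"
        and a: "pair_law Q Y Z \<in> admissible_laws M X" "pair_law Q Y' Z \<in> admissible_laws M X"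
      interpret Q: prob_space Q by (rule Q)
      interpret QL: pair_prob_space Q law by unfold_locales
      let ?I = "\<lambda>\<omega>. indicator {\<omega>. \<bar>Y \<omega> - Y' \<omega>\<bar> \<le> \<epsilon>} \<omega> :: real"
      have Im[measurable]: "?I \<in> borel_measurable Q" by (simp add: indicator_def) measurable
      have dY: "distr Q borel Y = law" "distr Q borel Y' = law"
        using admissible_law_marginals[OF Q m(1,3) a(1)] admissible_law_marginals[OF Q m(2,3) a(2)] by auto
      have adm: "pair_law (Q \<Otimes>\<^sub>M law) (\<lambda>z. U (fst z)) snd \<in> admissible_laws M X"
        if U[measurable]: "U \<in> borel_measurable Q" and d: "distr Q borel U = law" for U
      proof -
        have dl: "distr law borel (\<lambda>y. y) = law" by (rule distr_id2) simp
        have "distr Q borel U \<Otimes>\<^sub>M distr law borel (\<lambda>y. y) = distr (Q \<Otimes>\<^sub>M law) (borel \<Otimes>\<^sub>M borel) (\<lambda>(x, y). (U x, y))"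
          by (rule pair_measure_distr) (auto simp: dl law.sigma_finite_measure_axioms)
        then have "pair_law (Q \<Otimes>\<^sub>M law) (\<lambda>z. U (fst z)) snd = law \<Otimes>\<^sub>M law"
          unfolding pair_law_def by (simp add: d dl case_prod_unfold)
        then show ?thesis unfolding admissible_laws_def by simp
      qed
      have hi: "AE \<omega> in Q. integrable law (h (U \<omega>))" if U: "U \<in> borel_measurable Q" and d: "distr Q borel U = law" for U
      proof -
        have "AE x in distr Q borel U. integrable law (h x)" unfolding d using AE_h_integrable by eventually_elim simp
        then show ?thesis by (rule AE_distrD[OF U])
      qed
      have "(\<integral>\<^sup>+\<omega>. ennreal (\<bar>h1 M X h (Y \<omega>) - h1 M X h (Y' \<omega>)\<bar> * ?I \<omega>) \<partial>Q)
          \<le> (\<integral>\<^sup>+\<omega>. (\<integral>\<^sup>+z. ennreal (\<bar>h (Y \<omega>) z - h (Y' \<omega>) z\<bar> * ?I \<omega>) \<partial>law) \<partial>Q)"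
      proof (rule nn_integral_mono_AE)
        show "AE \<omega> in Q. ennreal (\<bar>h1 M X h (Y \<omega>) - h1 M X h (Y' \<omega>)\<bar> * ?I \<omega>)
            \<le> (\<integral>\<^sup>+z. ennreal (\<bar>h (Y \<omega>) z - h (Y' \<omega>) z\<bar> * ?I \<omega>) \<partial>law)"
          using hi[OF m(1) dY(1)] hi[OF m(2) dY(2)]
        proof eventually_elim
          case (elim \<omega>)
          have i: "integrable law (\<lambda>z. (h (Y \<omega>) z - h (Y' \<omega>) z) * ?I \<omega>)" using elim by auto
          have eq: "(h1 M X h (Y \<omega>) - h1 M X h (Y' \<omega>)) * ?I \<omega> = (\<integral>z. (h (Y \<omega>) z - h (Y' \<omega>) z) * ?I \<omega> \<partial>law)"
            unfolding h1_def using elim by simp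
          have ab: "\<bar>u\<bar> * ?I \<omega> = \<bar>u * ?I \<omega>\<bar>" for u by (simp add: abs_mult)
          have "ennreal (\<bar>h1 M X h (Y \<omega>) - h1 M X h (Y' \<omega>)\<bar> * ?I \<omega>) = ennreal (norm (\<integral>z. (h (Y \<omega>) z - h (Y' \<omega>) z) * ?I \<omega> \<partial>law))"
            unfolding ab eq real_norm_def ..
          also have "\<dots> \<le> (\<integral>\<^sup>+z. norm ((h (Y \<omega>) z - h (Y' \<omega>) z) * ?I \<omega>) \<partial>law)"
            by (rule integral_norm_bound_ennreal[OF i])
          finally show ?case by (simp add: abs_mult)
        qed
      qed
      also have "\<dots> = (\<integral>\<^sup>+t. ennreal (\<bar>h (Y (fst t)) (snd t) - h (Y' (fst t)) (snd t)\<bar>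
          * indicator {t. \<bar>Y (fst t) - Y' (fst t)\<bar> \<le> \<epsilon>} t) \<partial>(Q \<Otimes>\<^sub>M law))"
      proof -
        have [measurable]: "(\<lambda>t. ennreal (\<bar>h (Y (fst t)) (snd t) - h (Y' (fst t)) (snd t)\<bar>
          * ?I (fst t))) \<in> borel_measurable (Q \<Otimes>\<^sub>M law)" by measurable
        have "(\<integral>\<^sup>+\<omega>. (\<integral>\<^sup>+z. ennreal (\<bar>h (Y \<omega>) z - h (Y' \<omega>) z\<bar> * ?I \<omega>) \<partial>law) \<partial>Q)
           = (\<integral>\<^sup>+t. ennreal (\<bar>h (Y (fst t)) (snd t) - h (Y' (fst t)) (snd t)\<bar> * ?I (fst t)) \<partial>(Q \<Otimes>\<^sub>M law))"
          by (subst law.nn_integral_fst[symmetric]) auto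
        then show ?thesis by (simp add: indicator_def)
      qed
      also have "\<dots> \<le> ennreal (L2 * \<epsilon>)"
        by (rule Lipschitz_atD[OF l2[OF e] QL.P.prob_space_axioms _ _ _ adm[OF m(1) dY(1)] adm[OF m(2) dY(2)]]) auto
      finally have 2: "(\<integral>\<^sup>+\<omega>. ennreal (\<bar>h1 M X h (Y \<omega>) - h1 M X h (Y' \<omega>)\<bar> * ?I \<omega>) \<partial>Q) \<le> ennreal (L2 * \<epsilon>)" .
      have "(\<integral>\<^sup>+\<omega>. ennreal (\<bar>h2 (Y \<omega>) (Z \<omega>) - h2 (Y' \<omega>) (Z \<omega>)\<bar> * ?I \<omega>) \<partial>Q)
         \<le> (\<integral>\<^sup>+\<omega>. ennreal (\<bar>h (Y \<omega>) (Z \<omega>) - h (Y' \<omega>) (Z \<omega>)\<bar> * ?I \<omega>) + ennreal (\<bar>h1 M X h (Y \<omega>) - h1 M X h (Y' \<omega>)\<bar> * ?I \<omega>) \<partial>Q)"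
      proof (rule nn_integral_mono)
        fix \<omega>
        have "\<bar>h2 (Y \<omega>) (Z \<omega>) - h2 (Y' \<omega>) (Z \<omega>)\<bar> \<le> \<bar>h (Y \<omega>) (Z \<omega>) - h (Y' \<omega>) (Z \<omega>)\<bar> + \<bar>h1 M X h (Y \<omega>) - h1 M X h (Y' \<omega>)\<bar>"
          unfolding h2_def by linarith
        then have "\<bar>h2 (Y \<omega>) (Z \<omega>) - h2 (Y' \<omega>) (Z \<omega>)\<bar> * ?I \<omega> \<le> \<bar>h (Y \<omega>) (Z \<omega>) - h (Y' \<omega>) (Z \<omega>)\<bar> * ?I \<omega> + \<bar>h1 M X h (Y \<omega>) - h1 M X h (Y' \<omega>)\<bar> * ?I \<omega>"
          unfolding distrib_right[symmetric] by (intro mult_right_mono) auto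
        then show "ennreal (\<bar>h2 (Y \<omega>) (Z \<omega>) - h2 (Y' \<omega>) (Z \<omega>)\<bar> * ?I \<omega>) \<le> ennreal (\<bar>h (Y \<omega>) (Z \<omega>) - h (Y' \<omega>) (Z \<omega>)\<bar> * ?I \<omega>) + ennreal (\<bar>h1 M X h (Y \<omega>) - h1 M X h (Y' \<omega>)\<bar> * ?I \<omega>)"
          by (simp flip: ennreal_plus)
      qed
      also have "\<dots> = (\<integral>\<^sup>+\<omega>. ennreal (\<bar>h (Y \<omega>) (Z \<omega>) - h (Y' \<omega>) (Z \<omega>)\<bar> * ?I \<omega>) \<partial>Q) + (\<integral>\<^sup>+\<omega>. ennreal (\<bar>h1 M X h (Y \<omega>) - h1 M X h (Y' \<omega>)\<bar> * ?I \<omega>) \<partial>Q)"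
        by (rule nn_integral_add) measurable
      also have "\<dots> \<le> ennreal (L1 * \<epsilon>) + ennreal (L2 * \<epsilon>)"
        by (intro add_mono 2 Lipschitz_atD[OF l1[OF e] Q m a])
      also have "\<dots> = ennreal ((L1 + L2) * \<epsilon>)" using L1 L2 e by (simp add: distrib_right flip: ennreal_plus)
      finally show "(\<integral>\<^sup>+\<omega>. ennreal (\<bar>h2 (Y \<omega>) (Z \<omega>) - h2 (Y' \<omega>) (Z \<omega>)\<bar> * ?I \<omega>) \<partial>Q) \<le> ennreal ((L1 + L2) * \<epsilon>)" .
    qed
  qed
qed

section \<open>Cell averages and the maximal coupling\<close>

lemma cell_decompose:
  fixes cell :: "'b \<Rightarrow> nat"
  assumes "\<And>x. cell x \<le> N"
  shows "(\<Sum>i\<le>N. indicator {x. cell x = i} x * f i :: real) = f (cell x)"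
proof -
  have "(\<Sum>i\<le>N. indicator {x. cell x = i} x * f i) = (\<Sum>i\<le>N. if i = cell x then f i else 0)"
    by (rule sum.cong) (auto simp: indicator_def)
  then show ?thesis using assms[of x] by simp
qed

text \<open>The conditional mean of \<open>g x y\<close> given that \<open>x\<close> lies in cell
  \<open>i\<close>; for a null cell it is 0 by the convention for division.\<close>

definition cell_avg :: "(real \<Rightarrow> nat) \<Rightarrow> (real \<Rightarrow> real \<Rightarrow> real) \<Rightarrow> nat \<Rightarrow> real \<Rightarrow> real" where
  "cell_avg cell g i y = (\<integral>x. indicator {x. cell x = i} x * g x y \<partial>law) / measure law {x. cell x = i}"

lemma cell_sets:
  assumes "cell \<in> borel \<rightarrow>\<^sub>M count_space UNIV"
  shows "{x. cell x = i} \<in> sets borel"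
  using measurable_sets[OF assms, of "{i}"] by (simp add: vimage_def)

lemma cell_avg_measurable:
  assumes c: "cell \<in> borel \<rightarrow>\<^sub>M count_space UNIV" and g: "(\<lambda>(x, y). g x y) \<in> borel_measurable (borel \<Otimes>\<^sub>M borel)"
  shows "cell_avg cell g i \<in> borel_measurable borel"
proof -
  have [measurable]: "{x. cell x = i} \<in> sets borel" by (rule cell_sets[OF c])
  have gm: "(\<lambda>z. g (snd z) (fst z)) \<in> borel_measurable (borel \<Otimes>\<^sub>M law)"
    using measurable_compose[OF _ g, of "\<lambda>z. (snd z, fst z)" "borel \<Otimes>\<^sub>M law"] by simp
  have "(\<lambda>y. \<integral>x. indicator {x. cell x = i} x * g x y \<partial>law) \<in> borel_measurable borel"
    by (rule law.borel_measurable_lebesgue_integral) (use gm in \<open>simp add: case_prod_unfold\<close>)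
  then show ?thesis unfolding cell_avg_def[abs_def] by simp
qed

lemma abs_cell_avg_le:
  assumes c: "cell \<in> borel \<rightarrow>\<^sub>M count_space UNIV" and g: "(\<lambda>(x, y). g x y) \<in> borel_measurable (borel \<Otimes>\<^sub>M borel)"
    and b: "\<And>x y. \<bar>g x y\<bar> \<le> K"
  shows "\<bar>cell_avg cell g i y\<bar> \<le> K"
proof -
  have K: "0 \<le> K" using b[of 0 0] by linarith
  have [measurable]: "{x. cell x = i} \<in> sets borel" by (rule cell_sets[OF c])
  have gm[measurable]: "(\<lambda>x. g x y) \<in> borel_measurable borel" using measurable_compose[OF _ g, of "\<lambda>x. (x, y)" borel] by simp
  have "\<bar>\<integral>x. indicator {x. cell x = i} x * g x y \<partial>law\<bar> \<le> (\<integral>x. \<bar>indicator {x. cell x = i} x * g x y\<bar> \<partial>law)"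
    by (rule integral_abs_bound)
  also have "\<dots> \<le> (\<integral>x. indicator {x. cell x = i} x * K \<partial>law)"
  proof (rule integral_mono)
    show "integrable law (\<lambda>x. \<bar>indicator {x. cell x = i} x * g x y\<bar>)"
      by (rule law.integrable_bounded[of _ K], measurable, use b K in \<open>auto simp: indicator_def\<close>)
    show "integrable law (\<lambda>x. indicator {x. cell x = i} x * K)"
      by (rule law.integrable_bounded[of _ K], measurable, use K in \<open>auto simp: indicator_def\<close>)
  qed (use b in \<open>auto simp: indicator_def\<close>)
  also have "\<dots> = measure law {x. cell x = i} * K" by simp
  finally have "\<bar>\<integral>x. indicator {x. cell x = i} x * g x y \<partial>law\<bar> \<le> measure law {x. cell x = i} * K" .
  then show ?thesis
    unfolding cell_avg_def abs_divide using K
    by (cases "measure law {x. cell x = i} = 0") (auto simp: divide_le_eq zero_less_measure_iff mult.commute less_le)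
qed

text \<open>The coupling: given \<open>G\<close>, the cell of an independent copy \<open>x'\<close> of \<open>V\<close> is coupled maximally to the
  cell of \<open>V\<close>, and \<open>x'\<close> is drawn from \<open>law\<close> conditioned on its cell. \<open>W i \<omega>\<close> is the density of \<open>x'\<close> on
  cell \<open>i\<close>. Divisions by \<open>0\<close> occur only on null events, or multiply a factor \<open>0\<close>.\<close>

lemma cell_average_approx:
  fixes \<Omega> :: "'b measure"
  assumes \<Omega>: "prob_space \<Omega>" and G: "subalgebra \<Omega> G"
    and V[measurable]: "V \<in> borel_measurable \<Omega>" and Y: "Y \<in> borel_measurable G"
    and adm: "pair_law \<Omega> V Y \<in> admissible_laws M X"
    and cm: "cell \<in> borel \<rightarrow>\<^sub>M count_space UNIV" and cN: "\<And>x. cell x \<le> N"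
    and c\<epsilon>: "\<And>x x'. cell x = cell x' \<Longrightarrow> cell x < N \<Longrightarrow> \<bar>x - x'\<bar> \<le> \<epsilon>"
    and d: "(\<Sum>i\<le>N. \<integral>\<omega>. \<bar>real_cond_exp \<Omega> G (\<lambda>\<omega>. indicator {x. cell x = i} (V \<omega>)) \<omega> - measure law {x. cell x = i}\<bar> \<partial>\<Omega>) \<le> d"
    and g: "(\<lambda>(x, y). g x y) \<in> borel_measurable (borel \<Otimes>\<^sub>M borel)" and gK: "\<And>x y. \<bar>g x y\<bar> \<le> K"
    and L: "0 \<le> l"
    and Lip: "Lipschitz_at TYPE('b \<times> real) M X g \<epsilon> l"
  shows "(\<integral>\<omega>. \<bar>g (V \<omega>) (Y \<omega>) - cell_avg cell g (cell (V \<omega>)) (Y \<omega>)\<bar> \<partial>\<Omega>)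
    \<le> l + 2 * K * (d + measure law {x. cell x = N})"
proof -
  interpret O: prob_space \<Omega> by (rule \<Omega>)
  interpret OG: finite_measure_subalgebra \<Omega> G by unfold_locales (rule G)
  interpret OL: pair_prob_space \<Omega> law by unfold_locales
  have YO[measurable]: "Y \<in> borel_measurable \<Omega>" by (rule measurable_from_subalg[OF G Y])
  note cm[measurable]
  have K0: "0 \<le> K" using gK[of 0 0] by linarith
  have gOL[measurable (raw)]: "(\<lambda>x. g (u x) (v x)) \<in> borel_measurable R"
    if "u \<in> borel_measurable R" "v \<in> borel_measurable R" for u v and R :: "('b \<times> real) measure"
    using measurable_compose[OF measurable_Pair[OF that] g] by simp
  have gO[measurable (raw)]: "(\<lambda>x. g (u x) (v x)) \<in> borel_measurable R"
    if "u \<in> borel_measurable R" "v \<in> borel_measurable R" for u v and R :: "'b measure"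
    using measurable_compose[OF measurable_Pair[OF that] g] by simp
  have gR[measurable (raw)]: "(\<lambda>x. g (u x) (v x)) \<in> borel_measurable R"
    if "u \<in> borel_measurable R" "v \<in> borel_measurable R" for u v and R :: "real measure"
    using measurable_compose[OF measurable_Pair[OF that] g] by simp
  define A where "A = (\<lambda>i. {x. cell x = i})"
  have Am[measurable]: "A i \<in> sets borel" for i unfolding A_def by (rule cell_sets[OF cm])
  define q where "q = (\<lambda>i. measure law (A i))"
  have q0: "0 \<le> q i" for i by (simp add: q_def)
  have cover: "(\<Sum>i\<le>N. indicator (A i) x * f i :: real) = f (cell x)" for x f
    unfolding A_def by (rule cell_decompose[OF cN])
  have bsum: "(\<Sum>i\<le>N. measure law (B \<inter> A i)) = measure law B" if B: "B \<in> sets borel" for B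
  proof -
    have "measure law (\<Union>i\<in>{..N}. B \<inter> A i) = (\<Sum>i\<le>N. measure law (B \<inter> A i))"
      by (rule law.finite_measure_finite_Union) (use B in \<open>auto simp: disjoint_family_on_def A_def\<close>)
    moreover have "(\<Union>i\<in>{..N}. B \<inter> A i) = B" using cN by (auto simp: A_def)
    ultimately show ?thesis by simp
  qed
  have qsum: "(\<Sum>i\<le>N. q i) = 1" using bsum[of UNIV] by (simp add: q_def)
  define e where "e = (\<lambda>i. real_cond_exp \<Omega> G (\<lambda>\<omega>. indicator (A i) (V \<omega>)))"
  \<comment> \<open>The clamp makes the bounds of a conditional probability hold at every point, so
    that the coupling weights built from it are bounded everywhere.\<close>
  define p where "p = (\<lambda>i \<omega>. max 0 (min 1 (e i \<omega>)))"
  have eG[measurable]: "e i \<in> borel_measurable G" for i unfolding e_def by measurable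
  have pG[measurable]: "p i \<in> borel_measurable G" for i unfolding p_def by measurable
  have p01: "0 \<le> p i \<omega>" "p i \<omega> \<le> 1" for i \<omega> unfolding p_def by auto
  have IAm[measurable]: "(\<lambda>\<omega>. indicator (A i) (V \<omega>) :: real) \<in> borel_measurable \<Omega>" for i
    by (rule measurable_compose[OF V]) simp
  have Ii: "integrable \<Omega> (\<lambda>\<omega>. indicator (A i) (V \<omega>) :: real)" for i
    by (rule O.integrable_bounded[OF IAm, of _ 1]) (simp add: indicator_def)
  have pe: "AE \<omega> in \<Omega>. p i \<omega> = e i \<omega>" for i
  proof -
    have "AE \<omega> in \<Omega>. e i \<omega> \<ge> 0" unfolding e_def by (rule OG.real_cond_exp_ge_c[OF Ii]) simp
    moreover have "AE \<omega> in \<Omega>. e i \<omega> \<le> 1" unfolding e_def by (rule OG.real_cond_exp_le_c[OF Ii]) (simp add: indicator_def)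
    ultimately show ?thesis by eventually_elim (simp add: p_def)
  qed
  have psum: "AE \<omega> in \<Omega>. (\<Sum>i\<le>N. p i \<omega>) = 1"
  proof -
    have 1: "AE \<omega> in \<Omega>. real_cond_exp \<Omega> G (\<lambda>\<omega>. \<Sum>i\<le>N. indicator (A i) (V \<omega>)) \<omega> = (\<Sum>i\<le>N. e i \<omega>)"
      unfolding e_def by (rule OG.real_cond_exp_sum[OF Ii])
    have c1: "(\<lambda>\<omega>. \<Sum>i\<le>N. indicator (A i) (V \<omega>) :: real) = (\<lambda>_. 1)" using cover[of _ "\<lambda>_. 1"] by simp
    have "AE \<omega> in \<Omega>. real_cond_exp \<Omega> G (\<lambda>_. 1) \<omega> = 1" by (rule OG.real_cond_exp_F_meas) auto
    moreover have "AE \<omega> in \<Omega>. \<forall>i\<in>{..N}. p i \<omega> = e i \<omega>" by (rule AE_finite_allI) (use pe in auto)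
    ultimately show ?thesis
      using 1[unfolded c1]
    proof eventually_elim
      case (elim \<omega>)
      then show ?case using sum.cong[of "{..N}" "{..N}" "\<lambda>i. p i \<omega>" "\<lambda>i. e i \<omega>"] by simp
    qed
  qed
  have E1: "(\<integral>\<omega>. indicator (A j) (V \<omega>) * f \<omega> \<partial>\<Omega>) = (\<integral>\<omega>. p j \<omega> * f \<omega> \<partial>\<Omega>)"
    if f[measurable]: "f \<in> borel_measurable G" and fb: "\<And>\<omega>. \<bar>f \<omega>\<bar> \<le> b" for j f b
  proof -
    have fO[measurable]: "f \<in> borel_measurable \<Omega>" by (rule measurable_from_subalg[OF G f])
    have i: "integrable \<Omega> (\<lambda>\<omega>. f \<omega> * indicator (A j) (V \<omega>))"
      by (rule O.integrable_bounded[of _ b], measurable, use fb in \<open>auto simp: indicator_def intro: order_trans[OF abs_ge_zero]\<close>)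
    have "(\<integral>\<omega>. f \<omega> * e j \<omega> \<partial>\<Omega>) = (\<integral>\<omega>. f \<omega> * indicator (A j) (V \<omega>) \<partial>\<Omega>)"
      unfolding e_def by (rule OG.real_cond_exp_intg(2)[OF i f]) measurable
    moreover have "(\<integral>\<omega>. f \<omega> * e j \<omega> \<partial>\<Omega>) = (\<integral>\<omega>. p j \<omega> * f \<omega> \<partial>\<Omega>)"
    proof (rule integral_cong_AE)
      show "AE \<omega> in \<Omega>. f \<omega> * e j \<omega> = p j \<omega> * f \<omega>" using pe[of j] by eventually_elim simp
    qed (use measurable_from_subalg[OF G eG] measurable_from_subalg[OF G pG] in auto)
    ultimately show ?thesis by (simp add: mult.commute)
  qed
  \<comment> \<open>The maximal coupling of the conditional cell law \<open>p\<close> with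
    \<open>q\<close>: \<open>v i\<close> is the probability of leaving cell \<open>i\<close>, which
    has excess mass; \<open>D\<close> is the total variation distance; \<open>r\<close> distributes
    the mass that leaves over the cells with a deficit.\<close>
  define v where "v = (\<lambda>i \<omega>. max 0 (p i \<omega> - q i) / p i \<omega>)"
  define D where "D = (\<lambda>\<omega>. \<Sum>i\<le>N. max 0 (q i - p i \<omega>))"
  define r where "r = (\<lambda>i \<omega>. max 0 (q i - p i \<omega>) / D \<omega>)"
  have vG[measurable]: "v i \<in> borel_measurable G" for i unfolding v_def by measurable
  have DG[measurable]: "D \<in> borel_measurable G" unfolding D_def by measurable
  have rG[measurable]: "r i \<in> borel_measurable G" for i unfolding r_def by measurable
  have v01: "0 \<le> v i \<omega>" "v i \<omega> \<le> 1" for i \<omega>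
    unfolding v_def using p01(1)[of i \<omega>] q0[of i] by (auto simp: divide_le_eq)
  have pv: "p i \<omega> * v i \<omega> = max 0 (p i \<omega> - q i)" for i \<omega>
    unfolding v_def using p01(1)[of i \<omega>] q0[of i] by (cases "p i \<omega> = 0") auto
  have D0: "0 \<le> D \<omega>" for \<omega> unfolding D_def by (simp add: sum_nonneg)
  have Dge: "max 0 (q i - p i \<omega>) \<le> D \<omega>" if "i \<le> N" for i \<omega>
    unfolding D_def using that by (intro member_le_sum) auto
  have r0: "0 \<le> r i \<omega>" for i \<omega> unfolding r_def using D0 by simp
  have r1: "r i \<omega> \<le> 1" if "i \<le> N" for i \<omega>
    unfolding r_def using Dge[OF that, of \<omega>] D0[of \<omega>] by (cases "D \<omega> = 0") (auto simp: divide_le_eq)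
  have Dr: "D \<omega> * r i \<omega> = max 0 (q i - p i \<omega>)" if "i \<le> N" for i \<omega>
    unfolding r_def using Dge[OF that, of \<omega>] by (cases "D \<omega> = 0") auto
  \<comment> \<open>Total excess equals total deficit because \<open>p\<close> and \<open>q\<close>
    both sum to 1.\<close>
  have excess: "(\<Sum>i\<le>N. p i \<omega> * v i \<omega>) = D \<omega>" if "(\<Sum>i\<le>N. p i \<omega>) = 1" for \<omega>
  proof -
    have "(\<Sum>i\<le>N. p i \<omega> * v i \<omega>) - D \<omega> = (\<Sum>i\<le>N. p i \<omega> - q i)"
      unfolding pv D_def sum_subtractf[symmetric] by (intro sum.cong) (auto simp: max_def)
    then show ?thesis using that qsum by (simp add: sum_subtractf)
  qed
  define c where "c = (\<lambda>\<omega>. cell (V \<omega>))"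
  have c_le: "c \<omega> \<le> N" for \<omega> unfolding c_def by (rule cN)
  have c_m[measurable]: "c \<in> \<Omega> \<rightarrow>\<^sub>M count_space UNIV" unfolding c_def by measurable
  define W where "W = (\<lambda>i \<omega>. (1 - v (c \<omega>) \<omega>) * (if i = c \<omega> then 1 / q i else 0) + v (c \<omega>) \<omega> * (r i \<omega> / q i))"
  note vO[measurable] = measurable_from_subalg[OF G vG] and rO[measurable] = measurable_from_subalg[OF G rG]
    and pO[measurable] = measurable_from_subalg[OF G pG]
  have vc[measurable]: "(\<lambda>\<omega>. v (c \<omega>) \<omega>) \<in> borel_measurable \<Omega>"
    by (rule measurable_compose_countable[OF vO c_m])
  have Wm[measurable]: "W i \<in> borel_measurable \<Omega>" for i unfolding W_def by measurable
  have W0: "0 \<le> W i \<omega>" for i \<omega>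
    unfolding W_def by (intro add_nonneg_nonneg mult_nonneg_nonneg) (use v01[of "c \<omega>" \<omega>] r0[of i \<omega>] q0 in auto)
  define Wb where "Wb = (\<Sum>i\<le>N. 2 / q i)"
  have WWb: "W i \<omega> \<le> Wb" if i: "i \<le> N" for i \<omega>
  proof -
    have "W i \<omega> \<le> 1 * (1 / q i) + 1 * (1 / q i)"
      unfolding W_def using v01[of "c \<omega>" \<omega>] r0[of i \<omega>] r1[OF i, of \<omega>] q0[of i]
      by (intro add_mono mult_mono divide_right_mono) auto
    also have "\<dots> = 2 / q i" by simp
    also have "\<dots> \<le> Wb" unfolding Wb_def by (rule member_le_sum) (use i q0 in auto)
    finally show ?thesis .
  qed
  define w where "w = (\<lambda>z. W (cell (snd z)) (fst z))"
  have wm[measurable]: "w \<in> borel_measurable (\<Omega> \<Otimes>\<^sub>M law)"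
    unfolding w_def by (rule measurable_compose_countable[of "\<lambda>i z. W i (fst z)"]) measurable
  have w0: "0 \<le> w z" and wWb: "w z \<le> Wb" for z unfolding w_def using W0 WWb[OF cN] by auto
  have Wb0: "0 \<le> Wb" using w0 wWb by (meson order_trans)
  have intB: "(\<integral>\<^sup>+x. ennreal (w (\<omega>, x) * indicator B x) \<partial>law) = ennreal (\<Sum>i\<le>N. W i \<omega> * measure law (B \<inter> A i))"
    if [measurable]: "B \<in> sets borel" for \<omega> B
  proof -
    have "w (\<omega>, x) * indicator B x = (\<Sum>i\<le>N. W i \<omega> * indicator (B \<inter> A i) x)" for x
      using cover[of x "\<lambda>i. W i \<omega> * indicator B x"] by (simp add: w_def indicator_inter_arith mult_ac)
    then have "(\<integral>\<^sup>+x. ennreal (w (\<omega>, x) * indicator B x) \<partial>law) = (\<integral>\<^sup>+x. (\<Sum>i\<le>N. ennreal (W i \<omega>) * indicator (B \<inter> A i) x) \<partial>law)"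
      using W0 by (simp add: sum_nonneg ennreal_mult' ennreal_indicator flip: sum_ennreal)
    also have "\<dots> = (\<Sum>i\<le>N. ennreal (W i \<omega>) * emeasure law (B \<inter> A i))"
      by (subst nn_integral_sum) (auto simp: nn_integral_cmult_indicator)
    also have "\<dots> = ennreal (\<Sum>i\<le>N. W i \<omega> * measure law (B \<inter> A i))"
      using W0 by (simp add: law.emeasure_eq_measure ennreal_mult' flip: sum_ennreal)
    finally show ?thesis .
  qed
  have qc: "AE \<omega> in \<Omega>. q (c \<omega>) \<noteq> 0"
  proof -
    have "AE x in law. \<forall>i\<in>{..N}. q i = 0 \<longrightarrow> x \<notin> A i"
    proof (rule AE_finite_allI)
      fix i show "AE x in law. q i = 0 \<longrightarrow> x \<notin> A i"
      proof (cases "q i = 0")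
        case True
        then have "A i \<in> null_sets law" by (auto simp: null_sets_def law.emeasure_eq_measure q_def)
        then show ?thesis by (auto dest: AE_not_in)
      qed simp
    qed simp
    then have "AE x in distr \<Omega> borel V. q (cell x) \<noteq> 0"
      unfolding admissible_law_marginals(1)[OF \<Omega> V YO adm] by eventually_elim (use cN in \<open>auto simp: A_def\<close>)
    then show ?thesis unfolding c_def by (rule AE_distrD[OF V])
  qed
  have tot: "AE \<omega> in \<Omega>. (\<Sum>i\<le>N. W i \<omega> * q i) = 1"
    using psum qc
  proof eventually_elim
    case (elim \<omega>)
    have "(\<Sum>i\<le>N. W i \<omega> * q i) = (\<Sum>i\<le>N. (1 - v (c \<omega>) \<omega>) * (if i = c \<omega> then 1 else 0) + v (c \<omega>) \<omega> * r i \<omega>)"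
    proof (rule sum.cong[OF refl])
      fix i assume i: "i \<in> {..N}"
      have rq: "r i \<omega> / q i * q i = r i \<omega>"
        unfolding r_def using p01(1)[of i \<omega>] by (cases "q i = 0") auto
      have "W i \<omega> * q i = (1 - v (c \<omega>) \<omega>) * ((if i = c \<omega> then 1 / q i else 0) * q i) + v (c \<omega>) \<omega> * (r i \<omega> / q i * q i)"
        unfolding W_def by (simp only: distrib_right mult.assoc)
      then show "W i \<omega> * q i = (1 - v (c \<omega>) \<omega>) * (if i = c \<omega> then 1 else 0) + v (c \<omega>) \<omega> * r i \<omega>"
        unfolding rq using elim(2) by auto
    qed
    also have "\<dots> = (1 - v (c \<omega>) \<omega>) + v (c \<omega>) \<omega> * (\<Sum>i\<le>N. r i \<omega>)"
      using c_le[of \<omega>] by (simp add: sum.distrib sum_distrib_left[symmetric])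
    also have "v (c \<omega>) \<omega> * (\<Sum>i\<le>N. r i \<omega>) = v (c \<omega>) \<omega>"
    proof (cases "D \<omega> = 0")
      case False
      have "(\<Sum>i\<le>N. r i \<omega>) = D \<omega> / D \<omega>"
        unfolding r_def sum_divide_distrib[symmetric] by (simp only: D_def)
      then have "(\<Sum>i\<le>N. r i \<omega>) = 1" using False by simp
      then show ?thesis by simp
    next
      case True
      \<comment> \<open>If \<open>D \<omega> = 0\<close>, the weights \<open>r\<close> are all 0 by
        convention and do not sum to 1; but then the present cell is left with probability
        0.\<close>
      then have "(\<Sum>i\<le>N. p i \<omega> * v i \<omega>) = 0" using excess[OF elim(1)] by simp
      moreover have "p (c \<omega>) \<omega> * v (c \<omega>) \<omega> \<le> (\<Sum>i\<le>N. p i \<omega> * v i \<omega>)"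
        by (rule member_le_sum) (use c_le[of \<omega>] p01 v01 in auto)
      moreover have "0 \<le> p (c \<omega>) \<omega> * v (c \<omega>) \<omega>" using p01 v01 by simp
      ultimately have "p (c \<omega>) \<omega> * v (c \<omega>) \<omega> = 0" by linarith
      then have "v (c \<omega>) \<omega> = 0" by (auto simp: v_def)
      then show ?thesis by simp
    qed
    finally show ?case by simp
  qed
  \<comment> \<open>Independence of \<open>x'\<close> from \<open>G\<close>, tested on rectangles.
    It comes down to \<open>p j - p j * v j + D * r j = q j\<close>: the mass kept plus the mass
    received is the prescribed mass of the cell.\<close>
  have rect: "(\<integral>\<omega>. indicator C \<omega> * (\<Sum>i\<le>N. W i \<omega> * measure law (B \<inter> A i)) \<partial>\<Omega>) = O.prob C * measure law B"
    if C: "C \<in> sets G" and B[measurable]: "B \<in> sets borel" for C B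
  proof -
    have CO[measurable]: "C \<in> sets \<Omega>" using C G by (auto simp: subalgebra_def)
    define b where "b = (\<lambda>i. measure law (B \<inter> A i))"
    have b0: "0 \<le> b i" "b i \<le> q i" for i unfolding b_def q_def by (auto intro!: law.finite_measure_mono)
    define s where "s = (\<lambda>\<omega>. \<Sum>i\<le>N. r i \<omega> * (b i / q i))"
    have bq: "0 \<le> b i / q i" "b i / q i \<le> 1" for i using b0[of i] q0[of i] by (auto simp: divide_le_eq)
    have sG[measurable]: "s \<in> borel_measurable G" unfolding s_def by measurable
    have s0: "0 \<le> s \<omega>" for \<omega> unfolding s_def using r0 bq by (intro sum_nonneg mult_nonneg_nonneg)
    have sN: "s \<omega> \<le> real (Suc N)" for \<omega>
    proof -
      have "s \<omega> \<le> (\<Sum>i\<le>N. 1)" unfolding s_def using r0 r1 bq by (intro sum_mono mult_le_one) auto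
      then show ?thesis by simp
    qed
    define f where "f = (\<lambda>j \<omega>. indicator C \<omega> * ((1 - v j \<omega>) * (b j / q j) + v j \<omega> * s \<omega>))"
    have fG[measurable]: "f j \<in> borel_measurable G" for j unfolding f_def using C by measurable
    have fO[measurable]: "f j \<in> borel_measurable \<Omega>" for j by (rule measurable_from_subalg[OF G fG])
    have fb: "\<bar>f j \<omega>\<bar> \<le> 1 + real (Suc N)" for j \<omega>
    proof -
      have "(1 - v j \<omega>) * (b j / q j) + v j \<omega> * s \<omega> \<le> 1 * 1 + 1 * real (Suc N)"
        using v01[of j \<omega>] bq[of j] s0[of \<omega>] sN[of \<omega>] by (intro add_mono mult_mono) auto
      moreover have "0 \<le> (1 - v j \<omega>) * (b j / q j) + v j \<omega> * s \<omega>"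
        using v01[of j \<omega>] bq[of j] s0[of \<omega>] by (intro add_nonneg_nonneg mult_nonneg_nonneg) auto
      ultimately show ?thesis unfolding f_def by (auto simp: indicator_def)
    qed
    have fi: "integrable \<Omega> (\<lambda>\<omega>. indicator (A j) (V \<omega>) * f j \<omega>)" "integrable \<Omega> (\<lambda>\<omega>. p j \<omega> * f j \<omega>)" for j
    proof -
      show "integrable \<Omega> (\<lambda>\<omega>. indicator (A j) (V \<omega>) * f j \<omega>)"
        by (rule O.integrable_bounded[of _ "1 + real (Suc N)"], measurable, use fb in \<open>auto simp: indicator_def\<close>)
      have "\<bar>p j \<omega> * f j \<omega>\<bar> \<le> 1 * (1 + real (Suc N))" for \<omega>
        unfolding abs_mult using p01 fb by (intro mult_mono) auto
      then show "integrable \<Omega> (\<lambda>\<omega>. p j \<omega> * f j \<omega>)"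
        by (intro O.integrable_bounded[of _ "1 + real (Suc N)"]) auto
    qed
    have "indicator C \<omega> * (\<Sum>i\<le>N. W i \<omega> * measure law (B \<inter> A i)) = (\<Sum>j\<le>N. indicator (A j) (V \<omega>) * f j \<omega>)" for \<omega>
    proof -
      have "(\<Sum>i\<le>N. W i \<omega> * b i) = (\<Sum>i\<le>N. (1 - v (c \<omega>) \<omega>) * (if i = c \<omega> then b i / q i else 0) + v (c \<omega>) \<omega> * (r i \<omega> * (b i / q i)))"
        by (rule sum.cong) (auto simp: W_def algebra_simps)
      also have "\<dots> = (1 - v (c \<omega>) \<omega>) * (b (c \<omega>) / q (c \<omega>)) + v (c \<omega>) \<omega> * s \<omega>"
      proof -
        have "(\<Sum>i\<le>N. (1 - v (c \<omega>) \<omega>) * (if i = c \<omega> then b i / q i else 0)) = (1 - v (c \<omega>) \<omega>) * (b (c \<omega>) / q (c \<omega>))"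
          using c_le[of \<omega>] by (simp add: sum_distrib_left[symmetric])
        moreover have "(\<Sum>i\<le>N. v (c \<omega>) \<omega> * (r i \<omega> * (b i / q i))) = v (c \<omega>) \<omega> * s \<omega>"
          by (simp only: s_def sum_distrib_left)
        ultimately show ?thesis by (simp only: sum.distrib)
      qed
      finally show ?thesis using cover[of "V \<omega>" "\<lambda>j. f j \<omega>"] by (simp add: f_def b_def c_def)
    qed
    then have "(\<integral>\<omega>. indicator C \<omega> * (\<Sum>i\<le>N. W i \<omega> * measure law (B \<inter> A i)) \<partial>\<Omega>)
        = (\<integral>\<omega>. (\<Sum>j\<le>N. indicator (A j) (V \<omega>) * f j \<omega>) \<partial>\<Omega>)" by (simp only:)
    also have "\<dots> = (\<Sum>j\<le>N. \<integral>\<omega>. indicator (A j) (V \<omega>) * f j \<omega> \<partial>\<Omega>)"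
      by (rule Bochner_Integration.integral_sum) (rule fi(1))
    also have "\<dots> = (\<Sum>j\<le>N. \<integral>\<omega>. p j \<omega> * f j \<omega> \<partial>\<Omega>)" by (intro sum.cong refl E1[OF fG fb])
    also have "\<dots> = (\<integral>\<omega>. (\<Sum>j\<le>N. p j \<omega> * f j \<omega>) \<partial>\<Omega>)" by (rule Bochner_Integration.integral_sum[symmetric]) (rule fi(2))
    also have "\<dots> = (\<integral>\<omega>. indicator C \<omega> * measure law B \<partial>\<Omega>)"
    proof (rule integral_cong_AE)
      show "AE \<omega> in \<Omega>. (\<Sum>j\<le>N. p j \<omega> * f j \<omega>) = indicator C \<omega> * measure law B"
        using psum
      proof eventually_elim
        case (elim \<omega>)
        have "(\<Sum>j\<le>N. p j \<omega> * ((1 - v j \<omega>) * (b j / q j) + v j \<omega> * s \<omega>))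
            = (\<Sum>j\<le>N. (p j \<omega> - p j \<omega> * v j \<omega>) * (b j / q j)) + (\<Sum>j\<le>N. p j \<omega> * v j \<omega>) * s \<omega>"
        proof -
          have "p j \<omega> * ((1 - v j \<omega>) * x + v j \<omega> * y) = (p j \<omega> - p j \<omega> * v j \<omega>) * x + (p j \<omega> * v j \<omega>) * y" for j x y
            by (simp add: algebra_simps)
          then show ?thesis by (simp only: sum.distrib sum_distrib_right)
        qed
        also have "(\<Sum>j\<le>N. p j \<omega> * v j \<omega>) * s \<omega> = (\<Sum>j\<le>N. D \<omega> * r j \<omega> * (b j / q j))"
          unfolding excess[OF elim] s_def sum_distrib_left by (simp add: mult.assoc)
        also have "(\<Sum>j\<le>N. (p j \<omega> - p j \<omega> * v j \<omega>) * (b j / q j)) + (\<Sum>j\<le>N. D \<omega> * r j \<omega> * (b j / q j)) = (\<Sum>j\<le>N. b j)"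
          unfolding sum.distrib[symmetric]
        proof (rule sum.cong[OF refl])
          fix j assume "j \<in> {..N}"
          then have j: "j \<le> N" by simp
          have "(p j \<omega> - p j \<omega> * v j \<omega>) + D \<omega> * r j \<omega> = q j" unfolding pv Dr[OF j] by (auto simp: max_def)
          then have "(p j \<omega> - p j \<omega> * v j \<omega>) * (b j / q j) + D \<omega> * r j \<omega> * (b j / q j) = q j * (b j / q j)"
            by (simp only: distrib_right[symmetric])
          also have "\<dots> = b j" using b0[of j] by (cases "q j = 0") auto
          finally show "(p j \<omega> - p j \<omega> * v j \<omega>) * (b j / q j) + D \<omega> * r j \<omega> * (b j / q j) = b j" .
        qed
        also have "\<dots> = measure law B" unfolding b_def by (rule bsum[OF B])
        finally have "(\<Sum>j\<le>N. p j \<omega> * ((1 - v j \<omega>) * (b j / q j) + v j \<omega> * s \<omega>)) = measure law B" .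
        moreover have "(\<Sum>j\<le>N. p j \<omega> * f j \<omega>) = indicator C \<omega> * (\<Sum>j\<le>N. p j \<omega> * ((1 - v j \<omega>) * (b j / q j) + v j \<omega> * s \<omega>))"
          unfolding f_def sum_distrib_left by (simp add: mult_ac)
        ultimately show ?case by simp
      qed
    qed measurable
    also have "\<dots> = O.prob C * measure law B" by simp
    finally show ?thesis .
  qed
  define Q where "Q = density (\<Omega> \<Otimes>\<^sub>M law) (\<lambda>z. ennreal (w z))"
  have sQ[measurable_cong, simp]: "sets Q = sets (\<Omega> \<Otimes>\<^sub>M law)" unfolding Q_def by simp
  have spQ[simp]: "space Q = space (\<Omega> \<Otimes>\<^sub>M law)" unfolding Q_def by simp
  have eQ: "emeasure Q (E \<times> B) = ennreal (\<integral>\<omega>. indicator E \<omega> * (\<Sum>i\<le>N. W i \<omega> * measure law (B \<inter> A i)) \<partial>\<Omega>)"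
    if E[measurable]: "E \<in> sets \<Omega>" and B[measurable]: "B \<in> sets borel" for E B
  proof -
    have "emeasure Q (E \<times> B) = (\<integral>\<^sup>+z. ennreal (w z) * indicator (E \<times> B) z \<partial>(\<Omega> \<Otimes>\<^sub>M law))"
      unfolding Q_def by (rule emeasure_density) auto
    also have "\<dots> = (\<integral>\<^sup>+\<omega>. (\<integral>\<^sup>+x. ennreal (w (\<omega>, x)) * indicator (E \<times> B) (\<omega>, x) \<partial>law) \<partial>\<Omega>)"
      by (rule law.nn_integral_fst[symmetric]) measurable
    also have "\<dots> = (\<integral>\<^sup>+\<omega>. ennreal (indicator E \<omega> * (\<Sum>i\<le>N. W i \<omega> * measure law (B \<inter> A i))) \<partial>\<Omega>)"
    proof (rule nn_integral_cong)
      fix \<omega>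
      show "(\<integral>\<^sup>+x. ennreal (w (\<omega>, x)) * indicator (E \<times> B) (\<omega>, x) \<partial>law) = ennreal (indicator E \<omega> * (\<Sum>i\<le>N. W i \<omega> * measure law (B \<inter> A i)))"
      proof (cases "\<omega> \<in> E")
        case True
        have "(\<integral>\<^sup>+x. ennreal (w (\<omega>, x)) * indicator (E \<times> B) (\<omega>, x) \<partial>law) = (\<integral>\<^sup>+x. ennreal (w (\<omega>, x) * indicator B x) \<partial>law)"
          using True by (intro nn_integral_cong) (auto simp: indicator_def)
        then show ?thesis using True intB[OF B, of \<omega>] by simp
      next
        case False
        have "(\<integral>\<^sup>+x. ennreal (w (\<omega>, x)) * indicator (E \<times> B) (\<omega>, x) \<partial>law) = (\<integral>\<^sup>+x. 0 \<partial>law)"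
          using False by (intro nn_integral_cong) (auto simp: indicator_def)
        then show ?thesis using False by simp
      qed
    qed
    also have "\<dots> = ennreal (\<integral>\<omega>. indicator E \<omega> * (\<Sum>i\<le>N. W i \<omega> * measure law (B \<inter> A i)) \<partial>\<Omega>)"
    proof (rule nn_integral_eq_integral)
      have s0: "0 \<le> (\<Sum>i\<le>N. W i \<omega> * measure law (B \<inter> A i))" for \<omega> using W0 by (intro sum_nonneg) auto
      have s1: "(\<Sum>i\<le>N. W i \<omega> * measure law (B \<inter> A i)) \<le> (\<Sum>i\<le>N. Wb * 1)" for \<omega>
        using W0 WWb Wb0 by (intro sum_mono mult_mono) auto
      show "integrable \<Omega> (\<lambda>\<omega>. indicator E \<omega> * (\<Sum>i\<le>N. W i \<omega> * measure law (B \<inter> A i)))"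
        by (rule O.integrable_bounded[of _ "\<Sum>i\<le>N. Wb * 1"], measurable, use s0 s1 order_trans[OF s0 s1] in \<open>auto simp: indicator_def\<close>)
      show "AE \<omega> in \<Omega>. 0 \<le> indicator E \<omega> * (\<Sum>i\<le>N. W i \<omega> * measure law (B \<inter> A i))" using s0 by (auto intro!: AE_I2)
    qed
    finally show ?thesis .
  qed
  have eQ1: "emeasure Q (E \<times> UNIV) = emeasure \<Omega> E" if E[measurable]: "E \<in> sets \<Omega>" for E
  proof -
    have "(\<integral>\<omega>. indicator E \<omega> * (\<Sum>i\<le>N. W i \<omega> * measure law (UNIV \<inter> A i)) \<partial>\<Omega>) = (\<integral>\<omega>. indicator E \<omega> \<partial>\<Omega>)"
    proof (rule integral_cong_AE)
      show "AE \<omega> in \<Omega>. indicator E \<omega> * (\<Sum>i\<le>N. W i \<omega> * measure law (UNIV \<inter> A i)) = indicator E \<omega>"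
        using tot by eventually_elim (simp add: q_def)
    qed measurable
    then show ?thesis using eQ[OF E, of UNIV] by (simp add: O.emeasure_eq_measure)
  qed
  have Qp: "prob_space Q"
  proof (rule prob_spaceI)
    have "space Q = space \<Omega> \<times> UNIV" by (simp add: space_pair_measure)
    then show "emeasure Q (space Q) = 1" using eQ1[of "space \<Omega>"] O.emeasure_space_1 by simp
  qed
  have dfst: "distr Q \<Omega> fst = \<Omega>"
  proof (rule measure_eqI)
    fix E assume "E \<in> sets (distr Q \<Omega> fst)"
    then have E: "E \<in> sets \<Omega>" by simp
    have "fst -` E \<inter> space Q = E \<times> UNIV" using sets.sets_into_space[OF E] by (auto simp: space_pair_measure)
    then show "emeasure (distr Q \<Omega> fst) E = emeasure \<Omega> E" using E eQ1[OF E] by (simp add: emeasure_distr)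
  qed simp
  have pl1: "pair_law Q (\<lambda>z. V (fst z)) (\<lambda>z. Y (fst z)) \<in> admissible_laws M X"
  proof -
    have "pair_law Q (\<lambda>z. V (fst z)) (\<lambda>z. Y (fst z)) = pair_law (distr Q \<Omega> fst) V Y"
      unfolding pair_law_def by (subst distr_distr) (auto simp: comp_def)
    then show ?thesis using adm unfolding dfst by simp
  qed
  \<comment> \<open>Since \<open>Y\<close> is \<open>G\<close>-measurable and \<open>x'\<close> is
    independent of \<open>G\<close> with law \<open>law\<close>, the new pair has the product law,
    which is admissible.\<close>
  have pl2: "pair_law Q snd (\<lambda>z. Y (fst z)) \<in> admissible_laws M X"
  proof -
    have "law \<Otimes>\<^sub>M law = pair_law Q snd (\<lambda>z. Y (fst z))"
    proof (rule pair_measure_eqI)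
      show "sets (law \<Otimes>\<^sub>M law) = sets (pair_law Q snd (\<lambda>z. Y (fst z)))"
        unfolding pair_law_def by (simp cong: sets_pair_measure_cong)
      fix B C assume "B \<in> sets law" "C \<in> sets law"
      then have B[measurable]: "B \<in> sets borel" and C[measurable]: "C \<in> sets borel" by auto
      have CG: "Y -` C \<inter> space \<Omega> \<in> sets G" using measurable_sets[OF Y C] G by (simp add: subalgebra_def)
      then have CO: "Y -` C \<inter> space \<Omega> \<in> sets \<Omega>" using G by (auto simp: subalgebra_def)
      have YC: "O.prob (Y -` C \<inter> space \<Omega>) = measure law C"
        unfolding admissible_law_marginals(2)[OF \<Omega> V YO adm, symmetric] by (rule measure_distr[symmetric]) auto
      have "emeasure (pair_law Q snd (\<lambda>z. Y (fst z))) (B \<times> C) = emeasure Q ((Y -` C \<inter> space \<Omega>) \<times> B)"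
        unfolding pair_law_def
        by (subst emeasure_distr) (auto simp: space_pair_measure intro!: arg_cong[of _ _ "emeasure Q"])
      also have "\<dots> = ennreal (O.prob (Y -` C \<inter> space \<Omega>) * measure law B)" unfolding eQ[OF CO B] rect[OF CG B] ..
      finally show "emeasure law B * emeasure law C = emeasure (pair_law Q snd (\<lambda>z. Y (fst z))) (B \<times> C)"
        unfolding YC by (simp add: law.emeasure_eq_measure ennreal_mult' mult.commute)
    qed (unfold_locales)
    then show ?thesis unfolding admissible_laws_def by simp
  qed
  let ?g = "\<lambda>\<omega>. g (V \<omega>) (Y \<omega>)" and ?a = "\<lambda>\<omega>. cell_avg cell g (c \<omega>) (Y \<omega>)"
  have am[measurable]: "?a \<in> borel_measurable \<Omega>"
    by (rule measurable_compose_countable[OF _ c_m]) (rule measurable_compose[OF YO cell_avg_measurable[OF cm g]])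
  define Z where "Z = (\<lambda>\<omega>. \<bar>?g \<omega> - ?a \<omega>\<bar>)"
  have Zm[measurable]: "Z \<in> borel_measurable \<Omega>" unfolding Z_def by measurable
  have Z2K: "0 \<le> Z \<omega>" "Z \<omega> \<le> 2 * K" for \<omega>
    unfolding Z_def using gK[of "V \<omega>" "Y \<omega>"] abs_cell_avg_le[OF cm g gK, of "c \<omega>" "Y \<omega>"] by (auto simp: abs_le_iff)
  \<comment> \<open>The part of the error that the coupling controls: the cell is kept and is not
    the outer one. The rest is at most \<open>2 * K\<close> times the probability of changing the
    cell or starting in the outer one.\<close>
  define m where "m = (\<lambda>\<omega>. (1 - v (c \<omega>) \<omega>) * (if c \<omega> < N then Z \<omega> else 0))"
  have mm[measurable]: "m \<in> borel_measurable \<Omega>" unfolding m_def by measurable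
  have m0: "0 \<le> m \<omega>" "m \<omega> \<le> 2 * K" for \<omega>
    unfolding m_def using v01[of "c \<omega>" \<omega>] Z2K[of \<omega>] K0 mult_mono[of "1 - v (c \<omega>) \<omega>" 1 "Z \<omega>" "2 * K"] by auto
  have mi: "integrable \<Omega> m" by (rule O.integrable_bounded[of _ "2 * K"]) (use m0 in auto)
  \<comment> \<open>Inside a cell the error is the modulus of a mean over \<open>x'\<close> in the
    same cell. Moving the modulus inside the mean bounds it by the Lipschitz integrand under
    \<open>Q\<close>, as \<open>V\<close> and \<open>x'\<close> are within \<open>\<epsilon>\<close>
    there.\<close>
  have main: "(\<integral>\<omega>. m \<omega> \<partial>\<Omega>) \<le> l"
  proof -
    let ?F = "\<lambda>z. \<bar>g (V (fst z)) (Y (fst z)) - g (snd z) (Y (fst z))\<bar> * indicator {z. \<bar>V (fst z) - snd z\<bar> \<le> \<epsilon>} z"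
    have Fm[measurable]: "?F \<in> borel_measurable (\<Omega> \<Otimes>\<^sub>M law)" by (simp add: indicator_def) measurable
    have "ennreal (\<integral>\<omega>. m \<omega> \<partial>\<Omega>) = (\<integral>\<^sup>+\<omega>. ennreal (m \<omega>) \<partial>\<Omega>)"
      by (rule nn_integral_eq_integral[symmetric, OF mi]) (use m0 in auto)
    also have "\<dots> \<le> (\<integral>\<^sup>+\<omega>. (\<integral>\<^sup>+x. ennreal (w (\<omega>, x)) * ennreal (?F (\<omega>, x)) \<partial>law) \<partial>\<Omega>)"
    proof (rule nn_integral_mono_AE)
      show "AE \<omega> in \<Omega>. ennreal (m \<omega>) \<le> (\<integral>\<^sup>+x. ennreal (w (\<omega>, x)) * ennreal (?F (\<omega>, x)) \<partial>law)"
        using qc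
      proof eventually_elim
        case (elim \<omega>)
        show ?case
        proof (cases "c \<omega> < N")
          case False then show ?thesis by (simp add: m_def)
        next
          case True
          define k where "k = (1 - v (c \<omega>) \<omega>) / q (c \<omega>)"
          have k0: "0 \<le> k" unfolding k_def using v01[of "c \<omega>" \<omega>] q0 by simp
          define \<phi> where "\<phi> = (\<lambda>x. indicator (A (c \<omega>)) x * (g (V \<omega>) (Y \<omega>) - g x (Y \<omega>)))"
          have ib: "integrable law (\<lambda>x. indicator (A (c \<omega>)) x * g x (Y \<omega>))"
            by (rule law.integrable_bounded[of _ K], measurable, use gK K0 in \<open>auto simp: indicator_def\<close>)
          have ic: "integrable law (\<lambda>x. indicator (A (c \<omega>)) x * g (V \<omega>) (Y \<omega>))"
            by (rule law.integrable_bounded[of _ K], measurable, use gK K0 in \<open>auto simp: indicator_def\<close>)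
          have \<phi>i: "integrable law \<phi>" unfolding \<phi>_def right_diff_distrib using ib ic by auto
          have "(\<integral>x. \<phi> x \<partial>law) = q (c \<omega>) * (?g \<omega> - ?a \<omega>)"
            unfolding \<phi>_def right_diff_distrib using ib ic elim
            by (simp add: q_def A_def cell_avg_def right_diff_distrib)
          then have Zeq: "m \<omega> = k * norm (\<integral>x. \<phi> x \<partial>law)"
            unfolding m_def k_def Z_def using True elim q0[of "c \<omega>"] by (simp add: abs_mult)
          have "ennreal (m \<omega>) = ennreal k * ennreal (norm (\<integral>x. \<phi> x \<partial>law))"
            unfolding Zeq using k0 by (simp add: ennreal_mult')
          also have "\<dots> \<le> ennreal k * (\<integral>\<^sup>+x. norm (\<phi> x) \<partial>law)"
            by (intro mult_left_mono integral_norm_bound_ennreal \<phi>i) simp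
          also have "\<dots> = (\<integral>\<^sup>+x. ennreal k * norm (\<phi> x) \<partial>law)"
            by (rule nn_integral_cmult[symmetric]) (use \<phi>i in measurable)
          also have "\<dots> \<le> (\<integral>\<^sup>+x. ennreal (w (\<omega>, x)) * ennreal (?F (\<omega>, x)) \<partial>law)"
          proof (rule nn_integral_mono)
            fix x
            show "ennreal k * ennreal (norm (\<phi> x)) \<le> ennreal (w (\<omega>, x)) * ennreal (?F (\<omega>, x))"
            proof (cases "cell x = c \<omega>")
              case xc: True
              have "k \<le> w (\<omega>, x)"
                unfolding k_def w_def W_def using xc v01[of "c \<omega>" \<omega>] r0[of "c \<omega>" \<omega>] q0[of "c \<omega>"] by simp
              moreover have "norm (\<phi> x) = ?F (\<omega>, x)"
                using xc c\<epsilon>[of "V \<omega>" x] True unfolding \<phi>_def by (simp add: A_def c_def)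
              ultimately show ?thesis by (intro mult_mono) (auto simp: ennreal_leI)
            next
              case False then show ?thesis by (simp add: \<phi>_def A_def)
            qed
          qed
          finally show ?thesis .
        qed
      qed
    qed
    also have "\<dots> = (\<integral>\<^sup>+z. ennreal (w z) * ennreal (?F z) \<partial>(\<Omega> \<Otimes>\<^sub>M law))"
      by (rule law.nn_integral_fst) measurable
    also have "\<dots> = (\<integral>\<^sup>+z. ennreal (?F z) \<partial>Q)"
      unfolding Q_def by (rule nn_integral_density[symmetric]) measurable
    also have "\<dots> \<le> ennreal l"
      by (rule Lipschitz_atD[OF Lip Qp _ _ _ pl1 pl2]) measurable
    finally show ?thesis using L by (simp add: ennreal_le_iff)
  qed
  have vci: "integrable \<Omega> (\<lambda>\<omega>. v (c \<omega>) \<omega>)" by (rule O.integrable_bounded[of _ 1]) (use v01 in auto)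
  \<comment> \<open>The probability of changing the cell averages the excess masses
    \<open>p j * v j\<close>, each of which is at most the deviation of the conditional cell
    probability.\<close>
  have Ev: "(\<integral>\<omega>. v (c \<omega>) \<omega> \<partial>\<Omega>) \<le> d"
  proof -
    have vi: "integrable \<Omega> (\<lambda>\<omega>. indicator (A j) (V \<omega>) * v j \<omega>)" for j
      by (rule O.integrable_bounded[of _ 1], measurable, use v01 in \<open>auto simp: indicator_def\<close>)
    have ei: "integrable \<Omega> (e j)" for j unfolding e_def by (rule OG.real_cond_exp_int(1)[OF Ii])
    have "v (c \<omega>) \<omega> = (\<Sum>j\<le>N. indicator (A j) (V \<omega>) * v j \<omega>)" for \<omega>
      using cover[of "V \<omega>" "\<lambda>j. v j \<omega>"] by (simp add: c_def)
    then have "(\<integral>\<omega>. v (c \<omega>) \<omega> \<partial>\<Omega>) = (\<Sum>j\<le>N. \<integral>\<omega>. indicator (A j) (V \<omega>) * v j \<omega> \<partial>\<Omega>)"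
      by (simp only: Bochner_Integration.integral_sum[OF vi])
    also have "\<dots> = (\<Sum>j\<le>N. \<integral>\<omega>. p j \<omega> * v j \<omega> \<partial>\<Omega>)"
    proof (rule sum.cong[OF refl])
      have vb: "\<bar>v j \<omega>\<bar> \<le> 1" for j \<omega> using v01 by simp
      show "(\<integral>\<omega>. indicator (A j) (V \<omega>) * v j \<omega> \<partial>\<Omega>) = (\<integral>\<omega>. p j \<omega> * v j \<omega> \<partial>\<Omega>)" for j
        by (rule E1[OF vG vb])
    qed
    also have "\<dots> \<le> (\<Sum>j\<le>N. \<integral>\<omega>. \<bar>e j \<omega> - q j\<bar> \<partial>\<Omega>)"
    proof (rule sum_mono)
      fix j
      show "(\<integral>\<omega>. p j \<omega> * v j \<omega> \<partial>\<Omega>) \<le> (\<integral>\<omega>. \<bar>e j \<omega> - q j\<bar> \<partial>\<Omega>)"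
      proof (rule integral_mono_AE)
        have "\<bar>p j \<omega> * v j \<omega>\<bar> \<le> 1" for \<omega> unfolding abs_mult using p01 v01 by (intro mult_le_one) auto
        then show "integrable \<Omega> (\<lambda>\<omega>. p j \<omega> * v j \<omega>)" by (intro O.integrable_bounded[of _ 1]) auto
        show "integrable \<Omega> (\<lambda>\<omega>. \<bar>e j \<omega> - q j\<bar>)" using ei by auto
        show "AE \<omega> in \<Omega>. p j \<omega> * v j \<omega> \<le> \<bar>e j \<omega> - q j\<bar>"
          using pe[of j]
        proof eventually_elim
          case (elim \<omega>)
          show ?case unfolding pv elim[symmetric] by auto
        qed
      qed
    qed
    also have "\<dots> \<le> d" using d unfolding e_def q_def A_def .
    finally show ?thesis .
  qed
  have EN: "(\<integral>\<omega>. indicator (A N) (V \<omega>) \<partial>\<Omega>) = q N"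
    unfolding q_def admissible_law_marginals(1)[OF \<Omega> V YO adm, symmetric]
    using integral_distr[OF V, of "indicator (A N) :: real \<Rightarrow> real"] by simp
  have "(\<integral>\<omega>. Z \<omega> \<partial>\<Omega>) \<le> (\<integral>\<omega>. m \<omega> + 2 * K * (v (c \<omega>) \<omega> + indicator (A N) (V \<omega>)) \<partial>\<Omega>)"
  proof (rule integral_mono)
    show "integrable \<Omega> Z" by (rule O.integrable_bounded[of _ "2 * K"]) (use Z2K in auto)
    show "integrable \<Omega> (\<lambda>\<omega>. m \<omega> + 2 * K * (v (c \<omega>) \<omega> + indicator (A N) (V \<omega>)))" using mi vci Ii by auto
    fix \<omega>
    show "Z \<omega> \<le> m \<omega> + 2 * K * (v (c \<omega>) \<omega> + indicator (A N) (V \<omega>))"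
    proof (cases "c \<omega> < N")
      case True
      have "v (c \<omega>) \<omega> * Z \<omega> \<le> v (c \<omega>) \<omega> * (2 * K)" using Z2K v01 by (intro mult_left_mono) auto
      then have "Z \<omega> \<le> m \<omega> + 2 * K * v (c \<omega>) \<omega>" using True by (simp add: m_def algebra_simps)
      moreover have "0 \<le> 2 * K * indicator (A N) (V \<omega>)" using K0 by simp
      ultimately show ?thesis unfolding distrib_left by linarith
    next
      case False
      then have "indicator (A N) (V \<omega>) = (1::real)" using c_le[of \<omega>] by (simp add: A_def c_def)
      moreover have "0 \<le> 2 * K * v (c \<omega>) \<omega>" using K0 v01 by simp
      ultimately show ?thesis using Z2K[of \<omega>] m0[of \<omega>] by (simp add: distrib_left)
    qed
  qed
  also have "\<dots> = (\<integral>\<omega>. m \<omega> \<partial>\<Omega>) + 2 * K * ((\<integral>\<omega>. v (c \<omega>) \<omega> \<partial>\<Omega>) + q N)"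
    using mi vci Ii EN by simp
  also have "\<dots> \<le> l + 2 * K * (d + q N)"
    using main Ev K0 by (intro add_mono mult_left_mono) auto
  finally show ?thesis unfolding Z_def q_def A_def c_def .
qed

end

section \<open>Decay under strong mixing for Lipschitz kernels\<close>

text \<open>The index \<open>nat \<lceil>2 * R / \<epsilon>\<rceil>\<close> is reserved for the
  complement of the interval \<open>[-R, R)\<close>. By \<open>grid_less\<close> no inner cell
  reaches it, so \<open>cell x < N\<close> singles out the inner cells.\<close>

definition grid :: "real \<Rightarrow> real \<Rightarrow> real \<Rightarrow> nat" where
  "grid R \<epsilon> x = (if - R \<le> x \<and> x < R then nat \<lfloor>(x + R) / \<epsilon>\<rfloor> else nat \<lceil>2 * R / \<epsilon>\<rceil>)"

lemma grid_measurable: "grid R \<epsilon> \<in> borel \<rightarrow>\<^sub>M count_space UNIV"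
  unfolding grid_def[abs_def] by measurable

lemma grid_less:
  assumes "0 < \<epsilon>" "- R \<le> x" "x < R"
  shows "grid R \<epsilon> x < nat \<lceil>2 * R / \<epsilon>\<rceil>"
proof -
  have "0 \<le> (x + R) / \<epsilon>" "(x + R) / \<epsilon> < 2 * R / \<epsilon>" using assms by (auto intro: divide_strict_right_mono)
  then have "\<lfloor>(x + R) / \<epsilon>\<rfloor> < \<lceil>2 * R / \<epsilon>\<rceil>" "0 \<le> \<lfloor>(x + R) / \<epsilon>\<rfloor>" by linarith+
  then show ?thesis using assms by (simp add: grid_def)
qed

lemma grid_le: "0 < \<epsilon> \<Longrightarrow> grid R \<epsilon> x \<le> nat \<lceil>2 * R / \<epsilon>\<rceil>"
  using grid_less[of \<epsilon> R x] by (cases "- R \<le> x \<and> x < R") (auto simp: grid_def)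

lemma grid_close:
  assumes e: "0 < \<epsilon>" and eq: "grid R \<epsilon> x = grid R \<epsilon> x'" and lt: "grid R \<epsilon> x < nat \<lceil>2 * R / \<epsilon>\<rceil>"
  shows "\<bar>x - x'\<bar> \<le> \<epsilon>"
proof -
  have in1: "- R \<le> x \<and> x < R" using lt by (auto simp: grid_def split: if_splits)
  have in2: "- R \<le> x' \<and> x' < R" using lt eq by (auto simp: grid_def split: if_splits)
  have "0 \<le> (x + R) / \<epsilon>" "0 \<le> (x' + R) / \<epsilon>" using in1 in2 e by auto
  then have "0 \<le> \<lfloor>(x + R) / \<epsilon>\<rfloor>" "0 \<le> \<lfloor>(x' + R) / \<epsilon>\<rfloor>" by auto
  then have "\<lfloor>(x + R) / \<epsilon>\<rfloor> = \<lfloor>(x' + R) / \<epsilon>\<rfloor>" 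
    using eq in1 in2 eq_nat_nat_iff by (simp add: grid_def)
  then have "(x + R) / \<epsilon> - (x' + R) / \<epsilon> \<le> 1" "(x' + R) / \<epsilon> - (x + R) / \<epsilon> \<le> 1" by linarith+
  moreover have "(x + R) / \<epsilon> - (x' + R) / \<epsilon> = (x - x') / \<epsilon>" "(x' + R) / \<epsilon> - (x + R) / \<epsilon> = (x' - x) / \<epsilon>"
    by (simp_all add: diff_divide_distrib add_divide_distrib)
  ultimately have "x - x' \<le> \<epsilon>" "x' - x \<le> \<epsilon>" using e by (simp_all add: divide_le_eq)
  then show ?thesis by linarith
qed

lemma (in prob_space) abs_expectation_mult_diff_le:
  fixes u v w :: "'a \<Rightarrow> real"
  assumes m: "u \<in> borel_measurable M" "v \<in> borel_measurable M" "w \<in> borel_measurable M"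
    and u: "\<And>\<omega>. \<bar>u \<omega>\<bar> \<le> T" and v: "\<And>\<omega>. \<bar>v \<omega>\<bar> \<le> T" and w: "\<And>\<omega>. \<bar>w \<omega>\<bar> \<le> T"
  shows "\<bar>expectation (\<lambda>\<omega>. u \<omega> * w \<omega>) - expectation (\<lambda>\<omega>. v \<omega> * w \<omega>)\<bar> \<le> T * expectation (\<lambda>\<omega>. \<bar>u \<omega> - v \<omega>\<bar>)"
proof -
  note m[measurable]
  have T: "0 \<le> T" using u[of undefined] by linarith
  have TT: "\<bar>x * y\<bar> \<le> T * T" if "\<bar>x\<bar> \<le> T" "\<bar>y\<bar> \<le> T" for x y :: real
    unfolding abs_mult using that T by (intro mult_mono) auto
  have iu: "integrable M (\<lambda>\<omega>. u \<omega> * w \<omega>)" and iv: "integrable M (\<lambda>\<omega>. v \<omega> * w \<omega>)"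
    by (rule integrable_bounded[of _ "T * T"], measurable, intro TT u v w)+
  have id: "integrable M (\<lambda>\<omega>. \<bar>u \<omega> - v \<omega>\<bar>)"
    by (intro integrable_abs Bochner_Integration.integrable_diff integrable_bounded[of _ T] m u v)
  have e: "expectation (\<lambda>\<omega>. u \<omega> * w \<omega>) - expectation (\<lambda>\<omega>. v \<omega> * w \<omega>) = expectation (\<lambda>\<omega>. (u \<omega> - v \<omega>) * w \<omega>)"
    using iu iv by (simp add: left_diff_distrib)
  have i: "integrable M (\<lambda>\<omega>. (u \<omega> - v \<omega>) * w \<omega>)" unfolding left_diff_distrib using iu iv by auto
  have 1: "\<bar>expectation (\<lambda>\<omega>. (u \<omega> - v \<omega>) * w \<omega>)\<bar> \<le> expectation (\<lambda>\<omega>. \<bar>(u \<omega> - v \<omega>) * w \<omega>\<bar>)"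
    by (rule integral_abs_bound)
  have 2: "expectation (\<lambda>\<omega>. \<bar>(u \<omega> - v \<omega>) * w \<omega>\<bar>) \<le> expectation (\<lambda>\<omega>. T * \<bar>u \<omega> - v \<omega>\<bar>)"
  proof (rule integral_mono)
    show "\<bar>(u \<omega> - v \<omega>) * w \<omega>\<bar> \<le> T * \<bar>u \<omega> - v \<omega>\<bar>" for \<omega>
      unfolding abs_mult using mult_right_mono[OF w abs_ge_zero, of \<omega> "u \<omega> - v \<omega>"] by (simp only: mult.commute)
  qed (use i id in auto)
  have 3: "expectation (\<lambda>\<omega>. T * \<bar>u \<omega> - v \<omega>\<bar>) = T * expectation (\<lambda>\<omega>. \<bar>u \<omega> - v \<omega>\<bar>)" by simp
  show ?thesis unfolding e by (rule order_trans[OF 1 2[unfolded 3]])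
qed

context ustat_process
begin

text \<open>The law of total expectation. A null cell contributes 0 on both sides: its mass is 0 and
  its indicator vanishes almost surely.\<close>

lemma cell_avg_total:
  assumes c: "cell \<in> borel \<rightarrow>\<^sub>M count_space UNIV" and cN: "\<And>x. cell x \<le> N"
    and g: "(\<lambda>(x, y). g x y) \<in> borel_measurable (borel \<Otimes>\<^sub>M borel)" and b: "\<And>x y. \<bar>g x y\<bar> \<le> K"
  shows "(\<Sum>i\<le>N. measure law {x. cell x = i} * cell_avg cell g i y) = (\<integral>x. g x y \<partial>law)"
proof -
  have K: "0 \<le> K" using b[of 0 0] by linarith
  have m[measurable]: "{x. cell x = i} \<in> sets borel" for i by (rule cell_sets[OF c])
  have gm[measurable]: "(\<lambda>x. g x y) \<in> borel_measurable borel" using measurable_compose[OF _ g, of "\<lambda>x. (x, y)" borel] by simp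
  have i: "integrable law (\<lambda>x. indicator {x. cell x = i} x * g x y)" for i
    by (rule law.integrable_bounded[of _ K], measurable, use b K in \<open>auto simp: indicator_def\<close>)
  have "measure law {x. cell x = i} * cell_avg cell g i y = (\<integral>x. indicator {x. cell x = i} x * g x y \<partial>law)" for i
  proof (cases "measure law {x. cell x = i} = 0")
    case True
    then have "{x. cell x = i} \<in> null_sets law" by (auto simp: null_sets_def law.emeasure_eq_measure)
    then have "AE x in law. indicator {x. cell x = i} x * g x y = 0" by (auto dest!: AE_not_in)
    then have "(\<integral>x. indicator {x. cell x = i} x * g x y \<partial>law) = (\<integral>x. 0 \<partial>law)"
      by (intro integral_cong_AE) auto
    then show ?thesis using True by simp
  qed (simp add: cell_avg_def)
  then have "(\<Sum>i\<le>N. measure law {x. cell x = i} * cell_avg cell g i y) = (\<Sum>i\<le>N. \<integral>x. indicator {x. cell x = i} x * g x y \<partial>law)"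
    by simp
  also have "\<dots> = (\<integral>x. (\<Sum>i\<le>N. indicator {x. cell x = i} x * g x y) \<partial>law)"
    by (rule Bochner_Integration.integral_sum[symmetric]) (rule i)
  also have "\<dots> = (\<integral>x. g x y \<partial>law)" by (simp only: cell_decompose[of cell N, OF cN])
  finally show ?thesis .
qed

text \<open>Two instances of the Lipschitz condition: the coupling adds a real coordinate to its
  space, which is \<open>M\<close> in \<open>approx_pair\<close> and
  \<open>M \<Otimes>\<^sub>M law\<close> in \<open>approx_indep\<close>.\<close>

context
  fixes cell :: "real \<Rightarrow> nat" and N :: nat and \<epsilon> T b :: real
  assumes cm: "cell \<in> borel \<rightarrow>\<^sub>M count_space UNIV" and cN: "\<And>x. cell x \<le> N"
    and c\<epsilon>: "\<And>x x'. cell x = cell x' \<Longrightarrow> cell x < N \<Longrightarrow> \<bar>x - x'\<bar> \<le> \<epsilon>"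
    and T: "0 < T" and b: "0 \<le> b"
    and Lip1: "Lipschitz_at TYPE('a \<times> real) M X (\<lambda>x y. clip T (h2 x y)) \<epsilon> b"
    and Lip2: "Lipschitz_at TYPE(('a \<times> real) \<times> real) M X (\<lambda>x y. clip T (h2 x y)) \<epsilon> b"
begin

lemma clip_h2_measurable: "(\<lambda>(x, y). clip T (h2 x y)) \<in> borel_measurable (borel \<Otimes>\<^sub>M borel)"
  by measurable

lemma abs_clip_h2_le: "\<bar>clip T (h2 x y)\<bar> \<le> T"
  by (rule abs_clip_le) (use T in simp)

abbreviation avg :: "nat \<Rightarrow> real \<Rightarrow> real" where "avg \<equiv> cell_avg cell (\<lambda>x y. clip T (h2 x y))"

abbreviation outer :: real where "outer \<equiv> measure law {x. cell x = N}"

lemma avg_measurable: "avg i \<in> borel_measurable borel"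
  by (rule cell_avg_measurable[OF cm clip_h2_measurable])

lemma abs_avg_le: "\<bar>avg i y\<bar> \<le> T"
  by (rule abs_cell_avg_le[OF cm clip_h2_measurable abs_clip_h2_le])

lemma avg_cell_measurable:
  assumes U: "U \<in> borel_measurable R" and Z: "Z \<in> borel_measurable R"
  shows "(\<lambda>\<omega>. avg (cell (U \<omega>)) (Z \<omega>)) \<in> borel_measurable R"
  by (rule measurable_compose_countable[OF _ measurable_compose[OF U cm]]) (rule measurable_compose[OF Z avg_measurable])

lemma indicator_cell_measurable:
  assumes U: "U \<in> borel_measurable R"
  shows "(\<lambda>\<omega>. indicator {x. cell x = i} (U \<omega>) :: real) \<in> borel_measurable R"
  by (rule measurable_compose[OF U]) (use cell_sets[OF cm, of i] in simp)

lemma pair_law_admissible: "1 \<le> i \<Longrightarrow> i \<le> j \<Longrightarrow> pair_law M (X i) (X j) \<in> admissible_laws M X"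
  using pair_law_shift[of i "j - i"] unfolding admissible_laws_def by (auto intro!: exI[of _ "1 + (j - i)"])

text \<open>The cell indicators of \<open>X i\<close> belong to the past and add up to 1, so
  \<open>sum_cond_exp_deviation_le\<close> bounds the mean cost of the coupling with
  \<open>u = 1\<close>; the index set \<open>{..N}\<close> has \<open>Suc N\<close>
  elements.\<close>

lemma approx_pair:
  assumes i: "1 \<le> i" "i \<le> e" and j: "e + m \<le> j" and ab: "alpha_bound M (past e) (future (e + m)) \<alpha>"
  shows "(\<integral>\<omega>. \<bar>clip T (h2 (X i \<omega>) (X j \<omega>)) - avg (cell (X i \<omega>)) (X j \<omega>)\<bar> \<partial>M)
    \<le> b + 2 * T * (8 * sqrt (Suc N) * \<alpha> + outer)"
proof -
  have em: "1 \<le> e + m" "1 \<le> j" "i \<le> j" using i j by auto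
  have V: "X i \<in> borel_measurable (past e)" by (rule measurable_past) (use i in auto)
  have Y: "X j \<in> borel_measurable (future (e + m))" by (rule measurable_future) (use j in auto)
  have VM: "X i \<in> borel_measurable M" by (rule X_measurable[OF i(1)])
  have q: "expectation (\<lambda>\<omega>. indicator {x. cell x = k} (X i \<omega>)) = measure law {x. cell x = k}" for k
    using integral_X[OF i(1), of "indicator {x. cell x = k}"] cell_sets[OF cm, of k] by simp
  have "(\<Sum>k\<in>{..N}. \<integral>\<omega>. \<bar>real_cond_exp M (future (e + m)) (\<lambda>\<omega>. indicator {x. cell x = k} (X i \<omega>)) \<omega>
      - expectation (\<lambda>\<omega>. indicator {x. cell x = k} (X i \<omega>))\<bar> \<partial>M) \<le> 8 * sqrt (card {..N}) * \<alpha> * 1"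
  proof (rule sum_cond_exp_deviation_le[OF subalgebra_past subalgebra_future[OF em(1)] ab])
    show "(\<lambda>\<omega>. indicator {x. cell x = k} (X i \<omega>) :: real) \<in> borel_measurable (past e)" for k
      by (rule indicator_cell_measurable[OF V])
    show "(\<Sum>k\<in>{..N}. \<bar>indicator {x. cell x = k} (X i \<omega>) :: real\<bar>) \<le> 1" for \<omega>
      using cell_decompose[of cell N, OF cN, where x = "X i \<omega>" and f = "\<lambda>_. 1"] by simp
  qed auto
  then have d: "(\<Sum>k\<le>N. \<integral>\<omega>. \<bar>real_cond_exp M (future (e + m)) (\<lambda>\<omega>. indicator {x. cell x = k} (X i \<omega>)) \<omega>
      - measure law {x. cell x = k}\<bar> \<partial>M) \<le> 8 * sqrt (Suc N) * \<alpha>" unfolding q by simp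
  show ?thesis
    by (rule cell_average_approx[OF prob_space_axioms subalgebra_future[OF em(1)] VM Y
          pair_law_admissible[OF i(1) em(3)] cm cN c\<epsilon> d clip_h2_measurable abs_clip_h2_le b Lip1])
qed

text \<open>On the product space the two coordinates generate independent algebras, so
  \<open>alpha_bound\<close> holds with 0 and the coupling keeps the cell almost surely. Only the
  cell width and the outer cell contribute.\<close>

lemma approx_indep:
  assumes r: "1 \<le> r"
  shows "(\<integral>z. \<bar>clip T (h2 (X r (fst z)) (snd z)) - avg (cell (X r (fst z))) (snd z)\<bar> \<partial>(M \<Otimes>\<^sub>M law)) \<le> b + 2 * T * outer"
proof -
  let ?P = "M \<Otimes>\<^sub>M law" and ?V = "\<lambda>z. X r (fst z)"
  let ?F = "vimage_algebra (space (M \<Otimes>\<^sub>M law)) (\<lambda>z. X r (fst z)) borel"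
  let ?G = "vimage_algebra (space (M \<Otimes>\<^sub>M law)) snd (borel :: real measure)"
  have [measurable]: "X r \<in> borel_measurable M" by (rule X_measurable[OF r])
  have V: "?V \<in> borel_measurable ?P" by measurable
  have Y: "snd \<in> borel_measurable ?P" by measurable
  have F: "subalgebra ?P ?F"
    unfolding subalgebra_def sets_vimage_algebra
    by (intro conjI sets.sigma_sets_subset) (use measurable_sets[OF V] in auto)
  have G: "subalgebra ?P ?G"
    unfolding subalgebra_def sets_vimage_algebra
    by (intro conjI sets.sigma_sets_subset) (use measurable_sets[OF Y] in auto)
  have VF: "?V \<in> borel_measurable ?F" by (rule measurable_vimage_algebra1) simp
  have YG: "snd \<in> borel_measurable ?G" by (rule measurable_vimage_algebra1) simp
  have ab: "alpha_bound ?P ?F ?G 0"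
    unfolding alpha_bound_def
  proof (intro ballI)
    fix A B assume "A \<in> sets ?F" "B \<in> sets ?G"
    moreover have "sets ?F = {?V -` A \<inter> space ?P |A. A \<in> sets borel}" by (rule sets_vimage_algebra2) simp
    moreover have "sets ?G = {snd -` B \<inter> space ?P |B. B \<in> sets (borel :: real measure)}" by (rule sets_vimage_algebra2) simp
    ultimately obtain A' B' where A': "A' \<in> sets borel" "A = ?V -` A' \<inter> space ?P"
      and B': "B' \<in> sets borel" "B = snd -` B' \<inter> space ?P" by auto
    let ?A = "X r -` A' \<inter> space M"
    have Am: "?A \<in> sets M" using A' by measurable
    have s: "A = ?A \<times> UNIV" "B = space M \<times> B'" "A \<inter> B = ?A \<times> B'" unfolding A' B' by (auto simp: space_pair_measure)
    have "measure ?P (E \<times> D) = prob E * measure law D" if "E \<in> sets M" "D \<in> sets borel" for E D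
      unfolding measure_def using that by (subst law.emeasure_pair_measure_Times) (auto simp: enn2real_mult)
    from this[OF Am] this[OF sets.top] this[OF Am B'(1)]
    show "\<bar>measure ?P (A \<inter> B) - measure ?P A * measure ?P B\<bar> \<le> 0"
      unfolding s(3) unfolding s(1,2) using B'(1) by (simp add: prob_space)
  qed
  have d1: "distr ?P borel ?V = law"
  proof -
    have "distr ?P borel ?V = distr (distr ?P M fst) borel (X r)" by (subst distr_distr) (auto simp: comp_def)
    then show ?thesis using law.distr_pair_fst[of M] distr_X[OF r] by simp
  qed
  have adm: "pair_law ?P ?V snd \<in> admissible_laws M X"
    unfolding pair_law_def distr_independent_copy[OF r] admissible_laws_def by simp
  have q: "(\<integral>z. indicator {x. cell x = k} (?V z) \<partial>?P) = measure law {x. cell x = k}" for k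
    using integral_distr[OF V, of "indicator {x. cell x = k} :: real \<Rightarrow> real"] cell_sets[OF cm, of k] unfolding d1 by simp
  have "(\<Sum>k\<in>{..N}. \<integral>z. \<bar>real_cond_exp ?P ?G (\<lambda>z. indicator {x. cell x = k} (?V z)) z
      - (\<integral>z. indicator {x. cell x = k} (?V z) \<partial>?P)\<bar> \<partial>?P) \<le> 8 * sqrt (card {..N}) * 0 * 1"
  proof (rule ext.P.sum_cond_exp_deviation_le[OF F G ab])
    show "(\<lambda>z. indicator {x. cell x = k} (?V z) :: real) \<in> borel_measurable ?F" for k
      by (rule indicator_cell_measurable[OF VF])
    show "(\<Sum>k\<in>{..N}. \<bar>indicator {x. cell x = k} (?V z) :: real\<bar>) \<le> 1" for z
      using cell_decompose[of cell N, OF cN, where x = "?V z" and f = "\<lambda>_. 1"] by simp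
  qed auto
  then have d: "(\<Sum>k\<le>N. \<integral>z. \<bar>real_cond_exp ?P ?G (\<lambda>z. indicator {x. cell x = k} (?V z)) z
      - measure law {x. cell x = k}\<bar> \<partial>?P) \<le> 0" unfolding q by simp
  have "(\<integral>z. \<bar>clip T (h2 (X r (fst z)) (snd z)) - avg (cell (X r (fst z))) (snd z)\<bar> \<partial>?P) \<le> b + 2 * T * (0 + outer)"
    by (rule cell_average_approx[OF ext.P.prob_space_axioms G V YG adm cm cN c\<epsilon> d clip_h2_measurable abs_clip_h2_le b Lip2])
  then show ?thesis by simp
qed

lemma clip_quad_near_avg:
  assumes i: "1 \<le> i" "i \<le> e" and j: "e + m \<le> j" and ab: "alpha_bound M (past e) (future (e + m)) \<alpha>" and kl: "1 \<le> k" "1 \<le> l"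
  shows "\<bar>clip_quad T i j k l - (\<integral>\<omega>. avg (cell (X i \<omega>)) (X j \<omega>) * clip T (h2 (X k \<omega>) (X l \<omega>)) \<partial>M)\<bar>
    \<le> T * (b + 2 * T * (8 * sqrt (Suc N) * \<alpha> + outer))"
proof -
  have mX[measurable]: "X i \<in> borel_measurable M" "X j \<in> borel_measurable M" "X k \<in> borel_measurable M" "X l \<in> borel_measurable M"
    using X_measurable i j kl by auto
  let ?W = "\<lambda>\<omega>. clip T (h2 (X k \<omega>) (X l \<omega>))"
  let ?u = "\<lambda>\<omega>. clip T (h2 (X i \<omega>) (X j \<omega>))" and ?v = "\<lambda>\<omega>. avg (cell (X i \<omega>)) (X j \<omega>)"
  have vm[measurable]: "?v \<in> borel_measurable M" by (rule avg_cell_measurable) auto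
  have Wm: "?W \<in> borel_measurable M" "?u \<in> borel_measurable M" by measurable
  show ?thesis
    by (rule order_trans[OF abs_expectation_mult_diff_le[OF Wm(2) vm Wm(1) abs_clip_h2_le abs_avg_le abs_clip_h2_le, folded clip_quad_def]])
      (use approx_pair[OF i j ab] T in \<open>auto intro: mult_left_mono\<close>)
qed

text \<open>After averaging, the integrand is a sum of cell indicators of \<open>X i\<close> times
  functions of the future. Replacing each indicator by its probability rebuilds the full integral
  over \<open>law\<close>, by \<open>cell_avg_total\<close>, so no averaging error arises on the
  independent side.\<close>

lemma clip_quad_diff_le_first:
  assumes i: "1 \<le> i" and j: "i + m \<le> j" and k: "i + m \<le> k" "k < l"
    and ab: "alpha_bound M (past i) (future (i + m)) \<alpha>"
  shows "\<bar>clip_quad T i j k l - clip_quad_indep T j k l\<bar> \<le> T * (b + 2 * T * (8 * sqrt (Suc N) * \<alpha> + outer)) + 8 * sqrt (Suc N) * \<alpha> * T^2"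
proof -
  have ge: "1 \<le> j" "1 \<le> k" "1 \<le> l" "1 \<le> i + m" using i j k by auto
  have mX[measurable]: "X i \<in> borel_measurable M" "X j \<in> borel_measurable M" "X k \<in> borel_measurable M" "X l \<in> borel_measurable M"
    using X_measurable i ge by auto
  let ?W = "\<lambda>\<omega>. clip T (h2 (X k \<omega>) (X l \<omega>))" and ?A = "\<lambda>c \<omega>. indicator {x. cell x = c} (X i \<omega>) :: real"
  let ?\<psi> = "\<lambda>c \<omega>. avg c (X j \<omega>) * ?W \<omega>"
  have TT: "\<bar>x * y\<bar> \<le> T * T" if "\<bar>x\<bar> \<le> T" "\<bar>y\<bar> \<le> T" for x y :: real
    unfolding abs_mult using that T by (intro mult_mono) auto
  have Xf: "X j \<in> borel_measurable (future (i + m))" "X k \<in> borel_measurable (future (i + m))" "X l \<in> borel_measurable (future (i + m))"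
    by (rule measurable_future; use j k in simp)+
  have Wf: "?W \<in> borel_measurable (future (i + m))" using Xf by measurable
  have avM[measurable]: "(\<lambda>\<omega>. avg c (X j \<omega>)) \<in> borel_measurable M" for c by (rule measurable_compose[OF mX(2) avg_measurable])
  have Am[measurable]: "?A c \<in> borel_measurable M" for c by (rule indicator_cell_measurable) simp
  have \<psi>b: "\<bar>?\<psi> c \<omega>\<bar> \<le> T * T" for c \<omega> by (intro TT abs_avg_le abs_clip_h2_le)
  have \<psi>i: "integrable M (?\<psi> c)" for c by (rule integrable_bounded[OF _ \<psi>b]) measurable
  have A\<psi>i: "integrable M (\<lambda>\<omega>. ?A c \<omega> * ?\<psi> c \<omega>)" for c
    by (rule integrable_bounded[of _ "T * T"], measurable, use \<psi>b T in \<open>auto simp: indicator_def\<close>)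
  have 1: "\<bar>clip_quad T i j k l - (\<integral>\<omega>. avg (cell (X i \<omega>)) (X j \<omega>) * ?W \<omega> \<partial>M)\<bar> \<le> T * (b + 2 * T * (8 * sqrt (Suc N) * \<alpha> + outer))"
    by (rule clip_quad_near_avg[OF i order_refl j ab ge(2,3)])
  have 2: "(\<integral>\<omega>. avg (cell (X i \<omega>)) (X j \<omega>) * ?W \<omega> \<partial>M) = (\<Sum>c\<in>{..N}. \<integral>\<omega>. ?A c \<omega> * ?\<psi> c \<omega> \<partial>M)"
    by (subst Bochner_Integration.integral_sum[symmetric, OF A\<psi>i]) (simp only: cell_decompose[of cell N, OF cN])
  have 3: "\<bar>\<Sum>c\<in>{..N}. (\<integral>\<omega>. ?A c \<omega> * ?\<psi> c \<omega> \<partial>M) - expectation (?A c) * expectation (?\<psi> c)\<bar> \<le> 8 * sqrt (card {..N}) * \<alpha> * 1 * (T * T)"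
  proof (rule sum_covariance_le[OF subalgebra_past subalgebra_future[OF ge(4)] ab])
    show "?A c \<in> borel_measurable (past i)" for c
      by (rule indicator_cell_measurable[OF measurable_past]) (use i in auto)
    show "(\<Sum>c\<in>{..N}. \<bar>?A c \<omega>\<bar>) \<le> 1" for \<omega> using cell_decompose[of cell N, OF cN, where x = "X i \<omega>" and f = "\<lambda>_. 1"] by simp
    show "?\<psi> c \<in> borel_measurable (future (i + m))" for c
      by (intro borel_measurable_times measurable_compose[OF Xf(1) avg_measurable] Wf)
    show "\<bar>?\<psi> c \<omega>\<bar> \<le> T * T" for c \<omega> by (rule \<psi>b)
  qed (use T in auto)
  have 4: "(\<Sum>c\<in>{..N}. expectation (?A c) * expectation (?\<psi> c)) = clip_quad_indep T j k l"
  proof -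
    have q: "expectation (?A c) = measure law {x. cell x = c}" for c
      using integral_X[OF i(1), of "indicator {x. cell x = c}"] cell_sets[OF cm, of c] by simp
    have "(\<Sum>c\<in>{..N}. expectation (?A c) * expectation (?\<psi> c)) = (\<Sum>c\<in>{..N}. \<integral>\<omega>. measure law {x. cell x = c} * ?\<psi> c \<omega> \<partial>M)"
      unfolding q by simp
    also have "\<dots> = (\<integral>\<omega>. (\<Sum>c\<in>{..N}. measure law {x. cell x = c} * ?\<psi> c \<omega>) \<partial>M)"
      by (rule Bochner_Integration.integral_sum[symmetric]) (use \<psi>i in auto)
    also have "\<dots> = (\<integral>\<omega>. (\<integral>x. clip T (h2 x (X j \<omega>)) \<partial>law) * ?W \<omega> \<partial>M)"
      by (simp only: cell_avg_total[OF cm cN clip_h2_measurable abs_clip_h2_le, symmetric] sum_distrib_right mult.assoc)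
    also have "\<dots> = (\<integral>\<omega>. (\<integral>y. clip T (h2 (X j \<omega>) y) * ?W \<omega> \<partial>law) \<partial>M)"
      by (simp add: h2_sym)
    also have "\<dots> = clip_quad_indep T j k l"
    proof -
      have "integrable (M \<Otimes>\<^sub>M law) (\<lambda>(\<omega>, y). clip T (h2 (X j \<omega>) y) * ?W \<omega>)"
        by (rule ext.P.integrable_bounded[of _ "T * T"], measurable) (auto intro!: TT abs_clip_h2_le)
      from ext.integral_fst[OF this] show ?thesis unfolding clip_quad_indep_def by (simp add: case_prod_unfold)
    qed
    finally show ?thesis .
  qed
  have "\<bar>(\<integral>\<omega>. avg (cell (X i \<omega>)) (X j \<omega>) * ?W \<omega> \<partial>M) - clip_quad_indep T j k l\<bar> \<le> 8 * sqrt (Suc N) * \<alpha> * T^2"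
    using 3 unfolding 2 sum_subtractf 4 by (simp add: power2_eq_square)
  then show ?thesis using 1 by linarith
qed

text \<open>The averaged variable \<open>X i\<close> is now the partner of the isolated
  \<open>X j\<close>. The kernel thus stays averaged after \<open>X j\<close> has been replaced, and
  the last term of the bound undoes this on the product space by
  \<open>approx_indep\<close>.\<close>

lemma clip_quad_diff_le_last:
  assumes i: "1 \<le> i" and k: "1 \<le> k" "k < l" and j: "i + m \<le> j" "l + m \<le> j"
    and ab: "alpha_bound M (past (j - m)) (future j) \<alpha>"
  shows "\<bar>clip_quad T i j k l - clip_quad_indep T i k l\<bar>
    \<le> T * (b + 2 * T * (8 * sqrt (Suc N) * \<alpha> + outer)) + 8 * sqrt (Suc N) * \<alpha> * T^2 + T * (b + 2 * T * outer)"
proof -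
  define e where "e = j - m"
  have e: "e + m = j" "i \<le> e" "l \<le> e" "1 \<le> e" using i j by (auto simp: e_def)
  have ab': "alpha_bound M (past e) (future (e + m)) \<alpha>" using ab e by (simp add: e_def)
  have ge: "1 \<le> j" "1 \<le> l" "1 \<le> e + m" using i j k e by auto
  have mX[measurable]: "X i \<in> borel_measurable M" "X j \<in> borel_measurable M" "X k \<in> borel_measurable M" "X l \<in> borel_measurable M"
    using X_measurable i k ge by auto
  let ?W = "\<lambda>\<omega>. clip T (h2 (X k \<omega>) (X l \<omega>))" and ?A = "\<lambda>c \<omega>. indicator {x. cell x = c} (X i \<omega>) :: real"
  let ?Z = "\<lambda>c \<omega>. ?A c \<omega> * ?W \<omega>" and ?\<psi> = "\<lambda>c \<omega>. avg c (X j \<omega>)"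
  have TT: "\<bar>x * y\<bar> \<le> T * T" if "\<bar>x\<bar> \<le> T" "\<bar>y\<bar> \<le> T" for x y :: real
    unfolding abs_mult using that T by (intro mult_mono) auto
  have avM[measurable]: "?\<psi> c \<in> borel_measurable M" for c by (rule measurable_compose[OF mX(2) avg_measurable])
  have Am[measurable]: "?A c \<in> borel_measurable M" for c by (rule indicator_cell_measurable) simp
  have Zb: "\<bar>?Z c \<omega>\<bar> \<le> T" for c \<omega> using abs_clip_h2_le[of "X k \<omega>" "X l \<omega>"] T by (auto simp: indicator_def)
  have Zi: "integrable M (?Z c)" for c by (rule integrable_bounded[OF _ Zb]) measurable
  have Z\<psi>i: "integrable M (\<lambda>\<omega>. ?Z c \<omega> * ?\<psi> c \<omega>)" for c
    by (rule integrable_bounded[of _ "T * T"], measurable, intro TT Zb abs_avg_le)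
  have 1: "\<bar>clip_quad T i j k l - (\<integral>\<omega>. avg (cell (X i \<omega>)) (X j \<omega>) * ?W \<omega> \<partial>M)\<bar> \<le> T * (b + 2 * T * (8 * sqrt (Suc N) * \<alpha> + outer))"
    by (rule clip_quad_near_avg[OF i e(2) _ ab' k(1) ge(2)]) (use e in simp)
  have 2: "(\<integral>\<omega>. avg (cell (X i \<omega>)) (X j \<omega>) * ?W \<omega> \<partial>M) = (\<Sum>c\<in>{..N}. \<integral>\<omega>. ?Z c \<omega> * ?\<psi> c \<omega> \<partial>M)"
  proof -
    have "(\<Sum>c\<in>{..N}. ?Z c \<omega> * ?\<psi> c \<omega>) = avg (cell (X i \<omega>)) (X j \<omega>) * ?W \<omega>" for \<omega>
      using cell_decompose[of cell N, OF cN, where x = "X i \<omega>" and f = "\<lambda>c. ?W \<omega> * ?\<psi> c \<omega>"] by (simp only: mult_ac)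
    then show ?thesis by (subst Bochner_Integration.integral_sum[symmetric, OF Z\<psi>i]) (simp only:)
  qed
  have 3: "\<bar>\<Sum>c\<in>{..N}. (\<integral>\<omega>. ?Z c \<omega> * ?\<psi> c \<omega> \<partial>M) - expectation (?Z c) * expectation (?\<psi> c)\<bar> \<le> 8 * sqrt (card {..N}) * \<alpha> * T * T"
  proof (rule sum_covariance_le[OF subalgebra_past subalgebra_future[OF ge(3)] ab'])
    have Xp: "X i \<in> borel_measurable (past e)" "X k \<in> borel_measurable (past e)" "X l \<in> borel_measurable (past e)"
      by (rule measurable_past; use i k e in simp)+
    show "?Z c \<in> borel_measurable (past e)" for c
      using indicator_cell_measurable[OF Xp(1), of c] Xp(2,3) by measurable
    show "(\<Sum>c\<in>{..N}. \<bar>?Z c \<omega>\<bar>) \<le> T" for \<omega>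
    proof -
      have "(\<Sum>c\<in>{..N}. \<bar>?Z c \<omega>\<bar>) = \<bar>?W \<omega>\<bar>"
        using cell_decompose[of cell N, OF cN, where x = "X i \<omega>" and f = "\<lambda>_. \<bar>?W \<omega>\<bar>"] by (simp add: abs_mult)
      then show ?thesis using abs_clip_h2_le by simp
    qed
    show "?\<psi> c \<in> borel_measurable (future (e + m))" for c
      by (rule measurable_compose[OF measurable_future avg_measurable]) (use e in simp)
    show "\<bar>?\<psi> c \<omega>\<bar> \<le> T" for c \<omega> by (rule abs_avg_le)
  qed (use T in auto)
  have vm[measurable]: "(\<lambda>z. avg (cell (X i (fst z))) (snd z)) \<in> borel_measurable (M \<Otimes>\<^sub>M law)"
    by (rule avg_cell_measurable) measurable
  have 4: "(\<Sum>c\<in>{..N}. expectation (?Z c) * expectation (?\<psi> c)) = (\<integral>z. avg (cell (X i (fst z))) (snd z) * ?W (fst z) \<partial>(M \<Otimes>\<^sub>M law))"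
  proof -
    have q: "expectation (?\<psi> c) = (\<integral>y. avg c y \<partial>law)" for c by (rule integral_X[OF ge(1) avg_measurable])
    have "(\<Sum>c\<in>{..N}. expectation (?Z c) * expectation (?\<psi> c)) = (\<Sum>c\<in>{..N}. \<integral>\<omega>. ?Z c \<omega> * (\<integral>y. avg c y \<partial>law) \<partial>M)"
      unfolding q by simp
    also have "\<dots> = (\<integral>\<omega>. (\<Sum>c\<in>{..N}. ?Z c \<omega> * (\<integral>y. avg c y \<partial>law)) \<partial>M)"
      by (rule Bochner_Integration.integral_sum[symmetric]) (use Zi in auto)
    also have "\<dots> = (\<integral>\<omega>. (\<integral>y. avg (cell (X i \<omega>)) y * ?W \<omega> \<partial>law) \<partial>M)"
    proof (rule Bochner_Integration.integral_cong[OF refl])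
      fix \<omega>
      have "(\<Sum>c\<in>{..N}. ?Z c \<omega> * (\<integral>y. avg c y \<partial>law)) = ?W \<omega> * (\<integral>y. avg (cell (X i \<omega>)) y \<partial>law)"
        using cell_decompose[of cell N, OF cN, where x = "X i \<omega>" and f = "\<lambda>c. ?W \<omega> * (\<integral>y. avg c y \<partial>law)"] by (simp only: mult.assoc)
      then show "(\<Sum>c\<in>{..N}. ?Z c \<omega> * (\<integral>y. avg c y \<partial>law)) = (\<integral>y. avg (cell (X i \<omega>)) y * ?W \<omega> \<partial>law)"
        by (simp add: mult.commute)
    qed
    also have "\<dots> = (\<integral>z. avg (cell (X i (fst z))) (snd z) * ?W (fst z) \<partial>(M \<Otimes>\<^sub>M law))"
    proof -
      have "integrable (M \<Otimes>\<^sub>M law) (\<lambda>(\<omega>, y). avg (cell (X i \<omega>)) y * ?W \<omega>)"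
        unfolding case_prod_unfold
        by (rule ext.P.integrable_bounded[of _ "T * T"], measurable, intro TT abs_clip_h2_le abs_avg_le)
      from ext.integral_fst[OF this] show ?thesis by (simp add: case_prod_unfold)
    qed
    finally show ?thesis .
  qed
  have 5: "\<bar>clip_quad_indep T i k l - (\<integral>z. avg (cell (X i (fst z))) (snd z) * ?W (fst z) \<partial>(M \<Otimes>\<^sub>M law))\<bar> \<le> T * (b + 2 * T * outer)"
  proof -
    let ?u = "\<lambda>z. clip T (h2 (X i (fst z)) (snd z))" and ?v = "\<lambda>z. avg (cell (X i (fst z))) (snd z)"
    let ?P = "M \<Otimes>\<^sub>M law"
    have Wm: "(\<lambda>z. ?W (fst z)) \<in> borel_measurable ?P" "?u \<in> borel_measurable ?P" by measurable
    show ?thesis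
      by (rule order_trans[OF ext.P.abs_expectation_mult_diff_le[OF Wm(2) vm Wm(1) abs_clip_h2_le abs_avg_le abs_clip_h2_le, folded clip_quad_indep_def]])
        (use approx_indep[OF i] T in \<open>auto intro: mult_left_mono\<close>)
  qed
  have "\<bar>(\<integral>\<omega>. avg (cell (X i \<omega>)) (X j \<omega>) * ?W \<omega> \<partial>M) - (\<integral>z. avg (cell (X i (fst z))) (snd z) * ?W (fst z) \<partial>(M \<Otimes>\<^sub>M law))\<bar> \<le> 8 * sqrt (Suc N) * \<alpha> * T^2"
    using 3 unfolding 2 sum_subtractf 4 by (simp add: power2_eq_square mult.assoc)
  then show ?thesis using 1 5 by linarith
qed

end

end

lemma (in stationary_process) alpha_mix_nonneg: "0 \<le> alpha_mix M X m"
proof -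
  have "\<bar>prob ({} \<inter> {}) - prob {} * prob {}\<bar> \<le> alpha_mix M X m"
    using alpha_bound_alpha_mix[of 1 m] unfolding alpha_bound_def by (blast intro: sets.empty_sets)
  then show ?thesis by simp
qed

section \<open>Balance of truncation level, cell width and range of the grid\<close>

context ustat_process
begin

lemma tail_le:
  assumes \<gamma>: "0 < \<gamma>" and i: "integrable law (\<lambda>x. \<bar>x\<bar> powr \<gamma>)" and R: "0 < R" and cell: "A \<subseteq> {x. R \<le> \<bar>x\<bar>}"
  shows "measure law A \<le> (\<integral>x. \<bar>x\<bar> powr \<gamma> \<partial>law) * R powr (- \<gamma>)"
proof -
  have "A \<subseteq> {x \<in> space law. R powr \<gamma> \<le> \<bar>x\<bar> powr \<gamma>}"
    using cell R \<gamma> by (auto intro!: powr_mono2)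
  then have "measure law A \<le> measure law {x \<in> space law. R powr \<gamma> \<le> \<bar>x\<bar> powr \<gamma>}"
    by (rule law.finite_measure_mono) measurable
  also have "\<dots> \<le> (\<integral>x. \<bar>x\<bar> powr \<gamma> \<partial>law) / R powr \<gamma>"
    by (rule integral_Markov_inequality_measure[OF i]) (use R in auto)
  finally show ?thesis by (simp add: powr_minus_divide)
qed

lemma quad_decay_alpha:
  assumes P: "P_Lipschitz M X h" and \<gamma>: "0 < \<gamma>" and mom: "integrable M (\<lambda>\<omega>. \<bar>X 1 \<omega>\<bar> powr \<gamma>)"
    and \<rho>: "(3 * \<gamma> * \<delta> + \<delta> + 5 * \<gamma> + 2) / (2 * \<gamma> * \<delta>) < \<rho>"
    and a: "0 \<le> a" "\<And>m. 1 \<le> m \<Longrightarrow> alpha_mix M X m \<le> a * real m powr (- \<rho>)"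
  shows "\<exists>D \<eta>. quad_decay D \<eta>"
proof -
  obtain L1 where L1: "0 < L1" "\<And>\<epsilon>. 0 < \<epsilon> \<Longrightarrow> Lipschitz_at TYPE('a \<times> real) M X h2 \<epsilon> (L1 * \<epsilon>)"
    by (rule h2_Lipschitz[OF P, where 'b = "'a \<times> real"]) blast
  obtain L2 where L2: "0 < L2" "\<And>\<epsilon>. 0 < \<epsilon> \<Longrightarrow> Lipschitz_at TYPE(('a \<times> real) \<times> real) M X h2 \<epsilon> (L2 * \<epsilon>)"
    by (rule h2_Lipschitz[OF P, where 'b = "('a \<times> real) \<times> real"]) blast
  define L where "L = max L1 L2"
  have L: "0 < L" using L1(1) by (simp add: L_def)
  have Lip: "Lipschitz_at TYPE('a \<times> real) M X (\<lambda>x y. clip T (h2 x y)) \<epsilon> (L * \<epsilon>)"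
    "Lipschitz_at TYPE(('a \<times> real) \<times> real) M X (\<lambda>x y. clip T (h2 x y)) \<epsilon> (L * \<epsilon>)" if "0 < \<epsilon>" for T \<epsilon>
    by (rule Lipschitz_at_clip[OF Lipschitz_at_mono[OF L1(2)[OF that]]], use that in \<open>simp add: L_def\<close>)
      (rule Lipschitz_at_clip[OF Lipschitz_at_mono[OF L2(2)[OF that]]], use that in \<open>simp add: L_def\<close>)
  define E where "E = (\<integral>x. \<bar>x\<bar> powr \<gamma> \<partial>law)"
  have E: "0 \<le> E" unfolding E_def by (rule integral_nonneg_AE) simp
  have mom': "integrable law (\<lambda>x. \<bar>x\<bar> powr \<gamma>)"
    using mom integrable_X[of 1 "\<lambda>x. \<bar>x\<bar> powr \<gamma>"] by (simp only: order_refl) measurable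
  \<comment> \<open>The factor by which \<open>\<rho>\<close> exceeds its threshold is
    \<open>1 + \<eta>\<close>. All exponents below are linear in \<open>q = 1 + \<eta>\<close>, so
    they balance as soon as they do for \<open>q = 1\<close>.\<close>
  define \<eta> where "\<eta> = \<rho> * (2 * \<gamma> * \<delta>) / (3 * \<gamma> * \<delta> + \<delta> + 5 * \<gamma> + 2) - 1"
  \<comment> \<open>With truncation at \<open>m powr \<kappa>\<close>, cells of width \<open>m powr (- (\<kappa> + q))\<close> and a grid covering
    \<open>[- m powr s, m powr s]\<close>, the Lipschitz, tail and mixing errors are all of order \<open>m powr (- q)\<close>.\<close>
  define q where "q = 1 + \<eta>"
  define \<kappa> where "\<kappa> = q / \<delta>"
  define s where "s = (2 * \<kappa> + q) / \<gamma>"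
  define w where "w = s + (\<kappa> + q)"
  have den: "0 < 3 * \<gamma> * \<delta> + \<delta> + 5 * \<gamma> + 2" "0 < 2 * \<gamma> * \<delta>" using \<gamma> \<delta>_pos by (simp_all add: add_pos_pos)
  have \<eta>: "0 < \<eta>" using \<rho> den unfolding \<eta>_def by (simp add: pos_divide_less_eq pos_less_divide_eq)
  have q: "0 < q" using \<eta> by (simp add: q_def)
  have \<kappa>: "0 < \<kappa>" using q \<delta>_pos by (simp add: \<kappa>_def)
  have s: "0 < s" "\<gamma> * s = 2 * \<kappa> + q" using q \<kappa> \<gamma> by (simp_all add: s_def)
  \<comment> \<open>The mixing error is \<open>sqrt N * \<alpha>(m) * T^2\<close> with about
    \<open>m powr w\<close> cells. For \<open>q = 1\<close> the equation reads
    \<open>\<rho> = w / 2 + 2 * \<kappa> + 1\<close> with \<open>\<kappa> = 1 / \<delta>\<close> and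
    \<open>w = (2 / \<delta> + 1) / \<gamma> + 1 / \<delta> + 1\<close>; this value of
    \<open>\<rho>\<close> is the threshold of the theorem.\<close>
  have ex: "w / 2 + 2 * \<kappa> - \<rho> = - q"
  proof -
    have "\<rho> = q * (3 * \<gamma> * \<delta> + \<delta> + 5 * \<gamma> + 2) / (2 * \<gamma> * \<delta>)" using den(1) \<gamma> \<delta>_pos unfolding q_def \<eta>_def by simp
    then show ?thesis unfolding w_def s_def \<kappa>_def using \<gamma> \<delta>_pos by (simp add: field_simps)
  qed
  \<comment> \<open>The Lipschitz error occurs twice, the tail four times, and the mixing error 24
    times with constant \<open>2 * a\<close>.\<close>
  define C where "C = 2 * L + 4 * E + 48 * a"
  have C: "0 \<le> C" using L E a(1) by (simp add: C_def)
  \<comment> \<open>One bound for both ends: its last summand arises only when the largest index is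
    isolated, and being nonnegative it may be added in the other case.\<close>
  have bound: "\<exists>cell N \<epsilon>. cell \<in> borel \<rightarrow>\<^sub>M count_space UNIV \<and> (\<forall>x. cell x \<le> N) \<and>
      (\<forall>x x'. cell x = cell x' \<longrightarrow> cell x < N \<longrightarrow> \<bar>x - x'\<bar> \<le> \<epsilon>) \<and> 0 < \<epsilon> \<and>
      real m powr \<kappa> * (L * \<epsilon> + 2 * real m powr \<kappa> * (8 * sqrt (Suc N) * alpha_mix M X m + measure law {x. cell x = N}))
        + 8 * sqrt (Suc N) * alpha_mix M X m * (real m powr \<kappa>)^2 + real m powr \<kappa> * (L * \<epsilon> + 2 * real m powr \<kappa> * measure law {x. cell x = N})
      \<le> C * real m powr (- q)" if m: "1 \<le> m" for m
  proof -
    define \<mu> where "\<mu> = real m"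
    have \<mu>: "1 \<le> \<mu>" using m by (simp add: \<mu>_def)
    define \<epsilon> where "\<epsilon> = \<mu> powr (- (\<kappa> + q))"
    define R where "R = \<mu> powr s"
    define N where "N = nat \<lceil>2 * R / \<epsilon>\<rceil>"
    have \<epsilon>: "0 < \<epsilon>" using \<mu> by (simp add: \<epsilon>_def)
    have R: "0 < R" using \<mu> by (simp add: R_def)
    have w: "0 < w" using s q \<kappa> by (simp add: w_def)
    have R\<epsilon>: "R / \<epsilon> = \<mu> powr w" unfolding R_def \<epsilon>_def w_def powr_diff[symmetric]
      by (rule arg_cong[where f = "(powr) \<mu>"]) simp
    have "1 \<le> \<mu> powr w" using \<mu> w by (intro ge_one_powr_ge_zero) auto
    moreover have "real N \<le> 2 * (R / \<epsilon>) + 1" unfolding N_def using R \<epsilon> by (simp; linarith)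
    \<comment> \<open>Rounding up and counting the outer cell add at most 2, which is absorbed
      because \<open>\<mu> powr w\<close> is at least 1.\<close>
    ultimately have "real (Suc N) \<le> 4 * \<mu> powr w" unfolding R\<epsilon> by simp
    then have "sqrt (Suc N) \<le> sqrt (4 * \<mu> powr w)" by (rule real_sqrt_le_mono)
    also have "sqrt (4 * \<mu> powr w) = 2 * \<mu> powr (w / 2)"
      using powr_half_sqrt_powr[of \<mu> w] \<mu> by (simp add: real_sqrt_mult)
    finally have sN: "sqrt (Suc N) \<le> 2 * \<mu> powr (w / 2)" .
    have outer: "measure law {x. grid R \<epsilon> x = N} \<le> E * \<mu> powr (- (2 * \<kappa> + q))"
    proof -
      have "{x. grid R \<epsilon> x = N} \<subseteq> {x. R \<le> \<bar>x\<bar>}"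
      proof
        fix x assume "x \<in> {x. grid R \<epsilon> x = N}"
        then have "\<not> (- R \<le> x \<and> x < R)" using grid_less[OF \<epsilon>, of R x] unfolding N_def by auto
        then show "x \<in> {x. R \<le> \<bar>x\<bar>}" by (auto simp: abs_if)
      qed
      from tail_le[OF \<gamma> mom' R this] show ?thesis
        unfolding E_def R_def powr_powr using s(2) by (simp only: mult.commute mult_minus_left mult_minus_right)
    qed
    have \<alpha>: "alpha_mix M X m \<le> a * \<mu> powr (- \<rho>)" using a(2)[OF m] by (simp add: \<mu>_def)
    have \<alpha>0: "0 \<le> alpha_mix M X m" by (rule alpha_mix_nonneg)
    let ?T = "\<mu> powr \<kappa>" and ?q = "\<mu> powr (- q)"
    have t1: "?T * (L * \<epsilon>) = L * ?q" unfolding \<epsilon>_def by (simp add: powr_add[symmetric] mult.left_commute)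
    have t2: "?T^2 * measure law {x. grid R \<epsilon> x = N} \<le> E * ?q"
    proof -
      have "?T^2 * measure law {x. grid R \<epsilon> x = N} \<le> ?T^2 * (E * \<mu> powr (- (2 * \<kappa> + q)))"
        by (rule mult_left_mono[OF outer]) simp
      also have "?T^2 * (E * \<mu> powr (- (2 * \<kappa> + q))) = E * (\<mu> powr \<kappa> * \<mu> powr \<kappa> * \<mu> powr (- (2 * \<kappa> + q)))"
        by (simp only: power2_eq_square mult_ac)
      also have "\<mu> powr \<kappa> * \<mu> powr \<kappa> * \<mu> powr (- (2 * \<kappa> + q)) = ?q" by (simp add: powr_add[symmetric])
      finally show ?thesis .
    qed
    have t3: "sqrt (Suc N) * alpha_mix M X m * ?T^2 \<le> 2 * a * ?q"
    proof -
      have "sqrt (Suc N) * alpha_mix M X m * ?T^2 \<le> (2 * \<mu> powr (w / 2)) * (a * \<mu> powr (- \<rho>)) * ?T^2"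
        by (intro mult_right_mono mult_mono sN \<alpha> \<alpha>0) auto
      also have "(2 * \<mu> powr (w / 2)) * (a * \<mu> powr (- \<rho>)) * ?T^2
          = 2 * a * (\<mu> powr (w / 2) * \<mu> powr (- \<rho>) * (\<mu> powr \<kappa> * \<mu> powr \<kappa>))"
        by (simp only: power2_eq_square mult_ac)
      also have "\<mu> powr (w / 2) * \<mu> powr (- \<rho>) * (\<mu> powr \<kappa> * \<mu> powr \<kappa>) = ?q"
        unfolding powr_add[symmetric] ex[symmetric] by (rule arg_cong[where f = "(powr) \<mu>"]) simp
      finally show ?thesis .
    qed
    have "?T * (L * \<epsilon> + 2 * ?T * (8 * sqrt (Suc N) * alpha_mix M X m + measure law {x. grid R \<epsilon> x = N}))
        + 8 * sqrt (Suc N) * alpha_mix M X m * ?T^2 + ?T * (L * \<epsilon> + 2 * ?T * measure law {x. grid R \<epsilon> x = N})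
      = 2 * (?T * (L * \<epsilon>)) + 24 * (sqrt (Suc N) * alpha_mix M X m * ?T^2) + 4 * (?T^2 * measure law {x. grid R \<epsilon> x = N})"
      by (simp only: power2_eq_square) algebra
    also have "\<dots> \<le> 2 * (L * ?q) + 24 * (2 * a * ?q) + 4 * (E * ?q)"
      unfolding t1 by (intro add_mono mult_left_mono t2 t3 order_refl) auto
    also have "\<dots> = C * ?q" unfolding C_def by algebra
    finally show ?thesis
      unfolding \<mu>_def[symmetric]
      using grid_measurable[of R \<epsilon>] grid_le[OF \<epsilon>, of R] grid_close[OF \<epsilon>] \<epsilon>
      by (intro exI[of _ "grid R \<epsilon>"] exI[of _ N] exI[of _ \<epsilon>] conjI allI impI) (auto simp: N_def)
  qed
  have "quad_decay (4 * C2 + C) \<eta>"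
  proof (rule quad_decayI[OF \<eta> C])
    fix m i j k l :: nat
    assume b: "1 \<le> m" "1 \<le> i" "i + m \<le> j" "i + m \<le> k" "k < l"
    obtain cell N \<epsilon> where c: "cell \<in> borel \<rightarrow>\<^sub>M count_space UNIV" "\<And>x. cell x \<le> N"
      "\<And>x x'. cell x = cell x' \<Longrightarrow> cell x < N \<Longrightarrow> \<bar>x - x'\<bar> \<le> \<epsilon>" "0 < \<epsilon>" and
      le: "real m powr \<kappa> * (L * \<epsilon> + 2 * real m powr \<kappa> * (8 * sqrt (Suc N) * alpha_mix M X m + measure law {x. cell x = N}))
        + 8 * sqrt (Suc N) * alpha_mix M X m * (real m powr \<kappa>)^2 + real m powr \<kappa> * (L * \<epsilon> + 2 * real m powr \<kappa> * measure law {x. cell x = N})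
      \<le> C * real m powr (- q)" using bound[OF b(1)] by blast
    have T: "0 < real m powr \<kappa>" and Le: "0 \<le> L * \<epsilon>" using b(1) L c(4) by auto
    have 1: "\<bar>clip_quad (real m powr \<kappa>) i j k l - clip_quad_indep (real m powr \<kappa>) j k l\<bar> \<le>
      real m powr \<kappa> * (L * \<epsilon> + 2 * real m powr \<kappa> * (8 * sqrt (Suc N) * alpha_mix M X m + measure law {x. cell x = N}))
        + 8 * sqrt (Suc N) * alpha_mix M X m * (real m powr \<kappa>)^2"
      by (rule clip_quad_diff_le_first[OF c(1,2) _ T Le Lip[OF c(4)] b(2-5) alpha_bound_alpha_mix[OF b(2)]]) (rule c(3))
    have 2: "0 \<le> real m powr \<kappa> * (L * \<epsilon> + 2 * real m powr \<kappa> * measure law {x. cell x = N})"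
      by (rule mult_nonneg_nonneg[OF _ add_nonneg_nonneg[OF Le]]) auto
    show "\<bar>clip_quad (real m powr ((1 + \<eta>) / \<delta>)) i j k l - clip_quad_indep (real m powr ((1 + \<eta>) / \<delta>)) j k l\<bar> \<le> C * real m powr (- (1 + \<eta>))"
      unfolding q_def[symmetric] \<kappa>_def[symmetric] by (rule order_trans[OF add_increasing2[OF 2 1] le])
  next
    fix m i j k l :: nat
    assume b: "1 \<le> m" "1 \<le> i" "1 \<le> k" "k < l" "i + m \<le> j" "l + m \<le> j"
    obtain cell N \<epsilon> where c: "cell \<in> borel \<rightarrow>\<^sub>M count_space UNIV" "\<And>x. cell x \<le> N"
      "\<And>x x'. cell x = cell x' \<Longrightarrow> cell x < N \<Longrightarrow> \<bar>x - x'\<bar> \<le> \<epsilon>" "0 < \<epsilon>" and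
      le: "real m powr \<kappa> * (L * \<epsilon> + 2 * real m powr \<kappa> * (8 * sqrt (Suc N) * alpha_mix M X m + measure law {x. cell x = N}))
        + 8 * sqrt (Suc N) * alpha_mix M X m * (real m powr \<kappa>)^2 + real m powr \<kappa> * (L * \<epsilon> + 2 * real m powr \<kappa> * measure law {x. cell x = N})
      \<le> C * real m powr (- q)" using bound[OF b(1)] by blast
    have T: "0 < real m powr \<kappa>" and Le: "0 \<le> L * \<epsilon>" using b(1) L c(4) by auto
    have ab: "alpha_bound M (past (j - m)) (future j) (alpha_mix M X m)"
      using alpha_bound_alpha_mix[of "j - m" m] b by simp
    show "\<bar>clip_quad (real m powr ((1 + \<eta>) / \<delta>)) i j k l - clip_quad_indep (real m powr ((1 + \<eta>) / \<delta>)) i k l\<bar> \<le> C * real m powr (- (1 + \<eta>))"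
      unfolding q_def[symmetric] \<kappa>_def[symmetric]
      by (rule order_trans[OF clip_quad_diff_le_last[OF c(1,2) _ T Le Lip[OF c(4)] b(2-6) ab] le]) (rule c(3))
  qed
  then show ?thesis by blast
qed

end

section \<open>The limit theorem\<close>

lemma real_distribution_normal_law: "0 \<le> v \<Longrightarrow> real_distribution (normal_law 0 v)"
  unfolding real_distribution_def real_distribution_axioms_def normal_law_def
  by (auto intro: prob_space_return prob_space_normal_density)

lemma char_normal_law:
  assumes v: "0 \<le> v"
  shows "char (normal_law 0 v) t = complex_of_real (exp (- (t^2 * v / 2)))"
proof (cases "v = 0")
  case True
  then show ?thesis unfolding char_def normal_law_def by (simp add: integral_return)
next
  case False
  then have v': "0 < sqrt v" using v by simp
  interpret S: prob_space std_normal_distribution by (rule prob_space_normal_density) simp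
  have "distributed std_normal_distribution lborel (\<lambda>x. x) (\<lambda>x. ennreal (normal_density 0 1 x))"
    unfolding distributed_def by (auto simp: distr_id2)
  from S.normal_density_affine[OF this, of "sqrt v" 0]
  have d: "distributed std_normal_distribution lborel (\<lambda>x. sqrt v * x) (\<lambda>x. ennreal (normal_density 0 (sqrt v) x))"
    using v' by simp
  have "normal_law 0 v = distr std_normal_distribution borel (\<lambda>x. sqrt v * x)"
  proof -
    have "distr std_normal_distribution borel (\<lambda>x. sqrt v * x) = distr std_normal_distribution lborel (\<lambda>x. sqrt v * x)"
      by (rule distr_cong) simp_all
    then show ?thesis using distributed_distr_eq_density[OF d] False unfolding normal_law_def by simp
  qed
  then have "char (normal_law 0 v) t = (CLINT x|std_normal_distribution. iexp (t * (sqrt v * x)))"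
    unfolding char_def by (simp add: integral_distr)
  also have "\<dots> = char std_normal_distribution (t * sqrt v)" unfolding char_def by (simp only: mult.assoc)
  also have "\<dots> = complex_of_real (exp (- ((t * sqrt v)^2) / 2))" by (simp add: char_std_normal_distribution)
  also have "(t * sqrt v)^2 = t^2 * v" using v by (simp add: power_mult_distrib)
  finally show ?thesis by simp
qed

lemma sum_index_pairs_Suc:
  fixes g :: "nat \<Rightarrow> nat \<Rightarrow> real"
  shows "(\<Sum>(i, j)\<in>{(i, j). 1 \<le> i \<and> i < j \<and> j \<le> Suc n}. g i j)
    = (\<Sum>(i, j)\<in>{(i, j). 1 \<le> i \<and> i < j \<and> j \<le> n}. g i j) + (\<Sum>i\<in>{1..n}. g i (Suc n))"
proof -
  have s: "{(i, j). 1 \<le> i \<and> i < j \<and> j \<le> Suc n} = {(i, j). 1 \<le> i \<and> i < j \<and> j \<le> n} \<union> (\<lambda>i. (i, Suc n)) ` {1..n}"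
    by (auto simp: le_Suc_eq)
  have "(\<Sum>(i, j)\<in>(\<lambda>i. (i, Suc n)) ` {1..n}. g i j) = (\<Sum>i\<in>{1..n}. g i (Suc n))"
    by (subst sum.reindex) (auto simp: inj_on_def)
  moreover have "{(i, j). 1 \<le> i \<and> i < j \<and> j \<le> n} \<inter> (\<lambda>i. (i, Suc n)) ` {1..n} = {}" by auto
  ultimately show ?thesis unfolding s using finite_index_pairs[of n] by (subst sum.union_disjoint) auto
qed

text \<open>Every index belongs to \<open>n - 1\<close> of the pairs. At \<open>n = 0\<close> the
  real factor \<open>-1\<close> multiplies an empty sum.\<close>

lemma sum_index_pairs_additive:
  fixes f :: "nat \<Rightarrow> real"
  shows "(\<Sum>(i, j)\<in>{(i, j). 1 \<le> i \<and> i < j \<and> j \<le> n}. c + f i + f j)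
    = c * (real n * (real n - 1) / 2) + (real n - 1) * (\<Sum>i\<in>{1..n}. f i)"
proof (induction n)
  case 0
  have "{(i, j). 1 \<le> i \<and> i < j \<and> j \<le> (0::nat)} = {}" by auto
  then show ?case by (simp only: sum.empty) simp
next
  case (Suc n)
  have "(\<Sum>i\<in>{1..n}. c + f i + f (Suc n)) = real n * c + (\<Sum>i\<in>{1..n}. f i) + real n * f (Suc n)"
    by (simp add: sum.distrib)
  moreover have "(\<Sum>i\<in>{1..Suc n}. f i) = (\<Sum>i\<in>{1..n}. f i) + f (Suc n)" by simp
  ultimately show ?case unfolding sum_index_pairs_Suc Suc.IH by (simp add: field_simps)
qed

lemma (in prob_space) expectation_abs_le_sqrt:
  fixes Y :: "'a \<Rightarrow> real"
  assumes Y: "Y \<in> borel_measurable M" and sq: "integrable M (\<lambda>\<omega>. (Y \<omega>)^2)"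
  shows "integrable M Y" "expectation (\<lambda>\<omega>. \<bar>Y \<omega>\<bar>) \<le> sqrt (expectation (\<lambda>\<omega>. (Y \<omega>)^2))"
proof -
  show i: "integrable M Y" by (rule square_integrable_imp_integrable[OF Y sq])
  have "0 \<le> variance (\<lambda>\<omega>. \<bar>Y \<omega>\<bar>)" by (rule variance_positive)
  also have "variance (\<lambda>\<omega>. \<bar>Y \<omega>\<bar>) = expectation (\<lambda>\<omega>. (Y \<omega>)^2) - (expectation (\<lambda>\<omega>. \<bar>Y \<omega>\<bar>))^2"
    using variance_eq[of "\<lambda>\<omega>. \<bar>Y \<omega>\<bar>"] i sq by simp
  finally show "expectation (\<lambda>\<omega>. \<bar>Y \<omega>\<bar>) \<le> sqrt (expectation (\<lambda>\<omega>. (Y \<omega>)^2))" by (intro real_le_rsqrt) simp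
qed

lemma bigo_powr_bound:
  fixes f :: "nat \<Rightarrow> real"
  assumes f: "f \<in> O(\<lambda>n. real n powr (- r))"
  shows "\<exists>a>0. \<forall>m\<ge>1. f m \<le> a * real m powr (- r)"
proof -
  obtain c where c: "c > 0" "\<forall>\<^sub>F n in sequentially. norm (f n) \<le> c * norm (real n powr (- r))"
    using landau_o.bigE[OF f] by blast
  then obtain n0 where n0: "\<And>n. n \<ge> n0 \<Longrightarrow> \<bar>f n\<bar> \<le> c * real n powr (- r)"
    unfolding eventually_sequentially by auto
  \<comment> \<open>Finitely many initial values are absorbed into the constant. Index 0 contributes
    a quotient by \<open>0 powr (- r) = 0\<close>, which is 0.\<close>
  define b where "b = (\<Sum>m<n0. \<bar>f m\<bar> / real m powr (- r))"
  have "f m \<le> (c + b) * real m powr (- r)" if m: "1 \<le> m" for m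
  proof -
    have p: "0 < real m powr (- r)" using m by simp
    have b0: "0 \<le> b" unfolding b_def by (intro sum_nonneg) auto
    show ?thesis
    proof (cases "n0 \<le> m")
      case True
      have "f m \<le> c * real m powr (- r)" using n0[OF True] by linarith
      moreover have "0 \<le> b * real m powr (- r)" using b0 by simp
      ultimately show ?thesis by (simp add: distrib_right)
    next
      case False
      have "\<bar>f m\<bar> / real m powr (- r) \<le> b"
        unfolding b_def by (rule member_le_sum[of m]) (use False in auto)
      then have "\<bar>f m\<bar> \<le> b * real m powr (- r)" by (simp only: pos_divide_le_eq[OF p])
      moreover have "0 \<le> c * real m powr (- r)" using c(1) by simp
      ultimately show ?thesis by (simp add: distrib_right)
    qed
  qed
  moreover have "0 \<le> b" unfolding b_def by (intro sum_nonneg) auto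
  ultimately show ?thesis using c(1) by (intro exI[of _ "c + b"]) auto
qed

section \<open>From partial sums to the U-statistic\<close>

context ustat_process
begin

lemma degenerate_sum_measurable: "degenerate_sum n \<in> borel_measurable M"
  unfolding degenerate_sum_def[abs_def] case_prod_unfold
  by (intro borel_measurable_sum) (auto intro!: h2_comp_measurable X_measurable)

lemma U_stat_measurable: "U_stat X h n \<in> borel_measurable M"
  unfolding U_stat_def[abs_def] case_prod_unfold
  by (intro borel_measurable_times borel_measurable_sum borel_measurable_const) (auto intro!: h_comp_measurable X_measurable)

lemma cen_h1: "cen (h1 M X h) i \<omega> = h1 M X h (X i \<omega>)"
  unfolding cen_def integral_h1(2) by simp

lemma U_stat_decomposition:
  assumes n: "2 \<le> n"
  shows "U_stat X h n \<omega> - U_mean M X h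
    = 2 / real n * psum (h1 M X h) {1..n} \<omega> + 2 / (real n * (real n - 1)) * degenerate_sum n \<omega>"
proof -
  let ?P = "{(i, j). 1 \<le> i \<and> i < j \<and> j \<le> n}" and ?f = "\<lambda>i. h1 M X h (X i \<omega>)"
  have "(\<Sum>(i, j)\<in>?P. h (X i \<omega>) (X j \<omega>)) = (\<Sum>(i, j)\<in>?P. U_mean M X h + ?f i + ?f j) + degenerate_sum n \<omega>"
    unfolding degenerate_sum_def sum.distrib[symmetric] by (rule sum.cong) (auto simp: h2_def)
  also have "(\<Sum>(i, j)\<in>?P. U_mean M X h + ?f i + ?f j)
      = U_mean M X h * (real n * (real n - 1) / 2) + (real n - 1) * psum (h1 M X h) {1..n} \<omega>"
    unfolding sum_index_pairs_additive psum_def cen_h1 ..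
  finally have s: "(\<Sum>(i, j)\<in>?P. h (X i \<omega>) (X j \<omega>))
      = U_mean M X h * (real n * (real n - 1) / 2) + (real n - 1) * psum (h1 M X h) {1..n} \<omega> + degenerate_sum n \<omega>" .
  show ?thesis unfolding U_stat_def s using n by (simp add: field_simps)
qed

lemma h1_covar_eq_acov: "h1_covar M X h k = acov (h1 M X h) k"
proof -
  have "(\<integral>\<omega>. h1 M X h (X i \<omega>) \<partial>M) = 0" if "1 \<le> i" for i
    using integral_X[OF that h1_measurable] integral_h1(2) by simp
  from this[of 1] this[of "1 + k"] show ?thesis
    unfolding h1_covar_def covar_def acov_def cen_h1 by simp
qed

text \<open>The remainder of the decomposition tends to 0 in L1, and characteristic functions are
  Lipschitz in the L1 distance.\<close>

lemma chf_U_stat_tendsto: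
  assumes dec: "quad_decay D \<eta>"
    and lim: "(\<lambda>n. chf (psum (h1 M X h) {1..n}) ((2 * t) / sqrt (real n))) \<longlonglongrightarrow> l"
    and pm: "\<And>n. psum (h1 M X h) {1..n} \<in> borel_measurable M"
  shows "(\<lambda>n. chf (\<lambda>\<omega>. sqrt (real n) * (U_stat X h n \<omega> - U_mean M X h)) t) \<longlonglongrightarrow> l"
proof -
  let ?Y = "\<lambda>n \<omega>. sqrt (real n) * (U_stat X h n \<omega> - U_mean M X h)"
  let ?Z = "\<lambda>n \<omega>. 2 / sqrt (real n) * psum (h1 M X h) {1..n} \<omega>"
  let ?E = "\<lambda>n. \<integral>\<omega>. (degenerate_sum n \<omega>)^2 \<partial>M"
  have z: "chf (?Z n) t = chf (psum (h1 M X h) {1..n}) ((2 * t) / sqrt (real n))" for n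
    unfolding chf_def by (rule Bochner_Integration.integral_cong[OF refl]) (simp add: field_simps)
  have "(\<lambda>n. chf (?Y n) t - chf (?Z n) t) \<longlonglongrightarrow> 0"
  proof (rule Lim_null_comparison)
    show "\<forall>\<^sub>F n in sequentially. cmod (chf (?Y n) t - chf (?Z n) t) \<le> 4 * \<bar>t\<bar> * sqrt (?E n / real n ^ 3)"
      using eventually_ge_at_top[of 2]
    proof eventually_elim
      case (elim n)
      let ?c = "2 * sqrt (real n) / (real n * (real n - 1))"
      have c0: "0 \<le> ?c" using elim by simp
      have s: "sqrt (real n) * sqrt (real n) = real n" by simp
      have r: "sqrt (real n) * (2 / real n) = 2 / sqrt (real n)" using elim s by (simp add: field_simps)
      have d: "?Y n \<omega> - ?Z n \<omega> = ?c * degenerate_sum n \<omega>" for \<omega>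
        unfolding U_stat_decomposition[OF elim] distrib_left mult.assoc[symmetric] r by simp
      note D = expectation_abs_le_sqrt[OF degenerate_sum_measurable degenerate_sum_square(1)[OF dec], of n]
      have "cmod (chf (?Y n) t - chf (?Z n) t) \<le> \<bar>t\<bar> * (\<integral>\<omega>. \<bar>?Y n \<omega> - ?Z n \<omega>\<bar> \<partial>M)"
      proof (rule chf_diff_le)
        show "?Y n \<in> borel_measurable M" using U_stat_measurable by measurable
        show "?Z n \<in> borel_measurable M" using pm by measurable
        show "integrable M (\<lambda>\<omega>. ?Y n \<omega> - ?Z n \<omega>)" unfolding d using D(1) by simp
      qed
      also have "(\<integral>\<omega>. \<bar>?Y n \<omega> - ?Z n \<omega>\<bar> \<partial>M) = ?c * (\<integral>\<omega>. \<bar>degenerate_sum n \<omega>\<bar> \<partial>M)"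
        unfolding d abs_mult abs_of_nonneg[OF c0] by simp
      finally have 1: "cmod (chf (?Y n) t - chf (?Z n) t) \<le> \<bar>t\<bar> * (?c * (\<integral>\<omega>. \<bar>degenerate_sum n \<omega>\<bar> \<partial>M))" .
      have 2: "\<bar>t\<bar> * (?c * (\<integral>\<omega>. \<bar>degenerate_sum n \<omega>\<bar> \<partial>M)) \<le> \<bar>t\<bar> * (?c * sqrt (?E n))"
        by (intro mult_left_mono D(2) c0) simp
      \<comment> \<open>The coefficient of the remainder is of order
        \<open>n powr (- 3 / 2)\<close>, the square root of the normalisation in
        \<open>degenerate_sum_tendsto\<close>; \<open>n \<ge> 2\<close> gives
        \<open>2 / (n - 1) \<le> 4 / n\<close>.\<close>
      have "?c \<le> 4 / sqrt (real n ^ 3)"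
      proof -
        have "sqrt (real n ^ 3) = real n * sqrt (real n)" by (simp add: power3_eq_cube real_sqrt_mult)
        moreover have "1 / sqrt (real n) = sqrt (real n) / real n" using elim s by (simp add: field_simps)
        ultimately have "4 / sqrt (real n ^ 3) = sqrt (real n) / real n * (4 / real n)"
          by (metis (no_types) divide_divide_eq_left mult.commute times_divide_eq_right mult.right_neutral)
        moreover have "sqrt (real n) / real n * (2 / (real n - 1)) \<le> sqrt (real n) / real n * (4 / real n)"
          by (rule mult_left_mono) (use elim in \<open>auto simp: field_simps\<close>)
        ultimately show ?thesis by (simp add: mult.commute)
      qed
      then have "?c * sqrt (?E n) \<le> 4 / sqrt (real n ^ 3) * sqrt (?E n)" by (rule mult_right_mono) simp
      also have "4 / sqrt (real n ^ 3) * sqrt (?E n) = 4 * sqrt (?E n / real n ^ 3)" by (simp add: real_sqrt_divide)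
      finally have 3: "\<bar>t\<bar> * (?c * sqrt (?E n)) \<le> \<bar>t\<bar> * (4 * sqrt (?E n / real n ^ 3))" by (rule mult_left_mono) simp
      show ?case using order_trans[OF 1 order_trans[OF 2 3]] by (simp only: mult_ac)
    qed
    have "(\<lambda>n. 4 * \<bar>t\<bar> * sqrt (?E n / real n ^ 3)) \<longlonglongrightarrow> 4 * \<bar>t\<bar> * sqrt 0"
      by (intro tendsto_intros degenerate_sum_tendsto[OF dec])
    then show "(\<lambda>n. 4 * \<bar>t\<bar> * sqrt (?E n / real n ^ 3)) \<longlonglongrightarrow> 0" by simp
  qed
  from tendsto_add[OF this lim[folded z]] show ?thesis by simp
qed

text \<open>The two cases of the theorem enter only through \<open>quad_decay\<close> and a mixing
  rate with exponent above \<open>(2 + \<delta>) / \<delta>\<close>. The 4 in the limit variance is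
  the square of the 2 in front of the linear part, which appears as evaluation at
  \<open>2 * t\<close>.\<close>

lemma central_limit:
  assumes dec: "quad_decay D \<eta>" and \<rho>: "(2 + \<delta>) / \<delta> < \<rho>" and a: "0 < a"
    and mixing: "\<And>k m. 1 \<le> k \<Longrightarrow> 1 \<le> m \<Longrightarrow> alpha_bound M (past k) (future (k + m)) (a * real m powr (- \<rho>))"
  shows "summable (\<lambda>k. h1_covar M X h (Suc k)) \<and> 0 \<le> long_run_variance M X h \<and>
    weak_conv_m (\<lambda>n. distr M borel (\<lambda>\<omega>. sqrt (real n) * (U_stat X h n \<omega> - U_mean M X h)))
      (normal_law 0 (4 * long_run_variance M X h))"
proof -
  interpret mix: stationary_mixing M X \<delta> \<rho> a
    by unfold_locales (use \<delta>_pos a \<rho> mixing in auto)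
  define A where "A = (\<integral>x. \<bar>h1 M X h x\<bar> powr (2 + \<delta>) \<partial>law) + 1"
  have "0 \<le> (\<integral>x. \<bar>h1 M X h x\<bar> powr (2 + \<delta>) \<partial>law)" by (rule integral_nonneg_AE) simp
  then have fA: "mix.moment_le (h1 M X h) A"
    unfolding mix.moment_le_def A_def using h1_powr_integrable by (auto intro: add_nonneg_pos)
  have v: "long_run_variance M X h = asym_var (h1 M X h)"
    unfolding long_run_variance_def asym_var_def h1_covar_eq_acov ..
  have nn: "0 \<le> asym_var (h1 M X h)" by (rule mix.asym_var_nonneg[OF fA])
  have Ym: "(\<lambda>\<omega>. sqrt (real n) * (U_stat X h n \<omega> - U_mean M X h)) \<in> borel_measurable M" for n
    using U_stat_measurable by measurable
  have "weak_conv_m (\<lambda>n. distr M borel (\<lambda>\<omega>. sqrt (real n) * (U_stat X h n \<omega> - U_mean M X h)))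
      (normal_law 0 (4 * asym_var (h1 M X h)))"
  proof (rule levy_continuity)
    show "real_distribution (distr M borel (\<lambda>\<omega>. sqrt (real n) * (U_stat X h n \<omega> - U_mean M X h)))" for n
      by (rule real_distribution_distr[OF Ym])
    show "real_distribution (normal_law 0 (4 * asym_var (h1 M X h)))"
      by (rule real_distribution_normal_law) (use nn in simp)
    fix t
    have "(\<lambda>n. chf (\<lambda>\<omega>. sqrt (real n) * (U_stat X h n \<omega> - U_mean M X h)) t)
        \<longlonglongrightarrow> complex_of_real (exp (- ((2 * t)^2 * asym_var (h1 M X h) / 2)))"
      by (rule chf_U_stat_tendsto[OF dec mix.chf_psum_tendsto[OF fA] mix.psum_measurable[OF fA]]) simp
    moreover have "(2 * t)^2 * asym_var (h1 M X h) / 2 = t^2 * (4 * asym_var (h1 M X h)) / 2" by (simp add: power_mult_distrib)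
    ultimately show "(\<lambda>n. char (distr M borel (\<lambda>\<omega>. sqrt (real n) * (U_stat X h n \<omega> - U_mean M X h))) t)
        \<longlonglongrightarrow> char (normal_law 0 (4 * asym_var (h1 M X h))) t"
      using char_normal_law[of "4 * asym_var (h1 M X h)" t] nn by (simp only: char_distr_eq[OF Ym])
  qed
  then show ?thesis unfolding v h1_covar_eq_acov using nn mix.summable_acov[OF fA] by simp
qed

end

text \<open>\<open>C\<close> is the moment bound, as \<open>M\<close> denotes the measure. Infinite
  series and \<open>normal_law\<close> are total functions, so summability and a nonnegative
  variance are part of the conclusion: they give the limit law its intended meaning.\<close>

theorem theorem1p8:
  fixes M :: "'a measure"
    and X :: "nat \<Rightarrow> 'a \<Rightarrow> real"
    and h :: "real \<Rightarrow> real \<Rightarrow> real"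
    and \<delta> C :: real
  assumes "prob_space M"
    and "\<And>n. 1 \<le> n \<Longrightarrow> X n \<in> borel_measurable M"
    and "strictly_stationary M X"
    and "\<And>x y. h x y = h y x"
    and "(\<lambda>(x, y). h x y) \<in> borel_measurable (borel \<Otimes>\<^sub>M borel)"
    and "0 < \<delta>" and "0 < C"
    and "(\<integral>\<^sup>+x. (\<integral>\<^sup>+y. ennreal (\<bar>h x y\<bar> powr (2 + \<delta>)) \<partial>marginal M X) \<partial>marginal M X) \<le> ennreal C"
    and "\<And>k :: nat. (\<integral>\<^sup>+(x, y). ennreal (\<bar>h x y\<bar> powr (2 + \<delta>)) \<partial>pair_law M (X 1) (X (1 + k)))
           \<le> ennreal C"
    and "(absolutely_regular M X \<and>
          (\<exists>\<delta>'. 0 < \<delta>' \<and> \<delta>' < \<delta> \<and>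
             beta_mix M X \<in> O(\<lambda>n. real n powr (- ((2 + \<delta>') / \<delta>'))))) \<or>
         (strongly_mixing M X \<and> P_Lipschitz M X h \<and>
          (\<exists>\<gamma> \<rho>. 0 < \<gamma> \<and> integrable M (\<lambda>\<omega>. \<bar>X 1 \<omega>\<bar> powr \<gamma>) \<and>
             (3 * \<gamma> * \<delta> + \<delta> + 5 * \<gamma> + 2) / (2 * \<gamma> * \<delta>) < \<rho> \<and>
             alpha_mix M X \<in> O(\<lambda>n. real n powr (- \<rho>))))"
  shows "summable (\<lambda>k. h1_covar M X h (Suc k)) \<and>
         0 \<le> long_run_variance M X h \<and>
         weak_conv_m (\<lambda>n. distr M borel (\<lambda>\<omega>. sqrt (real n) * (U_stat X h n \<omega> - U_mean M X h)))
           (normal_law 0 (4 * long_run_variance M X h))"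
proof -
  interpret prob_space M by (rule assms(1))
  interpret ustat_process M X h \<delta> C by unfold_locales (fact assms)+
  have bound_mono: "alpha_bound M F G y" if "alpha_bound M F G x" "x \<le> y" for F G x y
    using that unfolding alpha_bound_def by (meson order_trans)
  from assms(10) show ?thesis
  proof (elim disjE conjE exE)
    fix \<delta>' assume \<delta>': "0 < \<delta>'" "\<delta>' < \<delta>" and O: "beta_mix M X \<in> O(\<lambda>n. real n powr (- ((2 + \<delta>') / \<delta>')))"
    let ?\<rho> = "(2 + \<delta>') / \<delta>'"
    \<comment> \<open>The quotient (2 + x) / x is strictly decreasing in x > 0.\<close>
    have \<rho>: "(2 + \<delta>) / \<delta> < ?\<rho>" using \<delta>' by (simp add: field_simps)
    obtain a where a: "a > 0" "\<And>m. 1 \<le> m \<Longrightarrow> beta_mix M X m \<le> a * real m powr (- ?\<rho>)"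
      using bigo_powr_bound[OF O] by auto
    obtain D \<eta> where dec: "quad_decay D \<eta>" using quad_decay_beta[OF \<rho> less_imp_le[OF a(1)] a(2)] by blast
    show ?thesis
      by (rule central_limit[OF dec \<rho> a(1) bound_mono[OF alpha_bound_beta_mix a(2)]])
  next
    fix \<gamma> \<rho> assume P: "P_Lipschitz M X h" and \<gamma>: "0 < \<gamma>" "integrable M (\<lambda>\<omega>. \<bar>X 1 \<omega>\<bar> powr \<gamma>)"
      and r: "(3 * \<gamma> * \<delta> + \<delta> + 5 * \<gamma> + 2) / (2 * \<gamma> * \<delta>) < \<rho>" and O: "alpha_mix M X \<in> O(\<lambda>n. real n powr (- \<rho>))"
    \<comment> \<open>The two sides differ by \<open>(\<gamma> * \<delta> + \<delta> + \<gamma> + 2)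
      / (2 * \<gamma> * \<delta>)\<close>, so the rate of the Lipschitz case always suffices for the
      partial sums.\<close>
    have "(2 + \<delta>) / \<delta> \<le> (3 * \<gamma> * \<delta> + \<delta> + 5 * \<gamma> + 2) / (2 * \<gamma> * \<delta>)"
      using \<gamma>(1) \<delta>_pos by (simp add: field_simps)
    then have \<rho>: "(2 + \<delta>) / \<delta> < \<rho>" using r by linarith
    obtain a where a: "a > 0" "\<And>m. 1 \<le> m \<Longrightarrow> alpha_mix M X m \<le> a * real m powr (- \<rho>)"
      using bigo_powr_bound[OF O] by auto
    obtain D \<eta> where dec: "quad_decay D \<eta>" using quad_decay_alpha[OF P \<gamma> r less_imp_le[OF a(1)] a(2)] by blast
    show ?thesis
      by (rule central_limit[OF dec \<rho> a(1) bound_mono[OF alpha_bound_alpha_mix a(2)]])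
  qed
qed

end
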